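(* Fix $d\in\{2,3\}$, $T,\gamma>0$, and $x\in\mathbb R^d\setminus\{0\}$. Let $\tau:=\inf\{t\in[0,T]:X_t=0\}$, with $\inf\varnothing=\infty$. The following hold. (i) Under the conditional law $\widehat{\mathbb P}_x^{T,\gamma}:=\mathbb P_x^{T,\gamma}[\,\cdot\mid\tau>T]$, the coordinate process $X=\{X_t\}_{t\in[0,T]}$ satisfies $$X_t=x+\int_0^t\widehat b^{\gamma}_{T-s}(X_s)\,ds+\widehat M^{T,\gamma}_t,\qquad t\in[0,T],$$ where $\{\widehat M_t^{T,\gamma}\}_{t\in[0,T]}$ is a continuous $d$-dimensional martingale with respect to $\{\mathcal F_t^{T,x}\}_{t\in[0,T]}$. (ii) Let $\rho$ be an $\{\mathcal F_t^{T,x}\}_{t\in[0,T]}$-stopping time taking values in $[0,T]$ such that $\mathbb P_x^{T,\gamma}[\rho<\tau]>0$. Then the stopped coordinate process $\{X_{t\wedge\rho}\}_{t\in[0,T]}$ has the same law under $\widehat{\mathbb P}_x^{T,\gamma,\rho}:=\mathbb P_x^{T,\gamma}[\,\cdot\mid\rho<\tau]$ as it does under the path measure $$\frac{\big(S^{\gamma}_{T-\rho}(X_\rho)\big)^{-1}}{\widehat{\mathbb E}_x^{T,\gamma}\Big[\big(S^{\gamma}_{T-\rho}(X_\rho)\big)^{-1}\Big]}\,\widehat{\mathbb P}_x^{T,\gamma},$$ where $\widehat{\mathbb E}_x^{T,\gamma}$ denotes expectation with respect to $\widehat{\mathbb P}_x^{T,\gamma}$.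
   Context: Free heat kernel: $g_t(z)=(2\pi t)^{-d/2}e^{-|z|^2/(2t)}$ on $\mathbb R^d$, $t>0$; $*$ is convolution on $\mathbb R^d$. Let $\lambda_\gamma=\gamma$ if $d=2$, $\lambda_\gamma=\gamma^2/2$ if $d=3$, and for $x\neq0$ let $\psi_\gamma(x)=\sqrt{2\gamma/\pi}\,K_0(\sqrt{2\gamma}|x|)$ if $d=2$ ($K_0$ the modified Bessel function of the second kind), $\psi_\gamma(x)=\sqrt{\gamma/(2\pi)}\,e^{-\gamma|x|}/|x|$ if $d=3$. Point-interaction kernel: $p_t^\gamma(x,y)=g_t(x-y)+h_t^\gamma(x,y)$ for $t>0$, $x,y\in\mathbb R^d\setminus\{0\}$, where for $d=2$ $$h_t^\gamma(x,y)=2\pi\gamma\int_{0<r<s<t}g_r(x)\,\nu'(\gamma(s-r))\,g_{t-s}(y)\,ds\,dr,\qquad \nu(a)=\int_0^\infty\frac{a^s}{\Gamma(s+1)}ds,$$ and for $d=3$ $$h_t^\gamma(x,y)=\frac{t}{|x||y|}\bar g_t(|x|+|y|)+\frac{\gamma t}{|x||y|}\int_0^\infty e^{\gamma u}\bar g_t(u+|x|+|y|)\,du,\qquad \bar g_t(r)=(2\pi t)^{-3/2}e^{-r^2/(2t)}.$$ Transition density: $q_t^\gamma(x,y)=e^{-\lambda_\gamma t}\frac{\psi_\gamma(y)}{\psi_\gamma(x)}p_t^\gamma(x,y)$. Process: $\Omega=C([0,T];\mathbb R^d)$ with the uniform metric and Borel $\sigma$-algebra $\mathcal B(\Omega)$,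 $X_t(\omega)=\omega(t)$, $\mathcal F_t=\sigma(X_s:0\le s\le t)$. It is known that for $x\ne0$ there is a unique probability measure $\mathbb P_x^{T,\gamma}$ on $(\Omega,\mathcal B(\Omega))$ under which $X_0=x$ a.s. and $X$ is a time-homogeneous Markov process with respect to $\{\mathcal F_t\}$ with transition density $q_t^\gamma$. Let $\mathcal N_x$ be the collection of all subsets of $\mathbb P_x^{T,\gamma}$-null sets and $\mathcal F_t^{T,x}=\sigma\{\mathcal F_t\cup\mathcal N_x\}$; $\mathbb P_x^{T,\gamma}$ is extended to $\sigma\{\mathcal B(\Omega)\cup\mathcal N_x\}$. Regularized drift: $\widehat b_t^\gamma(x)=\nabla\log(g_t*\psi_\gamma)(x)$ for $t>0$, $x\in\mathbb R^d\setminus\{0\}$. Function $S$: for $x\neq0$, $S_t^\gamma(x)=e^{-\lambda_\gamma t}\frac{(g_t*\psi_\gamma)(x)}{\psi_\gamma(x)}$ for $t>0$ and $S_0^\gamma(x)=1$; also $S_t^\gamma(0):=0$ for $t>0$. *)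

theory Defs
  imports "HOL-Probability.Probability"
begin

section \<open>Kernels\<close>

definition heat_kernel :: "real \<Rightarrow> real^'n \<Rightarrow> real" where
  "heat_kernel t z = (2 * pi * t) powr (- real CARD('n) / 2) * exp (- (norm z)\<^sup>2 / (2 * t))"

definition conv :: "(real^'n \<Rightarrow> real) \<Rightarrow> (real^'n \<Rightarrow> real) \<Rightarrow> real^'n \<Rightarrow> real" where
  "conv f g x = (LINT y|lborel. f (x - y) * g y)"

text \<open>Modified Bessel function of the second kind of order \<open>0\<close>, by its classical integral
  representation, valid for \<open>z > 0\<close>.\<close>

definition bessel_K0 :: "real \<Rightarrow> real" where
  "bessel_K0 z = (LBINT u:{0..}. exp (- z * cosh u))"

text \<open>Throughout, \<open>CARD('n)\<close> is the dimension \<open>d\<close>; only \<open>d = 2\<close> and \<open>d = 3\<close> are meaningful, and the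
  \<open>else\<close> branches below are those for \<open>d = 3\<close>.  Values at the origin, where \<open>\<psi>\<close> and the kernels are
  not defined, are the junk values of the formulas.\<close>

definition lam :: "nat \<Rightarrow> real \<Rightarrow> real" where
  "lam d \<gamma> = (if d = 2 then \<gamma> else \<gamma>\<^sup>2 / 2)"

definition psi :: "real \<Rightarrow> real^'n \<Rightarrow> real" where
  "psi \<gamma> x =
    (if CARD('n) = 2 then sqrt (2 * \<gamma> / pi) * bessel_K0 (sqrt (2 * \<gamma>) * norm x)
     else sqrt (\<gamma> / (2 * pi)) * exp (- \<gamma> * norm x) / norm x)"

definition nu :: "real \<Rightarrow> real" where
  "nu a = (LBINT s:{0..}. a powr s / Gamma (s + 1))"

definition radial_heat3 :: "real \<Rightarrow> real \<Rightarrow> real" where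
  "radial_heat3 t r = (2 * pi * t) powr (- 3 / 2) * exp (- r\<^sup>2 / (2 * t))"

definition interaction_part :: "real \<Rightarrow> real \<Rightarrow> real^'n \<Rightarrow> real^'n \<Rightarrow> real" where
  "interaction_part \<gamma> t x y =
    (if CARD('n) = 2 then
       2 * pi * \<gamma> *
         (LINT (r, s) : {(r, s). 0 < r \<and> r < s \<and> s < t} | lborel.
            heat_kernel r x * deriv nu (\<gamma> * (s - r)) * heat_kernel (t - s) y)
     else
       t / (norm x * norm y) * radial_heat3 t (norm x + norm y)
       + \<gamma> * t / (norm x * norm y) *
           (LBINT u:{0..}. exp (\<gamma> * u) * radial_heat3 t (u + norm x + norm y)))"

definition point_kernel :: "real \<Rightarrow> real \<Rightarrow> real^'n \<Rightarrow> real^'n \<Rightarrow> real" where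
  "point_kernel \<gamma> t x y = heat_kernel t (x - y) + interaction_part \<gamma> t x y"

definition trans_density :: "real \<Rightarrow> real \<Rightarrow> real^'n \<Rightarrow> real^'n \<Rightarrow> real" where
  "trans_density \<gamma> t x y =
    exp (- lam CARD('n) \<gamma> * t) * (psi \<gamma> y / psi \<gamma> x) * point_kernel \<gamma> t x y"

definition gradient :: "('a::real_inner \<Rightarrow> real) \<Rightarrow> 'a \<Rightarrow> 'a" where
  "gradient f x = (THE D. GDERIV f x :> D)"

definition reg_drift :: "real \<Rightarrow> real \<Rightarrow> real^'n \<Rightarrow> real^'n" where
  "reg_drift \<gamma> t x = gradient (\<lambda>z. ln (conv (heat_kernel t) (psi \<gamma>) z)) x"

definition surv :: "real \<Rightarrow> real \<Rightarrow> real^'n \<Rightarrow> real" where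
  "surv \<gamma> t x =
    (if x = 0 then 0
     else if t = 0 then 1
     else exp (- lam CARD('n) \<gamma> * t) * conv (heat_kernel t) (psi \<gamma>) x / psi \<gamma> x)"


section \<open>Path space\<close>

text \<open>\<open>C([0,T]; \<real>\<^sup>d)\<close> with the uniform metric.  Its points are the functions that are continuous on
  \<open>{0..T}\<close> and \<open>undefined\<close> outside \<open>{0..T}\<close>.\<close>

abbreviation path_metric :: "real \<Rightarrow> (real \<Rightarrow> real^'n) metric" where
  "path_metric T \<equiv> cfunspace (top_of_set {0..T}) euclidean_metric"

definition path_borel :: "real \<Rightarrow> (real \<Rightarrow> real^'n) measure" where
  "path_borel T = sigma (mspace (path_metric T)) {U. openin (mtopology_of (path_metric T)) U}"

lemma space_path_borel:
  "space (path_borel T) = {\<omega> \<in> extensional {0..T}. continuous_on {0..T} \<omega>}"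
proof -
  have bdd: "bounded (\<omega> ` {0..T})" if "continuous_on {0..T} \<omega>" for \<omega> :: "real \<Rightarrow> real^'n"
    by (rule compact_imp_bounded [OF compact_continuous_image [OF that compact_Icc]])
  let ?m = "path_metric T :: (real \<Rightarrow> real^'n) metric"
  have "{U. openin (mtopology_of ?m) U} \<subseteq> Pow (mspace ?m)"
  proof
    fix U assume "U \<in> {U. openin (mtopology_of ?m) U}"
    then have "U \<subseteq> topspace (mtopology_of ?m)"
      by (intro openin_subset) simp
    then show "U \<in> Pow (mspace ?m)"
      by (simp only: topspace_mtopology_of Pow_iff)
  qed
  then have "space (path_borel T) = mspace ?m"
    unfolding path_borel_def by (rule space_measure_of)
  also have "\<dots> = {\<omega> \<in> extensional {0..T}. continuous_on {0..T} \<omega>}"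
    using bdd by auto
  finally show ?thesis .
qed

text \<open>The filtrations are indexed by all reals, as required by \<^const>\<open>stopping_time\<close>: they are
  trivial (up to null sets) for \<open>t < 0\<close> and constant for \<open>t \<ge> T\<close>, so that for times with
  values in \<open>[0,T]\<close> nothing is changed.\<close>

definition path_filt :: "real \<Rightarrow> real \<Rightarrow> (real \<Rightarrow> real^'n) measure" where
  "path_filt T t =
    sigma (space (path_borel T))
      {(\<lambda>\<omega>. \<omega> s) -` B \<inter> space (path_borel T) | s B. s \<in> {0..T} \<and> s \<le> t \<and> B \<in> sets borel}"

definition augmented_filt ::
  "real \<Rightarrow> (real \<Rightarrow> real^'n) measure \<Rightarrow> real \<Rightarrow> (real \<Rightarrow> real^'n) measure" where
  "augmented_filt T P t =
    sigma (space (path_borel T))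
      (sets (path_filt T t) \<union> {N. \<exists>Z \<in> null_sets P. N \<subseteq> Z})"

text \<open>\<open>P\<close> is the law on path space of the time-homogeneous Markov process started at \<open>x\<close> with
  transition density \<^const>\<open>trans_density\<close>.\<close>

definition point_interaction_law ::
  "real \<Rightarrow> real \<Rightarrow> real^'n \<Rightarrow> (real \<Rightarrow> real^'n) measure \<Rightarrow> bool" where
  "point_interaction_law T \<gamma> x P \<longleftrightarrow>
     prob_space P \<and> sets P = sets (path_borel T) \<and>
     (AE \<omega> in P. \<omega> 0 = x) \<and>
     (\<forall>s t. \<forall>B \<in> sets borel. 0 \<le> s \<and> s < t \<and> t \<le> T \<longrightarrow>
        (AE \<omega> in P.
           real_cond_exp P (path_filt T s) (\<lambda>\<omega>. indicator B (\<omega> t)) \<omega>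
             = (LBINT y:B. trans_density \<gamma> (t - s) (\<omega> s) y)))"

definition hit_time :: "real \<Rightarrow> (real \<Rightarrow> real^'n) \<Rightarrow> ereal" where
  "hit_time T \<omega> = (INF t \<in> {t \<in> {0..T}. \<omega> t = 0}. ereal t)"

text \<open>The extension of \<open>P\<close> to the \<open>\<sigma>\<close>-algebra generated by its domain and all subsets of
  \<open>P\<close>-null sets is \<^term>\<open>completion P\<close>.\<close>

definition cond_law_surv :: "real \<Rightarrow> (real \<Rightarrow> real^'n) measure \<Rightarrow> (real \<Rightarrow> real^'n) measure" where
  "cond_law_surv T P = uniform_measure (completion P) {\<omega> \<in> space P. ereal T < hit_time T \<omega>}"

definition cond_law_before ::
  "real \<Rightarrow> (real \<Rightarrow> real^'n) measure \<Rightarrow> ((real \<Rightarrow> real^'n) \<Rightarrow> real) \<Rightarrow> (real \<Rightarrow> real^'n) measure" where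
  "cond_law_before T P \<rho> =
    uniform_measure (completion P) {\<omega> \<in> space P. ereal (\<rho> \<omega>) < hit_time T \<omega>}"

definition stopped_path ::
  "real \<Rightarrow> ((real \<Rightarrow> real^'n) \<Rightarrow> real) \<Rightarrow> (real \<Rightarrow> real^'n) \<Rightarrow> real \<Rightarrow> real^'n" where
  "stopped_path T \<rho> \<omega> = (\<lambda>t \<in> {0..T}. \<omega> (min t (\<rho> \<omega>)))"


section \<open>Continuous martingales on a compact time interval\<close>

definition continuous_martingale ::
  "'w measure \<Rightarrow> (real \<Rightarrow> 'w measure) \<Rightarrow> real \<Rightarrow> (real \<Rightarrow> 'w \<Rightarrow> 'a::euclidean_space) \<Rightarrow> bool" where
  "continuous_martingale Q F T M \<longleftrightarrow>
     prob_space Q \<and> filtration (space Q) F \<and>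
     (\<forall>t \<in> {0..T}. subalgebra Q (F t) \<and> M t \<in> borel_measurable (F t) \<and> integrable Q (M t)) \<and>
     (\<forall>s \<in> {0..T}. \<forall>t \<in> {s..T}. \<forall>b \<in> Basis.
        AE \<omega> in Q. real_cond_exp Q (F s) (\<lambda>\<omega>. M t \<omega> \<bullet> b) \<omega> = M s \<omega> \<bullet> b) \<and>
     (AE \<omega> in Q. continuous_on {0..T} (\<lambda>t. M t \<omega>))"

end

theory Submission
  imports Defs
begin

text \<open>
  Let \<open>k\<^sub>t x y = exp (- \<lambda> t) * (\<psi> y / \<psi> x) * g\<^sub>t (x - y)\<close>, the transition density of the process killed
  at 0. The density \<open>q\<^sub>t\<close> dominates \<open>k\<^sub>t\<close>, and for short steps away from 0 it exceeds \<open>k\<^sub>t\<close> only by a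
  factor \<open>1 + O(t\<^sup>2)\<close>. Discretising time on ever finer grids, this bounds the law of the surviving
  process from above by the semigroup of \<open>k\<close>. From below, \<open>S\<^sub>T\<^sub>-\<^sub>t(X\<^sub>t)\<close> is a submartingale (because
  \<open>q \<ge> k\<close>) that is small when \<open>X\<^sub>t\<close> is close to 0, whence \<open>P(\<tau> > T) \<ge> S\<^sub>T(x)\<close>, which is the total mass of the
  upper bound. So the two bounds agree: the surviving process is Markov with density \<open>k\<close>, and under the
  conditional law its density is
  \<open>g\<^sub>t\<^sub>-\<^sub>s(y - z) * (g\<^sub>T\<^sub>-\<^sub>t * \<psi>)(z) / (g\<^sub>T\<^sub>-\<^sub>s * \<psi>)(y)\<close>.

  For (i), the Gaussian convolution identities give the means of \<open>X\<^sub>t\<close> and of the drift at \<open>X\<^sub>t\<close> given \<open>X\<^sub>s\<close>,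
  and the martingale property reduces to these. For (ii), \<open>1{\<tau> > t} * S\<^sub>T\<^sub>-\<^sub>t(X\<^sub>t)\<close> is the martingale
  \<open>P(\<tau> > T | F\<^sub>t)\<close>; sampling it at \<open>\<rho>\<close> shows that \<open>S\<^sub>T\<^sub>-\<^sub>\<rho>(X\<^sub>\<rho>)\<close> is the density of
  conditioning on \<open>\<tau> > T\<close> relative to conditioning on \<open>\<rho> < \<tau>\<close>, up to normalisation, on events before \<open>\<rho>\<close>.
\<close>

section \<open>Gaussian kernels\<close>

text \<open>\<open>trans_density\<close> enters only as a conditional density; even its total mass 1
  is read off from the Markov property. What happens at 0 is therefore not computed but squeezed
  between two estimates that use single Markov steps. The factor 1 + O(t^2): the interaction term
  stands for a passage through 0, a Gaussian detour of length at least 2e if both ends are at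
  distance e from 0, against a direct step of length at most e/2. The quotient decays like exp (- c
  / t); a bound by \<open>t\<^sup>2\<close> suffices, since the errors of n steps of length 1/n then
  multiply to a factor with limit 1. The lower estimate works because psi is unbounded at 0 while
  its heat flow at a positive time is bounded. So S vanishes at 0, and a path that comes close to 0
  adds almost nothing to the submartingale. For the martingale part, the heat flow commutes with the
  gradient, so the drift along the conditioned process is itself a martingale before T. Its integral
  over [s, t] then has conditional mean (t - s) times the drift at s, which is exactly the
  conditional mean of the increment of X.\<close>

lemma nn_integral_lborel_reflect:
  fixes f :: "'a::euclidean_space \<Rightarrow> ennreal"
  assumes [measurable]: "f \<in> borel_measurable borel"
  shows "(\<integral>\<^sup>+y. f (a - y) \<partial>lborel) = (\<integral>\<^sup>+y. f y \<partial>lborel)"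
proof -
  have "(\<integral>\<^sup>+y. f y \<partial>lborel) = (\<integral>\<^sup>+y. f y \<partial>density (distr lborel borel (\<lambda>x. a + (-1) *\<^sub>R x)) (\<lambda>_. ennreal (\<bar>-1\<bar> ^ DIM('a))))"
    by (subst lborel_affine[of "-1" a]) simp_all
  also have "\<dots> = (\<integral>\<^sup>+y. f (a - y) \<partial>lborel)"
    by (subst nn_integral_density) (simp_all add: nn_integral_distr)
  finally show ?thesis ..
qed

lemma nn_integral_lborel_translate:
  fixes f :: "'a::euclidean_space \<Rightarrow> ennreal"
  assumes [measurable]: "f \<in> borel_measurable borel"
  shows "(\<integral>\<^sup>+y. f (y - a) \<partial>lborel) = (\<integral>\<^sup>+y. f y \<partial>lborel)"
proof -
  have "(\<integral>\<^sup>+y. f (y - a) \<partial>lborel) = (\<integral>\<^sup>+y. f (0 - (a - y)) \<partial>lborel)"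
    by simp
  also have "\<dots> = (\<integral>\<^sup>+y. f (0 - y) \<partial>lborel)"
    by (rule nn_integral_lborel_reflect) measurable
  finally show ?thesis
    by (simp add: nn_integral_lborel_reflect del: diff_0)
qed

lemma integral_lborel_reflect:
  fixes f :: "'a::euclidean_space \<Rightarrow> 'b::{banach, second_countable_topology}"
  assumes [measurable]: "f \<in> borel_measurable borel"
  shows "(LINT y|lborel. f (a - y)) = (LINT y|lborel. f y)"
proof -
  have "(LINT y|lborel. f y) = (LINT y|density (distr lborel borel (\<lambda>x. a + (-1) *\<^sub>R x)) (\<lambda>_. ennreal (\<bar>-1\<bar> ^ DIM('a))). f y)"
    by (subst lborel_affine[of "-1" a]) simp_all
  also have "\<dots> = (LINT y|lborel. f (a - y))"
    by (subst integral_density) (simp_all add: integral_distr)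
  finally show ?thesis ..
qed

lemma integrable_lborel_reflect:
  fixes f :: "'a::euclidean_space \<Rightarrow> 'b::{banach, second_countable_topology}"
  assumes "integrable lborel f"
  shows "integrable lborel (\<lambda>y. f (a - y))"
proof -
  have [measurable]: "f \<in> borel_measurable borel"
    using assms by (simp add: integrable_iff_bounded)
  then show ?thesis
    using assms nn_integral_lborel_reflect[of "\<lambda>y. ennreal (norm (f y))" a]
    by (simp add: integrable_iff_bounded)
qed

lemma heat_kernel_nonneg [simp]: "0 \<le> heat_kernel t z"
  by (simp add: heat_kernel_def)

lemma heat_kernel_pos: "0 < t \<Longrightarrow> 0 < heat_kernel t z"
  by (simp add: heat_kernel_def)

lemma heat_kernel_minus: "heat_kernel t (y - x) = heat_kernel t (x - y)"
  by (simp add: heat_kernel_def norm_minus_commute)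

lemma heat_kernel_uminus [simp]: "heat_kernel t (- z) = heat_kernel t z"
  by (simp add: heat_kernel_def)

lemma measurable_heat_kernel [measurable]:
  assumes [measurable]: "t \<in> borel_measurable M" "z \<in> borel_measurable M"
  shows "(\<lambda>\<omega>. heat_kernel (t \<omega>) (z \<omega>)) \<in> borel_measurable M"
  unfolding heat_kernel_def by measurable

lemma heat_kernel_le: "heat_kernel t z \<le> (2 * pi * t) powr (- (real CARD('n) / 2))"
  if "0 < t" for z :: "real^'n"
  using that by (simp add: heat_kernel_def mult_left_le)

text \<open>The factorisation over the coordinates reduces the total mass to that of the
  one-dimensional normal density of variance t.\<close>

lemma heat_kernel_prod:
  fixes z :: "real^'n"
  assumes "0 < t"
  shows "heat_kernel t z = (\<Prod>b\<in>Basis. normal_density 0 (sqrt t) (z \<bullet> b))"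
proof -
  have "(\<Prod>b\<in>Basis. normal_density 0 (sqrt t) (z \<bullet> b)) =
    (\<Prod>b\<in>(Basis::(real^'n) set). 1 / sqrt (2 * pi * t)) * (\<Prod>b\<in>Basis. exp (-(z \<bullet> b)\<^sup>2 / (2 * t)))"
    using assms by (simp only: prod.distrib[symmetric]) (simp add: normal_density_def)
  also have "(\<Prod>b\<in>(Basis::(real^'n) set). 1 / sqrt (2 * pi * t)) = (1 / sqrt (2 * pi * t)) ^ CARD('n)"
    by simp
  also have "\<dots> = (2 * pi * t) powr (- real CARD('n) / 2)"
  proof -
    have "1 / sqrt (2 * pi * t) = (2 * pi * t) powr (- 1 / 2)"
      using assms by (simp add: powr_half_sqrt powr_minus_divide)
    then show ?thesis
      using assms by (simp add: powr_realpow[symmetric] powr_powr)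
  qed
  also have "(\<Prod>b\<in>Basis. exp (-(z \<bullet> b)\<^sup>2 / (2 * t))) = exp (- (norm z)\<^sup>2 / (2 * t))"
  proof -
    have "(norm z)\<^sup>2 = (\<Sum>b\<in>Basis. (z \<bullet> b)\<^sup>2)"
      unfolding power2_norm_eq_inner by (simp add: euclidean_inner[of z z] power2_eq_square)
    then show ?thesis
      by (subst exp_sum[symmetric]) (simp_all add: sum_negf sum_divide_distrib)
  qed
  finally show ?thesis
    by (simp add: heat_kernel_def)
qed

lemma nn_integral_heat_kernel:
  assumes "0 < t"
  shows "(\<integral>\<^sup>+z. ennreal (heat_kernel t (z::real^'n)) \<partial>lborel) = 1"
proof -
  have "(\<integral>\<^sup>+x. ennreal (normal_density 0 (sqrt t) x) \<partial>lborel) = 1"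
    using assms integral_normal_density[of "sqrt t" 0] integrable_normal_density[of "sqrt t" 0]
    by (subst nn_integral_eq_integral) auto
  then have "(\<integral>\<^sup>+z. (\<Prod>b\<in>(Basis::(real^'n) set). ennreal (normal_density 0 (sqrt t) (z \<bullet> b))) \<partial>lborel) = 1"
    by (subst nn_integral_lborel_prod) auto
  then show ?thesis
    using assms by (simp add: heat_kernel_prod prod_ennreal)
qed

lemma integrable_heat_kernel: "0 < t \<Longrightarrow> integrable lborel (heat_kernel t :: real^'n \<Rightarrow> real)"
  using nn_integral_heat_kernel[of t, where 'n='n] by (intro integrableI_nonneg) auto

lemma integral_heat_kernel: "0 < t \<Longrightarrow> (LINT z|lborel. heat_kernel t (z::real^'n)) = 1"
  using nn_integral_heat_kernel[of t, where 'n='n] by (simp add: integral_eq_nn_integral)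

text \<open>The linear factor is paid for by half of the Gaussian exponent, which amounts to
  doubling the time. So the moment and gradient bounds below remain bounds by a heat kernel, to
  which the semigroup law applies.\<close>

lemma norm_heat_kernel_le:
  fixes z :: "real^'n"
  assumes "0 < t"
  shows "norm z * heat_kernel t z \<le> sqrt t * 2 powr (real CARD('n) / 2) * heat_kernel (2 * t) z"
proof -
  define v where "v = norm z / sqrt t"
  have nz: "norm z = v * sqrt t" "(norm z)\<^sup>2 = v\<^sup>2 * t" and v0: "0 \<le> v"
    using assms by (simp_all add: v_def power_divide)
  have "v \<le> 1 + v\<^sup>2 / 4"
    using zero_le_power2[of "v / 2 - 1"] by (simp add: power2_eq_square algebra_simps)
  also have "\<dots> \<le> exp (v\<^sup>2 / 4)"
    by (rule exp_ge_add_one_self)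
  finally have "v * exp (- v\<^sup>2 / 4) \<le> 1"
    by (simp add: exp_minus field_simps)
  then have "sqrt t * exp (- v\<^sup>2 / 4) * (v * exp (- v\<^sup>2 / 4)) \<le> sqrt t * exp (- v\<^sup>2 / 4)"
    using assms by (intro mult_left_le) auto
  moreover have "exp (- v\<^sup>2 / 4) * exp (- v\<^sup>2 / 4) = exp (- v\<^sup>2 / 2)"
    by (simp add: exp_add[symmetric])
  ultimately have *: "v * sqrt t * exp (- v\<^sup>2 / 2) \<le> sqrt t * exp (- v\<^sup>2 / 4)"
    by (simp add: mult_ac)
  have e: "(2 * pi * t) powr (- real CARD('n) / 2) =
     2 powr (real CARD('n) / 2) * (2 * pi * (2 * t)) powr (- real CARD('n) / 2)"
    using assms by (simp add: powr_mult powr_minus field_simps powr_add[symmetric])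
  have "norm z * heat_kernel t z = (2 * pi * t) powr (- real CARD('n) / 2) * (v * sqrt t * exp (- v\<^sup>2 / 2))"
    using assms by (simp add: heat_kernel_def nz power_mult_distrib)
  also have "\<dots> \<le> (2 * pi * t) powr (- real CARD('n) / 2) * (sqrt t * exp (- v\<^sup>2 / 4))"
    using * by (intro mult_left_mono) auto
  also have "\<dots> = sqrt t * 2 powr (real CARD('n) / 2) * heat_kernel (2 * t) z"
    unfolding e using assms by (simp add: heat_kernel_def nz power_mult_distrib)
  finally show ?thesis .
qed

text \<open>Completing the square in z: the last factor is the law at time a of the Brownian bridge
  from 0 to w of duration a + b, with mean a/(a+b) w and variance ab/(a+b). Its mass gives the
  semigroup law, its mean the first moments below.\<close>

lemma heat_kernel_mult:
  fixes z w :: "real^'n"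
  assumes a: "0 < a" and b: "0 < b"
  shows "heat_kernel a z * heat_kernel b (w - z) =
    heat_kernel (a + b) w * heat_kernel (a * b / (a + b)) (z - (a / (a + b)) *\<^sub>R w)"
proof -
  have pre: "(2 * pi * a) powr e * (2 * pi * b) powr e = (2 * pi * (a + b)) powr e * (2 * pi * (a * b / (a + b))) powr e" for e
  proof -
    have "(2 * pi * a) powr e * (2 * pi * b) powr e = ((2 * pi * a) * (2 * pi * b)) powr e"
      using a b by (subst powr_mult) auto
    also have "(2 * pi * a) * (2 * pi * b) = (2 * pi * (a + b)) * (2 * pi * (a * b / (a + b)))"
      using a b by (simp add: divide_simps)
    also have "\<dots> powr e = (2 * pi * (a + b)) powr e * (2 * pi * (a * b / (a + b))) powr e"
      using a b by (subst powr_mult) auto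
    finally show ?thesis .
  qed
  have ex: "- (norm z)\<^sup>2 / (2 * a) + - (norm (w - z))\<^sup>2 / (2 * b) =
    - (norm w)\<^sup>2 / (2 * (a + b)) + - (norm (z - (a / (a + b)) *\<^sub>R w))\<^sup>2 / (2 * (a * b / (a + b)))"
  proof -
    define p q r where "p = z \<bullet> z" and "q = w \<bullet> w" and "r = w \<bullet> z"
    have n: "(norm z)\<^sup>2 = p" "(norm w)\<^sup>2 = q" "(norm (w - z))\<^sup>2 = q - 2 * r + p"
      "(norm (z - (a / (a + b)) *\<^sub>R w))\<^sup>2 = p - 2 * (a / (a + b)) * r + (a / (a + b))\<^sup>2 * q"
      unfolding power2_norm_eq_inner
      by (simp_all add: p_def q_def r_def inner_diff_left inner_diff_right inner_commute power2_eq_square)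
    have "a + b \<noteq> 0" using a b by simp
    then show ?thesis
      unfolding n using a b by (simp add: divide_simps) (simp add: power2_eq_square algebra_simps)
  qed
  show ?thesis
    unfolding heat_kernel_def
    using arg_cong[OF ex, of exp] pre[of "- real CARD('n) / 2"]
    unfolding exp_add by (simp add: algebra_simps)
qed

lemma heat_kernel_semigroup:
  fixes x w :: "real^'n"
  assumes a: "0 < a" and b: "0 < b"
  shows "(\<integral>\<^sup>+y. ennreal (heat_kernel a (x - y)) * ennreal (heat_kernel b (y - w)) \<partial>lborel) =
    ennreal (heat_kernel (a + b) (x - w))"
proof -
  have "(\<integral>\<^sup>+y. ennreal (heat_kernel a (x - y)) * ennreal (heat_kernel b (y - w)) \<partial>lborel) =
      (\<integral>\<^sup>+y. (\<lambda>z. ennreal (heat_kernel a z * heat_kernel b ((x - w) - z))) (x - y) \<partial>lborel)"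
    by (simp add: ennreal_mult)
  also have "\<dots> = (\<integral>\<^sup>+z. ennreal (heat_kernel a z * heat_kernel b ((x - w) - z)) \<partial>lborel)"
    by (rule nn_integral_lborel_reflect) measurable
  also have "\<dots> = (\<integral>\<^sup>+z. ennreal (heat_kernel (a + b) (x - w)) *
      (\<lambda>z. ennreal (heat_kernel (a * b / (a + b)) z)) (z - (a / (a + b)) *\<^sub>R (x - w)) \<partial>lborel)"
    using a b by (simp add: heat_kernel_mult ennreal_mult)
  also have "\<dots> = ennreal (heat_kernel (a + b) (x - w))"
    using a b by (subst nn_integral_cmult, measurable, subst nn_integral_lborel_translate)
       (auto simp: nn_integral_heat_kernel)
  finally show ?thesis .
qed

lemma heat_kernel_moment_integrable:
  assumes "0 < t"
  shows "integrable lborel (\<lambda>z::real^'n. heat_kernel t z *\<^sub>R z)"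
proof (rule Bochner_Integration.integrable_bound)
  show "integrable lborel (\<lambda>z::real^'n. sqrt t * 2 powr (real CARD('n) / 2) * heat_kernel (2 * t) z)"
    using assms by (intro integrable_mult_right integrable_heat_kernel) auto
  show "AE z in lborel. norm (heat_kernel t z *\<^sub>R z) \<le> norm (sqrt t * 2 powr (real CARD('n) / 2) * heat_kernel (2 * t) (z::real^'n))"
  proof (rule AE_I2)
    fix z :: "real^'n"
    show "norm (heat_kernel t z *\<^sub>R z) \<le> norm (sqrt t * 2 powr (real CARD('n) / 2) * heat_kernel (2 * t) z)"
    using norm_heat_kernel_le[OF assms, of z] assms by (simp add: mult.commute)
  qed
qed measurable

text \<open>The integrand is odd.\<close>

lemma heat_kernel_first_moment:
  assumes "0 < t"
  shows "(LINT z|lborel. heat_kernel t z *\<^sub>R (z::real^'n)) = 0"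
proof -
  have "(LINT z|lborel. heat_kernel t z *\<^sub>R (z::real^'n)) = (LINT z|lborel. heat_kernel t (0 - z) *\<^sub>R (0 - z))"
    by (rule integral_lborel_reflect[symmetric]) measurable
  also have "\<dots> = - (LINT z|lborel. heat_kernel t z *\<^sub>R (z::real^'n))"
    by simp
  finally have "2 *\<^sub>R (LINT z|lborel. heat_kernel t z *\<^sub>R (z::real^'n)) = 0"
    by (simp add: scaleR_2 eq_neg_iff_add_eq_0)
  then show ?thesis by simp
qed

lemma heat_kernel_mean:
  assumes "0 < t"
  shows "integrable lborel (\<lambda>z. heat_kernel t (z - v) *\<^sub>R (z::real^'n))"
    and "(LINT z|lborel. heat_kernel t (z - v) *\<^sub>R (z::real^'n)) = v"
proof -
  let ?f = "\<lambda>z::real^'n. heat_kernel t z *\<^sub>R z" and ?g = "\<lambda>z::real^'n. heat_kernel t z *\<^sub>R v"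
  have i: "integrable lborel ?f" "integrable lborel ?g"
    using assms by (auto intro: heat_kernel_moment_integrable integrable_heat_kernel)
  have e: "heat_kernel t (z - v) *\<^sub>R (z::real^'n) = ?g (v - z) - ?f (v - z)" for z
    by (simp add: heat_kernel_minus algebra_simps)
  have i': "integrable lborel (\<lambda>z. ?f (v - z))" "integrable lborel (\<lambda>z. ?g (v - z))"
    using i by (auto intro: integrable_lborel_reflect)
  show "integrable lborel (\<lambda>z. heat_kernel t (z - v) *\<^sub>R (z::real^'n))"
    unfolding e using i' by (intro Bochner_Integration.integrable_diff)
  have "(LINT z|lborel. heat_kernel t (z - v) *\<^sub>R (z::real^'n)) = (LINT z|lborel. ?g (v - z)) - (LINT z|lborel. ?f (v - z))"
    unfolding e using i' by (intro Bochner_Integration.integral_diff)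
  also have "(LINT z|lborel. ?g (v - z)) = (LINT z|lborel. ?g z)"
    by (rule integral_lborel_reflect[of ?g v]) measurable
  also have "(LINT z|lborel. ?f (v - z)) = (LINT z|lborel. ?f z)"
    by (rule integral_lborel_reflect[of ?f v]) measurable
  finally show "(LINT z|lborel. heat_kernel t (z - v) *\<^sub>R (z::real^'n)) = v"
    using assms by (simp add: heat_kernel_first_moment integral_heat_kernel integrable_heat_kernel)
qed

text \<open>The mean of the bridge in \<open>heat_kernel_mult\<close>.\<close>

lemma heat_kernel_moment_convolution:
  fixes w :: "real^'n"
  assumes a: "0 < a" and b: "0 < b"
  shows "integrable lborel (\<lambda>z. (heat_kernel a z * heat_kernel b (w - z)) *\<^sub>R z)"
    and "(LINT z|lborel. (heat_kernel a z * heat_kernel b (w - z)) *\<^sub>R z) = (a / (a + b) * heat_kernel (a + b) w) *\<^sub>R w"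
proof -
  have c: "0 < a * b / (a + b)" using a b by simp
  have e: "(heat_kernel a z * heat_kernel b (w - z)) *\<^sub>R z =
     heat_kernel (a + b) w *\<^sub>R (heat_kernel (a * b / (a + b)) (z - (a / (a + b)) *\<^sub>R w) *\<^sub>R z)" for z
    by (simp add: heat_kernel_mult[OF a b])
  show "integrable lborel (\<lambda>z. (heat_kernel a z * heat_kernel b (w - z)) *\<^sub>R z)"
    unfolding e by (intro integrable_scaleR_right heat_kernel_mean c)
  show "(LINT z|lborel. (heat_kernel a z * heat_kernel b (w - z)) *\<^sub>R z) = (a / (a + b) * heat_kernel (a + b) w) *\<^sub>R w"
    unfolding e by (subst integral_scaleR_right) (simp_all add: heat_kernel_mean c mult.commute)
qed

lemma integral_lborel_translate:
  fixes f :: "'a::euclidean_space \<Rightarrow> 'b::{banach, second_countable_topology}"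
  assumes [measurable]: "f \<in> borel_measurable borel"
  shows "(LINT y|lborel. f (y - a)) = (LINT y|lborel. f y)"
proof -
  have "(LINT y|lborel. f (0 - (a - y))) = (LINT y|lborel. f (0 - y))"
    by (rule integral_lborel_reflect[of "\<lambda>y. f (0 - y)"]) measurable
  also have "\<dots> = (LINT y|lborel. f y)"
    by (rule integral_lborel_reflect) measurable
  finally show ?thesis
    by simp
qed

lemma nn_integral_heat_semigroup:
  fixes u :: "real^'n \<Rightarrow> ennreal"
  assumes a: "0 < a" and b: "0 < b" and [measurable]: "u \<in> borel_measurable borel"
  shows "(\<integral>\<^sup>+y. ennreal (heat_kernel a (x - y)) * (\<integral>\<^sup>+z. ennreal (heat_kernel b (y - z)) * u z \<partial>lborel) \<partial>lborel) =
    (\<integral>\<^sup>+z. ennreal (heat_kernel (a + b) (x - z)) * u z \<partial>lborel)"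
proof -
  have "(\<integral>\<^sup>+y. ennreal (heat_kernel a (x - y)) * (\<integral>\<^sup>+z. ennreal (heat_kernel b (y - z)) * u z \<partial>lborel) \<partial>lborel)
     = (\<integral>\<^sup>+y. \<integral>\<^sup>+z. ennreal (heat_kernel a (x - y)) * (ennreal (heat_kernel b (y - z)) * u z) \<partial>lborel \<partial>lborel)"
    by (simp add: nn_integral_cmult)
  also have "\<dots> = (\<integral>\<^sup>+z. \<integral>\<^sup>+y. ennreal (heat_kernel a (x - y)) * (ennreal (heat_kernel b (y - z)) * u z) \<partial>lborel \<partial>lborel)"
    by (rule lborel_pair.Fubini') measurable
  also have "\<dots> = (\<integral>\<^sup>+z. (\<integral>\<^sup>+y. ennreal (heat_kernel a (x - y)) * ennreal (heat_kernel b (y - z)) \<partial>lborel) * u z \<partial>lborel)"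
    by (subst nn_integral_multc[symmetric]) (simp_all add: mult.assoc)
  also have "\<dots> = (\<integral>\<^sup>+z. ennreal (heat_kernel (a + b) (x - z)) * u z \<partial>lborel)"
    using a b by (simp add: heat_kernel_semigroup)
  finally show ?thesis .
qed

section \<open>The gradient of the heat kernel and its uniform Taylor expansion\<close>

definition heat_grad :: "real \<Rightarrow> real^'n \<Rightarrow> real^'n" where
  "heat_grad t z = - (heat_kernel t z / t) *\<^sub>R z"

definition conv_grad :: "real \<Rightarrow> (real^'n \<Rightarrow> real) \<Rightarrow> real^'n \<Rightarrow> real^'n" where
  "conv_grad t f x = (LINT y|lborel. f y *\<^sub>R heat_grad t (x - y))"

lemma measurable_heat_grad [measurable]:
  assumes [measurable]: "t \<in> borel_measurable M" "z \<in> borel_measurable M"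
  shows "(\<lambda>\<omega>. heat_grad (t \<omega>) (z \<omega>)) \<in> borel_measurable M"
  unfolding heat_grad_def by measurable

lemma norm_heat_grad_le:
  fixes z :: "real^'n"
  assumes "0 < t"
  shows "norm (heat_grad t z) \<le> 2 powr (real CARD('n) / 2) / sqrt t * heat_kernel (2 * t) z"
proof -
  have "norm (heat_grad t z) = norm z * heat_kernel t z / t"
    using assms by (simp add: heat_grad_def)
  also have "\<dots> \<le> (sqrt t * 2 powr (real CARD('n) / 2) * heat_kernel (2 * t) z) / t"
    using assms by (intro divide_right_mono norm_heat_kernel_le) auto
  also have "\<dots> = 2 powr (real CARD('n) / 2) / sqrt t * heat_kernel (2 * t) z"
    using assms by (simp add: field_simps)
  finally show ?thesis .
qed

lemma heat_grad_bounded: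
  assumes "0 < t"
  obtains C where "0 \<le> C" "\<And>z::real^'n. norm (heat_grad t z) \<le> C"
proof
  let ?C = "2 powr (real CARD('n) / 2) / sqrt t * (2 * pi * (2 * t)) powr (- (real CARD('n) / 2))"
  show "0 \<le> ?C" using assms by simp
  fix z :: "real^'n"
  have "2 powr (real CARD('n) / 2) / sqrt t * heat_kernel (2 * t) z \<le> ?C"
    using assms by (intro mult_left_mono heat_kernel_le) auto
  then show "norm (heat_grad t z) \<le> ?C"
    using norm_heat_grad_le[OF assms, of z] by simp
qed

text \<open>The constant does not depend on z, so the remainder can be integrated against |f| for
  every integrable f. This is how differentiation under the integral sign is justified. The bound is
  a second-order Maclaurin expansion along the segment from z to z + h.\<close>

lemma heat_kernel_taylor:
  assumes t: "0 < t"
  obtains C where "0 \<le> C"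
    "\<And>z h::real^'n. \<bar>heat_kernel t (z + h) - heat_kernel t z - heat_grad t z \<bullet> h\<bar> \<le> C * (norm h)\<^sup>2"
proof -
  define A where "A = (2 * pi * t) powr (- (real CARD('n) / 2))"
  have A: "0 \<le> A" by (simp add: A_def)
  have "\<bar>heat_kernel t (z + h) - heat_kernel t z - heat_grad t z \<bullet> h\<bar> \<le> (3 * A / t) * (norm h)\<^sup>2"
    for z h :: "real^'n"
  proof -
    \<comment> \<open>Along the segment the kernel is \<open>A\<close> times the exponential of a
      quadratic polynomial in \<theta> whose coefficients are these inner products.\<close>
    define p q r where "p = z \<bullet> z" and "q = z \<bullet> h" and "r = h \<bullet> h"
    have r: "0 \<le> r" by (simp add: r_def)
    define F where "F = (\<lambda>\<theta>. A * exp (- (p + 2 * q * \<theta> + r * \<theta>\<^sup>2) / (2 * t)))"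
    have nF: "(norm (z + \<theta> *\<^sub>R h))\<^sup>2 = p + 2 * q * \<theta> + r * \<theta>\<^sup>2" for \<theta>
      unfolding power2_norm_eq_inner
      by (simp add: p_def q_def r_def inner_add_left inner_add_right inner_commute power2_eq_square algebra_simps)
    have gF: "heat_kernel t (z + \<theta> *\<^sub>R h) = F \<theta>" for \<theta>
      by (simp add: heat_kernel_def A_def F_def nF)
    define F1 where "F1 = (\<lambda>\<theta>. - ((q + r * \<theta>) / t) * F \<theta>)"
    define F2 where "F2 = (\<lambda>\<theta>. (((q + r * \<theta>) / t)\<^sup>2 - r / t) * F \<theta>)"
    have d1: "(F has_real_derivative F1 \<theta>) (at \<theta>)" for \<theta>
      unfolding F_def F1_def using t by (auto intro!: derivative_eq_intros simp: field_simps power2_eq_square)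
    have d2: "(F1 has_real_derivative F2 \<theta>) (at \<theta>)" for \<theta>
    proof -
      have "((\<lambda>\<theta>. - ((q + r * \<theta>) / t) * F \<theta>) has_real_derivative (- (r / t)) * F \<theta> + F1 \<theta> * (- ((q + r * \<theta>) / t))) (at \<theta>)"
        using t by (intro DERIV_mult d1) (auto intro!: derivative_eq_intros)
      also have "(- (r / t)) * F \<theta> + F1 \<theta> * (- ((q + r * \<theta>) / t)) = F2 \<theta>"
      proof -
        define m where "m = (q + r * \<theta>) / t"
        show ?thesis
          unfolding F1_def F2_def m_def[symmetric] by (simp add: power2_eq_square algebra_simps)
      qed
      finally show ?thesis unfolding F1_def .
    qed
    have "\<exists>\<theta>>0. \<theta> < 1 \<and> F 1 = (\<Sum>m<2. (case m of 0 \<Rightarrow> F | Suc 0 \<Rightarrow> F1 | _ \<Rightarrow> F2) 0 / fact m * 1 ^ m) +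
        (case 2::nat of 0 \<Rightarrow> F | Suc 0 \<Rightarrow> F1 | _ \<Rightarrow> F2) \<theta> / fact 2 * 1 ^ 2"
      by (rule Maclaurin) (auto simp: d1 d2 less_Suc_eq numeral_2_eq_2)
    then obtain \<theta> where \<theta>: "F 1 = F 0 + F1 0 + F2 \<theta> / 2"
      by (auto simp: numeral_2_eq_2)
    \<comment> \<open>Cauchy-Schwarz bounds the squared derivative of the exponent by |h|^2 times |z
      + \<theta> h|^2, and the Gaussian absorbs the latter through v exp (- v) <= 1.\<close>
    have "((q + r * \<theta>))\<^sup>2 \<le> (p + 2 * q * \<theta> + r * \<theta>\<^sup>2) * r"
    proof -
      have "q + r * \<theta> = (z + \<theta> *\<^sub>R h) \<bullet> h"
        by (simp add: q_def r_def inner_add_left)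
      then have "(q + r * \<theta>)\<^sup>2 = ((z + \<theta> *\<^sub>R h) \<bullet> h)\<^sup>2"
        by simp
      also have "\<dots> \<le> ((z + \<theta> *\<^sub>R h) \<bullet> (z + \<theta> *\<^sub>R h)) * (h \<bullet> h)"
        by (rule Cauchy_Schwarz_ineq)
      also have "(z + \<theta> *\<^sub>R h) \<bullet> (z + \<theta> *\<^sub>R h) = p + 2 * q * \<theta> + r * \<theta>\<^sup>2"
        by (rule nF[unfolded power2_norm_eq_inner])
      finally show ?thesis
        by (simp add: r_def)
    qed
    moreover define v where "v = (p + 2 * q * \<theta> + r * \<theta>\<^sup>2) / (2 * t)"
    ultimately have 1: "((q + r * \<theta>))\<^sup>2 \<le> 2 * t * v * r"
      using t by simp
    have v0: "0 \<le> v"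
      using nF[of \<theta>, symmetric] t by (simp add: v_def)
    have "v \<le> exp v"
      using exp_ge_add_one_self[of v] by linarith
    then have ve: "v * exp (- v) \<le> 1"
      by (simp add: exp_minus field_simps)
    have F\<theta>: "F \<theta> = A * exp (- v)"
      by (simp only: F_def v_def minus_divide_left)
    have "((q + r * \<theta>) / t)\<^sup>2 * F \<theta> \<le> (2 * t * v * r / t\<^sup>2) * (A * exp (- v))"
      unfolding F\<theta> power_divide using A 1 t by (intro mult_right_mono divide_right_mono) auto
    also have "\<dots> = (2 * r * A / t) * (v * exp (- v))"
      using t by (simp add: power2_eq_square field_simps)
    also have "\<dots> \<le> 2 * r * A / t"
      using ve r A t by (intro mult_left_le) auto
    finally have a: "((q + r * \<theta>) / t)\<^sup>2 * F \<theta> \<le> 2 * r * A / t" .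
    have b: "r / t * F \<theta> \<le> r / t * A"
      unfolding F\<theta> using v0 A r t by (intro mult_left_mono mult_left_le) auto
    have F0: "0 \<le> F \<theta>" using A by (simp add: F_def)
    have "\<bar>F2 \<theta>\<bar> \<le> \<bar>((q + r * \<theta>) / t)\<^sup>2 * F \<theta>\<bar> + \<bar>r / t * F \<theta>\<bar>"
      unfolding F2_def left_diff_distrib by (rule abs_triangle_ineq4)
    also have "\<dots> = ((q + r * \<theta>) / t)\<^sup>2 * F \<theta> + r / t * F \<theta>"
      using F0 r t by simp
    also have "\<dots> \<le> 2 * r * A / t + r / t * A"
      using a b by (rule add_mono)
    also have "\<dots> = 3 * r * A / t"
      by (simp add: add_divide_distrib[symmetric])
    finally have "\<bar>F2 \<theta> / 2\<bar> \<le> 3 * r * A / t"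
      by simp
    moreover have "heat_kernel t (z + h) - heat_kernel t z - heat_grad t z \<bullet> h = F2 \<theta> / 2"
    proof -
      have "heat_kernel t (z + h) = F 1" "heat_kernel t z = F 0"
        using gF[of 1] gF[of 0] by simp_all
      moreover have "heat_grad t z \<bullet> h = F1 0"
        unfolding heat_grad_def F1_def using gF[of 0] by (simp add: q_def)
      ultimately show ?thesis using \<theta> by simp
    qed
    ultimately have "\<bar>heat_kernel t (z + h) - heat_kernel t z - heat_grad t z \<bullet> h\<bar> \<le> 3 * r * A / t"
      by (simp only:)
    also have "\<dots> = (3 * A / t) * (norm h)\<^sup>2"
      unfolding power2_norm_eq_inner by (simp add: r_def)
    finally show ?thesis .
  qed
  then show ?thesis
    using that[of "3 * A / t"] A t by simp
qed

section \<open>Convolution of the heat kernel with an integrable function\<close>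

context
  fixes f :: "real^'n \<Rightarrow> real"
  assumes f: "integrable lborel f"
begin

lemma f_meas [measurable]: "f \<in> borel_measurable borel"
  using f by (simp add: integrable_iff_bounded)

lemma integrable_conv:
  assumes "0 < t"
  shows "integrable lborel (\<lambda>y. heat_kernel t (x - y) * f y)"
proof (rule Bochner_Integration.integrable_bound)
  show "integrable lborel (\<lambda>y. (2 * pi * t) powr (- (real CARD('n) / 2)) * f y)"
    using f by simp
  show "AE y in lborel. norm (heat_kernel t (x - y) * f y) \<le> norm ((2 * pi * t) powr (- (real CARD('n) / 2)) * f y)"
    using assms by (auto simp: abs_mult intro!: AE_I2 mult_right_mono heat_kernel_le)
qed measurable

lemma integrable_conv_grad:
  assumes "0 < t"
  shows "integrable lborel (\<lambda>y. f y *\<^sub>R heat_grad t (x - y))"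
proof -
  obtain C where C: "0 \<le> C" "\<And>z::real^'n. norm (heat_grad t z) \<le> C"
    using heat_grad_bounded[OF assms] by metis
  show ?thesis
  proof (rule Bochner_Integration.integrable_bound)
    show "integrable lborel (\<lambda>y. C * f y)"
      using f by simp
    show "AE y in lborel. norm (f y *\<^sub>R heat_grad t (x - y)) \<le> norm (C * f y)"
    proof (rule AE_I2)
      show "norm (f y *\<^sub>R heat_grad t (x - y)) \<le> norm (C * f y)" for y
        using mult_left_mono[OF C(2)[of "x - y"] abs_ge_zero[of "f y"]] C(1) by (simp add: abs_mult mult.commute)
    qed
  qed measurable
qed

lemma GDERIV_conv:
  assumes "0 < t"
  shows "GDERIV (conv (heat_kernel t) f) x :> conv_grad t f x"
proof -
  obtain C where C: "0 \<le> C"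
    "\<And>z h::real^'n. \<bar>heat_kernel t (z + h) - heat_kernel t z - heat_grad t z \<bullet> h\<bar> \<le> C * (norm h)\<^sup>2"
    using heat_kernel_taylor[OF assms] by metis
  define L where "L = (LINT y|lborel. \<bar>f y\<bar>)"
  show ?thesis
    unfolding gderiv_def
  proof (rule has_derivativeI_sandwich[where e=1 and H="\<lambda>y. C * L * norm (y - x)"])
    fix y assume y: "y \<noteq> x"
    let ?D = "\<lambda>z. heat_kernel t (y - z) - heat_kernel t (x - z) - heat_grad t (x - z) \<bullet> (y - x)"
    have e: "conv (heat_kernel t) f y - conv (heat_kernel t) f x - (y - x) \<bullet> conv_grad t f x = (LINT z|lborel. ?D z * f z)"
      and i: "integrable lborel (\<lambda>z. ?D z * f z)"
    proof -
      have 1: "?D z * f z = heat_kernel t (y - z) * f z - heat_kernel t (x - z) * f z - (y - x) \<bullet> (f z *\<^sub>R heat_grad t (x - z))" for z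
        by (simp add: algebra_simps inner_commute)
      have 2: "integrable lborel (\<lambda>z. (y - x) \<bullet> (f z *\<^sub>R heat_grad t (x - z)))"
        by (intro integrable_inner_right integrable_conv_grad assms)
      show "conv (heat_kernel t) f y - conv (heat_kernel t) f x - (y - x) \<bullet> conv_grad t f x = (LINT z|lborel. ?D z * f z)"
        unfolding 1 conv_def conv_grad_def integral_inner_right[OF integrable_conv_grad[OF assms], symmetric]
        by (subst Bochner_Integration.integral_diff, intro Bochner_Integration.integrable_diff integrable_conv assms, rule 2,
            subst Bochner_Integration.integral_diff, intro integrable_conv assms, intro integrable_conv assms, rule refl)
      show "integrable lborel (\<lambda>z. ?D z * f z)"
        unfolding 1 by (intro Bochner_Integration.integrable_diff integrable_conv assms 2)
    qed
    have "\<bar>LINT z|lborel. ?D z * f z\<bar> \<le> (LINT z|lborel. \<bar>?D z * f z\<bar>)"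
      by (rule integral_abs_bound)
    also have "\<dots> \<le> (LINT z|lborel. C * (norm (y - x))\<^sup>2 * \<bar>f z\<bar>)"
    proof (rule integral_mono)
      show "integrable lborel (\<lambda>z. \<bar>?D z * f z\<bar>)" using i by (rule integrable_abs)
      show "integrable lborel (\<lambda>z. C * (norm (y - x))\<^sup>2 * \<bar>f z\<bar>)" using f by simp
      fix z
      show "\<bar>?D z * f z\<bar> \<le> C * (norm (y - x))\<^sup>2 * \<bar>f z\<bar>"
        unfolding abs_mult using C(2)[of "x - z" "y - x"] by (intro mult_right_mono) auto
    qed
    also have "\<dots> = C * L * norm (y - x) * norm (y - x)"
      by (simp add: L_def power2_eq_square)
    finally show "norm (conv (heat_kernel t) f y - conv (heat_kernel t) f x - (y - x) \<bullet> conv_grad t f x) / norm (y - x) \<le> C * L * norm (y - x)"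
      using y unfolding e by (simp add: divide_le_eq)
  next
    have "((\<lambda>y. C * L * norm (y - x)) \<longlongrightarrow> C * L * norm (x - x)) (at x)"
      by (intro tendsto_intros)
    then show "((\<lambda>y. C * L * norm (y - x)) \<longlongrightarrow> 0) (at x)" by simp
  qed (auto intro: bounded_linear_inner_left)
qed

text \<open>Along a tail the times exceed t0/2, so all kernels lie below a common constant and a
  multiple of |f| dominates. Joint continuity in time and space is needed for S along a
  path.\<close>

lemma tendsto_conv:
  assumes t: "t \<longlonglongrightarrow> t0" "0 < t0" and x: "x \<longlonglongrightarrow> x0"
  shows "(\<lambda>n. conv (heat_kernel (t n)) f (x n)) \<longlonglongrightarrow> conv (heat_kernel t0) f x0"
proof -
  have "eventually (\<lambda>n. t0 / 2 < t n) sequentially"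
    using t by (intro order_tendstoD) auto
  then obtain N where N: "\<And>n. n \<ge> N \<Longrightarrow> t0 / 2 < t n"
    by (auto simp: eventually_sequentially)
  have t': "(\<lambda>n. t (n + N)) \<longlonglongrightarrow> t0" and x': "(\<lambda>n. x (n + N)) \<longlonglongrightarrow> x0"
    using t x by (auto intro: LIMSEQ_ignore_initial_segment)
  have "(\<lambda>n. conv (heat_kernel (t (n + N))) f (x (n + N))) \<longlonglongrightarrow> conv (heat_kernel t0) f x0"
    unfolding conv_def
  proof (rule integral_dominated_convergence[where w="\<lambda>y. (2 * pi * (t0 / 2)) powr (- (real CARD('n) / 2)) * \<bar>f y\<bar>"])
    show "integrable lborel (\<lambda>y. (2 * pi * (t0 / 2)) powr (- (real CARD('n) / 2)) * \<bar>f y\<bar>)"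
      using f by simp
    show "AE y in lborel. (\<lambda>n. heat_kernel (t (n + N)) (x (n + N) - y) * f y) \<longlonglongrightarrow> heat_kernel t0 (x0 - y) * f y"
      unfolding heat_kernel_def using t by (intro AE_I2 tendsto_intros t' x') auto
    show "AE y in lborel. norm (heat_kernel (t (n + N)) (x (n + N) - y) * f y) \<le> (2 * pi * (t0 / 2)) powr (- (real CARD('n) / 2)) * \<bar>f y\<bar>" for n
    proof (rule AE_I2)
      fix y
      have "heat_kernel (t (n + N)) (x (n + N) - y) \<le> (2 * pi * t (n + N)) powr (- (real CARD('n) / 2))"
        using N[of "n + N"] t by (intro heat_kernel_le) auto
      also have "\<dots> \<le> (2 * pi * (t0 / 2)) powr (- (real CARD('n) / 2))"
        using N[of "n + N"] t by (intro powr_mono2') auto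
      finally show "norm (heat_kernel (t (n + N)) (x (n + N) - y) * f y) \<le> (2 * pi * (t0 / 2)) powr (- (real CARD('n) / 2)) * \<bar>f y\<bar>"
        by (simp add: abs_mult mult_right_mono)
    qed
  qed measurable
  then show ?thesis by (rule LIMSEQ_offset)
qed

lemma measurable_conv [measurable (raw)]:
  assumes [measurable]: "t \<in> borel_measurable M" "x \<in> borel_measurable M"
  shows "(\<lambda>\<omega>. conv (heat_kernel (t \<omega>)) f (x \<omega>)) \<in> borel_measurable M"
  unfolding conv_def by measurable

lemma measurable_conv_grad [measurable (raw)]:
  assumes [measurable]: "t \<in> borel_measurable M" "x \<in> borel_measurable M"
  shows "(\<lambda>\<omega>. conv_grad (t \<omega>) f (x \<omega>)) \<in> borel_measurable M"
  unfolding conv_grad_def by measurable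

text \<open>Shared exchange of integrals for the two identities that follow: a bound on the inner
  integral that is uniform in z, together with the integrability of f, makes the double integral
  absolutely convergent.\<close>

lemma conv_Fubini:
  fixes H :: "real^'n \<Rightarrow> real^'n \<Rightarrow> real^'n"
  assumes [measurable]: "(\<lambda>(y, z). H y z) \<in> borel_measurable (borel \<Otimes>\<^sub>M borel)"
    and B: "\<And>z. (\<integral>\<^sup>+y. ennreal (norm (H y z)) \<partial>lborel) \<le> ennreal B"
    and J: "\<And>z. (LINT y|lborel. H y z) = J z"
  shows "integrable lborel (\<lambda>y. LINT z|lborel. f z *\<^sub>R H y z)"
    and "(LINT y|lborel. LINT z|lborel. f z *\<^sub>R H y z) = (LINT z|lborel. f z *\<^sub>R J z)"
proof -
  have m [measurable]: "(\<lambda>(y, z). f z *\<^sub>R H y z) \<in> borel_measurable (lborel \<Otimes>\<^sub>M lborel)"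
    by measurable
  have "(\<integral>\<^sup>+p. ennreal (norm (case p of (y, z) \<Rightarrow> f z *\<^sub>R H y z)) \<partial>(lborel \<Otimes>\<^sub>M lborel)) =
     (\<integral>\<^sup>+z. \<integral>\<^sup>+y. ennreal (norm (f z *\<^sub>R H y z)) \<partial>lborel \<partial>lborel)"
    by (subst lborel_pair.nn_integral_snd[symmetric]) auto
  also have "\<dots> = (\<integral>\<^sup>+z. ennreal \<bar>f z\<bar> * (\<integral>\<^sup>+y. ennreal (norm (H y z)) \<partial>lborel) \<partial>lborel)"
    by (simp add: ennreal_mult nn_integral_cmult)
  also have "\<dots> \<le> (\<integral>\<^sup>+z. ennreal \<bar>f z\<bar> * ennreal B \<partial>lborel)"
    by (intro nn_integral_mono mult_left_mono B) auto
  also have "\<dots> < \<infinity>"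
    using f by (simp add: nn_integral_multc integrable_iff_bounded ennreal_mult_less_top)
  finally have i: "integrable (lborel \<Otimes>\<^sub>M lborel) (\<lambda>(y, z). f z *\<^sub>R H y z)"
    by (intro integrableI_bounded m)
  show "integrable lborel (\<lambda>y. LINT z|lborel. f z *\<^sub>R H y z)"
    using lborel_pair.integrable_fst'[OF i] by simp
  have "(LINT y|lborel. LINT z|lborel. f z *\<^sub>R H y z) = (LINT z|lborel. LINT y|lborel. f z *\<^sub>R H y z)"
    by (rule lborel_pair.Fubini_integral[OF i, symmetric])
  then show "(LINT y|lborel. LINT z|lborel. f z *\<^sub>R H y z) = (LINT z|lborel. f z *\<^sub>R J z)"
    by (simp add: J)
qed

text \<open>Heat flow and gradient commute; for each fixed z this is again the mean of the Brownian
  bridge. It is the source of the martingale property of the drift.\<close>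

lemma conv_conv_grad:
  assumes a: "0 < a" and b: "0 < b"
  shows "integrable lborel (\<lambda>y. heat_kernel a (x - y) *\<^sub>R conv_grad b f y)" (is ?i)
    and "(LINT y|lborel. heat_kernel a (x - y) *\<^sub>R conv_grad b f y) = conv_grad (a + b) f x" (is ?e)
proof -
  let ?H = "\<lambda>y z. heat_kernel a (x - y) *\<^sub>R heat_grad b (y - z)"
  define c where "c = 2 powr (real CARD('n) / 2) / sqrt b"
  have c: "0 \<le> c" using b by (simp add: c_def)
  have B: "(\<integral>\<^sup>+y. ennreal (norm (?H y z)) \<partial>lborel) \<le> ennreal (c * (2 * pi * (a + 2 * b)) powr (- (real CARD('n) / 2)))" for z
  proof -
    have "(\<integral>\<^sup>+y. ennreal (norm (?H y z)) \<partial>lborel) \<le>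
       (\<integral>\<^sup>+y. ennreal c * (ennreal (heat_kernel a (x - y)) * ennreal (heat_kernel (2 * b) (y - z))) \<partial>lborel)"
    proof (rule nn_integral_mono)
      fix y
      have "norm (?H y z) \<le> heat_kernel a (x - y) * (c * heat_kernel (2 * b) (y - z))"
        using mult_left_mono[OF norm_heat_grad_le[OF b, of "y - z"], of "heat_kernel a (x - y)"] by (simp add: c_def)
      then show "ennreal (norm (?H y z)) \<le> ennreal c * (ennreal (heat_kernel a (x - y)) * ennreal (heat_kernel (2 * b) (y - z)))"
        using c by (simp add: ennreal_mult[symmetric] mult_ac ennreal_leI)
    qed
    also have "\<dots> = ennreal c * ennreal (heat_kernel (a + 2 * b) (x - z))"
      using a b by (subst nn_integral_cmult) (auto simp: heat_kernel_semigroup)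
    also have "\<dots> \<le> ennreal (c * (2 * pi * (a + 2 * b)) powr (- (real CARD('n) / 2)))"
      using a b c by (subst ennreal_mult[symmetric]) (auto intro!: ennreal_leI mult_left_mono heat_kernel_le)
    finally show ?thesis .
  qed
  have J: "(LINT y|lborel. ?H y z) = heat_grad (a + b) (x - z)" for z
  proof -
    have "?H y z = (-1 / b) *\<^sub>R (\<lambda>u. (heat_kernel b u * heat_kernel a ((x - z) - u)) *\<^sub>R u) (y - z)" for y
      by (simp add: heat_grad_def)
    then have "(LINT y|lborel. ?H y z) = (-1 / b) *\<^sub>R (LINT y|lborel. (\<lambda>u. (heat_kernel b u * heat_kernel a ((x - z) - u)) *\<^sub>R u) (y - z))"
      by (simp only: integral_scaleR_right)
    also have "(LINT y|lborel. (\<lambda>u. (heat_kernel b u * heat_kernel a ((x - z) - u)) *\<^sub>R u) (y - z)) =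
        (LINT u|lborel. (heat_kernel b u * heat_kernel a ((x - z) - u)) *\<^sub>R u)"
      by (rule integral_lborel_translate) measurable
    also have "\<dots> = (b / (b + a) * heat_kernel (b + a) (x - z)) *\<^sub>R (x - z)"
      by (rule heat_kernel_moment_convolution[OF b a])
    finally show ?thesis
      using a b by (simp add: heat_grad_def add.commute)
  qed
  have eq: "heat_kernel a (x - y) *\<^sub>R conv_grad b f y = (LINT z|lborel. f z *\<^sub>R ?H y z)" for y
    unfolding conv_grad_def by (subst integral_scaleR_right[symmetric]) (simp add: mult.commute)
  show ?i ?e
    unfolding eq using conv_Fubini[OF _ B J] by (auto simp: conv_grad_def)
qed

text \<open>Once more the bridge mean, now for the displacement from the start. Divided by the flow
  at time a + b, it says that the weighted step has mean displacement a times the logarithmic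
  gradient.\<close>

lemma conv_drift:
  assumes a: "0 < a" and b: "0 < b"
  shows "integrable lborel (\<lambda>y. (heat_kernel a (x - y) * conv (heat_kernel b) f y) *\<^sub>R (y - x))" (is ?i)
    and "(LINT y|lborel. (heat_kernel a (x - y) * conv (heat_kernel b) f y) *\<^sub>R (y - x)) = a *\<^sub>R conv_grad (a + b) f x" (is ?e)
proof -
  let ?H = "\<lambda>y z. (heat_kernel a (x - y) * heat_kernel b (y - z)) *\<^sub>R (y - x)"
  define c where "c = sqrt a * 2 powr (real CARD('n) / 2)"
  have c: "0 \<le> c" using a by (simp add: c_def)
  have B: "(\<integral>\<^sup>+y. ennreal (norm (?H y z)) \<partial>lborel) \<le> ennreal (c * (2 * pi * (2 * a + b)) powr (- (real CARD('n) / 2)))" for z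
  proof -
    have "(\<integral>\<^sup>+y. ennreal (norm (?H y z)) \<partial>lborel) \<le>
       (\<integral>\<^sup>+y. ennreal c * (ennreal (heat_kernel (2 * a) (x - y)) * ennreal (heat_kernel b (y - z))) \<partial>lborel)"
    proof (rule nn_integral_mono)
      fix y
      have "norm (?H y z) \<le> (c * heat_kernel (2 * a) (x - y)) * heat_kernel b (y - z)"
        using mult_right_mono[OF norm_heat_kernel_le[OF a, of "x - y"], of "heat_kernel b (y - z)"]
        by (simp add: c_def norm_minus_commute mult_ac)
      then show "ennreal (norm (?H y z)) \<le> ennreal c * (ennreal (heat_kernel (2 * a) (x - y)) * ennreal (heat_kernel b (y - z)))"
        using c by (simp add: ennreal_mult[symmetric] mult_ac ennreal_leI)
    qed
    also have "\<dots> = ennreal c * ennreal (heat_kernel (2 * a + b) (x - z))"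
      using a b by (subst nn_integral_cmult) (auto simp: heat_kernel_semigroup)
    also have "\<dots> \<le> ennreal (c * (2 * pi * (2 * a + b)) powr (- (real CARD('n) / 2)))"
      using a b c by (subst ennreal_mult[symmetric]) (auto intro!: ennreal_leI mult_left_mono heat_kernel_le)
    finally show ?thesis .
  qed
  have J: "(LINT y|lborel. ?H y z) = a *\<^sub>R heat_grad (a + b) (x - z)" for z
  proof -
    have "?H y z = (-1) *\<^sub>R (\<lambda>u. (heat_kernel a u * heat_kernel b ((x - z) - u)) *\<^sub>R u) (x - y)" for y
      by (simp add: algebra_simps)
    then have "(LINT y|lborel. ?H y z) = (-1) *\<^sub>R (LINT y|lborel. (\<lambda>u. (heat_kernel a u * heat_kernel b ((x - z) - u)) *\<^sub>R u) (x - y))"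
      by (simp only: integral_scaleR_right)
    also have "(LINT y|lborel. (\<lambda>u. (heat_kernel a u * heat_kernel b ((x - z) - u)) *\<^sub>R u) (x - y)) =
        (LINT u|lborel. (heat_kernel a u * heat_kernel b ((x - z) - u)) *\<^sub>R u)"
      by (rule integral_lborel_reflect) measurable
    also have "\<dots> = (a / (a + b) * heat_kernel (a + b) (x - z)) *\<^sub>R (x - z)"
      by (rule heat_kernel_moment_convolution[OF a b])
    finally show ?thesis
      using a b by (simp add: heat_grad_def)
  qed
  have eq: "(heat_kernel a (x - y) * conv (heat_kernel b) f y) *\<^sub>R (y - x) = (LINT z|lborel. f z *\<^sub>R ?H y z)" for y
  proof -
    have "(heat_kernel a (x - y) * conv (heat_kernel b) f y) *\<^sub>R (y - x) =
       (LINT z|lborel. heat_kernel a (x - y) * (heat_kernel b (y - z) * f z)) *\<^sub>R (y - x)"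
      by (simp add: conv_def)
    also have "\<dots> = (LINT z|lborel. (heat_kernel a (x - y) * (heat_kernel b (y - z) * f z)) *\<^sub>R (y - x))"
      by (rule integral_scaleR_left[symmetric]) (simp add: integrable_conv[OF b])
    finally show ?thesis by (simp add: mult_ac)
  qed
  have *: "(LINT z|lborel. f z *\<^sub>R (a *\<^sub>R heat_grad (a + b) (x - z))) = a *\<^sub>R conv_grad (a + b) f x"
    unfolding conv_grad_def by (subst integral_scaleR_right[symmetric]) (simp add: mult.commute)
  show ?i ?e
    unfolding eq using conv_Fubini[OF _ B J] * by auto
qed

text \<open>The counterpart of \<open>conv_drift\<close> for b = 0, where \<open>heat_kernel\<close>
  is identically 0 instead of a point mass. It serves the final time t = T.\<close>

lemma drift_initial:
  assumes "0 < a"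
  shows "integrable lborel (\<lambda>y. (heat_kernel a (x - y) * f y) *\<^sub>R (y - x))"
    and "(LINT y|lborel. (heat_kernel a (x - y) * f y) *\<^sub>R (y - x)) = a *\<^sub>R conv_grad a f x"
proof -
  have eq: "(heat_kernel a (x - y) * f y) *\<^sub>R (y - x) = a *\<^sub>R (f y *\<^sub>R heat_grad a (x - y))" for y
    using assms by (simp add: heat_grad_def algebra_simps)
  show "integrable lborel (\<lambda>y. (heat_kernel a (x - y) * f y) *\<^sub>R (y - x))"
    unfolding eq by (intro integrable_scaleR_right integrable_conv_grad assms)
  show "(LINT y|lborel. (heat_kernel a (x - y) * f y) *\<^sub>R (y - x)) = a *\<^sub>R conv_grad a f x"
    unfolding eq conv_grad_def by (rule integral_scaleR_right)
qed

context
  assumes f0: "\<And>y. 0 \<le> f y"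
begin

lemma conv_nonneg: "0 \<le> conv (heat_kernel t) f x"
  unfolding conv_def by (intro integral_nonneg_AE AE_I2 mult_nonneg_nonneg f0 heat_kernel_nonneg)

lemma nn_integral_conv:
  assumes "0 < t"
  shows "(\<integral>\<^sup>+y. ennreal (heat_kernel t (x - y)) * ennreal (f y) \<partial>lborel) = ennreal (conv (heat_kernel t) f x)"
  using nn_integral_eq_integral[OF integrable_conv[OF assms, of x]] f0 by (simp add: conv_def ennreal_mult)

lemma nn_integral_conv_conv:
  assumes "0 < a" "0 < b"
  shows "(\<integral>\<^sup>+y. ennreal (heat_kernel a (x - y)) * ennreal (conv (heat_kernel b) f y) \<partial>lborel) = ennreal (conv (heat_kernel (a + b)) f x)"
  using nn_integral_heat_semigroup[of a b "\<lambda>y. ennreal (f y)" x] assms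
  by (simp add: nn_integral_conv)

lemma conv_le:
  assumes "0 < t"
  shows "conv (heat_kernel t) f x \<le> (2 * pi * t) powr (- (real CARD('n) / 2)) * (LINT y|lborel. f y)"
proof -
  have "conv (heat_kernel t) f x \<le> (LINT y|lborel. (2 * pi * t) powr (- (real CARD('n) / 2)) * f y)"
    unfolding conv_def using f f0 assms
    by (intro integral_mono integrable_conv mult_right_mono heat_kernel_le) auto
  then show ?thesis by simp
qed

lemma norm_conv_grad_le:
  assumes "0 < t"
  shows "norm (conv_grad t f x) \<le> 2 powr (real CARD('n) / 2) / sqrt t * conv (heat_kernel (2 * t)) f x"
proof -
  have "norm (conv_grad t f x) \<le> (LINT y|lborel. norm (f y *\<^sub>R heat_grad t (x - y)))"
    unfolding conv_grad_def by (rule integral_norm_bound)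
  also have "\<dots> \<le> (LINT y|lborel. 2 powr (real CARD('n) / 2) / sqrt t * (heat_kernel (2 * t) (x - y) * f y))"
  proof (rule integral_mono)
    show "integrable lborel (\<lambda>y. norm (f y *\<^sub>R heat_grad t (x - y)))"
      by (intro integrable_norm integrable_conv_grad assms)
    show "integrable lborel (\<lambda>y. 2 powr (real CARD('n) / 2) / sqrt t * (heat_kernel (2 * t) (x - y) * f y))"
      using assms by (intro integrable_mult_right integrable_conv) auto
    show "norm (f y *\<^sub>R heat_grad t (x - y)) \<le> 2 powr (real CARD('n) / 2) / sqrt t * (heat_kernel (2 * t) (x - y) * f y)" for y
      using mult_left_mono[OF norm_heat_grad_le[OF assms, of "x - y"] f0[of y]] f0[of y] by (simp add: mult_ac)
  qed
  finally show ?thesis by (simp add: conv_def)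
qed

lemma conv_pos:
  assumes "0 < t" and pos: "AE y in lborel. 0 < f y"
  shows "0 < conv (heat_kernel t) f x"
proof (rule ccontr)
  assume "\<not> ?thesis"
  then have "conv (heat_kernel t) f x = 0"
    using conv_nonneg[of t x] by linarith
  then have "AE y in lborel. heat_kernel t (x - y) * f y = 0"
    unfolding conv_def using integral_nonneg_eq_0_iff_AE[OF integrable_conv[OF assms(1), of x]] f0 by simp
  then have "AE y in (lborel :: (real^'n) measure). False"
    using pos
  proof eventually_elim
    case (elim y)
    then show ?case using heat_kernel_pos[OF assms(1), of "x - y"] by auto
  qed
  then show False
    by (simp add: AE_iff_null null_sets_def)
qed

end

end

section \<open>The ground state\<close>

text \<open>True also for a non-integrable function, whose Bochner integral is 0. So upper bounds
  can be derived before integrability is known.\<close>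

lemma ennreal_integral_le_nn_integral:
  assumes "f \<in> borel_measurable M" "\<And>x. 0 \<le> f x"
  shows "ennreal (integral\<^sup>L M f) \<le> (\<integral>\<^sup>+x. ennreal (f x) \<partial>M)"
  using assms by (simp add: integral_eq_nn_integral ennreal_enn2real_if)

lemma nn_integral_exp_Ici:
  assumes "0 < l"
  shows "(\<integral>\<^sup>+u. ennreal (exp (- l * u)) * indicator {0..} u \<partial>lborel) = ennreal (1 / l)"
proof -
  have "(\<integral>\<^sup>+u. ennreal (exp (- l * u)) * indicator {0..} u \<partial>lborel) = ennreal (0 - (- exp (- l * 0) / l))"
  proof (rule nn_integral_FTC_atLeast[where F="\<lambda>u. - exp (- l * u) / l"])
    show "((\<lambda>u. - exp (- l * u) / l) has_real_derivative exp (- l * x)) (at x)" for x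
      using assms by (auto intro!: derivative_eq_intros)
    have "filterlim (\<lambda>u. - l * u) at_bot at_top"
      using assms by (intro filterlim_tendsto_neg_mult_at_bot[OF tendsto_const] filterlim_ident) auto
    then have "((\<lambda>u. exp (- l * u)) \<longlongrightarrow> 0) at_top"
      by (rule filterlim_compose[OF exp_at_bot])
    from tendsto_divide[OF tendsto_minus[OF this] tendsto_const[of l]]
    show "((\<lambda>u. - exp (- l * u) / l) \<longlongrightarrow> 0) at_top"
      using assms by simp
  qed auto
  then show ?thesis using assms by simp
qed

lemma nn_integral_exp_abs:
  assumes "0 < l"
  shows "(\<integral>\<^sup>+u. ennreal (exp (- l * \<bar>u\<bar>)) \<partial>lborel) \<le> ennreal (2 / l)"
proof -
  let ?f = "\<lambda>u. ennreal (exp (- l * u)) * indicator {0..} u"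
  have "(\<integral>\<^sup>+u. ennreal (exp (- l * \<bar>u\<bar>)) \<partial>lborel) \<le> (\<integral>\<^sup>+u. ?f u + ?f (0 - u) \<partial>lborel)"
    by (intro nn_integral_mono) (auto simp: indicator_def abs_if)
  also have "\<dots> = (\<integral>\<^sup>+u. ?f u \<partial>lborel) + (\<integral>\<^sup>+u. ?f (0 - u) \<partial>lborel)"
    by (rule nn_integral_add) measurable
  also have "(\<integral>\<^sup>+u. ?f (0 - u) \<partial>lborel) = (\<integral>\<^sup>+u. ?f u \<partial>lborel)"
    by (rule nn_integral_lborel_reflect) measurable
  also have "(\<integral>\<^sup>+u. ?f u \<partial>lborel) + (\<integral>\<^sup>+u. ?f u \<partial>lborel) = ennreal (2 / l)"
    unfolding nn_integral_exp_Ici[OF assms] using assms by (simp add: ennreal_plus[symmetric] del: ennreal_plus)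
  finally show ?thesis .
qed

text \<open>The sum of the coordinates |x_i| is at most d |x|, so the integrand is dominated by a
  product of one-dimensional exponentials with rate c / d, each of mass at most 2d / c.\<close>

lemma nn_integral_exp_norm:
  assumes "0 < c"
  shows "(\<integral>\<^sup>+x. ennreal (exp (- c * norm (x::real^'n))) \<partial>lborel) \<le> ennreal ((2 * real CARD('n) / c) ^ CARD('n))"
proof -
  let ?d = "real CARD('n)"
  have "(\<integral>\<^sup>+x. ennreal (exp (- c * norm (x::real^'n))) \<partial>lborel) \<le>
     (\<integral>\<^sup>+x. (\<Prod>b\<in>(Basis::(real^'n) set). ennreal (exp (- (c / ?d) * \<bar>x \<bullet> b\<bar>))) \<partial>lborel)"
  proof (rule nn_integral_mono)
    fix x :: "real^'n"
    have "(\<Sum>b\<in>(Basis::(real^'n) set). \<bar>x \<bullet> b\<bar>) \<le> (\<Sum>b\<in>(Basis::(real^'n) set). norm x)"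
      by (intro sum_mono Basis_le_norm)
    then have "(\<Sum>b\<in>(Basis::(real^'n) set). \<bar>x \<bullet> b\<bar>) \<le> ?d * norm x"
      by simp
    then have "(c / ?d) * (\<Sum>b\<in>(Basis::(real^'n) set). \<bar>x \<bullet> b\<bar>) \<le> (c / ?d) * (?d * norm x)"
      using assms by (intro mult_left_mono) auto
    then have "- (c / ?d) * (?d * norm x) \<le> - (c / ?d) * (\<Sum>b\<in>(Basis::(real^'n) set). \<bar>x \<bullet> b\<bar>)"
      by (simp only: mult_minus_left neg_le_iff_le)
    moreover have "- (c / ?d) * (?d * norm x) = - c * norm x"
      by simp
    ultimately have "- c * norm x \<le> (\<Sum>b\<in>(Basis::(real^'n) set). - (c / ?d) * \<bar>x \<bullet> b\<bar>)"
      by (simp only: sum_distrib_left)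
    then have "exp (- c * norm x) \<le> (\<Prod>b\<in>(Basis::(real^'n) set). exp (- (c / ?d) * \<bar>x \<bullet> b\<bar>))"
      by (subst exp_sum[symmetric]) auto
    then show "ennreal (exp (- c * norm x)) \<le> (\<Prod>b\<in>(Basis::(real^'n) set). ennreal (exp (- (c / ?d) * \<bar>x \<bullet> b\<bar>)))"
      by (subst prod_ennreal) (auto intro: ennreal_leI)
  qed
  also have "\<dots> = (\<Prod>b\<in>(Basis::(real^'n) set). \<integral>\<^sup>+u. ennreal (exp (- (c / ?d) * \<bar>u\<bar>)) \<partial>lborel)"
    by (rule nn_integral_lborel_prod) auto
  also have "\<dots> \<le> (\<Prod>b\<in>(Basis::(real^'n) set). ennreal (2 / (c / ?d)))"
    using assms by (intro prod_mono_ennreal nn_integral_exp_abs) auto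
  also have "\<dots> = ennreal ((2 * ?d / c) ^ CARD('n))"
    using assms by (simp add: ennreal_power)
  finally show ?thesis .
qed

section \<open>The Bessel function K_0 and the integrability of psi\<close>

lemma cosh_real_ge: "(1 + u) / 2 \<le> cosh (u::real)" "exp u / 2 \<le> cosh u"
proof -
  have "cosh u = (exp u + exp (- u)) / 2"
    by (simp add: cosh_def)
  moreover have "(1 + u) / 2 \<le> (p + q) / 2 \<and> p / 2 \<le> (p + q) / 2" if "0 < q" "1 + u \<le> p" for p q :: real
    using that by (simp add: field_simps)
  ultimately show "(1 + u) / 2 \<le> cosh u" "exp u / 2 \<le> cosh u"
    using exp_gt_zero[of "- u"] exp_ge_add_one_self[of u] by metis+
qed

lemma integrable_bessel_K0:
  fixes z :: real
  assumes "0 < z"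
  shows "set_integrable lborel {0..} (\<lambda>u. exp (- z * cosh u))"
  unfolding set_integrable_def
proof (rule integrableI_bounded)
  have "(\<integral>\<^sup>+u. ennreal (norm (indicator {0..} u *\<^sub>R exp (- z * cosh u))) \<partial>lborel) \<le>
    (\<integral>\<^sup>+u. ennreal (exp (- (z / 2) * u)) * indicator {0..} u \<partial>lborel)"
  proof (rule nn_integral_mono)
    fix u :: real
    have "z * ((1 + u) / 2) \<le> z * cosh u"
      using assms cosh_real_ge(1)[of u] by (intro mult_left_mono) auto
    moreover have "z * ((1 + u) / 2) = z / 2 + (z / 2) * u"
      by (simp add: field_simps)
    ultimately have "- z * cosh u \<le> - (z / 2) * u"
      using assms by linarith
    then show "ennreal (norm (indicator {0..} u *\<^sub>R exp (- z * cosh u))) \<le> ennreal (exp (- (z / 2) * u)) * indicator {0..} u"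
      by (auto simp: indicator_def intro!: ennreal_leI)
  qed
  also have "\<dots> < \<infinity>"
    using assms by (subst nn_integral_exp_Ici) auto
  finally show "(\<integral>\<^sup>+u. ennreal (norm (indicator {0..} u *\<^sub>R exp (- z * cosh u))) \<partial>lborel) < \<infinity>" .
qed (simp add: cosh_def)

lemma bessel_K0_nonneg: "0 \<le> bessel_K0 z"
  unfolding bessel_K0_def set_lebesgue_integral_def by (intro integral_nonneg_AE) auto

text \<open>Only the range [0, U] is kept, where cosh u is at most cosh U. The free parameter U
  makes one bound serve for positivity and for the divergence at 0.\<close>

lemma bessel_K0_ge:
  assumes "0 < z" "0 \<le> U"
  shows "U * exp (- z * cosh U) \<le> bessel_K0 z"
proof -
  have "U * exp (- z * cosh U) = (LBINT u:{0..U}. exp (- z * cosh U))"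
    using assms by (simp add: set_lebesgue_integral_def)
  also have "\<dots> = (LBINT u. indicator {0..U} u *\<^sub>R exp (- z * cosh U))"
    by (simp add: set_lebesgue_integral_def)
  also have "\<dots> \<le> (LBINT u. indicator {0..} u *\<^sub>R exp (- z * cosh u))"
  proof (rule integral_mono)
    show "integrable lborel (\<lambda>u. indicator {0..U} u *\<^sub>R exp (- z * cosh U))"
      using assms by (intro integrable_scaleR_left integrable_real_indicator) auto
    show "integrable lborel (\<lambda>u. indicator {0..} u *\<^sub>R exp (- z * cosh u))"
      using integrable_bessel_K0[OF assms(1)] by (simp add: set_integrable_def)
    fix u
    have "cosh u \<le> cosh U" if "0 \<le> u" "u \<le> U"
      using that by (simp add: cosh_real_nonneg_le_iff)
    then show "indicator {0..U} u *\<^sub>R exp (- z * cosh U) \<le> indicator {0..} u *\<^sub>R exp (- z * cosh u)"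
      using assms by (auto simp: indicator_def)
  qed
  finally show ?thesis by (simp add: bessel_K0_def set_lebesgue_integral_def)
qed

lemma tendsto_bessel_K0:
  assumes t: "t \<longlonglongrightarrow> t0" "0 < t0"
  shows "(\<lambda>n. bessel_K0 (t n)) \<longlonglongrightarrow> bessel_K0 t0"
proof -
  have "eventually (\<lambda>n. t0 / 2 < t n) sequentially"
    using t by (intro order_tendstoD) auto
  then obtain N where N: "\<And>n. n \<ge> N \<Longrightarrow> t0 / 2 < t n"
    by (auto simp: eventually_sequentially)
  have t': "(\<lambda>n. t (n + N)) \<longlonglongrightarrow> t0"
    using t by (auto intro: LIMSEQ_ignore_initial_segment)
  have "(\<lambda>n. bessel_K0 (t (n + N))) \<longlonglongrightarrow> bessel_K0 t0"
    unfolding bessel_K0_def set_lebesgue_integral_def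
  proof (rule integral_dominated_convergence[where w="\<lambda>u. indicator {0..} u *\<^sub>R exp (- (t0 / 2) * cosh u)"])
    show "integrable lborel (\<lambda>u. indicator {0..} u *\<^sub>R exp (- (t0 / 2) * cosh u))"
      using integrable_bessel_K0[of "t0 / 2"] t by (simp add: set_integrable_def)
    show "AE u in lborel. (\<lambda>n. indicator {0..} u *\<^sub>R exp (- t (n + N) * cosh u)) \<longlonglongrightarrow> indicator {0..} u *\<^sub>R exp (- t0 * cosh u)"
      by (intro AE_I2 tendsto_intros t')
    show "AE u in lborel. norm (indicator {0..} u *\<^sub>R exp (- t (n + N) * cosh u)) \<le> indicator {0..} u *\<^sub>R exp (- (t0 / 2) * cosh u)" for n
    proof (rule AE_I2)
      fix u :: real
      have "t0 / 2 * cosh u \<le> t (n + N) * cosh u"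
        using N[of "n + N"] by (intro mult_right_mono) auto
      then show "norm (indicator {0..} u *\<^sub>R exp (- t (n + N) * cosh u)) \<le> indicator {0..} u *\<^sub>R exp (- (t0 / 2) * cosh u)"
        by (auto simp: indicator_def)
    qed
  qed (simp_all add: cosh_def)
  then show ?thesis by (rule LIMSEQ_offset)
qed

lemma measurable_bessel_K0 [measurable]: "bessel_K0 \<in> borel_measurable borel"
  unfolding bessel_K0_def[abs_def] set_lebesgue_integral_def cosh_def by measurable

lemma measurable_psi [measurable]: "psi \<gamma> \<in> borel_measurable borel"
  unfolding psi_def[abs_def] by (cases "CARD('a) = 2") simp_all

lemma psi_nonneg [simp]: "0 < \<gamma> \<Longrightarrow> 0 \<le> psi \<gamma> x"
  by (simp add: psi_def bessel_K0_nonneg)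

lemma psi_pos:
  assumes "0 < \<gamma>" "x \<noteq> 0"
  shows "0 < psi \<gamma> x"
proof -
  have "0 < bessel_K0 (sqrt (2 * \<gamma>) * norm x)"
    using assms bessel_K0_ge[of "sqrt (2 * \<gamma>) * norm x" 1]
    by (intro less_le_trans[OF _ bessel_K0_ge[of "sqrt (2 * \<gamma>) * norm x" 1]]) auto
  then show ?thesis
    using assms by (simp add: psi_def)
qed

lemma tendsto_psi:
  fixes x :: "nat \<Rightarrow> real^'n"
  assumes "0 < \<gamma>" "x \<longlonglongrightarrow> x0" "x0 \<noteq> 0"
  shows "(\<lambda>n. psi \<gamma> (x n)) \<longlonglongrightarrow> psi \<gamma> x0"
proof (cases "CARD('n) = 2")
  case True
  have "(\<lambda>n. bessel_K0 (sqrt (2 * \<gamma>) * norm (x n))) \<longlonglongrightarrow> bessel_K0 (sqrt (2 * \<gamma>) * norm x0)"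
    using assms by (intro tendsto_bessel_K0 tendsto_intros) auto
  then show ?thesis
    unfolding psi_def using True by (auto intro!: tendsto_intros)
next
  case False
  then show ?thesis
    unfolding psi_def using assms by (auto intro!: tendsto_intros)
qed

text \<open>This divergence, logarithmic for d = 2 and like 1/|x| for d = 3, is what makes the
  survival function small near 0.\<close>

lemma psi_large_near_0:
  assumes g: "0 < \<gamma>"
  obtains \<epsilon> where "0 < \<epsilon>" "\<And>x::real^'n. x \<noteq> 0 \<Longrightarrow> norm x \<le> \<epsilon> \<Longrightarrow> B \<le> psi \<gamma> x"
proof (cases "CARD('n) = 2")
  case True
  define c where "c = sqrt (2 * \<gamma> / pi)"
  define z where "z = sqrt (2 * \<gamma>)"
  have c: "0 < c" and z: "0 < z" using g by (auto simp: c_def z_def)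
  \<comment> \<open>Chosen so that c U exp (- 1) = |B|. For |x| at most 1 / (z cosh U) the exponent
    in \<open>bessel_K0_ge\<close> stays above -1.\<close>
  define U where "U = \<bar>B\<bar> * exp 1 / c"
  have U: "0 \<le> U" using c by (simp add: U_def)
  show ?thesis
  proof (rule that[of "1 / (z * cosh U)"])
    show "0 < 1 / (z * cosh U)" using z by simp
    fix x :: "real^'n" assume x: "x \<noteq> 0" "norm x \<le> 1 / (z * cosh U)"
    have "z * norm x * cosh U \<le> 1"
      using x z by (simp add: field_simps)
    then have "exp (- 1) \<le> exp (- (z * norm x) * cosh U)"
      by simp
    then have "U * exp (- 1) \<le> bessel_K0 (z * norm x)"
      using bessel_K0_ge[of "z * norm x" U] U x z mult_left_mono[of "exp (-1)" "exp (- (z * norm x) * cosh U)" U] by simp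
    then have "c * (U * exp (- 1)) \<le> c * bessel_K0 (z * norm x)"
      using c by (intro mult_left_mono) auto
    moreover have "c * (U * exp (- 1)) = \<bar>B\<bar>"
      using c by (simp add: U_def exp_minus)
    ultimately show "B \<le> psi \<gamma> x"
      using True by (simp add: psi_def c_def z_def)
  qed
next
  case False
  define c where "c = sqrt (\<gamma> / (2 * pi)) * exp (- \<gamma>)"
  have c: "0 < c" using g by (simp add: c_def)
  show ?thesis
  proof (rule that[of "min 1 (c / (\<bar>B\<bar> + 1))"])
    show "0 < min 1 (c / (\<bar>B\<bar> + 1))" using c by simp
    fix x :: "real^'n" assume x: "x \<noteq> 0" "norm x \<le> min 1 (c / (\<bar>B\<bar> + 1))"
    have "B * norm x \<le> (\<bar>B\<bar> + 1) * norm x"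
      by (intro mult_right_mono) auto
    also have "\<dots> \<le> c"
      using x by (simp add: field_simps)
    also have "\<dots> \<le> sqrt (\<gamma> / (2 * pi)) * exp (- \<gamma> * norm x)"
      unfolding c_def using x g by (intro mult_left_mono) (auto simp: mult_left_le)
    finally show "B \<le> psi \<gamma> x"
      using False x by (simp add: psi_def field_simps)
  qed
qed

lemma nn_integral_cosh: "(\<integral>\<^sup>+u. ennreal ((1 / cosh u)\<^sup>2) * indicator {0..} u \<partial>lborel) < \<infinity>"
proof -
  have "(\<integral>\<^sup>+u. ennreal ((1 / cosh u)\<^sup>2) * indicator {0..} u \<partial>lborel) \<le>
     (\<integral>\<^sup>+u. 4 * (ennreal (exp (- 2 * u)) * indicator {0..} u) \<partial>lborel)"
  proof (rule nn_integral_mono)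
    fix u :: real
    have "(1 / cosh u)\<^sup>2 \<le> (2 * exp (- u))\<^sup>2"
      using cosh_real_ge(2)[of u] by (intro power_mono) (auto simp: exp_minus field_simps)
    also have "\<dots> = 4 * exp (- 2 * u)"
      by (simp add: power2_eq_square exp_add[symmetric])
    finally show "ennreal ((1 / cosh u)\<^sup>2) * indicator {0..} u \<le> 4 * (ennreal (exp (- 2 * u)) * indicator {0..} u)"
      by (auto simp: indicator_def ennreal_mult[symmetric] simp flip: ennreal_numeral intro!: ennreal_leI)
  qed
  also have "\<dots> = 4 * ennreal (1 / 2)"
    by (subst nn_integral_cmult, measurable, subst nn_integral_exp_Ici) auto
  also have "\<dots> < \<infinity>"
    unfolding infinity_ennreal_def ennreal_mult_less_top using ennreal_less_top[of "1 / 2"] by (simp only: ennreal_numeral_less_top simp_thms)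
  finally show ?thesis .
qed

lemma nn_integral_inverse_cube:
  assumes "0 < \<gamma>"
  shows "(\<integral>\<^sup>+u. ennreal ((1 / (\<gamma> + u)) ^ 3) * indicator {0..} u \<partial>lborel) < \<infinity>"
proof -
  have "(\<integral>\<^sup>+u. ennreal ((1 / (\<gamma> + u)) ^ 3) * indicator {0..} u \<partial>lborel) = ennreal (0 - (- 1 / (2 * (\<gamma> + 0)\<^sup>2)))"
  proof (rule nn_integral_FTC_atLeast[where F="\<lambda>u. - 1 / (2 * (\<gamma> + u)\<^sup>2)"])
    show "((\<lambda>u. - 1 / (2 * (\<gamma> + u)\<^sup>2)) has_real_derivative (1 / (\<gamma> + x)) ^ 3) (at x)" if "0 \<le> x" for x
      using assms that by (auto intro!: derivative_eq_intros simp: divide_simps power2_eq_square power3_eq_cube)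
    have "filterlim (\<lambda>u. \<gamma> + u) at_top at_top"
      by (intro filterlim_tendsto_add_at_top[OF tendsto_const] filterlim_ident)
    then have "filterlim (\<lambda>u. 2 * (\<gamma> + u)\<^sup>2) at_top at_top"
      by (intro filterlim_tendsto_pos_mult_at_top[OF tendsto_const] filterlim_pow_at_top) auto
    then show "((\<lambda>u. - 1 / (2 * (\<gamma> + u)\<^sup>2)) \<longlongrightarrow> 0) at_top"
      by (intro tendsto_divide_0[OF tendsto_const] filterlim_at_top_imp_at_infinity)
  qed (use assms in auto)
  then show ?thesis by simp
qed

text \<open>psi is dominated by a mixture of the exponentials \<open>exp (- w u * norm x)\<close>:
  for d = 2 through the integral that defines K_0, for d = 3 by writing 1/|x| as the integral of exp
  (- u |x|) over u >= 0. By Tonelli the mass reduces to an integral of \<open>w u\<close> to the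
  power -d, that is, of 1 / cosh^2 or of 1 / (\<gamma> + u)^3.\<close>

lemma integrable_psi:
  assumes g: "0 < \<gamma>" and d: "CARD('n) \<in> {2, 3}"
  shows "integrable lborel (psi \<gamma> :: real^'n \<Rightarrow> real)"
proof -
  define c where "c = (if CARD('n) = 2 then sqrt (2 * \<gamma> / pi) else sqrt (\<gamma> / (2 * pi)))"
  define w where "w = (\<lambda>u. if CARD('n) = 2 then sqrt (2 * \<gamma>) * cosh u else \<gamma> + u)"
  have c: "0 \<le> c" using g by (simp add: c_def)
  have w0: "0 < w u" if "0 \<le> u" for u using g that by (simp add: w_def)
  have [measurable]: "w \<in> borel_measurable borel"
    unfolding w_def cosh_def by (cases "CARD('n) = 2") simp_all
  have rep: "ennreal (psi \<gamma> x) \<le> ennreal c * (\<integral>\<^sup>+u. ennreal (exp (- w u * norm x)) * indicator {0..} u \<partial>lborel)" for x :: "real^'n"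
  proof (cases "CARD('n) = 2")
    case True
    let ?z = "sqrt (2 * \<gamma>) * norm x"
    have "ennreal (bessel_K0 ?z) \<le> (\<integral>\<^sup>+u. ennreal (indicator {0..} u *\<^sub>R exp (- ?z * cosh u)) \<partial>lborel)"
      unfolding bessel_K0_def set_lebesgue_integral_def by (rule ennreal_integral_le_nn_integral) (simp_all add: cosh_def)
    also have "\<dots> = (\<integral>\<^sup>+u. ennreal (exp (- w u * norm x)) * indicator {0..} u \<partial>lborel)"
      by (intro nn_integral_cong) (auto simp: w_def True indicator_def mult_ac)
    finally show ?thesis
      using True c by (simp add: psi_def c_def ennreal_mult bessel_K0_nonneg mult_left_mono)
  next
    case False
    show ?thesis
    \<comment> \<open>At x = 0 this formula divides by 0 and has the value 0.\<close>
    proof (cases "x = 0")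
      case False
      have "(\<integral>\<^sup>+u. ennreal (exp (- w u * norm x)) * indicator {0..} u \<partial>lborel) =
         (\<integral>\<^sup>+u. ennreal (exp (- \<gamma> * norm x)) * (ennreal (exp (- norm x * u)) * indicator {0..} u) \<partial>lborel)"
        using \<open>CARD('n) \<noteq> 2\<close> by (intro nn_integral_cong)
          (auto simp: w_def indicator_def ennreal_mult[symmetric] exp_add[symmetric] algebra_simps)
      also have "\<dots> = ennreal (exp (- \<gamma> * norm x)) * ennreal (1 / norm x)"
        using False by (subst nn_integral_cmult, measurable, subst nn_integral_exp_Ici) auto
      finally show ?thesis
        using \<open>CARD('n) \<noteq> 2\<close> g by (simp add: psi_def c_def ennreal_mult[symmetric])
    qed (use False in \<open>simp add: psi_def\<close>)
  qed
  have "(\<integral>\<^sup>+x. \<integral>\<^sup>+u. ennreal (exp (- w u * norm (x::real^'n))) * indicator {0..} u \<partial>lborel \<partial>lborel) =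
     (\<integral>\<^sup>+u. \<integral>\<^sup>+x. ennreal (exp (- w u * norm (x::real^'n))) * indicator {0..} u \<partial>lborel \<partial>lborel)"
    by (rule lborel_pair.Fubini') measurable
  also have "\<dots> = (\<integral>\<^sup>+u. (\<integral>\<^sup>+x. ennreal (exp (- w u * norm (x::real^'n))) \<partial>lborel) * indicator {0..} u \<partial>lborel)"
    by (simp add: nn_integral_multc)
  also have "\<dots> \<le> (\<integral>\<^sup>+u. ennreal ((2 * real CARD('n) / w u) ^ CARD('n)) * indicator {0..} u \<partial>lborel)"
  proof (rule nn_integral_mono)
    show "(\<integral>\<^sup>+x. ennreal (exp (- w u * norm (x::real^'n))) \<partial>lborel) * indicator {0..} u \<le>
       ennreal ((2 * real CARD('n) / w u) ^ CARD('n)) * indicator {0..} u" for u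
      using nn_integral_exp_norm[OF w0, of u, where 'n='n] by (auto simp: indicator_def)
  qed
  also have "\<dots> < \<infinity>"
  proof (cases "CARD('n) = 2")
    case True
    have "(\<integral>\<^sup>+u. ennreal ((2 * real CARD('n) / w u) ^ CARD('n)) * indicator {0..} u \<partial>lborel) =
       (\<integral>\<^sup>+u. ennreal ((4 / sqrt (2 * \<gamma>))\<^sup>2) * (ennreal ((1 / cosh u)\<^sup>2) * indicator {0..} u) \<partial>lborel)"
      unfolding True by (intro nn_integral_cong)
        (auto simp: w_def True indicator_def ennreal_mult[symmetric] power_mult_distrib[symmetric] simp del: real_sqrt_mult)
    also have "\<dots> = ennreal ((4 / sqrt (2 * \<gamma>))\<^sup>2) * (\<integral>\<^sup>+u. ennreal ((1 / cosh u)\<^sup>2) * indicator {0..} u \<partial>lborel)"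
      by (rule nn_integral_cmult) (simp add: cosh_def)
    finally show ?thesis
      using nn_integral_cosh by (simp add: ennreal_mult_less_top)
  next
    case False
    then have d3: "CARD('n) = 3" using d by auto
    define K where "K = (6::real) ^ 3"
    have K: "0 \<le> K" "(6 / v) ^ 3 = K * (1 / v) ^ 3" for v :: real
      by (simp_all add: K_def power_divide)
    have "(\<integral>\<^sup>+u. ennreal ((2 * real CARD('n) / w u) ^ CARD('n)) * indicator {0..} u \<partial>lborel) =
       (\<integral>\<^sup>+u. ennreal K * (ennreal ((1 / (\<gamma> + u)) ^ 3) * indicator {0..} u) \<partial>lborel)"
      unfolding d3 using g K(1) by (intro nn_integral_cong)
        (auto simp: w_def d3 indicator_def ennreal_mult[symmetric] K(2) simp del: power_one_over)
    also have "\<dots> = ennreal K * (\<integral>\<^sup>+u. ennreal ((1 / (\<gamma> + u)) ^ 3) * indicator {0..} u \<partial>lborel)"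
      by (rule nn_integral_cmult) simp
    also have "\<dots> < \<infinity>"
      unfolding infinity_ennreal_def ennreal_mult_less_top
      using nn_integral_inverse_cube[OF g] by (simp only: infinity_ennreal_def ennreal_less_top simp_thms)
    finally show ?thesis .
  qed
  finally have fin: "(\<integral>\<^sup>+x. \<integral>\<^sup>+u. ennreal (exp (- w u * norm (x::real^'n))) * indicator {0..} u \<partial>lborel \<partial>lborel) < \<infinity>" .
  have "(\<integral>\<^sup>+x. ennreal (psi \<gamma> (x::real^'n)) \<partial>lborel) \<le>
     (\<integral>\<^sup>+x. ennreal c * (\<integral>\<^sup>+u. ennreal (exp (- w u * norm (x::real^'n))) * indicator {0..} u \<partial>lborel) \<partial>lborel)"
    by (intro nn_integral_mono rep)
  also have "\<dots> = ennreal c * (\<integral>\<^sup>+x. \<integral>\<^sup>+u. ennreal (exp (- w u * norm (x::real^'n))) * indicator {0..} u \<partial>lborel \<partial>lborel)"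
    by (rule nn_integral_cmult) measurable
  also have "\<dots> < \<infinity>"
    using fin by (simp add: ennreal_mult_less_top)
  finally show ?thesis
    using g by (intro integrableI_nonneg) auto
qed

section \<open>The Volterra function\<close>

text \<open>Only the part [K, K + 1] of Euler's integral is kept. As K is arbitrary, Gamma outgrows
  every exponential, so \<open>volterra_weight\<close> has all exponential moments.\<close>

lemma Gamma_ge:
  fixes s K :: real
  assumes "0 \<le> s" "0 < K"
  shows "K powr s * exp (- (K + 1)) \<le> Gamma (s + 1)"
proof -
  let ?f = "\<lambda>t. t powr s / exp t" and ?c = "K powr s * exp (- (K + 1))"
  have G: "(?f has_integral Gamma (s + 1)) {0..}"
    using Gamma_integral_real[of "s + 1"] assms by simp
  have i: "?f integrable_on {K..K+1}"
    using assms by (intro integrable_on_subinterval[OF has_integral_integrable[OF G]]) auto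
  have le: "?c \<le> ?f t" if "t \<in> {K..K+1}" for t
  proof -
    have "K powr s * exp (- (K + 1)) \<le> t powr s * exp (- t)"
      using that assms by (intro mult_mono powr_mono2) auto
    then show ?thesis by (simp add: exp_minus divide_inverse)
  qed
  have "((\<lambda>t. ?c) has_integral ?c) {K..K+1}"
    using has_integral_const_real[of ?c K "K + 1"] by simp
  then have "?c \<le> integral {K..K+1} ?f"
    by (rule has_integral_le[OF _ integrable_integral[OF i]]) (rule le)
  also have "\<dots> \<le> Gamma (s + 1)"
    by (rule has_integral_subset_le[OF _ integrable_integral[OF i] G]) (use assms in auto)
  finally show ?thesis .
qed

text \<open>With \<open>a = exp z\<close>, the function \<open>nu a\<close> becomes a Laplace transform in \<open>z\<close>, whose moments
  give its derivatives.\<close>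

definition volterra_weight :: "real \<Rightarrow> real" where
  "volterra_weight s = indicator {0..} s *\<^sub>R (1 / Gamma (s + 1))"

lemma measurable_volterra_weight [measurable]: "volterra_weight \<in> borel_measurable borel"
  unfolding volterra_weight_def[abs_def]
proof -
  have *: "s + 1 \<notin> \<int>\<^sub>\<le>\<^sub>0" if "0 \<le> s" for s :: real
    using that by (auto elim!: nonpos_Ints_cases)
  have "isCont (\<lambda>s::real. 1 / Gamma (s + 1)) s" if "0 \<le> s" for s
    using *[OF that] by (intro isCont_divide isCont_Gamma isCont_add continuous_const continuous_ident) (auto simp: Gamma_eq_zero_iff)
  then have "continuous_on {0..} (\<lambda>s::real. 1 / Gamma (s + 1))"
    by (intro continuous_at_imp_continuous_on) auto
  then show "(\<lambda>s::real. indicator {0..} s *\<^sub>R (1 / Gamma (s + 1))) \<in> borel_measurable borel"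
    by (intro borel_measurable_continuous_on_indicator) auto
qed

definition volterra_moment :: "nat \<Rightarrow> real \<Rightarrow> real" where
  "volterra_moment k z = (LINT s|lborel. volterra_weight s * (s ^ k * exp (s * z)))"

lemma volterra_integrable:
  "integrable lborel (\<lambda>s::real. volterra_weight s * (s ^ k * exp (s * z)))"
proof (rule integrableI_bounded)
  \<comment> \<open>\<open>Gamma_ge\<close> is used with K = exp (z + 2). Of the rate z + 2, the
    part z cancels \<open>exp (s * z)\<close>, one unit pays for \<open>s ^ k\<close> through s^k <=
    k! exp s, and one unit remains as the decay exp (- s). The factor exp (exp (z + 2) + 1) undoes
    exp (- (K + 1)).\<close>
  define c where "c = fact k * exp (exp (z + 2) + 1)"
  have c: "0 \<le> c" by (simp add: c_def)
  have "(\<integral>\<^sup>+s. ennreal (norm (volterra_weight s * (s ^ k * exp (s * z)))) \<partial>lborel) \<le>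
    (\<integral>\<^sup>+s. ennreal c * (ennreal (exponential_density 1 s)) \<partial>lborel)"
  proof (rule nn_integral_mono)
    fix s :: real
    have "s ^ k * exp (s * z) / Gamma (s + 1) \<le> c * exp (- s)" if s: "0 \<le> s"
    proof -
      have G: "exp (s * (z + 2)) * exp (- (exp (z + 2) + 1)) \<le> Gamma (s + 1)"
        using Gamma_ge[of s "exp (z + 2)"] s by (simp add: powr_def)
      have sk: "s ^ k \<le> fact k * exp s"
      proof -
        obtain t where "exp s = (\<Sum>m<Suc k. s ^ m / fact m) + exp t / fact (Suc k) * s ^ Suc k"
          using Maclaurin_exp_le[of s "Suc k"] by auto
        moreover have "0 \<le> (\<Sum>m<k. s ^ m / fact m)" "0 \<le> exp t / fact (Suc k) * s ^ Suc k"
          using s by (auto intro!: sum_nonneg)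
        ultimately have "s ^ k / fact k \<le> exp s"
          by simp
        then show ?thesis by (simp add: field_simps)
      qed
      have "s ^ k * exp (s * z) \<le> fact k * exp s * exp (s * z)"
        using sk by (intro mult_right_mono) auto
      also have "\<dots> = c * exp (- s) * (exp (s * (z + 2)) * exp (- (exp (z + 2) + 1)))"
        by (simp add: c_def exp_add[symmetric] algebra_simps)
      also have "\<dots> \<le> c * exp (- s) * Gamma (s + 1)"
        using G c by (intro mult_left_mono) auto
      finally show ?thesis
        using Gamma_real_pos[of "s + 1"] s by (simp add: field_simps)
    qed
    then show "ennreal (norm (volterra_weight s * (s ^ k * exp (s * z)))) \<le> ennreal c * ennreal (exponential_density 1 s)"
      using c Gamma_real_pos[of "s + 1"]
      by (auto simp: exponential_density_def ennreal_mult[symmetric] indicator_def abs_mult volterra_weight_def intro!: ennreal_leI)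
  qed
  also have "\<dots> = ennreal c * emeasure (density lborel (exponential_density 1)) (space (density lborel (exponential_density 1)))"
    by (subst nn_integral_cmult) (auto simp: emeasure_density)
  also have "\<dots> < \<infinity>"
    using prob_space.emeasure_space_1[OF prob_space_exponential_density[of 1]] by simp
  finally show "(\<integral>\<^sup>+s. ennreal (norm (volterra_weight s * (s ^ k * exp (s * z)))) \<partial>lborel) < \<infinity>" .
qed measurable

lemma exp_second_order: "\<bar>exp v - 1 - v\<bar> \<le> v\<^sup>2 * exp \<bar>v\<bar>" for v :: real
proof -
  obtain t where t: "\<bar>t\<bar> \<le> \<bar>v\<bar>" "exp v = (\<Sum>m<2. (v ^ m) / fact m) + (exp t / fact 2) * v ^ 2"
    using Maclaurin_exp_le[of v 2] by auto
  have e: "exp v - 1 - v = exp t / 2 * v\<^sup>2"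
    using t(2) by (simp add: numeral_2_eq_2)
  have "exp t / 2 \<le> exp \<bar>v\<bar>"
    using t(1) exp_le_cancel_iff[of t "\<bar>v\<bar>"] exp_ge_zero[of t] by linarith
  then have "exp t / 2 * v\<^sup>2 \<le> exp \<bar>v\<bar> * v\<^sup>2"
    by (rule mult_right_mono) simp
  moreover have "\<bar>exp t / 2 * v\<^sup>2\<bar> = exp t / 2 * v\<^sup>2"
    by simp
  ultimately show ?thesis
    unfolding e by (simp only: mult.commute)
qed

text \<open>Differentiation under the integral sign with an explicit remainder: for |y - z| < 1 the
  factor exp |s (y - z)| is at most exp s, which turns the second-order error into (y - z)^2 times
  the second moment at z + 1.\<close>

lemma volterra_deriv: "(volterra_moment 0 has_real_derivative volterra_moment 1 z) (at z)"
  unfolding has_field_derivative_def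
proof (rule has_derivativeI_sandwich[where e=1 and H="\<lambda>y. volterra_moment 2 (z + 1) * norm (y - z)"])
  fix y assume y: "y \<in> UNIV" "y \<noteq> z" "dist y z < 1"
  let ?I = "\<lambda>k u s. volterra_weight s * (s ^ k * exp (s * u)) :: real"
  let ?D = "\<lambda>s. ?I 0 y s - ?I 0 z s - (y - z) * ?I 1 z s"
  have i: "integrable lborel ?D"
    by (intro Bochner_Integration.integrable_diff integrable_mult_right volterra_integrable)
  have e: "volterra_moment 0 y - volterra_moment 0 z - volterra_moment 1 z * (y - z) = (LINT s|lborel. ?D s)"
    unfolding volterra_moment_def
    by (subst Bochner_Integration.integral_diff, intro Bochner_Integration.integrable_diff volterra_integrable,
        intro integrable_mult_right volterra_integrable,
        subst Bochner_Integration.integral_diff, rule volterra_integrable, rule volterra_integrable,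
        subst integral_mult_right_zero) (simp add: mult.commute)
  have "\<bar>LINT s|lborel. ?D s\<bar> \<le> (LINT s|lborel. \<bar>?D s\<bar>)"
    by (rule integral_abs_bound)
  also have "\<dots> \<le> (LINT s|lborel. (y - z)\<^sup>2 * ?I 2 (z + 1) s)"
  proof (rule integral_mono)
    show "integrable lborel (\<lambda>s. \<bar>?D s\<bar>)" by (rule integrable_abs[OF i])
    show "integrable lborel (\<lambda>s. (y - z)\<^sup>2 * ?I 2 (z + 1) s)"
      by (rule integrable_mult_right[OF volterra_integrable])
    fix s :: real
    show "\<bar>?D s\<bar> \<le> (y - z)\<^sup>2 * ?I 2 (z + 1) s"
    proof (cases "0 \<le> s")
      case True
      have G: "0 < Gamma (s + 1)" using True by (simp add: Gamma_real_pos)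
      define v where "v = s * (y - z)"
      have ey: "exp (s * y) = exp (s * z) * exp v"
        by (simp add: v_def exp_add[symmetric] algebra_simps)
      have vs: "(y - z) * (s * exp (s * z)) = v * exp (s * z)"
        by (simp add: v_def)
      have "?D s = (exp (s * y) - exp (s * z) - (y - z) * (s * exp (s * z))) / Gamma (s + 1)"
        using True by (simp add: volterra_weight_def diff_divide_distrib)
      also have "\<dots> = (exp (s * z) / Gamma (s + 1)) * (exp v - 1 - v)"
        unfolding ey vs by (simp add: field_simps)
      finally have "?D s = (exp (s * z) / Gamma (s + 1)) * (exp v - 1 - v)" .
      then have "\<bar>?D s\<bar> = (exp (s * z) / Gamma (s + 1)) * \<bar>exp v - 1 - v\<bar>"
        using G by (simp add: abs_mult)
      also have "\<dots> \<le> (exp (s * z) / Gamma (s + 1)) * (v\<^sup>2 * exp s)"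
      proof (rule mult_left_mono)
        have "\<bar>v\<bar> \<le> s * 1"
          unfolding v_def abs_mult using y True by (intro mult_mono) (auto simp: dist_real_def)
        then have "v\<^sup>2 * exp \<bar>v\<bar> \<le> v\<^sup>2 * exp s"
          by (intro mult_left_mono) auto
        with exp_second_order[of v] show "\<bar>exp v - 1 - v\<bar> \<le> v\<^sup>2 * exp s"
          by (rule order_trans)
      qed (use G in auto)
      also have "\<dots> = (y - z)\<^sup>2 * ?I 2 (z + 1) s"
        using True by (simp add: v_def volterra_weight_def power_mult_distrib distrib_left exp_add)
      finally show ?thesis .
    qed (simp add: volterra_weight_def)
  qed
  also have "\<dots> = (y - z)\<^sup>2 * volterra_moment 2 (z + 1)"
    by (simp add: volterra_moment_def)
  also have "\<dots> = volterra_moment 2 (z + 1) * norm (y - z) * norm (y - z)"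
    by (simp add: power2_eq_square flip: abs_mult)
  finally show "norm (volterra_moment 0 y - volterra_moment 0 z - volterra_moment 1 z * (y - z)) / norm (y - z) \<le> volterra_moment 2 (z + 1) * norm (y - z)"
    unfolding e using y by (simp add: divide_le_eq)
next
  have "((\<lambda>y. volterra_moment 2 (z + 1) * norm (y - z)) \<longlongrightarrow> volterra_moment 2 (z + 1) * norm (z - z)) (at z)"
    by (intro tendsto_intros)
  then show "((\<lambda>y. volterra_moment 2 (z + 1) * norm (y - z)) \<longlongrightarrow> 0) (at z)" by simp
qed (auto simp: bounded_linear_mult_right)

lemma volterra_moment_nonneg: "0 \<le> volterra_moment k z"
  unfolding volterra_moment_def
  by (intro integral_nonneg_AE AE_I2) (auto simp: volterra_weight_def indicator_def intro!: Gamma_real_nonneg)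

lemma measurable_volterra_moment [measurable]: "volterra_moment k \<in> borel_measurable borel"
  unfolding volterra_moment_def[abs_def] by measurable

lemma nu_eq: "0 < a \<Longrightarrow> nu a = volterra_moment 0 (ln a)"
  unfolding nu_def volterra_moment_def set_lebesgue_integral_def
  by (intro Bochner_Integration.integral_cong) (auto simp: powr_def volterra_weight_def)

text \<open>The derivative of \<open>nu\<close>, by the chain rule with z = ln a. Unlike for
  \<open>deriv nu\<close>, measurability and sign are visible; the sign makes the interaction part
  nonnegative.\<close>

definition nu' :: "real \<Rightarrow> real" where
  "nu' a = volterra_moment 1 (ln a) / a"

lemma measurable_nu' [measurable]: "nu' \<in> borel_measurable borel"
  unfolding nu'_def[abs_def] by measurable

lemma nu'_nonneg: "0 < a \<Longrightarrow> 0 \<le> nu' a"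
  by (simp add: nu'_def volterra_moment_nonneg)

lemma has_real_derivative_nu:
  assumes "0 < a"
  shows "(nu has_real_derivative nu' a) (at a)"
proof (rule has_field_derivative_transform_within_open[where S="{0<..}"])
  show "((\<lambda>a. volterra_moment 0 (ln a)) has_real_derivative nu' a) (at a)"
    using DERIV_chain'[OF DERIV_ln[OF assms] volterra_deriv]
    by (simp only: nu'_def divide_inverse)
qed (use assms in \<open>auto simp: nu_eq\<close>)

lemma deriv_nu: "0 < a \<Longrightarrow> deriv nu a = nu' a"
  by (intro DERIV_imp_deriv has_real_derivative_nu)

text \<open>The integrand is singular at 0, so the fundamental theorem is applied on
  [1 / (n + 1), 1]. The lower boundary term is dropped since \<open>nu\<close> is nonnegative, and
  monotone convergence finishes.\<close>

lemma nn_integral_nu':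
  assumes "0 < \<gamma>"
  shows "(\<integral>\<^sup>+a. ennreal (nu' (\<gamma> * a)) * indicator {0<..1} a \<partial>lborel) \<le> ennreal (nu \<gamma> / \<gamma>)"
proof -
  let ?f = "\<lambda>a. nu' (\<gamma> * a)"
  have 1: "(\<integral>\<^sup>+a. ennreal (?f a) * indicator {1 / real (Suc n)..1} a \<partial>lborel) \<le> ennreal (nu \<gamma> / \<gamma>)" for n
  proof -
    have "(\<integral>\<^sup>+a. ennreal (?f a) * indicator {1 / real (Suc n)..1} a \<partial>lborel) =
      ennreal (nu (\<gamma> * 1) / \<gamma> - nu (\<gamma> * (1 / real (Suc n))) / \<gamma>)"
    proof (rule nn_integral_FTC_Icc[where F="\<lambda>a. nu (\<gamma> * a) / \<gamma>"])
      fix a assume "a \<in> {1 / real (Suc n)..1}"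
      then have a: "1 / real (Suc n) \<le> a" "a \<le> 1" by auto
      have a0: "0 < a" using a(1) by (rule less_le_trans[rotated]) simp
      have "((\<lambda>a. nu (\<gamma> * a)) has_real_derivative nu' (\<gamma> * a) * \<gamma>) (at a)"
        by (rule DERIV_chain2[OF has_real_derivative_nu]) (use assms a0 in \<open>auto intro!: derivative_eq_intros\<close>)
      from DERIV_cdivide[OF this, of \<gamma>]
      show "((\<lambda>a. nu (\<gamma> * a) / \<gamma>) has_real_derivative ?f a) (at a)"
        using assms by simp
      show "0 \<le> ?f a"
        using a0 assms by (simp add: nu'_nonneg)
    qed auto
    also have "\<dots> \<le> ennreal (nu \<gamma> / \<gamma>)"
      using assms volterra_moment_nonneg[of 0] by (intro ennreal_leI) (simp add: nu_eq)
    finally show ?thesis .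
  qed
  have "(\<integral>\<^sup>+a. ennreal (?f a) * indicator {0<..1} a \<partial>lborel) = (\<integral>\<^sup>+a. (SUP n. ennreal (?f a) * indicator {1 / real (Suc n)..1} a) \<partial>lborel)"
  proof (rule nn_integral_cong)
    fix a :: real
    have "indicator {0<..1} a = (SUP n. indicator {1 / real (Suc n)..1} a :: ennreal)"
    proof (cases "0 < a \<and> a \<le> 1")
      case True
      then obtain n where "1 / real (Suc n) < a"
        using reals_Archimedean[of a] by (auto simp: inverse_eq_divide)
      then have "indicator {1 / real (Suc n)..1} a = (1::ennreal)" using True by simp
      then have "(1::ennreal) \<le> (SUP n. indicator {1 / real (Suc n)..1} a)"
        by (intro SUP_upper2[of n]) auto
      moreover have "(SUP n. indicator {1 / real (Suc n)..1} a) \<le> (1::ennreal)"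
        by (intro SUP_least) (auto simp: indicator_def)
      ultimately show ?thesis using True by (simp add: antisym)
    next
      case False
      have "indicator {1 / real (Suc n)..1} a = (0::ennreal)" for n
      proof -
        have "0 < 1 / real (Suc n)" by simp
        then have "\<not> (1 / real (Suc n) \<le> a \<and> a \<le> 1)" using False by linarith
        then show ?thesis by (simp add: indicator_def del: of_nat_Suc)
      qed
      then show ?thesis using False by (auto simp: indicator_def)
    qed
    then show "ennreal (?f a) * indicator {0<..1} a = (SUP n. ennreal (?f a) * indicator {1 / real (Suc n)..1} a)"
      by (simp add: SUP_mult_left_ennreal)
  qed
  also have "\<dots> = (SUP n. \<integral>\<^sup>+a. ennreal (?f a) * indicator {1 / real (Suc n)..1} a \<partial>lborel)"
  proof (rule nn_integral_monotone_convergence_SUP)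
    show "incseq (\<lambda>n a. ennreal (?f a) * indicator {1 / real (Suc n)..1} a)"
    proof (intro incseq_SucI le_funI mult_left_mono)
      fix n and a :: real
      have "1 / real (Suc (Suc n)) \<le> 1 / real (Suc n)" by (simp add: field_simps)
      then show "indicator {1 / real (Suc n)..1} a \<le> (indicator {1 / real (Suc (Suc n))..1} a :: ennreal)"
        by (auto simp: indicator_def simp del: of_nat_Suc)
    qed simp
  qed measurable
  also have "\<dots> \<le> ennreal (nu \<gamma> / \<gamma>)"
    by (intro SUP_least 1)
  finally show ?thesis .
qed

section \<open>The interaction part for short times\<close>

text \<open>Converts exponential smallness in 1/t into a power of t.\<close>

lemma exp_minus_le: "0 < a \<Longrightarrow> exp (- a) \<le> 1 / (a::real)"
proof -
  assume "0 < a"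
  moreover have "a \<le> exp a"
    using exp_ge_add_one_self[of a] by linarith
  ultimately show ?thesis by (simp add: exp_minus field_simps)
qed

text \<open>On the triangle s - r is positive, so \<open>deriv nu\<close> may be replaced by the
  explicit \<open>nu'\<close>.\<close>

lemma interaction_part2:
  fixes x y :: "real^'n"
  assumes "0 < \<gamma>" "CARD('n) = 2"
  shows "interaction_part \<gamma> t x y = 2 * pi * \<gamma> * (LINT (r, s)|lborel.
     indicator {(r, s). 0 < r \<and> r < s \<and> s < t} (r, s) *\<^sub>R (heat_kernel r x * nu' (\<gamma> * (s - r)) * heat_kernel (t - s) y))"
proof -
  have "(LINT (r, s) : {(r, s). 0 < r \<and> r < s \<and> s < t} | lborel. heat_kernel r x * deriv nu (\<gamma> * (s - r)) * heat_kernel (t - s) y) =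
    (LINT (r, s)|lborel. indicator {(r, s). 0 < r \<and> r < s \<and> s < t} (r, s) *\<^sub>R (heat_kernel r x * nu' (\<gamma> * (s - r)) * heat_kernel (t - s) y))"
    unfolding set_lebesgue_integral_def
    by (intro Bochner_Integration.integral_cong refl) (use assms in \<open>auto simp: indicator_def deriv_nu\<close>)
  then show ?thesis
    using assms by (simp add: interaction_part_def)
qed

lemma measurable_triangle [measurable]: "{(r::real, s). 0 < r \<and> r < s \<and> s < t} \<in> sets borel"
proof -
  have "{(r::real, s). 0 < r \<and> r < s \<and> s < t} = {p. 0 < fst p} \<inter> {p. fst p < snd p} \<inter> {p. snd p < t}"
    by auto
  moreover have "open ({p::real \<times> real. 0 < fst p} \<inter> {p. fst p < snd p} \<inter> {p. snd p < t})"
    by (intro open_Int open_Collect_less continuous_intros)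
  ultimately show ?thesis
    by (metis borel_open)
qed

lemma measurable_fst_snd_borel [measurable]:
  "(fst :: real \<times> real \<Rightarrow> real) \<in> borel_measurable borel" "(snd :: real \<times> real \<Rightarrow> real) \<in> borel_measurable borel"
  by (intro borel_measurable_continuous_onI continuous_intros)+

lemma interaction_part_nonneg:
  fixes x y :: "real^'n"
  assumes "0 < \<gamma>" "0 < t"
  shows "0 \<le> interaction_part \<gamma> t x y"
proof (cases "CARD('n) = 2")
  case True
  have "0 \<le> (LINT (r, s)|lborel. indicator {(r, s). 0 < r \<and> r < s \<and> s < t} (r, s) *\<^sub>R
      (heat_kernel r x * nu' (\<gamma> * (s - r)) * heat_kernel (t - s) y))"
    using assms by (intro integral_nonneg_AE AE_I2) (auto simp: indicator_def nu'_nonneg)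
  then show ?thesis
    using assms by (simp add: interaction_part2 True)
next
  case False
  have "0 \<le> (LBINT u:{0..}. exp (\<gamma> * u) * radial_heat3 t (u + norm x + norm y))"
    unfolding set_lebesgue_integral_def by (intro integral_nonneg_AE AE_I2) (auto simp: radial_heat3_def)
  then show ?thesis
    using assms False by (simp add: interaction_part_def radial_heat3_def)
qed

lemma measurable_interaction_part [measurable (raw)]:
  fixes x y :: "'b \<Rightarrow> real^'n"
  assumes g: "0 < \<gamma>" and [measurable]: "x \<in> borel_measurable M" "y \<in> borel_measurable M"
  shows "(\<lambda>\<omega>. interaction_part \<gamma> t (x \<omega>) (y \<omega>)) \<in> borel_measurable M"
proof (cases "CARD('n) = 2")
  case True
  have [measurable]: "(\<lambda>p. indicator {(r, s). 0 < r \<and> r < s \<and> s < t} (snd p) :: real) \<in> borel_measurable (M \<Otimes>\<^sub>M (lborel :: (real \<times> real) measure))"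
    by measurable
  show ?thesis
    unfolding interaction_part2[OF g True] case_prod_beta' prod.collapse by measurable
next
  case False
  then show ?thesis
    unfolding interaction_part_def radial_heat3_def set_lebesgue_integral_def by simp
qed

definition nu_mass :: "real \<Rightarrow> real" where
  "nu_mass \<gamma> = nu \<gamma> / \<gamma>"

lemma nu_mass_nonneg: "0 < \<gamma> \<Longrightarrow> 0 \<le> nu_mass \<gamma>"
  by (simp add: nu_mass_def nu_eq volterra_moment_nonneg)

text \<open>For fixed r, a translation turns the integral over s into at most the mass of
  \<open>nu'\<close> on (0, 1], which contains s - r because t <= 1. The length of the range of r
  gives the factor t.\<close>

lemma nn_integral_nu'_triangle:
  assumes g: "0 < \<gamma>" and t: "0 < t" "t \<le> 1"
  shows "(\<integral>\<^sup>+p. indicator {(r, s). 0 < r \<and> r < s \<and> s < t} p * ennreal (nu' (\<gamma> * (snd p - fst p))) \<partial>lborel) \<le> ennreal (t * nu_mass \<gamma>)"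
proof -
  let ?n = "\<lambda>a. ennreal (nu' (\<gamma> * a)) * indicator {0<..1} a"
  have "(\<integral>\<^sup>+p. indicator {(r, s). 0 < r \<and> r < s \<and> s < t} p * ennreal (nu' (\<gamma> * (snd p - fst p))) \<partial>lborel) \<le>
     (\<integral>\<^sup>+p. indicator {0..t} (fst p) * ?n (snd p - fst p) \<partial>lborel)"
    using t by (intro nn_integral_mono) (auto simp: indicator_def)
  also have "\<dots> = (\<integral>\<^sup>+r. \<integral>\<^sup>+s. indicator {0..t} r * ?n (s - r) \<partial>lborel \<partial>lborel)"
    by (subst lborel_prod[symmetric], subst lborel.nn_integral_fst[symmetric]) (simp_all, measurable)
  also have "\<dots> = (\<integral>\<^sup>+r. indicator {0..t} r * (\<integral>\<^sup>+s. ?n (s - r) \<partial>lborel) \<partial>lborel)"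
    by (intro nn_integral_cong nn_integral_cmult) measurable
  also have "\<dots> = (\<integral>\<^sup>+r. indicator {0..t} r * (\<integral>\<^sup>+s. ?n s \<partial>lborel) \<partial>lborel)"
    by (subst nn_integral_lborel_translate[where f="?n"]) auto
  also have "\<dots> = ennreal t * (\<integral>\<^sup>+s. ?n s \<partial>lborel)"
    using t by (subst nn_integral_multc) auto
  also have "\<dots> \<le> ennreal t * ennreal (nu_mass \<gamma>)"
    unfolding nu_mass_def by (intro mult_left_mono nn_integral_nu' g) auto
  also have "\<dots> = ennreal (t * nu_mass \<gamma>)"
    using t g by (simp add: ennreal_mult nu_mass_nonneg)
  finally show ?thesis .
qed

text \<open>One half of the exponent absorbs the singular factor 1 / r; the other half keeps the
  exponential, which is largest at r = t.\<close>

lemma heat_kernel2_away: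
  fixes x :: "real^'n"
  assumes "CARD('n) = 2" "0 < e" "e \<le> norm x" "0 < r" "r \<le> t"
  shows "heat_kernel r x \<le> 2 / (pi * e\<^sup>2) * exp (- e\<^sup>2 / (4 * t))"
proof -
  have "heat_kernel r x = 1 / (2 * pi * r) * exp (- (norm x)\<^sup>2 / (2 * r))"
    using assms by (simp add: heat_kernel_def powr_minus_divide)
  also have "\<dots> \<le> 1 / (2 * pi * r) * exp (- e\<^sup>2 / (2 * r))"
    using assms by (intro mult_left_mono) (auto intro!: divide_right_mono power_mono)
  also have "\<dots> = 1 / (2 * pi * r) * exp (- (e\<^sup>2 / (4 * r))) * exp (- (e\<^sup>2 / (4 * r)))"
    using assms by (simp add: exp_add[symmetric] field_simps)
  also have "\<dots> \<le> 1 / (2 * pi * r) * (1 / (e\<^sup>2 / (4 * r))) * exp (- (e\<^sup>2 / (4 * t)))"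
    using assms by (intro mult_mono mult_left_mono exp_minus_le) (auto simp: divide_simps)
  also have "\<dots> = 2 / (pi * e\<^sup>2) * exp (- e\<^sup>2 / (4 * t))"
    using assms by (simp add: field_simps)
  finally show ?thesis .
qed

lemma heat_kernel_near:
  fixes x y :: "real^'n"
  assumes "0 < t" "norm (x - y) \<le> e / 2"
  shows "(2 * pi * t) powr (- (real CARD('n) / 2)) * exp (- e\<^sup>2 / (8 * t)) \<le> heat_kernel t (x - y)"
proof -
  have "(norm (x - y))\<^sup>2 \<le> (e / 2)\<^sup>2"
    using assms by (intro power_mono) auto
  then have "- e\<^sup>2 / (8 * t) \<le> - (norm (x - y))\<^sup>2 / (2 * t)"
    using assms by (simp add: field_simps)
  then show ?thesis
    unfolding heat_kernel_def by (auto intro!: mult_left_mono)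
qed

text \<open>Each of the two legs to and from 0 costs exp (- e^2 / (4t)), together exp (- e^2 /
  (2t)), while the direct kernel is at least exp (- e^2 / (8t)) / (2 pi t). The quotient exp (- 3
  e^2 / (8t)) of the exponentials is at most 8t / (3 e^2). The other two powers of t come from the
  normalisation and from \<open>nn_integral_nu'_triangle\<close>.\<close>

lemma interaction_part2_bound:
  fixes x y :: "real^'n"
  assumes g: "0 < \<gamma>" and d: "CARD('n) = 2" and e: "0 < e" and t: "0 < t" "t \<le> 1"
    and xy: "e \<le> norm x" "e \<le> norm y" "norm (x - y) \<le> e / 2"
  shows "interaction_part \<gamma> t x y \<le> (2 * pi * \<gamma> * (2 / (pi * e\<^sup>2))\<^sup>2 * nu_mass \<gamma> * 2 * pi * (8 / (3 * e\<^sup>2))) * t ^ 3 * heat_kernel t (x - y)"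
proof -
  define D where "D = 2 / (pi * e\<^sup>2) * exp (- e\<^sup>2 / (4 * t))"
  have D: "0 \<le> D" by (simp add: D_def)
  let ?S = "{(r::real, s). 0 < r \<and> r < s \<and> s < t}"
  let ?I = "\<lambda>p. indicator ?S p *\<^sub>R (heat_kernel (fst p) x * nu' (\<gamma> * (snd p - fst p)) * heat_kernel (t - snd p) y)"
  have nn: "0 \<le> ?I p" for p
    using g by (auto simp: indicator_def nu'_nonneg)
  have "ennreal (LINT p|lborel. ?I p) \<le> (\<integral>\<^sup>+p. ennreal (?I p) \<partial>lborel)"
    by (intro ennreal_integral_le_nn_integral nn) measurable
  also have "\<dots> \<le> (\<integral>\<^sup>+p. ennreal (D * D) * (indicator ?S p * ennreal (nu' (\<gamma> * (snd p - fst p)))) \<partial>lborel)"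
  proof (rule nn_integral_mono)
    fix p :: "real \<times> real"
    show "ennreal (?I p) \<le> ennreal (D * D) * (indicator ?S p * ennreal (nu' (\<gamma> * (snd p - fst p))))"
    proof (cases "p \<in> ?S")
      case True
      then have p: "0 < fst p" "fst p < snd p" "snd p < t" by auto
      have n: "0 \<le> nu' (\<gamma> * (snd p - fst p))" using p g by (simp add: nu'_nonneg)
      have "heat_kernel (fst p) x * heat_kernel (t - snd p) y \<le> D * D"
        unfolding D_def using p e xy d by (intro mult_mono heat_kernel2_away) auto
      then have "heat_kernel (fst p) x * heat_kernel (t - snd p) y * nu' (\<gamma> * (snd p - fst p)) \<le> D * D * nu' (\<gamma> * (snd p - fst p))"
        using n by (rule mult_right_mono)
      then show ?thesis
        using True n D by (simp add: ennreal_mult[symmetric] mult_ac ennreal_leI)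
    qed simp
  qed
  also have "\<dots> = ennreal (D * D) * (\<integral>\<^sup>+p. indicator ?S p * ennreal (nu' (\<gamma> * (snd p - fst p))) \<partial>lborel)"
    by (rule nn_integral_cmult) measurable
  also have "\<dots> \<le> ennreal (D * D) * ennreal (t * nu_mass \<gamma>)"
    by (intro mult_left_mono nn_integral_nu'_triangle g t) auto
  also have "\<dots> = ennreal (D * D * (t * nu_mass \<gamma>))"
    using D t g by (simp add: ennreal_mult nu_mass_nonneg)
  finally have I: "(LINT p|lborel. ?I p) \<le> D * D * (t * nu_mass \<gamma>)"
    using D t g by (subst (asm) ennreal_le_iff) (auto simp: nu_mass_nonneg)
  define E where "E = exp (- (e\<^sup>2 / (8 * t)))"
  have near: "1 / (2 * pi * t) * E \<le> heat_kernel t (x - y)"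
    using heat_kernel_near[OF t(1) xy(3)] d t by (simp add: powr_minus_divide E_def)
  have "D * D = (2 / (pi * e\<^sup>2))\<^sup>2 * (exp (- (3 * e\<^sup>2 / (8 * t))) * E)"
    unfolding D_def E_def using t by (simp add: power2_eq_square exp_add[symmetric] field_simps)
  also have "\<dots> \<le> (2 / (pi * e\<^sup>2))\<^sup>2 * ((8 / (3 * e\<^sup>2) * t) * E)"
  proof (intro mult_left_mono mult_right_mono)
    show "exp (- (3 * e\<^sup>2 / (8 * t))) \<le> 8 / (3 * e\<^sup>2) * t"
      using exp_minus_le[of "3 * e\<^sup>2 / (8 * t)"] e t by simp
  qed (auto simp: E_def)
  also have "\<dots> = (2 / (pi * e\<^sup>2))\<^sup>2 * (8 / (3 * e\<^sup>2) * t) * (2 * pi * t) * (1 / (2 * pi * t) * E)"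
    using t by simp
  also have "\<dots> \<le> (2 / (pi * e\<^sup>2))\<^sup>2 * (8 / (3 * e\<^sup>2) * t) * (2 * pi * t) * heat_kernel t (x - y)"
    using t by (intro mult_left_mono near) auto
  finally have DD: "D * D \<le> (2 / (pi * e\<^sup>2))\<^sup>2 * (8 / (3 * e\<^sup>2) * t) * (2 * pi * t) * heat_kernel t (x - y)" .
  have "interaction_part \<gamma> t x y = 2 * pi * \<gamma> * (LINT p|lborel. ?I p)"
    unfolding interaction_part2[OF g d] case_prod_beta' prod.collapse ..
  also have "\<dots> \<le> 2 * pi * \<gamma> * (D * D * (t * nu_mass \<gamma>))"
    using g by (intro mult_left_mono I) auto
  also have "\<dots> \<le> 2 * pi * \<gamma> * (((2 / (pi * e\<^sup>2))\<^sup>2 * (8 / (3 * e\<^sup>2) * t) * (2 * pi * t) * heat_kernel t (x - y)) * (t * nu_mass \<gamma>))"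
    using g t by (intro mult_left_mono mult_right_mono DD) (auto simp: nu_mass_nonneg)
  finally show ?thesis
    by (simp add: power3_eq_cube mult_ac)
qed

text \<open>Since R = |x| + |y| is at least 2e, exp (- R^2 / (2t)) is smaller than the exponential
  of the direct kernel by at least exp (- e^2 / t) <= t / e^2. The second power of t is the
  prefactor of the formula. The condition t <= e / \<gamma> tames the growth of exp (\<gamma>
  u).\<close>

lemma interaction_part3_bound:
  fixes x y :: "real^'n"
  assumes g: "0 < \<gamma>" and d: "CARD('n) = 3" and e: "0 < e" and t: "0 < t" "t \<le> e / \<gamma>"
    and xy: "e \<le> norm x" "e \<le> norm y" "norm (x - y) \<le> e / 2"
  shows "interaction_part \<gamma> t x y \<le> 2 / e ^ 4 * t\<^sup>2 * heat_kernel t (x - y)"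
proof -
  define R where "R = norm x + norm y"
  have R: "2 * e \<le> R" using xy by (simp add: R_def)
  define p where "p = (2 * pi * t) powr (- (3 / 2))"
  have p: "0 < p" using t by (simp add: p_def)
  have rh: "radial_heat3 t r = p * exp (- r\<^sup>2 / (2 * t))" for r by (simp add: radial_heat3_def p_def)
  \<comment> \<open>The cross term u R / t of the square is at least 2 \<gamma> u, which turns the
    growth exp (\<gamma> u) into the decay exp (- \<gamma> u). The integral over u then costs only 1
    / \<gamma>.\<close>
  have bd: "exp (\<gamma> * u) * radial_heat3 t (u + norm x + norm y) \<le> radial_heat3 t R * exp (- \<gamma> * u)" if u: "0 \<le> u" for u
  proof -
    have "\<gamma> * t * (2 * u) \<le> e * (2 * u)"
      using t g u by (intro mult_right_mono) (auto simp: field_simps)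
    moreover have "(2 * e) * u \<le> R * u" using R u by (intro mult_right_mono)
    moreover have "e * (2 * u) = (2 * e) * u" by simp
    ultimately have "\<gamma> * t * (2 * u) \<le> R * u" by linarith
    moreover have "2 * t * (2 * \<gamma> * u) = 2 * (\<gamma> * t * (2 * u))" by simp
    ultimately have "2 * t * (2 * \<gamma> * u) \<le> 2 * (R * u) + u\<^sup>2"
      using zero_le_power2[of u] by linarith
    then have "2 * \<gamma> * u \<le> (2 * (R * u) + u\<^sup>2) / (2 * t)"
      using t(1) by (simp add: pos_le_divide_eq mult_ac)
    moreover have "(u + R)\<^sup>2 / (2 * t) = R\<^sup>2 / (2 * t) + (2 * (R * u) + u\<^sup>2) / (2 * t)"
      unfolding add_divide_distrib[symmetric] by (simp add: power2_eq_square algebra_simps)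
    ultimately have "\<gamma> * u + - (u + R)\<^sup>2 / (2 * t) \<le> - R\<^sup>2 / (2 * t) + - \<gamma> * u"
      by (simp only: minus_divide_left[symmetric])
    then have "exp (\<gamma> * u + - (u + R)\<^sup>2 / (2 * t)) \<le> exp (- R\<^sup>2 / (2 * t) + - \<gamma> * u)"
      by simp
    then have "p * (exp (\<gamma> * u) * exp (- (u + R)\<^sup>2 / (2 * t))) \<le> p * (exp (- R\<^sup>2 / (2 * t)) * exp (- \<gamma> * u))"
      unfolding exp_add using p by (intro mult_left_mono) auto
    then show ?thesis by (simp add: rh R_def mult_ac add_ac)
  qed
  have r0: "0 \<le> radial_heat3 t R" using p by (simp add: rh)
  let ?J = "\<lambda>u. indicator {0..} u *\<^sub>R (exp (\<gamma> * u) * radial_heat3 t (u + norm x + norm y))"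
  have "ennreal (LINT u|lborel. ?J u) \<le> (\<integral>\<^sup>+u. ennreal (?J u) \<partial>lborel)"
  proof (rule ennreal_integral_le_nn_integral)
    show "?J \<in> borel_measurable lborel" unfolding radial_heat3_def by measurable
  qed (use p in \<open>auto simp: rh indicator_def\<close>)
  also have "\<dots> \<le> (\<integral>\<^sup>+u. ennreal (radial_heat3 t R) * (ennreal (exp (- \<gamma> * u)) * indicator {0..} u) \<partial>lborel)"
    by (intro nn_integral_mono) (use bd r0 in \<open>auto simp: indicator_def ennreal_mult[symmetric] intro!: ennreal_leI\<close>)
  also have "\<dots> = ennreal (radial_heat3 t R) * ennreal (1 / \<gamma>)"
    using g by (subst nn_integral_cmult, measurable, subst nn_integral_exp_Ici) auto
  also have "\<dots> = ennreal (radial_heat3 t R * (1 / \<gamma>))"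
    using g r0 by (subst ennreal_mult) auto
  finally have J: "(LINT u|lborel. ?J u) \<le> radial_heat3 t R * (1 / \<gamma>)"
    using g r0 by (subst (asm) ennreal_le_iff) auto
  have nxy: "0 < norm x * norm y" "e\<^sup>2 \<le> norm x * norm y"
    using xy e by (auto simp: power2_eq_square intro!: mult_mono mult_pos_pos)
  have near: "p * exp (- e\<^sup>2 / (8 * t)) \<le> heat_kernel t (x - y)"
    using heat_kernel_near[OF t(1) xy(3)] d by (simp add: p_def)
  have "radial_heat3 t R \<le> t / e\<^sup>2 * heat_kernel t (x - y)"
  proof -
    have "(2 * e)\<^sup>2 \<le> R\<^sup>2" using R e by (intro power_mono) auto
    then have "4 * e\<^sup>2 \<le> R\<^sup>2" by (simp add: power_mult_distrib)
    then have "9 * e\<^sup>2 \<le> 4 * R\<^sup>2"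
      using zero_le_power2[of e] by linarith
    then have "- R\<^sup>2 / (2 * t) \<le> - (e\<^sup>2 / t) + - e\<^sup>2 / (8 * t)"
      using t by (simp add: field_simps)
    then have "exp (- R\<^sup>2 / (2 * t)) \<le> exp (- (e\<^sup>2 / t)) * exp (- e\<^sup>2 / (8 * t))"
      unfolding exp_add[symmetric] exp_le_cancel_iff .
    also have "\<dots> \<le> (t / e\<^sup>2) * exp (- e\<^sup>2 / (8 * t))"
      using exp_minus_le[of "e\<^sup>2 / t"] e t by (intro mult_right_mono) auto
    finally have "radial_heat3 t R \<le> p * ((t / e\<^sup>2) * exp (- e\<^sup>2 / (8 * t)))"
      unfolding rh using p by (intro mult_left_mono) auto
    also have "\<dots> = (t / e\<^sup>2) * (p * exp (- e\<^sup>2 / (8 * t)))" by simp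
    also have "\<dots> \<le> (t / e\<^sup>2) * heat_kernel t (x - y)"
      using t by (intro mult_left_mono near) auto
    finally show ?thesis .
  qed
  note RH = this
  have "interaction_part \<gamma> t x y = t / (norm x * norm y) * (radial_heat3 t R + \<gamma> * (LINT u|lborel. ?J u))"
    unfolding interaction_part_def set_lebesgue_integral_def using d by (simp add: R_def distrib_left mult_ac)
  also have "\<dots> \<le> t / (norm x * norm y) * (radial_heat3 t R + \<gamma> * (radial_heat3 t R * (1 / \<gamma>)))"
    using J g t nxy by (intro mult_left_mono add_left_mono) auto
  also have "\<dots> = t / (norm x * norm y) * (2 * radial_heat3 t R)"
    using g by simp
  also have "\<dots> \<le> t / e\<^sup>2 * (2 * (t / e\<^sup>2 * heat_kernel t (x - y)))"
    using RH r0 t e nxy by (intro mult_mono divide_left_mono) auto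
  finally show ?thesis
    by (simp add: power2_eq_square power4_eq_xxxx mult_ac)
qed

lemma interaction_part_short_time:
  fixes \<gamma> e :: real
  assumes g: "0 < \<gamma>" and d: "CARD('n) \<in> {2, 3}" and e: "0 < e"
  obtains C t0 where "0 \<le> C" "0 < t0"
    "\<And>t (x::real^'n) y. 0 < t \<Longrightarrow> t \<le> t0 \<Longrightarrow> e \<le> norm x \<Longrightarrow> e \<le> norm y \<Longrightarrow> norm (x - y) \<le> e / 2 \<Longrightarrow>
       interaction_part \<gamma> t x y \<le> C * t\<^sup>2 * heat_kernel t (x - y)"
proof (cases "CARD('n) = 2")
  case True
  define C where "C = 2 * pi * \<gamma> * (2 / (pi * e\<^sup>2))\<^sup>2 * nu_mass \<gamma> * 2 * pi * (8 / (3 * e\<^sup>2))"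
  have C: "0 \<le> C" using g by (simp add: C_def nu_mass_nonneg)
  show ?thesis
  proof (rule that[of C 1])
    fix t :: real and x y :: "real^'n"
    assume *: "0 < t" "t \<le> 1" "e \<le> norm x" "e \<le> norm y" "norm (x - y) \<le> e / 2"
    have "interaction_part \<gamma> t x y \<le> C * t ^ 3 * heat_kernel t (x - y)"
      unfolding C_def by (rule interaction_part2_bound[OF g True e *])
    also have "\<dots> \<le> C * t\<^sup>2 * heat_kernel t (x - y)"
      using C * by (intro mult_right_mono mult_left_mono power_decreasing) auto
    finally show "interaction_part \<gamma> t x y \<le> C * t\<^sup>2 * heat_kernel t (x - y)" .
  qed (use C in auto)
next
  case False
  then have "CARD('n) = 3" using d by auto
  then show ?thesis
    using g e by (intro that[of "2 / e ^ 4" "e / \<gamma>"] interaction_part3_bound) auto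
qed

section \<open>Path space\<close>

lemma continuous_le_if_rational_le:
  fixes f :: "real \<Rightarrow> real"
  assumes T: "0 < T" and f: "continuous_on {0..T} f" and le: "\<And>t. t \<in> \<rat> \<Longrightarrow> t \<in> {0..T} \<Longrightarrow> f t \<le> c" and t: "t \<in> {0..T}"
  shows "f t \<le> c"
proof (rule ccontr)
  assume "\<not> f t \<le> c"
  then have "0 < f t - c" by simp
  then obtain d where d: "0 < d" "\<And>s. s \<in> {0..T} \<Longrightarrow> dist s t < d \<Longrightarrow> dist (f s) (f t) < f t - c"
    using f t unfolding continuous_on_iff by meson
  have "max 0 (t - d) < min T (t + d)"
    using T t d by auto
  from Rats_dense_in_real[OF this] obtain q where q: "q \<in> \<rat>" "max 0 (t - d) < q" "q < min T (t + d)"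
    by auto
  then have "dist (f q) (f t) < f t - c"
    by (intro d) (auto simp: dist_real_def)
  moreover have "f q \<le> c"
    using q by (intro le) auto
  ultimately show False
    by (auto simp: dist_real_def)
qed

lemma pred_Ball_countable:
  "countable X \<Longrightarrow> (\<And>i. i \<in> X \<Longrightarrow> Measurable.pred M (\<lambda>x. P x i)) \<Longrightarrow> Measurable.pred M (\<lambda>x. \<forall>i\<in>X. P x i)"
proof (cases "X = {}")
  case False
  assume *: "countable X" "\<And>i. i \<in> X \<Longrightarrow> Measurable.pred M (\<lambda>x. P x i)"
  have "{x \<in> space M. \<forall>i\<in>X. P x i} = (\<Inter>i\<in>X. {x \<in> space M. P x i})"
    using False by auto
  then show ?thesis
    using * False by (auto simp: pred_def intro!: sets.countable_INT')
qed simp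

text \<open>By continuity the random time can be replaced by grid times, of which there are
  countably many. The hypothesis concerns the coordinates in [0, t] only, so the lemma can be used
  with the information available at time t.\<close>

lemma measurable_continuous_at_random_time:
  fixes X :: "'a \<Rightarrow> real \<Rightarrow> 'b::{metric_space}"
  assumes cont: "\<And>x. x \<in> space M \<Longrightarrow> continuous_on {0..t} (X x)"
    and meas: "\<And>u. u \<in> {0..t} \<Longrightarrow> (\<lambda>x. X x u) \<in> borel_measurable M"
    and \<tau> [measurable]: "\<tau> \<in> borel_measurable M" and \<tau>0: "\<And>x. x \<in> space M \<Longrightarrow> \<tau> x \<in> {0..t}"
  shows "(\<lambda>x. X x (\<tau> x)) \<in> borel_measurable M"
proof (cases "0 \<le> t")
  case t: True
  \<comment> \<open>Clamped to [0, t], so that every approximating time is admissible.\<close>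
  define c where "c = (\<lambda>(n::nat) (k::int). max 0 (min t (real_of_int k / real (Suc n))))"
  have c0: "c n k \<in> {0..t}" for n k using t by (auto simp: c_def)
  show ?thesis
  proof (rule borel_measurable_LIMSEQ_metric)
    fix n
    show "(\<lambda>x. X x (c n \<lfloor>real (Suc n) * \<tau> x\<rfloor>)) \<in> borel_measurable M"
    proof (rule measurable_compose_countable[where f="\<lambda>k x. X x (c n k)"])
      show "(\<lambda>x. X x (c n k)) \<in> borel_measurable M" for k
        by (intro meas c0)
      show "(\<lambda>x. \<lfloor>real (Suc n) * \<tau> x\<rfloor>) \<in> measurable M (count_space UNIV)"
        by measurable
    qed
  next
    fix x assume x: "x \<in> space M"
    have "(\<lambda>n. real_of_int \<lfloor>real (Suc n) * \<tau> x\<rfloor> / real (Suc n)) \<longlonglongrightarrow> \<tau> x"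
    proof (rule tendsto_sandwich[where f="\<lambda>n. \<tau> x - 1 / real (Suc n)" and h="\<lambda>n. \<tau> x"])
      have "(\<lambda>n. \<tau> x - 1 / real (Suc n)) \<longlonglongrightarrow> \<tau> x - 0"
        by (intro tendsto_diff tendsto_const LIMSEQ_Suc lim_1_over_n)
      then show "(\<lambda>n. \<tau> x - 1 / real (Suc n)) \<longlonglongrightarrow> \<tau> x" by simp
      show "\<forall>\<^sub>F n in sequentially. \<tau> x - 1 / real (Suc n) \<le> real_of_int \<lfloor>real (Suc n) * \<tau> x\<rfloor> / real (Suc n)"
      proof (rule always_eventually, rule allI)
        fix n
        have "real (Suc n) * \<tau> x - 1 \<le> real_of_int \<lfloor>real (Suc n) * \<tau> x\<rfloor>"
          by linarith
        then have "(real (Suc n) * \<tau> x - 1) / real (Suc n) \<le> real_of_int \<lfloor>real (Suc n) * \<tau> x\<rfloor> / real (Suc n)"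
          by (rule divide_right_mono) simp
        then show "\<tau> x - 1 / real (Suc n) \<le> real_of_int \<lfloor>real (Suc n) * \<tau> x\<rfloor> / real (Suc n)"
          by (simp add: diff_divide_distrib del: of_nat_Suc)
      qed
      show "\<forall>\<^sub>F n in sequentially. real_of_int \<lfloor>real (Suc n) * \<tau> x\<rfloor> / real (Suc n) \<le> \<tau> x"
        by (rule always_eventually) (simp add: divide_le_eq mult.commute del: of_nat_Suc)
    qed simp
    then have "(\<lambda>n. c n \<lfloor>real (Suc n) * \<tau> x\<rfloor>) \<longlonglongrightarrow> max 0 (min t (\<tau> x))"
      unfolding c_def by (intro tendsto_intros)
    also have "max 0 (min t (\<tau> x)) = \<tau> x" using \<tau>0[OF x] by auto
    finally show "(\<lambda>n. X x (c n \<lfloor>real (Suc n) * \<tau> x\<rfloor>)) \<longlonglongrightarrow> X x (\<tau> x)"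
      using \<tau>0[OF x] c0 by (intro continuous_on_tendsto_compose[OF cont[OF x]]) auto
  qed
next
  case False
  then have "space M = {}" using \<tau>0 by auto
  then show ?thesis by (simp add: measurable_def)
qed

section \<open>Borel sets of path space and the coordinate maps\<close>

lemma space_path_borel_eq_mspace:
  "space (path_borel T :: (real \<Rightarrow> real^'n) measure) = mspace (path_metric T)"
proof -
  have "mspace (path_metric T) = {\<omega> \<in> extensional {0..T}. continuous_on {0..T} \<omega> \<and> bounded (\<omega> ` {0..T} :: (real^'n) set)}"
    by auto
  also have "\<dots> = space (path_borel T)"
    using compact_imp_bounded[OF compact_continuous_image[OF _ compact_Icc]] by (auto simp: space_path_borel)
  finally show ?thesis ..
qed

lemma openin_path_metric_subset: "openin (mtopology_of (path_metric T)) U \<Longrightarrow> U \<subseteq> mspace (path_metric T)"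
  using openin_subset[of "mtopology_of (path_metric T)" U] by (simp only: topspace_mtopology_of)

lemma sets_path_borel:
  "sets (path_borel T) = sigma_sets (space (path_borel T)) {U. openin (mtopology_of (path_metric T :: (real \<Rightarrow> real^'n) metric)) U}"
  unfolding space_path_borel_eq_mspace unfolding path_borel_def
  by (intro sets_measure_of) (auto dest!: openin_path_metric_subset simp del: mspace_cfunspace)

lemma openin_path_metric:
  "openin (mtopology_of (path_metric T)) U \<longleftrightarrow>
     U \<subseteq> space (path_borel T) \<and> (\<forall>\<omega>\<in>U. \<exists>r>0. \<forall>\<omega>'\<in>space (path_borel T). mdist (path_metric T) \<omega> \<omega>' < r \<longrightarrow> \<omega>' \<in> U)"
  for U :: "(real \<Rightarrow> real^'n) set"
proof -
  interpret m: Metric_space "mspace (path_metric T) :: (real \<Rightarrow> real^'n) set" "mdist (path_metric T)"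
    by (rule Metric_space_mspace_mdist)
  have "m.mball \<omega> r \<subseteq> U \<longleftrightarrow> (\<forall>\<omega>'\<in>mspace (path_metric T). mdist (path_metric T) \<omega> \<omega>' < r \<longrightarrow> \<omega>' \<in> U)"
    if "\<omega> \<in> mspace (path_metric T)" for \<omega> r
    using that by (auto simp: m.in_mball simp del: mspace_cfunspace)
  then show ?thesis
    unfolding space_path_borel_eq_mspace mtopology_of_def m.openin_mtopology by (meson subsetD)
qed

lemma dist_le_mdist_path_metric:
  fixes \<omega> :: "real \<Rightarrow> real^'n"
  assumes "\<omega> \<in> space (path_borel T)" "\<omega>' \<in> space (path_borel T)" "s \<in> {0..T}"
  shows "dist (\<omega> s) (\<omega>' s) \<le> mdist (path_metric T) \<omega> \<omega>'"
  using mdist_cfunspace_imp_mdist_le[of \<omega> "top_of_set {0..T}" euclidean_metric \<omega>' "mdist (path_metric T) \<omega> \<omega>'" s] assms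
  unfolding space_path_borel_eq_mspace by (simp del: mspace_cfunspace)

text \<open>Evaluation at s is 1-Lipschitz for the uniform metric.\<close>

lemma measurable_path_coordinate:
  assumes "s \<in> {0..T}"
  shows "(\<lambda>\<omega>. \<omega> s) \<in> borel_measurable (path_borel T :: (real \<Rightarrow> real^'n) measure)"
proof (rule borel_measurableI)
  fix S :: "(real^'n) set" assume S: "open S"
  let ?U = "(\<lambda>\<omega>. \<omega> s) -` S \<inter> space (path_borel T)"
  have "openin (mtopology_of (path_metric T)) ?U"
    unfolding openin_path_metric
  proof (intro conjI ballI)
    fix \<omega> assume \<omega>: "\<omega> \<in> ?U"
    then obtain r where r: "0 < r" "\<And>y. dist (\<omega> s) y < r \<Longrightarrow> y \<in> S"
      using S unfolding open_dist by (metis IntD1 dist_commute vimageE)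
    have "\<omega>' \<in> ?U" if "\<omega>' \<in> space (path_borel T)" "mdist (path_metric T) \<omega> \<omega>' < r" for \<omega>'
      using dist_le_mdist_path_metric[OF _ that(1) assms, of \<omega>] \<omega> that r(2) by auto
    then show "\<exists>r>0. \<forall>\<omega>'\<in>space (path_borel T). mdist (path_metric T) \<omega> \<omega>' < r \<longrightarrow> \<omega>' \<in> ?U"
      using r(1) by blast
  qed auto
  then show "?U \<in> sets (path_borel T)"
    unfolding sets_path_borel by (intro sigma_sets.Basic) simp
qed

lemma space_path_filt [simp]: "space (path_filt T t) = space (path_borel T)"
  unfolding path_filt_def by (rule space_measure_of) auto

lemma sets_path_filt:
  "sets (path_filt T t) = sigma_sets (space (path_borel T))
      {(\<lambda>\<omega>. \<omega> s) -` B \<inter> space (path_borel T) | s B. s \<in> {0..T} \<and> s \<le> t \<and> B \<in> sets borel}"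
  unfolding path_filt_def by (rule sets_measure_of) auto

lemma path_filt_subset_borel: "sets (path_filt T t) \<subseteq> sets (path_borel T)"
  unfolding sets_path_filt
  by (intro sets.sigma_sets_subset) (auto intro!: measurable_sets[OF measurable_path_coordinate])

lemma path_filt_mono: "s \<le> t \<Longrightarrow> sets (path_filt T s) \<subseteq> sets (path_filt T t)"
  unfolding sets_path_filt by (intro sigma_sets_mono') fastforce

lemma measurable_path_filt_coordinate:
  "s \<in> {0..T} \<Longrightarrow> s \<le> t \<Longrightarrow> (\<lambda>\<omega>. \<omega> s) \<in> borel_measurable (path_filt T t)"
  by (intro measurableI) (auto simp: sets_path_filt intro!: sigma_sets.Basic)

text \<open>Every open set is a union of members of a countable family of coordinate-measurable
  sets, because this family contains sets of arbitrarily small diameter around every path. So a map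
  into path space is measurable as soon as its coordinates are.\<close>

lemma path_borel_subset_filt:
  assumes T: "0 < T"
  shows "sets (path_borel T :: (real \<Rightarrow> real^'n) measure) \<subseteq> sets (path_filt T T)"
proof -
  let ?\<Omega> = "space (path_borel T :: (real \<Rightarrow> real^'n) measure)"
  obtain D :: "(real^'n) set" where D: "countable D" "\<And>X. open X \<Longrightarrow> X \<noteq> {} \<Longrightarrow> \<exists>d\<in>D. d \<in> X"
    using countable_dense_exists by metis
  define g where "g = (\<lambda>n k. real k * T / real (Suc n))"
  have g0: "g n k \<in> {0..T}" if "k \<le> Suc n" for n k
    using that T by (auto simp: g_def divide_le_eq mult.commute[of T] intro!: mult_right_mono)
  \<comment> \<open>Paths whose grid values are close to a list q of points of the dense set and
    whose oscillation around each grid point is small. The oscillation is tested at rational times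
    only, which keeps the set measurable.\<close>
  define C where "C = (\<lambda>(n::nat, m::nat, q::(real^'n) list).
    {\<omega> \<in> ?\<Omega>. (\<forall>k\<in>{..Suc n}. dist (\<omega> (g n k)) (q ! k) \<le> 1 / real (Suc m)) \<and>
      (\<forall>k\<in>{..Suc n}. \<forall>t\<in>{0..T} \<inter> \<rat>. \<bar>t - g n k\<bar> \<le> T / real (Suc n) \<longrightarrow> dist (\<omega> t) (\<omega> (g n k)) \<le> 1 / real (Suc m))})"
  define I where "I = (UNIV :: nat set) \<times> (UNIV :: nat set) \<times> lists D"
  have "countable I"
    unfolding I_def using D by (intro countable_SIGMA countable_lists) auto
  have cQ: "countable ({0..T} \<inter> \<rat>)"
    by (intro countable_Int2 countable_rat)
  have coord: "(\<lambda>\<omega>. \<omega> s) \<in> borel_measurable (path_filt T T)" if "s \<in> {0..T}" for s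
    using that by (intro measurable_path_filt_coordinate) auto
  have Cm: "C i \<in> sets (path_filt T T)" for i
  proof -
    obtain n m q where i: "i = (n, m, q)" by (cases i) auto
    have k: "(\<lambda>\<omega>. \<omega> (g n k)) \<in> borel_measurable (path_filt T T)" if "k \<in> {..Suc n}" for k
      using that by (intro coord g0) auto
    have "Measurable.pred (path_filt T T) (\<lambda>\<omega>. \<forall>k\<in>{..Suc n}. dist (\<omega> (g n k)) (q ! k) \<le> 1 / real (Suc m))"
    proof (rule pred_Ball_countable)
      show "Measurable.pred (path_filt T T) (\<lambda>\<omega>. dist (\<omega> (g n k)) (q ! k) \<le> 1 / real (Suc m))"
        if [THEN k, measurable]: "k \<in> {..Suc n}" for k
        by measurable
    qed simp
    moreover have "Measurable.pred (path_filt T T) (\<lambda>\<omega>. \<forall>k\<in>{..Suc n}. \<forall>t\<in>{0..T} \<inter> \<rat>.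
        \<bar>t - g n k\<bar> \<le> T / real (Suc n) \<longrightarrow> dist (\<omega> t) (\<omega> (g n k)) \<le> 1 / real (Suc m))"
    proof (rule pred_Ball_countable, simp, rule pred_Ball_countable, rule cQ)
      fix k t assume kt: "k \<in> {..Suc n}" "t \<in> {0..T} \<inter> \<rat>"
      note [measurable] = k[OF kt(1)]
      have [measurable]: "(\<lambda>\<omega>. \<omega> t) \<in> borel_measurable (path_filt T T)"
        using kt by (intro coord) auto
      show "Measurable.pred (path_filt T T) (\<lambda>\<omega>. \<bar>t - g n k\<bar> \<le> T / real (Suc n) \<longrightarrow> dist (\<omega> t) (\<omega> (g n k)) \<le> 1 / real (Suc m))"
        by measurable
    qed
    ultimately have "Measurable.pred (path_filt T T) (\<lambda>\<omega>. (\<forall>k\<in>{..Suc n}. dist (\<omega> (g n k)) (q ! k) \<le> 1 / real (Suc m)) \<and>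
      (\<forall>k\<in>{..Suc n}. \<forall>t\<in>{0..T} \<inter> \<rat>. \<bar>t - g n k\<bar> \<le> T / real (Suc n) \<longrightarrow> dist (\<omega> t) (\<omega> (g n k)) \<le> 1 / real (Suc m)))"
      by (rule pred_intros_logic)
    then show ?thesis
      unfolding pred_def i C_def by simp
  qed
  \<comment> \<open>Each of the two paths contributes one oscillation and one distance to the common
    point of q, hence the 4.\<close>
  have diam: "mdist (path_metric T) \<omega> \<omega>' \<le> 4 / real (Suc m)"
    if "\<omega> \<in> C (n, m, q)" "\<omega>' \<in> C (n, m, q)" for n m q \<omega> \<omega>'
  proof -
    have \<Omega>: "\<omega> \<in> ?\<Omega>" "\<omega>' \<in> ?\<Omega>" using that by (auto simp: C_def)
    then have cont: "continuous_on {0..T} (\<lambda>t. dist (\<omega> t) (\<omega>' t))"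
      unfolding space_path_borel by (auto intro!: continuous_intros)
    have "dist (\<omega> t) (\<omega>' t) \<le> 4 / real (Suc m)" if t: "t \<in> {0..T}" for t
    proof (rule continuous_le_if_rational_le[OF T cont _ t])
      fix t assume t: "t \<in> \<rat>" "t \<in> {0..T}"
      define k where "k = nat \<lfloor>t * real (Suc n) / T\<rfloor>"
      have k: "real k = real_of_int \<lfloor>t * real (Suc n) / T\<rfloor>"
        unfolding k_def using t T by (subst of_nat_nat) auto
      have kt: "real k \<le> t * real (Suc n) / T" "t * real (Suc n) / T < real k + 1"
        unfolding k by linarith+
      have "t * real (Suc n) / T \<le> real (Suc n)"
        using t T by (simp add: divide_le_eq mult.commute mult_left_mono)
      then have kn: "k \<le> Suc n" using kt by linarith
      have "g n k \<le> t" "t \<le> g n k + T / real (Suc n)"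
        using kt T unfolding g_def by (simp_all add: field_simps del: of_nat_Suc)
      then have near: "\<bar>t - g n k\<bar> \<le> T / real (Suc n)" by linarith
      have 1: "dist (\<omega> t) (\<omega> (g n k)) \<le> 1 / real (Suc m)" "dist (\<omega>' t) (\<omega>' (g n k)) \<le> 1 / real (Suc m)"
        "dist (\<omega> (g n k)) (q ! k) \<le> 1 / real (Suc m)" "dist (\<omega>' (g n k)) (q ! k) \<le> 1 / real (Suc m)"
        using \<open>\<omega> \<in> C (n, m, q)\<close> \<open>\<omega>' \<in> C (n, m, q)\<close> near t kn by (auto simp: C_def)
      have "dist (\<omega> t) (\<omega>' t) \<le> dist (\<omega> t) (\<omega> (g n k)) + dist (\<omega> (g n k)) (q ! k) + (dist (\<omega>' (g n k)) (q ! k) + dist (\<omega>' t) (\<omega>' (g n k)))"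
        by (smt (verit) dist_commute dist_triangle)
      also have "\<dots> \<le> 4 * (1 / real (Suc m))"
        using 1 by linarith
      finally show "dist (\<omega> t) (\<omega>' t) \<le> 4 / real (Suc m)" by simp
    qed
    then show ?thesis
      using \<Omega> unfolding space_path_borel_eq_mspace
      by (intro mdist_cfunspace_le) auto
  qed
  \<comment> \<open>The radius of the ball inside U fixes m, uniform continuity of \<omega> then
    fixes n, and density of D supplies q.\<close>
  have cover: "\<exists>i\<in>I. \<omega> \<in> C i \<and> C i \<subseteq> U" if U: "openin (mtopology_of (path_metric T)) U" and \<omega>: "\<omega> \<in> U" for U \<omega>
  proof -
    obtain r where r: "0 < r" "\<And>\<omega>'. \<omega>' \<in> ?\<Omega> \<Longrightarrow> mdist (path_metric T) \<omega> \<omega>' < r \<Longrightarrow> \<omega>' \<in> U"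
      using U \<omega> unfolding openin_path_metric by meson
    have \<omega>\<Omega>: "\<omega> \<in> ?\<Omega>" using U \<omega> unfolding openin_path_metric by auto
    obtain m where m: "1 / real (Suc m) < r / 4"
      using reals_Archimedean[of "r / 4"] r by (auto simp: inverse_eq_divide)
    have "uniformly_continuous_on {0..T} \<omega>"
      using \<omega>\<Omega> unfolding space_path_borel by (intro compact_uniformly_continuous) auto
    moreover have "0 < 1 / real (Suc m)" by simp
    ultimately obtain d where d: "0 < d" "\<And>s t. s \<in> {0..T} \<Longrightarrow> t \<in> {0..T} \<Longrightarrow> dist s t < d \<Longrightarrow> dist (\<omega> s) (\<omega> t) < 1 / real (Suc m)"
      unfolding uniformly_continuous_on_def by metis
    obtain n where n: "1 / real (Suc n) < d / T"
      using reals_Archimedean[of "d / T"] d T by (auto simp: inverse_eq_divide)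
    then have n: "T / real (Suc n) < d"
      using T by (simp add: field_simps)
    have "\<exists>d\<in>D. dist (\<omega> (g n k)) d \<le> 1 / real (Suc m)" for k
    proof -
      have "ball (\<omega> (g n k)) (1 / real (Suc m)) \<noteq> {}" by simp
      then show ?thesis using D(2)[OF open_ball] by (fastforce simp: less_imp_le)
    qed
    then obtain p where p: "\<And>k. p k \<in> D" "\<And>k. dist (\<omega> (g n k)) (p k) \<le> 1 / real (Suc m)"
      by metis
    define q where "q = map p [0..<Suc (Suc n)]"
    have qk: "q ! k = p k" if "k \<le> Suc n" for k
      using that unfolding q_def by (subst nth_map) (auto simp del: upt_Suc)
    have iI: "(n, m, q) \<in> I"
      using p by (auto simp: I_def q_def)
    have near: "dist (\<omega> t) (\<omega> (g n k)) \<le> 1 / real (Suc m)"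
      if "k \<le> Suc n" "t \<in> {0..T}" "\<bar>t - g n k\<bar> \<le> T / real (Suc n)" for t k
    proof -
      have "dist t (g n k) < d"
        using that n by (simp add: dist_real_def del: of_nat_Suc)
      then show ?thesis
        using d(2)[OF that(2) g0[OF that(1)]] by (simp del: of_nat_Suc)
    qed
    have mem: "\<omega> \<in> C (n, m, q)"
      using \<omega>\<Omega> p qk near unfolding C_def by (auto simp del: of_nat_Suc)
    have "C (n, m, q) \<subseteq> U"
    proof
      fix \<omega>' assume \<omega>': "\<omega>' \<in> C (n, m, q)"
      have "mdist (path_metric T) \<omega> \<omega>' \<le> 4 / real (Suc m)"
        by (rule diam[OF mem \<omega>'])
      also have "\<dots> < r" using m by simp
      finally show "\<omega>' \<in> U" using \<omega>' by (intro r) (auto simp: C_def)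
    qed
    then show ?thesis using iI mem by blast
  qed
  have "U \<in> sets (path_filt T T)" if U: "openin (mtopology_of (path_metric T)) U" for U :: "(real \<Rightarrow> real^'n) set"
  proof -
    have "U = (\<Union>i\<in>{i\<in>I. C i \<subseteq> U}. C i)"
      using cover[OF U] by auto
    moreover have "countable {i\<in>I. C i \<subseteq> U}"
      using \<open>countable I\<close> by (rule countable_subset[rotated]) auto
    ultimately show ?thesis
      using Cm by (metis (no_types, lifting) sets.countable_UN'')
  qed
  then show ?thesis
    unfolding sets_path_borel by (metis (no_types, lifting) mem_Collect_eq sets.sigma_sets_subset space_path_filt subsetI)
qed

lemma measurable_path_borel:
  fixes f :: "'b \<Rightarrow> real \<Rightarrow> real^'n"
  assumes T: "0 < T" and f: "\<And>x. x \<in> space M \<Longrightarrow> f x \<in> space (path_borel T)"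
    and meas: "\<And>s. s \<in> {0..T} \<Longrightarrow> (\<lambda>x. f x s) \<in> borel_measurable M"
  shows "f \<in> measurable M (path_borel T)"
proof -
  have "sets (path_borel T) = sets (path_filt T T :: (real \<Rightarrow> real^'n) measure)"
    using path_borel_subset_filt[OF T] path_filt_subset_borel by auto
  moreover have "f \<in> measurable M (path_filt T T)"
    unfolding path_filt_def
  proof (rule measurable_measure_of)
    show "f \<in> space M \<rightarrow> space (path_borel T)" using f by auto
    fix Y assume "Y \<in> {(\<lambda>\<omega>. \<omega> s) -` B \<inter> space (path_borel T :: (real \<Rightarrow> real^'n) measure) | s B. s \<in> {0..T} \<and> s \<le> T \<and> B \<in> sets borel}"
    then obtain s B where Y: "Y = (\<lambda>\<omega>. \<omega> s) -` B \<inter> space (path_borel T)" "s \<in> {0..T}" "B \<in> sets borel" by auto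
    have "f -` Y \<inter> space M = (\<lambda>x. f x s) -` B \<inter> space M"
      using f by (auto simp: Y)
    then show "f -` Y \<inter> space M \<in> sets M"
      using measurable_sets[OF meas[OF Y(2)] Y(3)] by simp
  qed auto
  ultimately show ?thesis
    using measurable_cong_sets by blast
qed

text \<open>For s in [0, T] this is the event \<tau> > s, see \<open>less_hit_time_iff\<close>, in a
  form that avoids the extended-real infimum.\<close>

definition alive :: "real \<Rightarrow> real \<Rightarrow> (real \<Rightarrow> real^'n) set" where
  "alive T s = {\<omega> \<in> space (path_borel T). \<forall>u\<in>{0..s}. \<omega> u \<noteq> 0}"

lemma alive_subset: "alive T s \<subseteq> space (path_borel T)"
  by (auto simp: alive_def)

lemma alive_antimono: "s \<le> t \<Longrightarrow> alive T t \<subseteq> alive T s"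
  by (auto simp: alive_def)

lemma path_bounded_away:
  fixes \<omega> :: "real \<Rightarrow> real^'n"
  assumes "0 \<le> s" "continuous_on {0..s} \<omega>" "\<forall>u\<in>{0..s}. \<omega> u \<noteq> 0"
  shows "\<exists>m. \<forall>u\<in>{0..s}. 1 / real (Suc m) \<le> norm (\<omega> u)"
proof -
  have "continuous_on {0..s} (\<lambda>u. norm (\<omega> u))" using assms by (intro continuous_intros)
  then obtain u0 where u0: "u0 \<in> {0..s}" "\<And>u. u \<in> {0..s} \<Longrightarrow> norm (\<omega> u0) \<le> norm (\<omega> u)"
    using continuous_attains_inf[of "{0..s}" "\<lambda>u. norm (\<omega> u)"] assms by auto
  then have "0 < norm (\<omega> u0)" using assms by auto
  then obtain m where "1 / real (Suc m) < norm (\<omega> u0)"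
    using reals_Archimedean[of "norm (\<omega> u0)"] by (auto simp: inverse_eq_divide)
  then show ?thesis
    using u0 by (meson less_imp_le order_trans)
qed

text \<open>The right-hand side asks for a uniform lower bound because a path may vanish at an
  irrational time only. In this form the event involves countably many coordinates.\<close>

lemma nonvanishing_iff:
  fixes \<omega> :: "real \<Rightarrow> real^'n"
  assumes s: "0 < s" and c: "continuous_on {0..s} \<omega>"
  shows "(\<forall>u\<in>{0..s}. \<omega> u \<noteq> 0) \<longleftrightarrow> (\<exists>m. \<forall>u\<in>{0..s} \<inter> \<rat>. 1 / real (Suc m) \<le> norm (\<omega> u))"
proof
  assume a: "\<forall>u\<in>{0..s}. \<omega> u \<noteq> 0"
  show "\<exists>m. \<forall>u\<in>{0..s} \<inter> \<rat>. 1 / real (Suc m) \<le> norm (\<omega> u)"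
    using path_bounded_away[OF less_imp_le[OF s] c a] by blast
next
  assume "\<exists>m. \<forall>u\<in>{0..s} \<inter> \<rat>. 1 / real (Suc m) \<le> norm (\<omega> u)"
  then obtain m where m: "\<forall>u\<in>{0..s} \<inter> \<rat>. 1 / real (Suc m) \<le> norm (\<omega> u)"
    by blast
  have "continuous_on {0..s} (\<lambda>u. - norm (\<omega> u))" using c by (intro continuous_intros)
  then have "- norm (\<omega> u) \<le> - (1 / real (Suc m))" if "u \<in> {0..s}" for u
    by (rule continuous_le_if_rational_le[OF s _ _ that]) (use m in \<open>auto simp del: of_nat_Suc\<close>)
  then have "0 < norm (\<omega> u)" if "u \<in> {0..s}" for u
  proof -
    have "0 < 1 / real (Suc m)" by simp
    moreover have "1 / real (Suc m) \<le> norm (\<omega> u)"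
      using that \<open>\<And>u. u \<in> {0..s} \<Longrightarrow> - norm (\<omega> u) \<le> - (1 / real (Suc m))\<close> by fastforce
    ultimately show ?thesis by (rule less_le_trans)
  qed
  then show "\<forall>u\<in>{0..s}. \<omega> u \<noteq> 0" by auto
qed

lemma path_continuous: "\<omega> \<in> space (path_borel T) \<Longrightarrow> s \<le> T \<Longrightarrow> continuous_on {0..s} \<omega>"
  unfolding space_path_borel by (auto intro: continuous_on_subset)

lemma alive_measurable:
  assumes "0 \<le> s" "s \<le> T"
  shows "(alive T s :: (real \<Rightarrow> real^'n) set) \<in> sets (path_filt T s)"
proof (cases "s = 0")
  case True
  have [measurable]: "(\<lambda>\<omega>::real \<Rightarrow> real^'n. \<omega> 0) \<in> borel_measurable (path_filt T s)"
    using assms by (intro measurable_path_filt_coordinate) auto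
  have "(alive T s :: (real \<Rightarrow> real^'n) set) = {\<omega> \<in> space (path_filt T s). \<omega> 0 \<noteq> 0}"
    using True by (auto simp: alive_def)
  also have "\<dots> \<in> sets (path_filt T s)"
    by measurable
  finally show ?thesis .
next
  case False
  then have s: "0 < s" using assms by simp
  have "Measurable.pred (path_filt T s) (\<lambda>\<omega>::real \<Rightarrow> real^'n. \<exists>m. \<forall>u\<in>{0..s} \<inter> \<rat>. 1 / real (Suc m) \<le> norm (\<omega> u))"
  proof (rule pred_intros_countable, rule pred_Ball_countable, intro countable_Int2 countable_rat)
    fix m :: nat and u assume "u \<in> {0..s} \<inter> \<rat>"
    then have [measurable]: "(\<lambda>\<omega>::real \<Rightarrow> real^'n. \<omega> u) \<in> borel_measurable (path_filt T s)"
      using assms by (intro measurable_path_filt_coordinate) auto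
    show "Measurable.pred (path_filt T s) (\<lambda>\<omega>::real \<Rightarrow> real^'n. 1 / real (Suc m) \<le> norm (\<omega> u))"
      by measurable
  qed
  moreover have "(alive T s :: (real \<Rightarrow> real^'n) set) =
      {\<omega> \<in> space (path_filt T s). \<exists>m. \<forall>u\<in>{0..s} \<inter> \<rat>. 1 / real (Suc m) \<le> norm (\<omega> u)}"
    using nonvanishing_iff[OF s path_continuous[OF _ assms(2)]] by (auto simp: alive_def)
  ultimately show ?thesis
    by (simp add: pred_def)
qed

text \<open>The zero set of a path is compact, so a first zero is attained whenever there is one;
  therefore the strict inequality excludes exactly the zeros in [0, s].\<close>

lemma less_hit_time_iff:
  fixes \<omega> :: "real \<Rightarrow> real^'n"
  assumes \<omega>: "\<omega> \<in> space (path_borel T)" and s: "s \<in> {0..T}"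
  shows "ereal s < hit_time T \<omega> \<longleftrightarrow> \<omega> \<in> alive T s"
proof
  assume l: "ereal s < hit_time T \<omega>"
  show "\<omega> \<in> alive T s"
    unfolding alive_def
  proof (intro CollectI conjI ballI \<omega>)
    fix u assume u: "u \<in> {0..s}"
    show "\<omega> u \<noteq> 0"
    proof
      assume "\<omega> u = 0"
      then have "hit_time T \<omega> \<le> ereal u"
        unfolding hit_time_def using u s by (intro INF_lower) auto
      also have "\<dots> \<le> ereal s" using u by simp
      finally show False using l by simp
    qed
  qed
next
  assume a: "\<omega> \<in> alive T s"
  let ?Z = "{t \<in> {0..T}. \<omega> t = 0}"
  show "ereal s < hit_time T \<omega>"
  proof (cases "?Z = {}")
    case True
    show ?thesis unfolding hit_time_def True by (simp add: top_ereal_def)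
  next
    case False
    have "closed ({0..T} \<inter> \<omega> -` {0})"
      using path_continuous[OF \<omega> order_refl] by (intro continuous_closed_preimage) auto
    moreover have "?Z = {0..T} \<inter> \<omega> -` {0}"
      by auto
    ultimately have "compact ?Z"
      by (auto simp: compact_eq_bounded_closed intro: bounded_subset[OF bounded_closed_interval])
    then obtain t0 where t0: "t0 \<in> ?Z" "\<And>t. t \<in> ?Z \<Longrightarrow> t0 \<le> t"
      using compact_attains_inf[OF _ False] by blast
    have "s < t0" using a t0(1) by (force simp: alive_def not_less)
    also have "ereal t0 \<le> hit_time T \<omega>"
      unfolding hit_time_def using t0(2) by (intro INF_greatest) auto
    finally show ?thesis by simp
  qed
qed

section \<open>The killed kernel\<close>

definition killed_density :: "real \<Rightarrow> real \<Rightarrow> real^'n \<Rightarrow> real^'n \<Rightarrow> real" where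
  "killed_density \<gamma> t x y = exp (- lam CARD('n) \<gamma> * t) * (psi \<gamma> y / psi \<gamma> x) * heat_kernel t (x - y)"

text \<open>Time 0 is set apart, since \<open>heat_kernel 0\<close> is identically 0 whereas the
  semigroup has to start at the identity.\<close>

definition killed_op :: "real \<Rightarrow> real \<Rightarrow> (real^'n \<Rightarrow> ennreal) \<Rightarrow> real^'n \<Rightarrow> ennreal" where
  "killed_op \<gamma> t u x = (if t = 0 then u x else \<integral>\<^sup>+y. ennreal (killed_density \<gamma> t x y) * u y \<partial>lborel)"

lemma lam_nonneg: "0 < \<gamma> \<Longrightarrow> 0 \<le> lam d \<gamma>"
  by (simp add: lam_def)

lemma killed_density_nonneg: "0 < \<gamma> \<Longrightarrow> 0 \<le> killed_density \<gamma> t x y"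
  by (simp add: killed_density_def)

lemma measurable_killed_density [measurable (raw)]:
  assumes [measurable]: "x \<in> borel_measurable M" "y \<in> borel_measurable M"
  shows "(\<lambda>\<omega>. killed_density \<gamma> t (x \<omega>) (y \<omega>)) \<in> borel_measurable M"
  unfolding killed_density_def by measurable

lemma measurable_trans_density [measurable (raw)]:
  assumes "0 < \<gamma>" and [measurable]: "x \<in> borel_measurable M" "y \<in> borel_measurable M"
  shows "(\<lambda>\<omega>. trans_density \<gamma> t (x \<omega>) (y \<omega>)) \<in> borel_measurable M"
proof -
  note [measurable (raw)] = measurable_interaction_part[OF assms]
  show ?thesis
    unfolding trans_density_def point_kernel_def by measurable
qed

lemma trans_density_eq:
  "trans_density \<gamma> t x y = killed_density \<gamma> t x y + exp (- lam CARD('n) \<gamma> * t) * (psi \<gamma> y / psi \<gamma> x) * interaction_part \<gamma> t x y"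
  for x y :: "real^'n"
  by (simp add: trans_density_def point_kernel_def killed_density_def distrib_left)

lemma killed_le_trans_density: "0 < \<gamma> \<Longrightarrow> 0 < t \<Longrightarrow> killed_density \<gamma> t x y \<le> trans_density \<gamma> t x y"
  by (simp add: trans_density_eq interaction_part_nonneg)

lemma trans_density_nonneg: "0 < \<gamma> \<Longrightarrow> 0 < t \<Longrightarrow> 0 \<le> trans_density \<gamma> t x y"
  using killed_le_trans_density[of \<gamma> t x y] killed_density_nonneg[of \<gamma> t x y] by simp

text \<open>The direct distance e / 2 is well below the length 2e of a detour through 0; this gap
  drives the short-time comparison.\<close>

definition good_step :: "real \<Rightarrow> real^'n \<Rightarrow> real^'n \<Rightarrow> bool" where
  "good_step e x y \<longleftrightarrow> e \<le> norm x \<and> e \<le> norm y \<and> norm (x - y) \<le> e / 2"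

text \<open>The error is of order \<open>t\<^sup>2\<close>, so the errors of \<open>n\<close> steps of length \<open>1/n\<close> multiply to a factor
  that tends to 1.\<close>

lemma trans_density_short_time:
  assumes g: "0 < \<gamma>" and d: "CARD('n) \<in> {2, 3}" and e: "0 < e"
  obtains C t0 where "0 \<le> C" "0 < t0"
    "\<And>t (x::real^'n) y. 0 < t \<Longrightarrow> t \<le> t0 \<Longrightarrow> good_step e x y \<Longrightarrow>
       trans_density \<gamma> t x y \<le> (1 + C * t\<^sup>2) * killed_density \<gamma> t x y"
proof -
  obtain C t0 where C: "0 \<le> C" "0 < t0"
    "\<And>t (x::real^'n) y. 0 < t \<Longrightarrow> t \<le> t0 \<Longrightarrow> e \<le> norm x \<Longrightarrow> e \<le> norm y \<Longrightarrow> norm (x - y) \<le> e / 2 \<Longrightarrow>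
       interaction_part \<gamma> t x y \<le> C * t\<^sup>2 * heat_kernel t (x - y)"
    using interaction_part_short_time[OF g d e] by metis
  have "trans_density \<gamma> t x y \<le> (1 + C * t\<^sup>2) * killed_density \<gamma> t x y"
    if "0 < t" "t \<le> t0" "good_step e x y" for t and x y :: "real^'n"
  proof -
    define m where "m = exp (- lam CARD('n) \<gamma> * t) * (psi \<gamma> y / psi \<gamma> x)"
    have "0 \<le> m" using g by (simp add: m_def)
    then have "m * interaction_part \<gamma> t x y \<le> m * (C * t\<^sup>2 * heat_kernel t (x - y))"
      using that by (intro mult_left_mono C) (auto simp: good_step_def)
    then show ?thesis
      unfolding trans_density_eq killed_density_def m_def[symmetric] by (simp add: algebra_simps)
  qed
  with C show ?thesis using that by blast
qed

lemma AE_lborel_nonzero: "AE y in (lborel :: (real^'n) measure). y \<noteq> 0"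
  by (rule AE_lborel_singleton)

text \<open>The killed kernel is a Doob transform of the heat kernel by psi; with the factors in x
  outside the integral, its properties reduce to those of the heat semigroup.\<close>

lemma killed_op_eq:
  fixes x :: "real^'n"
  assumes g: "0 < \<gamma>" and t: "0 < t" and [measurable]: "u \<in> borel_measurable borel"
  shows "killed_op \<gamma> t u x = ennreal (exp (- lam CARD('n) \<gamma> * t) / psi \<gamma> x) *
     (\<integral>\<^sup>+y. ennreal (heat_kernel t (x - y)) * (ennreal (psi \<gamma> y) * u y) \<partial>lborel)"
proof -
  let ?c = "exp (- lam CARD('n) \<gamma> * t) / psi \<gamma> x"
  have e: "ennreal (killed_density \<gamma> t x y) = ennreal ?c * (ennreal (heat_kernel t (x - y)) * ennreal (psi \<gamma> y))" for y
  proof -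
    have "killed_density \<gamma> t x y = ?c * (heat_kernel t (x - y) * psi \<gamma> y)"
      by (simp add: killed_density_def)
    also have "ennreal \<dots> = ennreal ?c * (ennreal (heat_kernel t (x - y)) * ennreal (psi \<gamma> y))"
      using g by (subst ennreal_mult, simp, simp, subst ennreal_mult, simp_all)
    finally show ?thesis .
  qed
  have "killed_op \<gamma> t u x = (\<integral>\<^sup>+y. ennreal ?c * (ennreal (heat_kernel t (x - y)) * (ennreal (psi \<gamma> y) * u y)) \<partial>lborel)"
    unfolding killed_op_def e using t by (simp only: mult.assoc if_False less_imp_neq[symmetric])
  then show ?thesis
    by (subst (asm) nn_integral_cmult) simp_all
qed

lemma measurable_killed_op [measurable]:
  assumes [measurable]: "u \<in> borel_measurable borel"
  shows "killed_op \<gamma> t u \<in> borel_measurable borel"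
  by (cases "t = 0") (simp_all add: killed_op_def[abs_def])

lemma killed_op_cong_AE:
  assumes "0 < t" "AE y in lborel. u y = v y"
  shows "killed_op \<gamma> t u x = killed_op \<gamma> t v x"
  using assms unfolding killed_op_def by (auto intro!: nn_integral_cong_AE)

text \<open>The weight psi y cancels the 1 / psi y of the inner operator except at y = 0, a null
  set. What is left are the heat semigroup and the addition law of exp.\<close>

lemma killed_op_semigroup:
  fixes x :: "real^'n"
  assumes g: "0 < \<gamma>" and s: "0 \<le> s" and t: "0 < t" and u [measurable]: "u \<in> borel_measurable borel"
  shows "killed_op \<gamma> s (killed_op \<gamma> t u) x = killed_op \<gamma> (s + t) u x"
proof (cases "s = 0")
  case True
  then show ?thesis using t by (simp add: killed_op_def[of \<gamma> 0])
next
  case False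
  then have s: "0 < s" using s by simp
  let ?v = "\<lambda>y. ennreal (psi \<gamma> y) * u y"
  let ?e = "\<lambda>t. exp (- lam CARD('n) \<gamma> * t)"
  have *: "ennreal (psi \<gamma> y) * killed_op \<gamma> t u y = ennreal (?e t) * (\<integral>\<^sup>+z. ennreal (heat_kernel t (y - z)) * ?v z \<partial>lborel)" if "y \<noteq> 0" for y :: "real^'n"
  proof -
    have "ennreal (psi \<gamma> y) * ennreal (?e t / psi \<gamma> y) = ennreal (?e t)"
      using psi_pos[OF g that] by (simp add: ennreal_mult[symmetric])
    then show ?thesis
      unfolding killed_op_eq[OF g t u] by (simp add: mult.assoc[symmetric])
  qed
  have "killed_op \<gamma> s (killed_op \<gamma> t u) x = ennreal (?e s / psi \<gamma> x) *
     (\<integral>\<^sup>+y. ennreal (heat_kernel s (x - y)) * (ennreal (psi \<gamma> y) * killed_op \<gamma> t u y) \<partial>lborel)"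
    by (rule killed_op_eq[OF g s]) measurable
  also have "(\<integral>\<^sup>+y. ennreal (heat_kernel s (x - y)) * (ennreal (psi \<gamma> y) * killed_op \<gamma> t u y) \<partial>lborel) =
     (\<integral>\<^sup>+y. ennreal (?e t) * (ennreal (heat_kernel s (x - y)) * (\<integral>\<^sup>+z. ennreal (heat_kernel t (y - z)) * ?v z \<partial>lborel)) \<partial>lborel)"
  proof (rule nn_integral_cong_AE)
    show "AE y in lborel. ennreal (heat_kernel s (x - y)) * (ennreal (psi \<gamma> y) * killed_op \<gamma> t u y) =
      ennreal (?e t) * (ennreal (heat_kernel s (x - y)) * (\<integral>\<^sup>+z. ennreal (heat_kernel t (y - z)) * ?v z \<partial>lborel))"
      using AE_lborel_nonzero
    proof eventually_elim
      case (elim y)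
      show ?case
        unfolding *[OF elim] by (rule mult.left_commute)
    qed
  qed
  also have "\<dots> = ennreal (?e t) * (\<integral>\<^sup>+z. ennreal (heat_kernel (s + t) (x - z)) * ?v z \<partial>lborel)"
    using s t by (subst nn_integral_cmult) (simp_all add: nn_integral_heat_semigroup)
  also have "ennreal (?e s / psi \<gamma> x) * \<dots> = ennreal (?e (s + t) / psi \<gamma> x) * (\<integral>\<^sup>+z. ennreal (heat_kernel (s + t) (x - z)) * ?v z \<partial>lborel)"
  proof -
    have "ennreal (?e s / psi \<gamma> x) * ennreal (?e t) = ennreal (?e (s + t) / psi \<gamma> x)"
      using g by (subst ennreal_mult[symmetric]) (simp_all add: exp_add[symmetric] algebra_simps)
    then show ?thesis by (simp only: mult.assoc[symmetric])
  qed
  also have "\<dots> = killed_op \<gamma> (s + t) u x"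
    using s t by (subst killed_op_eq[OF g _ u]) auto
  finally show ?thesis .
qed

lemma conv_psi_pos:
  fixes x :: "real^'n"
  assumes g: "0 < \<gamma>" and d: "CARD('n) \<in> {2, 3}" and t: "0 < t"
  shows "0 < conv (heat_kernel t) (psi \<gamma>) x"
proof (rule conv_pos[OF integrable_psi[OF g d] _ t])
  show "AE y in lborel. 0 < psi \<gamma> (y::real^'n)"
    using AE_lborel_nonzero by eventually_elim (use g in \<open>simp add: psi_pos\<close>)
qed (use g in simp)

lemma surv_nonneg: "0 < \<gamma> \<Longrightarrow> CARD('n) \<in> {2, 3} \<Longrightarrow> 0 \<le> t \<Longrightarrow> 0 \<le> surv \<gamma> t (x::real^'n)"
  using conv_psi_pos[of \<gamma> t x] by (auto simp: surv_def intro!: divide_nonneg_nonneg mult_nonneg_nonneg)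

lemma surv_pos: "0 < \<gamma> \<Longrightarrow> CARD('n) \<in> {2, 3} \<Longrightarrow> 0 \<le> t \<Longrightarrow> x \<noteq> 0 \<Longrightarrow> 0 < surv \<gamma> t (x::real^'n)"
  using conv_psi_pos[of \<gamma> t x] psi_pos[of \<gamma> x] by (auto simp: surv_def)

text \<open>Combined with the semigroup law, this makes S space-time harmonic for the killed
  kernel.\<close>

lemma killed_op_one:
  fixes x :: "real^'n"
  assumes g: "0 < \<gamma>" and d: "CARD('n) \<in> {2, 3}" and t: "0 \<le> t" and x: "x \<noteq> 0"
  shows "killed_op \<gamma> t (\<lambda>_. 1) x = ennreal (surv \<gamma> t x)"
proof (cases "t = 0")
  case False
  then have t: "0 < t" using t by simp
  have "killed_op \<gamma> t (\<lambda>_. 1) x = ennreal (exp (- lam CARD('n) \<gamma> * t) / psi \<gamma> x) * ennreal (conv (heat_kernel t) (psi \<gamma>) x)"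
    using g by (subst killed_op_eq[OF g t]) (simp_all add: nn_integral_conv[OF integrable_psi[OF g d] _ t])
  also have "\<dots> = ennreal (surv \<gamma> t x)"
    using g x t psi_pos[OF g x] conv_psi_pos[OF g d t, of x] by (subst ennreal_mult[symmetric]) (auto simp: surv_def)
  finally show ?thesis .
qed (use x in \<open>simp add: killed_op_def surv_def\<close>)

lemma measurable_surv [measurable (raw)]:
  fixes x :: "'b \<Rightarrow> real^'n"
  assumes g: "0 < \<gamma>" and d: "CARD('n) \<in> {2, 3}"
    and [measurable]: "t \<in> borel_measurable M" "x \<in> borel_measurable M"
  shows "(\<lambda>\<omega>. surv \<gamma> (t \<omega>) (x \<omega>)) \<in> borel_measurable M"
proof -
  note [measurable (raw)] = measurable_conv[OF integrable_psi[OF g d]]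
  show ?thesis unfolding surv_def by measurable
qed

text \<open>For times at least a, the heat flow of psi is at most the maximum of the kernel at time
  a times the mass of psi, while the denominator psi diverges at 0. Uniformity in t matters, because
  the bound is used along a whole time grid.\<close>

lemma surv_small_near_0:
  assumes g: "0 < \<gamma>" and d: "CARD('n) \<in> {2, 3}" and a: "0 < a" and \<eta>: "0 < \<eta>"
  obtains \<epsilon> where "0 < \<epsilon>" "\<And>t (y::real^'n). a \<le> t \<Longrightarrow> norm y \<le> \<epsilon> \<Longrightarrow> surv \<gamma> t y \<le> \<eta>"
proof -
  define B where "B = (2 * pi * a) powr (- (real CARD('n) / 2)) * (LINT y|lborel. psi \<gamma> (y::real^'n))"
  have B0: "0 \<le> B" using g by (simp add: B_def)
  obtain \<epsilon> where \<epsilon>: "0 < \<epsilon>" "\<And>x::real^'n. x \<noteq> 0 \<Longrightarrow> norm x \<le> \<epsilon> \<Longrightarrow> B / \<eta> \<le> psi \<gamma> x"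
    using psi_large_near_0[OF g] by metis
  have "surv \<gamma> t y \<le> \<eta>" if t: "a \<le> t" and y: "norm y \<le> \<epsilon>" for t and y :: "real^'n"
  proof (cases "y = 0")
    case True
    then show ?thesis using \<eta> by (simp add: surv_def)
  next
    case False
    have p: "0 < psi \<gamma> y" by (rule psi_pos[OF g False])
    have "conv (heat_kernel t) (psi \<gamma>) y \<le> (2 * pi * t) powr (- (real CARD('n) / 2)) * (LINT y|lborel. psi \<gamma> (y::real^'n))"
      using a t g by (intro conv_le integrable_psi g d) auto
    also have "\<dots> \<le> B"
      unfolding B_def using a t g by (intro mult_right_mono powr_mono2') auto
    finally have c: "conv (heat_kernel t) (psi \<gamma>) y \<le> B" .
    have "exp (- lam CARD('n) \<gamma> * t) * conv (heat_kernel t) (psi \<gamma>) y \<le> 1 * B"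
      using c a t lam_nonneg[OF g, of "CARD('n)"] conv_psi_pos[OF g d, of t y] by (intro mult_mono) auto
    also have "\<dots> \<le> \<eta> * psi \<gamma> y"
      using \<epsilon>(2)[OF False y] \<eta> by (simp add: divide_le_eq mult.commute)
    finally show ?thesis
      using False a t p by (simp add: surv_def divide_le_eq)
  qed
  with \<epsilon>(1) show ?thesis using that by blast
qed

section \<open>The law of the point interaction\<close>

locale point_interaction =
  fixes T \<gamma> :: real and x :: "real^'n" and P :: "(real \<Rightarrow> real^'n) measure"
  assumes dim: "CARD('n) \<in> {2, 3}" and T: "0 < T" and \<gamma>: "0 < \<gamma>" and x: "x \<noteq> 0"
    and law: "point_interaction_law T \<gamma> x P"
begin

sublocale prob_space P
  using law by (simp add: point_interaction_law_def)

lemma sets_P: "sets P = sets (path_borel T)"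
  using law by (simp add: point_interaction_law_def)

lemma space_P: "space P = space (path_borel T)"
  using sets_P by (rule sets_eq_imp_space_eq)

lemma AE_start: "AE \<omega> in P. \<omega> 0 = x"
  using law by (simp add: point_interaction_law_def)

lemma sets_filt_P: "A \<in> sets (path_filt T s) \<Longrightarrow> A \<in> sets P"
  using path_filt_subset_borel[of T s] by (auto simp: sets_P)

lemma coord [measurable]: "s \<in> {0..T} \<Longrightarrow> (\<lambda>\<omega>. \<omega> s) \<in> borel_measurable P"
  using measurable_path_coordinate measurable_cong_sets[OF sets_P refl] by blast

lemma subalgebra_filt: "subalgebra P (path_filt T s)"
  by (auto simp: subalgebra_def space_P sets_filt_P)

sublocale filt: finite_measure_subalgebra P "path_filt T s" for s
  by unfold_locales (rule subalgebra_filt)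

lemma cond_density:
  assumes "0 \<le> s" "s < t" "t \<le> T" "B \<in> sets borel"
  shows "AE \<omega> in P. real_cond_exp P (path_filt T s) (\<lambda>\<omega>. indicator B (\<omega> t)) \<omega>
             = (LBINT y:B. trans_density \<gamma> (t - s) (\<omega> s) y)"
  using law assms by (simp add: point_interaction_law_def)

text \<open>The conditional probability of the whole space is 1, and a non-integrable density would
  have Bochner integral 0. So both claims follow from the Markov property, without computing the
  mass.\<close>

lemma AE_trans_density:
  assumes st: "0 \<le> s" "s < t" "t \<le> T"
  shows "AE \<omega> in P. integrable lborel (\<lambda>y. trans_density \<gamma> (t - s) (\<omega> s) y) \<and>
     (LINT y|lborel. trans_density \<gamma> (t - s) (\<omega> s) y) = 1"
proof -
  have "AE \<omega> in P. real_cond_exp P (path_filt T s) (\<lambda>\<omega>. 1) \<omega> = 1"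
    by (rule filt.real_cond_exp_F_meas) auto
  moreover have "AE \<omega> in P. real_cond_exp P (path_filt T s) (\<lambda>\<omega>. 1) \<omega> = (LINT y|lborel. trans_density \<gamma> (t - s) (\<omega> s) y)"
    using cond_density[OF st, of UNIV] by (simp add: set_lebesgue_integral_def)
  ultimately show ?thesis
  proof eventually_elim
    case (elim \<omega>)
    then have "(LINT y|lborel. trans_density \<gamma> (t - s) (\<omega> s) y) = 1" by simp
    then show ?case
      using not_integrable_integral_eq by fastforce
  qed
qed

lemma AE_nn_trans_density:
  assumes st: "0 \<le> s" "s < t" "t \<le> T"
  shows "AE \<omega> in P. (\<integral>\<^sup>+y. ennreal (trans_density \<gamma> (t - s) (\<omega> s) y) \<partial>lborel) = 1"
  using AE_trans_density[OF st]
proof eventually_elim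
  case (elim \<omega>)
  then show ?case
    using st by (subst nn_integral_eq_integral) (auto simp: trans_density_nonneg[OF \<gamma>])
qed

text \<open>The conditional expectation is recast as an identity of nonnegative integrals over
  events of the past, where no integrability has to be carried along.\<close>

lemma markov_rectangle:
  assumes st: "0 \<le> s" "s < t" "t \<le> T" and A: "A \<in> sets (path_filt T s)" and B [measurable]: "B \<in> sets borel"
  shows "emeasure P (A \<inter> {\<omega> \<in> space P. \<omega> t \<in> B}) =
    (\<integral>\<^sup>+\<omega>. indicator A \<omega> * (\<integral>\<^sup>+y. ennreal (trans_density \<gamma> (t - s) (\<omega> s) y) * indicator B y \<partial>lborel) \<partial>P)"
proof -
  note q [measurable (raw)] = measurable_trans_density[OF \<gamma>]
  have [measurable]: "A \<in> sets P" using A by (rule sets_filt_P)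
  have [measurable]: "(\<lambda>\<omega>. \<omega> t) \<in> borel_measurable P" "(\<lambda>\<omega>. \<omega> s) \<in> borel_measurable P"
    using st by (auto intro!: coord)
  have q0: "0 \<le> trans_density \<gamma> (t - s) a b" for a b :: "real^'n"
    using st by (intro trans_density_nonneg \<gamma>) auto
  let ?q = "\<lambda>\<omega>. LBINT y:B. trans_density \<gamma> (t - s) (\<omega> s) y"
  have [measurable]: "?q \<in> borel_measurable P"
    unfolding set_lebesgue_integral_def by measurable
  have i: "integrable P (\<lambda>\<omega>. indicator B (\<omega> t) :: real)"
    by (rule integrable_const_bound[of _ 1]) (auto simp: indicator_def)
  have iq: "integrable P ?q"
  proof -
    have "integrable P (real_cond_exp P (path_filt T s) (\<lambda>\<omega>. indicator B (\<omega> t))) \<longleftrightarrow> integrable P ?q"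
      by (intro integrable_cong_AE cond_density st B) measurable
    then show ?thesis
      using filt.real_cond_exp_int(1)[OF i, of s] by simp
  qed
  have "(\<integral>\<^sup>+\<omega>. indicator A \<omega> * (\<integral>\<^sup>+y. ennreal (trans_density \<gamma> (t - s) (\<omega> s) y) * indicator B y \<partial>lborel) \<partial>P) =
      (\<integral>\<^sup>+\<omega>. ennreal (indicator A \<omega> * ?q \<omega>) \<partial>P)"
  proof (rule nn_integral_cong_AE)
    show "AE \<omega> in P. indicator A \<omega> * (\<integral>\<^sup>+y. ennreal (trans_density \<gamma> (t - s) (\<omega> s) y) * indicator B y \<partial>lborel) = ennreal (indicator A \<omega> * ?q \<omega>)"
      using AE_trans_density[OF st]
    proof eventually_elim
      case (elim \<omega>)
      then have "integrable lborel (\<lambda>y. indicator B y *\<^sub>R trans_density \<gamma> (t - s) (\<omega> s) y)"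
        by (intro integrable_mult_indicator) auto
      then have "ennreal (?q \<omega>) = (\<integral>\<^sup>+y. ennreal (indicator B y *\<^sub>R trans_density \<gamma> (t - s) (\<omega> s) y) \<partial>lborel)"
        unfolding set_lebesgue_integral_def using q0 by (intro nn_integral_eq_integral[symmetric]) auto
      also have "\<dots> = (\<integral>\<^sup>+y. ennreal (trans_density \<gamma> (t - s) (\<omega> s) y) * indicator B y \<partial>lborel)"
        by (intro nn_integral_cong) (auto simp: indicator_def)
      finally show ?case
        by (auto simp: indicator_def)
    qed
  qed
  also have "\<dots> = ennreal (LINT \<omega>|P. indicator A \<omega> * ?q \<omega>)"
  proof (rule nn_integral_eq_integral)
    show "integrable P (\<lambda>\<omega>. indicator A \<omega> * ?q \<omega>)"
      using integrable_mult_indicator[OF \<open>A \<in> sets P\<close> iq] by simp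
    have "0 \<le> ?q \<omega>" for \<omega>
      unfolding set_lebesgue_integral_def using q0 by (intro integral_nonneg_AE) auto
    then show "AE \<omega> in P. 0 \<le> indicator A \<omega> * ?q \<omega>" by auto
  qed
  also have "(LINT \<omega>|P. indicator A \<omega> * ?q \<omega>) = (LINT \<omega>|P. indicator A \<omega> *\<^sub>R real_cond_exp P (path_filt T s) (\<lambda>\<omega>. indicator B (\<omega> t)) \<omega>)"
  proof (rule integral_cong_AE)
    show "AE \<omega> in P. indicator A \<omega> * ?q \<omega> = indicator A \<omega> *\<^sub>R real_cond_exp P (path_filt T s) (\<lambda>\<omega>. indicator B (\<omega> t)) \<omega>"
      using cond_density[OF st B] by eventually_elim simp
  qed measurable
  also have "\<dots> = (LINT \<omega>:A|P. real_cond_exp P (path_filt T s) (\<lambda>\<omega>. indicator B (\<omega> t)) \<omega>)"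
    by (simp only: set_lebesgue_integral_def)
  also have "\<dots> = (LINT \<omega>:A|P. indicator B (\<omega> t))"
    using filt.real_cond_exp_intA[OF i A] by simp
  also have "\<dots> = (LINT \<omega>|P. indicator (A \<inter> {\<omega> \<in> space P. \<omega> t \<in> B}) \<omega>)"
    unfolding set_lebesgue_integral_def
    by (intro Bochner_Integration.integral_cong) (auto simp: indicator_def)
  also have "\<dots> = measure P (A \<inter> {\<omega> \<in> space P. \<omega> t \<in> B})"
    by (subst Bochner_Integration.integral_indicator) (auto intro!: arg_cong[where f=prob])
  finally show ?thesis
    by (simp add: emeasure_eq_measure)
qed

text \<open>Both sides are integrals of F against measures on pairs. These are finite and agree on
  rectangles by \<open>markov_rectangle\<close>, and the rectangles are stable under
  intersection.\<close>

theorem markov: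
  assumes st: "0 \<le> s" "s < t" "t \<le> T" and A: "A \<in> sets (path_filt T s)"
    and F [measurable]: "case_prod F \<in> borel_measurable (borel \<Otimes>\<^sub>M borel)"
  shows "(\<integral>\<^sup>+\<omega>. indicator A \<omega> * F (\<omega> s) (\<omega> t) \<partial>P) =
    (\<integral>\<^sup>+\<omega>. indicator A \<omega> * (\<integral>\<^sup>+y. ennreal (trans_density \<gamma> (t - s) (\<omega> s) y) * F (\<omega> s) y \<partial>lborel) \<partial>P)"
proof -
  note q [measurable (raw)] = measurable_trans_density[OF \<gamma>]
  have [measurable]: "A \<in> sets P" using A by (rule sets_filt_P)
  have [measurable]: "(\<lambda>\<omega>. \<omega> t) \<in> borel_measurable P" "(\<lambda>\<omega>. \<omega> s) \<in> borel_measurable P"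
    using st by (auto intro!: coord)
  have Fm: "(\<lambda>z. F (f z) (g z)) \<in> borel_measurable M"
    if "f \<in> borel_measurable M" "g \<in> borel_measurable M" for M :: "'z measure" and f g :: "'z \<Rightarrow> real^'n"
    using measurable_compose[OF measurable_Pair[OF that] F] by simp
  let ?E = "{a \<times> b | a b. a \<in> sets (borel :: (real^'n) measure) \<and> b \<in> sets (borel :: (real^'n) measure)}"
  let ?N = "borel \<Otimes>\<^sub>M borel :: ((real^'n) \<times> (real^'n)) measure"
  define \<mu> where "\<mu> = distr (density P (indicator A)) ?N (\<lambda>\<omega>. (\<omega> s, \<omega> t))"
  define \<nu> where "\<nu> = distr (density (P \<Otimes>\<^sub>M lborel) (\<lambda>(\<omega>, y). indicator A \<omega> * ennreal (trans_density \<gamma> (t - s) (\<omega> s) y))) ?N (\<lambda>(\<omega>, y). (\<omega> s, y))"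
  have \<mu>: "(\<integral>\<^sup>+p. G p \<partial>\<mu>) = (\<integral>\<^sup>+\<omega>. indicator A \<omega> * G (\<omega> s, \<omega> t) \<partial>P)" if [measurable]: "G \<in> borel_measurable ?N" for G
    unfolding \<mu>_def by (subst nn_integral_distr) (simp_all add: nn_integral_density)
  have \<nu>: "(\<integral>\<^sup>+p. G p \<partial>\<nu>) = (\<integral>\<^sup>+\<omega>. indicator A \<omega> * (\<integral>\<^sup>+y. ennreal (trans_density \<gamma> (t - s) (\<omega> s) y) * G (\<omega> s, y) \<partial>lborel) \<partial>P)"
    if [measurable]: "G \<in> borel_measurable ?N" for G
  proof -
    have "(\<integral>\<^sup>+p. G p \<partial>\<nu>) = (\<integral>\<^sup>+p. (indicator A (fst p) * ennreal (trans_density \<gamma> (t - s) (fst p s) (snd p))) * G (fst p s, snd p) \<partial>(P \<Otimes>\<^sub>M lborel))"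
      unfolding \<nu>_def by (subst nn_integral_distr) (simp_all add: nn_integral_density case_prod_beta')
    also have "\<dots> = (\<integral>\<^sup>+\<omega>. \<integral>\<^sup>+y. (indicator A \<omega> * ennreal (trans_density \<gamma> (t - s) (\<omega> s) y)) * G (\<omega> s, y) \<partial>lborel \<partial>P)"
      by (subst lborel.nn_integral_fst[symmetric]) simp_all
    also have "\<dots> = (\<integral>\<^sup>+\<omega>. indicator A \<omega> * (\<integral>\<^sup>+y. ennreal (trans_density \<gamma> (t - s) (\<omega> s) y) * G (\<omega> s, y) \<partial>lborel) \<partial>P)"
      by (simp add: mult.assoc nn_integral_cmult)
    finally show ?thesis .
  qed
  have "\<mu> = \<nu>"
  proof (rule measure_eqI_generator_eq[where \<Omega>=UNIV and E="?E" and A="\<lambda>_. UNIV"])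
    show "Int_stable ?E"
      by (rule Int_stable_pair_measure_generator)
    show "sets \<mu> = sigma_sets UNIV ?E"
      by (simp add: \<mu>_def sets_pair_measure)
    show "sets \<nu> = sigma_sets UNIV ?E"
      by (simp add: \<nu>_def sets_pair_measure)
    show "range (\<lambda>_::nat. UNIV) \<subseteq> ?E"
      by (auto intro!: exI[of _ UNIV])
    have eq: "emeasure \<mu> X = emeasure \<nu> X" if X': "X \<in> ?E" for X
    proof -
      obtain a b where X: "X = a \<times> b" and [measurable]: "a \<in> sets borel" "b \<in> sets borel"
        using X' by auto
      have [measurable]: "X \<in> sets ?N" unfolding X by measurable
      \<comment> \<open>The condition on X_s belongs to the past, so it is moved into the
        event.\<close>
      define A' where "A' = A \<inter> {\<omega> \<in> space P. \<omega> s \<in> a}"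
      have A': "A' \<in> sets (path_filt T s)"
      proof -
        have [measurable]: "(\<lambda>\<omega>. \<omega> s) \<in> borel_measurable (path_filt T s)"
          using st by (intro measurable_path_filt_coordinate) auto
        have "A' = A \<inter> {\<omega> \<in> space (path_filt T s). \<omega> s \<in> a}" by (simp add: A'_def space_P)
        moreover have "{\<omega> \<in> space (path_filt T s). \<omega> s \<in> a} \<in> sets (path_filt T s)" by measurable
        ultimately show ?thesis using A by (simp only: sets.Int)
      qed
      have [measurable]: "A' \<in> sets P" using A' by (rule sets_filt_P)
      have AP: "A \<subseteq> space P" using A sets.sets_into_space[OF sets_filt_P] by blast
      have "emeasure \<mu> X = (\<integral>\<^sup>+p. indicator X p \<partial>\<mu>)"
        by (rule nn_integral_indicator[symmetric]) (simp add: \<mu>_def)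
      also have "\<dots> = (\<integral>\<^sup>+\<omega>. indicator A \<omega> * indicator X (\<omega> s, \<omega> t) \<partial>P)"
        by (rule \<mu>) measurable
      also have "\<dots> = (\<integral>\<^sup>+\<omega>. indicator (A' \<inter> {\<omega> \<in> space P. \<omega> t \<in> b}) \<omega> \<partial>P)"
        using AP by (intro nn_integral_cong) (auto simp: indicator_def A'_def X)
      also have "\<dots> = emeasure P (A' \<inter> {\<omega> \<in> space P. \<omega> t \<in> b})"
        by (rule nn_integral_indicator) measurable
      also have "\<dots> = (\<integral>\<^sup>+\<omega>. indicator A' \<omega> * (\<integral>\<^sup>+y. ennreal (trans_density \<gamma> (t - s) (\<omega> s) y) * indicator b y \<partial>lborel) \<partial>P)"
        by (rule markov_rectangle[OF st A']) measurable
      also have "\<dots> = (\<integral>\<^sup>+\<omega>. indicator A \<omega> * (\<integral>\<^sup>+y. ennreal (trans_density \<gamma> (t - s) (\<omega> s) y) * indicator X (\<omega> s, y) \<partial>lborel) \<partial>P)"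
        using AP by (intro nn_integral_cong) (auto simp: indicator_def A'_def X)
      also have "\<dots> = (\<integral>\<^sup>+p. indicator X p \<partial>\<nu>)"
        by (rule \<nu>[symmetric]) measurable
      also have "\<dots> = emeasure \<nu> X"
        by (rule nn_integral_indicator) (simp add: \<nu>_def)
      finally show ?thesis .
    qed
    then show "emeasure \<mu> X = emeasure \<nu> X" if "X \<in> ?E" for X
      using that .
    have "emeasure \<mu> UNIV = (\<integral>\<^sup>+p. 1 \<partial>\<mu>)"
      by (simp add: \<mu>_def space_pair_measure)
    also have "\<dots> = emeasure P A"
      by (subst \<mu>) auto
    finally show "emeasure \<mu> UNIV \<noteq> \<infinity>" by simp
  qed auto
  then show ?thesis
    using \<mu>[of "case_prod F"] \<nu>[of "case_prod F"] by simp
qed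

lemma space_filt: "space P \<in> sets (path_filt T s)"
  using sets.top[of "path_filt T s"] by (simp add: space_P)

text \<open>At a positive time the law has a density and does not charge a point; at time 0 the path
  is at x. This disposes of the default values of psi and the kernels at 0.\<close>

lemma AE_nonzero:
  assumes "0 \<le> t" "t \<le> T"
  shows "AE \<omega> in P. \<omega> t \<noteq> 0"
proof (cases "t = 0")
  case True
  then show ?thesis using AE_start x by auto
next
  case False
  then have t: "0 < t" using assms by simp
  have [measurable]: "(\<lambda>\<omega>. \<omega> t) \<in> borel_measurable P"
    using assms by (auto intro!: coord)
  have "(\<integral>\<^sup>+\<omega>. indicator (space P) \<omega> * indicator {0} (\<omega> t) \<partial>P) =
     (\<integral>\<^sup>+\<omega>. indicator (space P) \<omega> * (\<integral>\<^sup>+y. ennreal (trans_density \<gamma> (t - 0) (\<omega> 0) y) * indicator {0} y \<partial>lborel) \<partial>P)"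
    by (rule markov[where F="\<lambda>_ y. indicator {0} y", OF order_refl t assms(2) space_filt]) measurable
  also have "\<dots> = (\<integral>\<^sup>+\<omega>. 0 \<partial>P)"
  proof (rule nn_integral_cong)
    fix \<omega> :: "real \<Rightarrow> real^'n"
    have "(\<integral>\<^sup>+y. ennreal (trans_density \<gamma> (t - 0) (\<omega> 0) y) * indicator {0} y \<partial>lborel) = (\<integral>\<^sup>+y. 0 \<partial>(lborel :: (real^'n) measure))"
    proof (rule nn_integral_cong_AE)
      show "AE y in lborel. ennreal (trans_density \<gamma> (t - 0) (\<omega> 0) y) * indicator {0} y = 0"
        using AE_lborel_nonzero by eventually_elim simp
    qed
    then show "indicator (space P) \<omega> * (\<integral>\<^sup>+y. ennreal (trans_density \<gamma> (t - 0) (\<omega> 0) y) * indicator {0} y \<partial>lborel) = 0"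
      by simp
  qed
  finally have "AE \<omega> in P. indicator (space P) \<omega> * indicator {0} (\<omega> t) = (0::ennreal)"
    by (subst nn_integral_0_iff_AE[symmetric]) simp_all
  then show ?thesis
    using AE_space by eventually_elim (auto simp: indicator_def split: if_splits)
qed

text \<open>S is the mass of the killed density, which lies below the transition density. The bound
  holds almost surely because the mass 1 of the latter is known in that sense.\<close>

lemma AE_surv_le_1:
  assumes "0 \<le> s" "s \<le> T"
  shows "AE \<omega> in P. surv \<gamma> (T - s) (\<omega> s) \<le> 1"
proof (cases "s = T")
  case True
  then show ?thesis by (simp add: surv_def)
next
  case False
  then have st: "0 \<le> s" "s < T" "T \<le> T" using assms by auto
  show ?thesis
    using AE_nn_trans_density[OF st] AE_nonzero[OF assms]
  proof eventually_elim
    case (elim \<omega>)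
    have "ennreal (surv \<gamma> (T - s) (\<omega> s)) = killed_op \<gamma> (T - s) (\<lambda>_. 1) (\<omega> s)"
      using st elim by (intro killed_op_one[symmetric] \<gamma> dim) auto
    also have "\<dots> \<le> (\<integral>\<^sup>+y. ennreal (trans_density \<gamma> (T - s) (\<omega> s) y) \<partial>lborel)"
      unfolding killed_op_def using st by (auto intro!: nn_integral_mono ennreal_leI killed_le_trans_density \<gamma>)
    finally show ?case
      using elim by simp
  qed
qed

text \<open>The lower half of the squeeze, from the pointwise domination of the densities; it
  applies to time steps of any length.\<close>

lemma killed_le_markov:
  assumes st: "0 \<le> s" "s \<le> t" "t \<le> T" and A: "A \<in> sets (path_filt T s)" and u [measurable]: "u \<in> borel_measurable borel"
  shows "(\<integral>\<^sup>+\<omega>. indicator A \<omega> * killed_op \<gamma> (t - s) u (\<omega> s) \<partial>P) \<le> (\<integral>\<^sup>+\<omega>. indicator A \<omega> * u (\<omega> t) \<partial>P)"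
proof (cases "s = t")
  case False
  then have st: "0 \<le> s" "s < t" "t \<le> T" using st by auto
  have "(\<integral>\<^sup>+\<omega>. indicator A \<omega> * killed_op \<gamma> (t - s) u (\<omega> s) \<partial>P) \<le>
     (\<integral>\<^sup>+\<omega>. indicator A \<omega> * (\<integral>\<^sup>+y. ennreal (trans_density \<gamma> (t - s) (\<omega> s) y) * u y \<partial>lborel) \<partial>P)"
    unfolding killed_op_def using st
    by (auto intro!: nn_integral_mono mult_left_mono mult_right_mono ennreal_leI killed_le_trans_density \<gamma>)
  also have "\<dots> = (\<integral>\<^sup>+\<omega>. indicator A \<omega> * u (\<omega> t) \<partial>P)"
    by (rule markov[OF st A, symmetric]) measurable
  finally show ?thesis .
qed (simp add: killed_op_def)

end

section \<open>The upper estimate by discretisation, and the submartingale S\<close>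

context point_interaction
begin

lemma pred_good_step: "Measurable.pred (borel \<Otimes>\<^sub>M borel) (\<lambda>(a, b). good_step e a (b::real^'n))"
  unfolding good_step_def by measurable

lemma killed_upper_step:
  assumes st: "0 \<le> s" "s < t" "t \<le> T" and A: "A \<in> sets (path_filt T s)" and u [measurable]: "u \<in> borel_measurable borel"
    and c: "0 \<le> c" "\<And>a b::real^'n. good_step e a b \<Longrightarrow> trans_density \<gamma> (t - s) a b \<le> c * killed_density \<gamma> (t - s) a b"
  shows "(\<integral>\<^sup>+\<omega>. indicator A \<omega> * (if good_step e (\<omega> s) (\<omega> t) then u (\<omega> t) else 0) \<partial>P) \<le>
    ennreal c * (\<integral>\<^sup>+\<omega>. indicator A \<omega> * killed_op \<gamma> (t - s) u (\<omega> s) \<partial>P)"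
proof -
  have [measurable]: "A \<in> sets P" using A by (rule sets_filt_P)
  have [measurable]: "(\<lambda>\<omega>. \<omega> s) \<in> borel_measurable P"
    using st by (auto intro!: coord)
  note [measurable] = pred_good_step[of e]
  have [measurable]: "case_prod (\<lambda>a b. if good_step e a b then u b else 0) \<in> borel_measurable (borel \<Otimes>\<^sub>M borel)"
  proof -
    have "(\<lambda>p. if (case p of (a, b) \<Rightarrow> good_step e a b) then u (snd p) else 0) \<in> borel_measurable (borel \<Otimes>\<^sub>M borel)"
      by measurable
    then show ?thesis by (simp add: case_prod_beta')
  qed
  have "(\<integral>\<^sup>+\<omega>. indicator A \<omega> * (if good_step e (\<omega> s) (\<omega> t) then u (\<omega> t) else 0) \<partial>P) =
     (\<integral>\<^sup>+\<omega>. indicator A \<omega> * (\<integral>\<^sup>+y. ennreal (trans_density \<gamma> (t - s) (\<omega> s) y) * (if good_step e (\<omega> s) y then u y else 0) \<partial>lborel) \<partial>P)"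
    by (rule markov[OF st A, where F="\<lambda>a b. if good_step e a b then u b else 0"]) measurable
  also have "\<dots> \<le> (\<integral>\<^sup>+\<omega>. ennreal c * (indicator A \<omega> * killed_op \<gamma> (t - s) u (\<omega> s)) \<partial>P)"
  proof (rule nn_integral_mono)
    fix \<omega> :: "real \<Rightarrow> real^'n"
    have "(\<integral>\<^sup>+y. ennreal (trans_density \<gamma> (t - s) (\<omega> s) y) * (if good_step e (\<omega> s) y then u y else 0) \<partial>lborel) \<le>
       (\<integral>\<^sup>+y. ennreal c * (ennreal (killed_density \<gamma> (t - s) (\<omega> s) y) * u y) \<partial>lborel)"
    proof (rule nn_integral_mono)
      fix y
      show "ennreal (trans_density \<gamma> (t - s) (\<omega> s) y) * (if good_step e (\<omega> s) y then u y else 0) \<le>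
         ennreal c * (ennreal (killed_density \<gamma> (t - s) (\<omega> s) y) * u y)"
      proof (cases "good_step e (\<omega> s) y")
        case True
        have "ennreal (trans_density \<gamma> (t - s) (\<omega> s) y) \<le> ennreal (c * killed_density \<gamma> (t - s) (\<omega> s) y)"
          using c(2)[OF True] by (rule ennreal_leI)
        also have "\<dots> = ennreal c * ennreal (killed_density \<gamma> (t - s) (\<omega> s) y)"
          using c(1) by (rule ennreal_mult) (rule killed_density_nonneg[OF \<gamma>])
        finally have "ennreal (trans_density \<gamma> (t - s) (\<omega> s) y) * u y \<le> ennreal c * ennreal (killed_density \<gamma> (t - s) (\<omega> s) y) * u y"
          by (rule mult_right_mono) simp
        then show ?thesis using True by (simp add: mult.assoc)
      qed simp
    qed
    also have "\<dots> = ennreal c * killed_op \<gamma> (t - s) u (\<omega> s)"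
      unfolding killed_op_def using st by (simp add: nn_integral_cmult)
    finally have "indicator A \<omega> * (\<integral>\<^sup>+y. ennreal (trans_density \<gamma> (t - s) (\<omega> s) y) * (if good_step e (\<omega> s) y then u y else 0) \<partial>lborel) \<le>
      indicator A \<omega> * (ennreal c * killed_op \<gamma> (t - s) u (\<omega> s))"
      by (rule mult_left_mono) simp
    then show "indicator A \<omega> * (\<integral>\<^sup>+y. ennreal (trans_density \<gamma> (t - s) (\<omega> s) y) * (if good_step e (\<omega> s) y then u y else 0) \<partial>lborel) \<le>
      ennreal c * (indicator A \<omega> * killed_op \<gamma> (t - s) u (\<omega> s))"
      by (simp only: mult.left_commute)
  qed
  also have "\<dots> = ennreal c * (\<integral>\<^sup>+\<omega>. indicator A \<omega> * killed_op \<gamma> (t - s) u (\<omega> s) \<partial>P)"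
    by (rule nn_integral_cmult) measurable
  finally show ?thesis .
qed

definition good_grid :: "(real \<Rightarrow> real^'n) set \<Rightarrow> real \<Rightarrow> real \<Rightarrow> real \<Rightarrow> nat \<Rightarrow> (real \<Rightarrow> real^'n) set" where
  "good_grid A e s r k = {\<omega> \<in> A. \<forall>i<k. good_step e (\<omega> (s + real i * r)) (\<omega> (s + real (Suc i) * r))}"

lemma good_grid_0 [simp]: "good_grid A e s r 0 = A"
  by (simp add: good_grid_def)

lemma good_grid_Suc: "good_grid A e s r (Suc k) = {\<omega> \<in> good_grid A e s r k. good_step e (\<omega> (s + real k * r)) (\<omega> (s + real (Suc k) * r))}"
  by (auto simp: good_grid_def less_Suc_eq simp del: of_nat_Suc)

lemma good_grid_measurable:
  assumes s: "0 \<le> s" and r: "0 \<le> r" and A: "A \<in> sets (path_filt T s)"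
  shows "s + real k * r \<le> T \<Longrightarrow> good_grid A e s r k \<in> sets (path_filt T (s + real k * r))"
proof (induction k)
  case 0
  then show ?case using A by simp
next
  case (Suc k)
  let ?a = "s + real k * r" and ?b = "s + real (Suc k) * r"
  have ab: "0 \<le> ?a" "?a \<le> ?b" using s r by (simp_all add: distrib_right)
  have G: "good_grid A e s r k \<in> sets (path_filt T ?b)"
    using Suc.IH ab Suc.prems path_filt_mono[OF ab(2), of T] by auto
  have [measurable]: "(\<lambda>\<omega>::real \<Rightarrow> real^'n. \<omega> ?a) \<in> borel_measurable (path_filt T ?b)" "(\<lambda>\<omega>::real \<Rightarrow> real^'n. \<omega> ?b) \<in> borel_measurable (path_filt T ?b)"
    using ab Suc.prems by (auto intro!: measurable_path_filt_coordinate simp del: of_nat_Suc)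
  have "{\<omega> :: real \<Rightarrow> real^'n. \<omega> \<in> space (path_filt T ?b) \<and> good_step e (\<omega> ?a) (\<omega> ?b)} \<in> sets (path_filt T ?b)"
    unfolding good_step_def by measurable
  moreover have "good_grid A e s r (Suc k) = good_grid A e s r k \<inter> {\<omega> \<in> space (path_filt T ?b). good_step e (\<omega> ?a) (\<omega> ?b)}"
    using sets.sets_into_space[OF G] by (auto simp: good_grid_Suc simp del: of_nat_Suc)
  ultimately show ?case
    using G by (simp only: sets.Int)
qed

text \<open>Induction on the number of steps: the one-step estimate peels off the last step and puts
  the kernel of time r on u; the induction hypothesis adds the kernel of time k r, and the semigroup
  law merges the two.\<close>

lemma killed_upper_grid:
  assumes s: "0 \<le> s" and r: "0 < r" and A: "A \<in> sets (path_filt T s)"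
    and c: "0 \<le> c" "\<And>a b::real^'n. good_step e a b \<Longrightarrow> trans_density \<gamma> r a b \<le> c * killed_density \<gamma> r a b"
  shows "s + real k * r \<le> T \<Longrightarrow> u \<in> borel_measurable borel \<Longrightarrow>
    (\<integral>\<^sup>+\<omega>. indicator (good_grid A e s r k) \<omega> * u (\<omega> (s + real k * r)) \<partial>P) \<le>
      ennreal (c ^ k) * (\<integral>\<^sup>+\<omega>. indicator A \<omega> * killed_op \<gamma> (real k * r) u (\<omega> s) \<partial>P)"
proof (induction k arbitrary: u)
  case 0
  then show ?case by (simp add: killed_op_def)
next
  case (Suc k)
  note [measurable] = Suc.prems(2)
  let ?a = "s + real k * r" and ?b = "s + real (Suc k) * r"
  have ab: "0 \<le> ?a" "?a < ?b" "?b - ?a = r" using s r by (simp_all add: distrib_right)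
  have aT: "?a \<le> T" using ab Suc.prems by linarith
  have "(\<integral>\<^sup>+\<omega>. indicator (good_grid A e s r (Suc k)) \<omega> * u (\<omega> ?b) \<partial>P) =
     (\<integral>\<^sup>+\<omega>. indicator (good_grid A e s r k) \<omega> * (if good_step e (\<omega> ?a) (\<omega> ?b) then u (\<omega> ?b) else 0) \<partial>P)"
    by (intro nn_integral_cong) (auto simp: good_grid_Suc indicator_def simp del: of_nat_Suc)
  also have "\<dots> \<le> ennreal c * (\<integral>\<^sup>+\<omega>. indicator (good_grid A e s r k) \<omega> * killed_op \<gamma> (?b - ?a) u (\<omega> ?a) \<partial>P)"
    using ab Suc.prems c r by (intro killed_upper_step good_grid_measurable s A aT) (auto simp: less_imp_le)
  also have "\<dots> \<le> ennreal c * (ennreal (c ^ k) * (\<integral>\<^sup>+\<omega>. indicator A \<omega> * killed_op \<gamma> (real k * r) (killed_op \<gamma> r u) (\<omega> s) \<partial>P))"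
    unfolding ab(3) by (intro mult_left_mono Suc.IH aT) simp_all
  also have "\<dots> = ennreal (c ^ Suc k) * (\<integral>\<^sup>+\<omega>. indicator A \<omega> * killed_op \<gamma> (real k * r) (killed_op \<gamma> r u) (\<omega> s) \<partial>P)"
    using c by (simp add: ennreal_mult mult.assoc)
  also have "(\<lambda>\<omega>. killed_op \<gamma> (real k * r) (killed_op \<gamma> r u) (\<omega> s)) = (\<lambda>\<omega>. killed_op \<gamma> (real (Suc k) * r) u (\<omega> s))"
    using r by (subst killed_op_semigroup[OF \<gamma>]) (auto simp: distrib_right add.commute)
  finally show ?case .
qed

text \<open>A path that is alive at t keeps some distance 1 / (m + 1) from 0 and, on a fine enough
  grid, makes good steps only. Fatou's lemma, in the mesh n for fixed m and then in m, carries the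
  grid estimate over to all surviving paths.\<close>

theorem killed_upper_bound:
  assumes st: "0 \<le> s" "s < t" "t \<le> T" and A: "A \<in> sets (path_filt T s)" and u [measurable]: "u \<in> borel_measurable borel"
  shows "(\<integral>\<^sup>+\<omega>. indicator (A \<inter> alive T t) \<omega> * u (\<omega> t) \<partial>P) \<le>
    (\<integral>\<^sup>+\<omega>. indicator (A \<inter> alive T s) \<omega> * killed_op \<gamma> (t - s) u (\<omega> s) \<partial>P)" (is "_ \<le> ?R")
\<comment> \<open>Finiteness is needed to take the limit in the product of \<open>?R\<close> with a
  factor tending to 1.\<close>
proof (cases "?R = \<top>")
  case False
  define A' where "A' = A \<inter> alive T s"
  have A': "A' \<in> sets (path_filt T s)"
    unfolding A'_def using A st alive_measurable[of s T] by auto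
  define e where "e = (\<lambda>m. 1 / real (Suc m))"
  define r where "r = (\<lambda>n. (t - s) / real (Suc n))"
  have r: "0 < r n" "real (Suc n) * r n = t - s" for n
    using st by (auto simp: r_def)
  have st_r: "s + real (Suc n) * r n = t" for n unfolding r by simp
  let ?G = "\<lambda>m n. good_grid A' (e m) s (r n) (Suc n)"
  let ?f = "\<lambda>m n \<omega>. indicator (?G m n) \<omega> * u (\<omega> t)"
  have ut [measurable]: "(\<lambda>\<omega>. u (\<omega> t)) \<in> borel_measurable P"
    using st by (intro measurable_compose[OF coord u]) auto
  have G [measurable]: "?G m n \<in> sets P" for m n
    using good_grid_measurable[OF st(1) less_imp_le[OF r(1)] A', of "Suc n" n "e m"] st st_r[of n]
    by (intro sets_filt_P[of _ t]) auto
  have bound: "liminf (\<lambda>n. \<integral>\<^sup>+\<omega>. ?f m n \<omega> \<partial>P) \<le> ?R" for m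
  proof -
    have "0 < e m" by (simp add: e_def)
    then obtain C t0 where C: "0 \<le> C" "0 < t0"
      "\<And>t (x::real^'n) y. 0 < t \<Longrightarrow> t \<le> t0 \<Longrightarrow> good_step (e m) x y \<Longrightarrow>
       trans_density \<gamma> t x y \<le> (1 + C * t\<^sup>2) * killed_density \<gamma> t x y"
      using trans_density_short_time[OF \<gamma> dim] by metis
    have r0: "r \<longlonglongrightarrow> 0"
      unfolding r_def by (rule LIMSEQ_Suc[OF lim_const_over_n])
    let ?e = "\<lambda>n. exp (C * (t - s) * r n)"
    have "\<forall>\<^sub>F n in sequentially. r n < t0"
      using r0 C(2) by (rule order_tendstoD)
    then have "\<forall>\<^sub>F n in sequentially. (\<integral>\<^sup>+\<omega>. ?f m n \<omega> \<partial>P) \<le> ennreal (?e n) * ?R"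
    proof eventually_elim
      case (elim n)
      have "(\<integral>\<^sup>+\<omega>. ?f m n \<omega> \<partial>P) \<le> ennreal ((1 + C * (r n)\<^sup>2) ^ Suc n) * ?R"
        using killed_upper_grid[OF st(1) r(1) A', of "1 + C * (r n)\<^sup>2" "e m" n "Suc n" u] C(1,3) r(1)[of n] elim st st_r[of n] r(2)[of n]
        by (auto simp: A'_def simp del: of_nat_Suc power_Suc)
      also have "\<dots> \<le> ennreal (?e n) * ?R"
      proof (intro mult_right_mono ennreal_leI)
        have "(1 + C * (r n)\<^sup>2) ^ Suc n \<le> exp (C * (r n)\<^sup>2) ^ Suc n"
          using C by (intro power_mono exp_ge_add_one_self) auto
        also have "\<dots> = exp (real (Suc n) * (C * (r n)\<^sup>2))"
          by (rule exp_of_nat_mult[symmetric])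
        also have "real (Suc n) * (C * (r n)\<^sup>2) = C * (real (Suc n) * r n) * r n"
          by (simp add: power2_eq_square)
        finally show "(1 + C * (r n)\<^sup>2) ^ Suc n \<le> ?e n"
          by (simp only: r(2))
      qed simp
      finally show ?case .
    qed
    then have "liminf (\<lambda>n. \<integral>\<^sup>+\<omega>. ?f m n \<omega> \<partial>P) \<le> liminf (\<lambda>n. ennreal (?e n) * ?R)"
      by (rule Liminf_mono)
    also have "\<dots> = ?R"
    proof (rule lim_imp_Liminf)
      have "?e \<longlonglongrightarrow> exp (C * (t - s) * 0)"
        by (intro tendsto_intros r0)
      then have "(\<lambda>n. ennreal (?e n)) \<longlonglongrightarrow> ennreal 1"
        by (intro tendsto_ennrealI) simp
      then have "(\<lambda>n. ennreal (?e n) * ?R) \<longlonglongrightarrow> ennreal 1 * ?R"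
        using False by (intro tendsto_mult_ennreal tendsto_const) auto
      then show "(\<lambda>n. ennreal (?e n) * ?R) \<longlonglongrightarrow> ?R" by simp
    qed simp
    finally show ?thesis .
  qed
  \<comment> \<open>Compactness of [0, t] gives the distance m0 from 0, and uniform continuity gives
    steps shorter than half of \<open>e m\<close> once the mesh is fine.\<close>
  have pw: "indicator (A \<inter> alive T t) \<omega> * u (\<omega> t) \<le> liminf (\<lambda>m. liminf (\<lambda>n. ?f m n \<omega>))" for \<omega>
  proof (cases "\<omega> \<in> A \<inter> alive T t")
    case True
    have \<omega>A: "\<omega> \<in> A'" using True alive_antimono[of s t T] st by (auto simp: A'_def)
    have \<omega>: "\<omega> \<in> space (path_borel T)" "\<forall>v\<in>{0..t}. \<omega> v \<noteq> 0" using True by (auto simp: alive_def)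
    have cont: "continuous_on {0..t} \<omega>" using path_continuous[OF \<omega>(1)] st by simp
    obtain m0 where m0: "\<forall>v\<in>{0..t}. e m0 \<le> norm (\<omega> v)"
      using path_bounded_away[OF _ cont \<omega>(2)] st by (auto simp: e_def simp del: of_nat_Suc)
    have "indicator (A \<inter> alive T t) \<omega> * u (\<omega> t) \<le> liminf (\<lambda>n. ?f m n \<omega>)" if m: "m0 \<le> m" for m
    proof (rule Liminf_bounded)
      have em: "e m \<le> e m0" using m by (auto simp: e_def frac_le)
      have "uniformly_continuous_on {0..t} \<omega>"
        using cont by (intro compact_uniformly_continuous) auto
      moreover have "0 < e m / 2" by (simp add: e_def)
      ultimately obtain d where d: "0 < d" "\<And>a b. a \<in> {0..t} \<Longrightarrow> b \<in> {0..t} \<Longrightarrow> dist a b < d \<Longrightarrow> dist (\<omega> a) (\<omega> b) < e m / 2"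
        unfolding uniformly_continuous_on_def by metis
      have "r \<longlonglongrightarrow> 0"
        unfolding r_def by (rule LIMSEQ_Suc[OF lim_const_over_n])
      then have "\<forall>\<^sub>F n in sequentially. r n < d"
        using d(1) by (rule order_tendstoD)
      then show "\<forall>\<^sub>F n in sequentially. indicator (A \<inter> alive T t) \<omega> * u (\<omega> t) \<le> ?f m n \<omega>"
      proof eventually_elim
        case (elim n)
        have "\<omega> \<in> ?G m n"
          unfolding good_grid_def
        proof (intro CollectI conjI \<omega>A allI impI)
          fix i assume i: "i < Suc n"
          let ?a = "s + real i * r n" and ?b = "s + real (Suc i) * r n"
          have "real (Suc i) * r n \<le> real (Suc n) * r n"
            using i r(1)[of n] by (intro mult_right_mono) auto
          then have "?b \<le> t" using st_r[of n] by linarith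
          moreover have "0 \<le> real i * r n" using r(1)[of n] by simp
          moreover have "?b = ?a + r n" by (simp add: distrib_right)
          ultimately have ab: "?a \<in> {0..t}" "?b \<in> {0..t}" "dist ?a ?b < d"
            using st r(1)[of n] elim by (auto simp: dist_real_def simp del: of_nat_Suc)
          have "norm (\<omega> ?a - \<omega> ?b) \<le> e m / 2"
            using d(2)[OF ab] by (simp add: dist_norm)
          then show "good_step (e m) (\<omega> ?a) (\<omega> ?b)"
            unfolding good_step_def using m0 ab em by (meson order_trans)
        qed
        then show ?case using True by simp
      qed
    qed
    then show ?thesis
      by (rule Liminf_bounded[OF eventually_sequentiallyI[of m0]])
  qed simp
  have "(\<integral>\<^sup>+\<omega>. indicator (A \<inter> alive T t) \<omega> * u (\<omega> t) \<partial>P) \<le> (\<integral>\<^sup>+\<omega>. liminf (\<lambda>m. liminf (\<lambda>n. ?f m n \<omega>)) \<partial>P)"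
    by (intro nn_integral_mono pw)
  also have "\<dots> \<le> liminf (\<lambda>m. \<integral>\<^sup>+\<omega>. liminf (\<lambda>n. ?f m n \<omega>) \<partial>P)"
    by (rule nn_integral_liminf) measurable
  also have "\<dots> \<le> liminf (\<lambda>m. liminf (\<lambda>n. \<integral>\<^sup>+\<omega>. ?f m n \<omega> \<partial>P))"
    by (intro Liminf_mono always_eventually allI nn_integral_liminf) measurable
  also have "\<dots> \<le> liminf (\<lambda>m. ?R)"
    by (intro Liminf_mono always_eventually allI bound)
  also have "\<dots> = ?R" by (simp add: Liminf_const)
  finally show ?thesis .
qed simp

text \<open>By the semigroup law, since S is the mass of the killed kernel over the remaining time.
  That identification is made off 0, which is enough inside the integral.\<close>

lemma killed_op_surv:
  assumes st: "0 \<le> s" "s \<le> t" "t \<le> T" and y: "y \<noteq> (0::real^'n)"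
  shows "killed_op \<gamma> (t - s) (\<lambda>y. ennreal (surv \<gamma> (T - t) y)) y = ennreal (surv \<gamma> (T - s) y)"
proof (cases "s = t")
  case False
  have "AE y in lborel. ennreal (surv \<gamma> (T - t) y) = killed_op \<gamma> (T - t) (\<lambda>_. 1) (y::real^'n)"
    using AE_lborel_nonzero
  proof eventually_elim
    case (elim y)
    show ?case using st by (simp add: killed_op_one[OF \<gamma> dim _ elim])
  qed
  then have "killed_op \<gamma> (t - s) (\<lambda>y. ennreal (surv \<gamma> (T - t) y)) y = killed_op \<gamma> (t - s) (killed_op \<gamma> (T - t) (\<lambda>_. 1)) y"
    using st False by (intro killed_op_cong_AE) auto
  also have "\<dots> = killed_op \<gamma> (T - s) (\<lambda>_. 1) y"
  proof (cases "t = T")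
    case True
    have "killed_op \<gamma> 0 (\<lambda>_. 1) = (\<lambda>_::real^'n. 1)" by (rule ext) (simp add: killed_op_def)
    then show ?thesis using True by simp
  next
    case False
    then show ?thesis using st by (subst killed_op_semigroup[OF \<gamma>]) auto
  qed
  also have "\<dots> = ennreal (surv \<gamma> (T - s) y)"
    using st by (intro killed_op_one \<gamma> dim y) auto
  finally show ?thesis .
qed (simp add: killed_op_def)

lemma measurable_surv_coord:
  "t \<in> {0..T} \<Longrightarrow> (\<lambda>\<omega>. surv \<gamma> c (\<omega> t)) \<in> borel_measurable P"
  by (rule measurable_surv[OF \<gamma> dim measurable_const coord]) auto

lemma measurable_surv_fixed [measurable]: "(\<lambda>y::real^'n. ennreal (surv \<gamma> c y)) \<in> borel_measurable borel"
proof -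
  have [measurable]: "(\<lambda>y::real^'n. surv \<gamma> c y) \<in> borel_measurable borel"
    by (rule measurable_surv[OF \<gamma> dim]) measurable
  show ?thesis by measurable
qed

text \<open>Harmonicity for the smaller kernel k becomes an inequality under the law with density q
  >= k.\<close>

lemma surv_submartingale:
  assumes st: "0 \<le> s" "s \<le> t" "t \<le> T" and A: "A \<in> sets (path_filt T s)"
  shows "(\<integral>\<^sup>+\<omega>. indicator A \<omega> * ennreal (surv \<gamma> (T - s) (\<omega> s)) \<partial>P) \<le>
     (\<integral>\<^sup>+\<omega>. indicator A \<omega> * ennreal (surv \<gamma> (T - t) (\<omega> t)) \<partial>P)"
proof -
  have "(\<integral>\<^sup>+\<omega>. indicator A \<omega> * ennreal (surv \<gamma> (T - s) (\<omega> s)) \<partial>P) =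
     (\<integral>\<^sup>+\<omega>. indicator A \<omega> * killed_op \<gamma> (t - s) (\<lambda>y. ennreal (surv \<gamma> (T - t) y)) (\<omega> s) \<partial>P)"
  proof (rule nn_integral_cong_AE)
    show "AE \<omega> in P. indicator A \<omega> * ennreal (surv \<gamma> (T - s) (\<omega> s)) =
        indicator A \<omega> * killed_op \<gamma> (t - s) (\<lambda>y. ennreal (surv \<gamma> (T - t) y)) (\<omega> s)"
      using AE_nonzero[of s] st by (auto elim!: eventually_mono simp: killed_op_surv)
  qed
  also have "\<dots> \<le> (\<integral>\<^sup>+\<omega>. indicator A \<omega> * ennreal (surv \<gamma> (T - t) (\<omega> t)) \<partial>P)"
    by (rule killed_le_markov[OF st A]) measurable
  finally show ?thesis .
qed

end

section \<open>Survival probabilities\<close>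

context point_interaction
begin

text \<open>The submartingale is stopped at the first grid time in the ball of radius \<epsilon>.
  There its value is at most \<eta>, and on the other paths it ends at most at 1. Ending at T' < T
  keeps the remaining time at least T - T', so that S is uniformly small near 0.\<close>

lemma surv_le_grid_survival:
  assumes T': "0 < T'" "T' < T" and \<eta>: "0 < \<eta>"
    and \<epsilon>: "\<And>t (y::real^'n). T - T' \<le> t \<Longrightarrow> norm y \<le> \<epsilon> \<Longrightarrow> surv \<gamma> t y \<le> \<eta>"
    and n: "0 < n"
  shows "surv \<gamma> T x \<le> prob {\<omega> \<in> space P. \<forall>j\<le>n. \<epsilon> < norm (\<omega> (real j * (T' / real n)))} + \<eta>"
proof -
  define g where "g = (\<lambda>j. real j * (T' / real n))"
  have g_mono: "g i \<le> g j" if "i \<le> j" for i j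
    unfolding g_def using that T' by (intro mult_right_mono) auto
  have g0: "g 0 = 0" by (simp add: g_def)
  have gn: "g n = T'" using n by (simp add: g_def)
  have gT: "0 \<le> g j" "g j \<le> T'" "g j \<le> T" if "j \<le> n" for j
    using g_mono[of 0 j] g_mono[OF that] g0 gn T' by auto
  define A where "A = (\<lambda>i. {\<omega> \<in> space P. \<forall>j\<le>i. \<epsilon> < norm (\<omega> (g j))})"
  have Am: "A i \<in> sets (path_filt T (g i))" if "i \<le> n" for i
  proof -
    have "Measurable.pred (path_filt T (g i)) (\<lambda>\<omega>::real \<Rightarrow> real^'n. \<forall>j\<in>{..i}. \<epsilon> < norm (\<omega> (g j)))"
    proof (rule pred_Ball_countable)
      fix j assume j: "j \<in> {..i}"
      then have [measurable]: "(\<lambda>\<omega>::real \<Rightarrow> real^'n. \<omega> (g j)) \<in> borel_measurable (path_filt T (g i))"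
      proof (intro measurable_path_filt_coordinate)
        have "j \<le> n" "j \<le> i" using j that by auto
        then show "g j \<in> {0..T}" "g j \<le> g i"
          using gT[of j] g_mono[of j i] by simp_all
      qed
      show "Measurable.pred (path_filt T (g i)) (\<lambda>\<omega>::real \<Rightarrow> real^'n. \<epsilon> < norm (\<omega> (g j)))"
        by measurable
    qed simp
    then show ?thesis unfolding A_def pred_def by (simp only: space_path_filt space_P Ball_def atMost_iff)
  qed
  have AP: "A i \<in> sets P" if "i \<le> n" for i
    using Am[OF that] by (rule sets_filt_P)
  have ASuc: "A (Suc i) = {\<omega> \<in> A i. \<epsilon> < norm (\<omega> (g (Suc i)))}" for i
    by (auto simp: A_def le_Suc_eq)
  let ?Z = "\<lambda>t \<omega>. ennreal (surv \<gamma> (T - t) (\<omega> t :: real^'n))"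
  have small: "?Z (g i) \<omega> \<le> ennreal \<eta>" if "i \<le> n" "\<not> \<epsilon> < norm (\<omega> (g i))" for i \<omega>
    using that gT[of i] by (intro ennreal_leI \<epsilon>) auto
  have Zm [measurable]: "?Z (g i) \<in> borel_measurable P" if "i \<le> n" for i
    using gT[OF that] by (intro measurable_compose[OF measurable_surv_coord measurable_ennreal]) auto
  \<comment> \<open>The invariant: the paths still outside the ball carry the submartingale, and
    each path that has entered it is charged \<eta>.\<close>
  have step: "i \<le> n \<Longrightarrow> ennreal (surv \<gamma> T x) \<le>
      (\<integral>\<^sup>+\<omega>. indicator (A i) \<omega> * ?Z (g i) \<omega> \<partial>P) + ennreal \<eta> * emeasure P (space P - A i)" for i
  proof (induction i)
    case 0
    have [measurable]: "A 0 \<in> sets P" using AP by simp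
    note [measurable] = Zm[OF 0]
    have "ennreal (surv \<gamma> T x) = (\<integral>\<^sup>+\<omega>. ennreal (surv \<gamma> T x) \<partial>P)"
      by (simp add: emeasure_space_1)
    also have "\<dots> = (\<integral>\<^sup>+\<omega>. ?Z (g 0) \<omega> \<partial>P)"
      using AE_start by (intro nn_integral_cong_AE) (auto elim!: eventually_mono simp: g0)
    also have "\<dots> \<le> (\<integral>\<^sup>+\<omega>. indicator (A 0) \<omega> * ?Z (g 0) \<omega> + ennreal \<eta> * indicator (space P - A 0) \<omega> \<partial>P)"
      by (intro nn_integral_mono) (auto simp: indicator_def A_def intro!: small)
    also have "\<dots> = (\<integral>\<^sup>+\<omega>. indicator (A 0) \<omega> * ?Z (g 0) \<omega> \<partial>P) + ennreal \<eta> * emeasure P (space P - A 0)"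
      by (subst nn_integral_add) (auto simp: nn_integral_cmult_indicator)
    finally show ?case .
  next
    case (Suc i)
    then have i: "i \<le> n" by simp
    have [measurable]: "A i \<in> sets P" "A (Suc i) \<in> sets P" using AP Suc.prems i by auto
    note [measurable] = Zm[OF i] Zm[OF Suc.prems]
    have "(\<integral>\<^sup>+\<omega>. indicator (A i) \<omega> * ?Z (g i) \<omega> \<partial>P) \<le> (\<integral>\<^sup>+\<omega>. indicator (A i) \<omega> * ?Z (g (Suc i)) \<omega> \<partial>P)"
      using gT[of i] gT[of "Suc i"] Suc.prems i by (intro surv_submartingale g_mono Am) auto
    also have "\<dots> \<le> (\<integral>\<^sup>+\<omega>. indicator (A (Suc i)) \<omega> * ?Z (g (Suc i)) \<omega> + ennreal \<eta> * indicator (A i - A (Suc i)) \<omega> \<partial>P)"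
      by (intro nn_integral_mono) (auto simp: indicator_def ASuc intro!: small[OF Suc.prems])
    also have "\<dots> = (\<integral>\<^sup>+\<omega>. indicator (A (Suc i)) \<omega> * ?Z (g (Suc i)) \<omega> \<partial>P) + ennreal \<eta> * emeasure P (A i - A (Suc i))"
      by (subst nn_integral_add) (auto simp: nn_integral_cmult_indicator)
    finally have "ennreal (surv \<gamma> T x) \<le> (\<integral>\<^sup>+\<omega>. indicator (A (Suc i)) \<omega> * ?Z (g (Suc i)) \<omega> \<partial>P) + ennreal \<eta> * emeasure P (A i - A (Suc i))
       + ennreal \<eta> * emeasure P (space P - A i)"
      using Suc.IH[OF i] by (meson add_right_mono order_trans)
    also have "\<dots> = (\<integral>\<^sup>+\<omega>. indicator (A (Suc i)) \<omega> * ?Z (g (Suc i)) \<omega> \<partial>P) + ennreal \<eta> * (emeasure P (A i - A (Suc i)) + emeasure P (space P - A i))"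
      by (simp add: distrib_left add.assoc)
    also have "emeasure P (A i - A (Suc i)) + emeasure P (space P - A i) = emeasure P ((A i - A (Suc i)) \<union> (space P - A i))"
      by (rule plus_emeasure) auto
    also have "(A i - A (Suc i)) \<union> (space P - A i) = space P - A (Suc i)"
      by (auto simp: A_def)
    finally show ?case .
  qed
  have [measurable]: "A n \<in> sets P" using AP by simp
  note step[of n]
  also have "(\<integral>\<^sup>+\<omega>. indicator (A n) \<omega> * ?Z (g n) \<omega> \<partial>P) \<le> (\<integral>\<^sup>+\<omega>. indicator (A n) \<omega> \<partial>P)"
  proof (rule nn_integral_mono_AE)
    show "AE \<omega> in P. indicator (A n) \<omega> * ?Z (g n) \<omega> \<le> indicator (A n) \<omega>"
      using AE_surv_le_1[of "g n"] gT[of n] by (auto elim!: eventually_mono simp: indicator_def)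
  qed
  also have "ennreal \<eta> * emeasure P (space P - A n) \<le> ennreal \<eta> * 1"
    by (intro mult_left_mono emeasure_le_1) simp
  finally have "ennreal (surv \<gamma> T x) \<le> emeasure P (A n) + ennreal \<eta>"
    by (simp add: add_mono)
  also have "\<dots> = ennreal (prob (A n) + \<eta>)"
    using \<eta> by (simp add: emeasure_eq_measure)
  finally have "surv \<gamma> T x \<le> prob (A n) + \<eta>"
    using \<eta> by (subst (asm) ennreal_le_iff) auto
  then show ?thesis
    by (simp only: A_def g_def)
qed

lemma alive_P: "0 \<le> s \<Longrightarrow> s \<le> T \<Longrightarrow> alive T s \<in> sets P"
  using alive_measurable sets_filt_P by blast

lemma alive_T_P [measurable, simp]: "alive T T \<in> sets P"
  by (rule alive_P[OF less_imp_le[OF T] order_refl])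

text \<open>By continuity, a path with a zero in [0, T'] is inside the ball at some grid time once
  the mesh is fine. Fatou's lemma for the complements therefore transfers the grid bound to
  continuous time, and \<eta> is arbitrary.\<close>

lemma surv_le_prob_alive_before:
  assumes T': "0 < T'" "T' < T"
  shows "surv \<gamma> T x \<le> prob (alive T T')"
proof (rule field_le_epsilon)
  fix \<eta> :: real assume \<eta>: "0 < \<eta>"
  obtain \<epsilon> where \<epsilon>: "0 < \<epsilon>" "\<And>t (y::real^'n). T - T' \<le> t \<Longrightarrow> norm y \<le> \<epsilon> \<Longrightarrow> surv \<gamma> t y \<le> \<eta>"
    using surv_small_near_0[OF \<gamma> dim, of "T - T'" \<eta>] T' \<eta> by auto
  let ?g = "\<lambda>n j. real j * (T' / real (Suc n))"
  define G where "G = (\<lambda>n. {\<omega> \<in> space P. \<forall>j\<le>Suc n. \<epsilon> < norm (\<omega> (?g n j))})"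
  have gT: "?g n j \<in> {0..T'}" if "j \<le> Suc n" for n j
  proof -
    have "?g n j \<le> real (Suc n) * (T' / real (Suc n))"
      using that T' by (intro mult_right_mono) auto
    then show ?thesis using T' by simp
  qed
  have Gm [measurable]: "G n \<in> sets P" for n
  proof -
    have "Measurable.pred P (\<lambda>\<omega>. \<forall>j\<in>{..Suc n}. \<epsilon> < norm (\<omega> (?g n j)))"
    proof (rule pred_Ball_countable)
      fix j assume "j \<in> {..Suc n}"
      then have [measurable]: "(\<lambda>\<omega>. \<omega> (?g n j)) \<in> borel_measurable P"
        using gT[of j n] T' by (intro coord) auto
      show "Measurable.pred P (\<lambda>\<omega>. \<epsilon> < norm (\<omega> (?g n j)))"
        by measurable
    qed (rule countable_finite[OF finite_atMost])
    then show ?thesis unfolding G_def pred_def by (simp only: Ball_def atMost_iff)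
  qed
  have G: "prob (space P - G n) \<le> 1 - surv \<gamma> T x + \<eta>" for n
  proof -
    have "surv \<gamma> T x \<le> prob {\<omega> \<in> space P. \<forall>j\<le>Suc n. \<epsilon> < norm (\<omega> (?g n j))} + \<eta>"
      by (rule surv_le_grid_survival[OF T' \<eta>]) (rule \<epsilon>(2), assumption+, simp)
    then show ?thesis
      using prob_compl[OF Gm, of n] unfolding G_def by linarith
  qed
  have [measurable]: "alive T T' \<in> sets P"
    using T' by (intro alive_P) auto
  have "ennreal (prob (space P - alive T T')) = emeasure P (space P - alive T T')"
    by (simp add: emeasure_eq_measure)
  also have "\<dots> = (\<integral>\<^sup>+\<omega>. indicator (space P - alive T T') \<omega> \<partial>P)"
    by (rule nn_integral_indicator[symmetric]) measurable
  also have "\<dots> \<le> (\<integral>\<^sup>+\<omega>. liminf (\<lambda>n. indicator (space P - G n) \<omega>) \<partial>P)"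
  proof (rule nn_integral_mono)
    fix \<omega> assume \<omega>: "\<omega> \<in> space P"
    show "indicator (space P - alive T T') \<omega> \<le> liminf (\<lambda>n. indicator (space P - G n) \<omega> :: ennreal)"
    proof (cases "\<omega> \<in> alive T T'")
      case False
      then obtain v where v: "v \<in> {0..T'}" "\<omega> v = 0" using \<omega> by (auto simp: alive_def space_P)
      have cont: "continuous_on {0..T'} \<omega>" using \<omega> T' by (intro path_continuous[of _ T]) (auto simp: space_P)
      then obtain d where d: "0 < d" "\<And>a. a \<in> {0..T'} \<Longrightarrow> dist a v < d \<Longrightarrow> dist (\<omega> a) (\<omega> v) < \<epsilon>"
        using v(1) \<epsilon>(1) unfolding continuous_on_iff by metis
      have "(\<lambda>n. T' / real (Suc n)) \<longlonglongrightarrow> 0" by (rule LIMSEQ_Suc[OF lim_const_over_n])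
      then have "\<forall>\<^sub>F n in sequentially. T' / real (Suc n) < d"
        using d(1) by (rule order_tendstoD)
      then have "\<forall>\<^sub>F n in sequentially. indicator (space P - alive T T') \<omega> \<le> (indicator (space P - G n) \<omega> :: ennreal)"
      proof eventually_elim
        case (elim n)
        define h where "h = T' / real (Suc n)"
        have h: "0 < h" using T' by (simp add: h_def)
        define j where "j = nat \<lfloor>v / h\<rfloor>"
        have j: "real j = real_of_int \<lfloor>v / h\<rfloor>"
          using v h unfolding j_def by (subst of_nat_nat) auto
        have jv: "real j \<le> v / h" "v / h < real j + 1" unfolding j by linarith+
        have "v / h \<le> real (Suc n)"
          using v T' h by (simp add: h_def field_simps del: of_nat_Suc)
        then have jn: "j \<le> Suc n" using jv by linarith
        have "real j * h \<le> v" "v < real j * h + h"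
          using jv h by (simp_all add: field_simps)
        then have "dist (real j * h) v < d"
          using elim by (simp add: dist_real_def h_def del: of_nat_Suc)
        then have "dist (\<omega> (real j * h)) (\<omega> v) < \<epsilon>"
          using d(2) gT[OF jn] by (simp add: h_def del: of_nat_Suc)
        then have "\<omega> \<notin> G n"
          using jn v(2) by (force simp: G_def h_def simp del: of_nat_Suc)
        then show ?case using \<omega> by (simp add: indicator_def)
      qed
      then show ?thesis by (rule Liminf_bounded)
    qed simp
  qed
  also have "\<dots> \<le> liminf (\<lambda>n. \<integral>\<^sup>+\<omega>. indicator (space P - G n) \<omega> \<partial>P)"
    by (rule nn_integral_liminf) measurable
  also have "\<dots> \<le> liminf (\<lambda>n. ennreal (1 - surv \<gamma> T x + \<eta>))"
    by (intro Liminf_mono always_eventually allI) (simp add: emeasure_eq_measure ennreal_leI G)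
  also have "\<dots> = ennreal (1 - surv \<gamma> T x + \<eta>)"
    by (simp add: Liminf_const)
  finally have "ennreal (prob (space P - alive T T')) \<le> ennreal (1 - surv \<gamma> T x + \<eta>)" .
  moreover have "0 \<le> 1 - surv \<gamma> T x + \<eta>"
    using G[of 0] measure_nonneg order_trans by blast
  ultimately have "prob (space P - alive T T') \<le> 1 - surv \<gamma> T x + \<eta>"
    by simp
  moreover have "prob (space P - alive T T') = 1 - prob (alive T T')"
    by (rule prob_compl) measurable
  ultimately show "surv \<gamma> T x \<le> prob (alive T T') + \<eta>" by simp
qed

text \<open>T' increases to T. The limit event differs from survival up to T only by paths that
  vanish at T itself, which have probability 0.\<close>

lemma surv_le_prob_alive: "surv \<gamma> T x \<le> prob (alive T T)"
proof -
  \<comment> \<open>The denominator starts at 2, which makes the first time positive.\<close>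
  define t where "t = (\<lambda>n. T * (1 - 1 / real (Suc (Suc n))))"
  have t: "0 < t n" "t n < T" for n
    using T by (auto simp: t_def)
  have t_lim: "t \<longlonglongrightarrow> T"
  proof -
    have "t \<longlonglongrightarrow> T * (1 - 0)"
      unfolding t_def by (intro tendsto_intros LIMSEQ_Suc lim_1_over_n)
    then show ?thesis by simp
  qed
  have t_mono: "t m \<le> t n" if "m \<le> n" for m n
    unfolding t_def using that T by (intro mult_left_mono diff_left_mono frac_le) auto
  have am: "alive T (t n) \<in> sets P" for n using t[of n] by (intro alive_P) auto
  have "(\<lambda>n. prob (alive T (t n))) \<longlonglongrightarrow> prob (\<Inter>n. alive T (t n))"
    using am t_mono by (intro finite_Lim_measure_decseq) (auto simp: decseq_def intro: subsetD[OF alive_antimono])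
  then have "surv \<gamma> T x \<le> prob (\<Inter>n. alive T (t n))"
    using t surv_le_prob_alive_before by (intro LIMSEQ_le_const) auto
  also have "prob (\<Inter>n. alive T (t n)) \<le> prob (alive T T)"
  proof (rule finite_measure_mono_AE)
    show "AE \<omega> in P. \<omega> \<in> (\<Inter>n. alive T (t n)) \<longrightarrow> \<omega> \<in> alive T T"
      using AE_nonzero[of T, OF less_imp_le[OF T] order_refl]
    proof eventually_elim
      case (elim \<omega>)
      show ?case
      proof
        assume \<omega>: "\<omega> \<in> (\<Inter>n. alive T (t n))"
        have "\<omega> u \<noteq> 0" if u: "u \<in> {0..T}" for u
        proof (cases "u = T")
          case False
          then have "\<forall>\<^sub>F n in sequentially. u < t n"
            using u t_lim by (intro order_tendstoD) auto
          then obtain n where "u < t n" by (auto simp: eventually_sequentially)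
          moreover have "\<omega> \<in> alive T (t n)" using \<omega> by auto
          ultimately show ?thesis using u by (auto simp: alive_def)
        qed (use elim in simp)
        then show "\<omega> \<in> alive T T"
          using \<omega> by (auto simp: alive_def)
      qed
    qed
    show "alive T T \<in> sets P" using T by simp
  qed
  finally show ?thesis .
qed

text \<open>The mass decreases in \<open>t\<close> by the upper bound; it starts at \<open>surv \<gamma> T x\<close> and ends at the probability
  of never hitting 0, which is at least \<open>surv \<gamma> T x\<close>. Hence it is constant.\<close>

lemma alive_mass:
  assumes t: "0 \<le> t" "t \<le> T"
  shows "(\<integral>\<^sup>+\<omega>. indicator (alive T t) \<omega> * ennreal (surv \<gamma> (T - t) (\<omega> t)) \<partial>P) = ennreal (surv \<gamma> T x)"
proof -
  define m where "m = (\<lambda>t. \<integral>\<^sup>+\<omega>. indicator (alive T t) \<omega> * ennreal (surv \<gamma> (T - t) (\<omega> t)) \<partial>P)"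
  have antimono: "m t \<le> m s" if st: "0 \<le> s" "s \<le> t" "t \<le> T" for s t
  proof (cases "s = t")
    case False
    then have st': "0 \<le> s" "s < t" "t \<le> T" using st by auto
    have "m t = (\<integral>\<^sup>+\<omega>. indicator (space P \<inter> alive T t) \<omega> * ennreal (surv \<gamma> (T - t) (\<omega> t)) \<partial>P)"
      unfolding m_def by (intro nn_integral_cong) (auto simp: indicator_def)
    also have "\<dots> \<le> (\<integral>\<^sup>+\<omega>. indicator (space P \<inter> alive T s) \<omega> * killed_op \<gamma> (t - s) (\<lambda>y. ennreal (surv \<gamma> (T - t) y)) (\<omega> s) \<partial>P)"
      by (rule killed_upper_bound[OF st' space_filt]) measurable
    also have "\<dots> = m s"
      unfolding m_def using st
      by (intro nn_integral_cong) (auto simp: indicator_def alive_def killed_op_surv)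
    finally show ?thesis .
  qed simp
  have "m 0 = (\<integral>\<^sup>+\<omega>. ennreal (surv \<gamma> T x) \<partial>P)"
    unfolding m_def
  proof (rule nn_integral_cong_AE)
    show "AE \<omega> in P. indicator (alive T 0) \<omega> * ennreal (surv \<gamma> (T - 0) (\<omega> 0)) = ennreal (surv \<gamma> T x)"
      using AE_start AE_space by eventually_elim (use x in \<open>auto simp: alive_def space_P indicator_def\<close>)
  qed
  then have m0: "m 0 = ennreal (surv \<gamma> T x)"
    by (simp add: emeasure_space_1)
  have "m T = (\<integral>\<^sup>+\<omega>. indicator (alive T T) \<omega> \<partial>P)"
    unfolding m_def using T by (intro nn_integral_cong) (auto simp: indicator_def alive_def surv_def)
  also have "\<dots> = ennreal (prob (alive T T))"
    using T by (simp add: emeasure_eq_measure)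
  finally have "ennreal (surv \<gamma> T x) \<le> m T"
    using surv_le_prob_alive by (simp add: ennreal_leI)
  moreover have "m T \<le> m t" "m t \<le> m 0"
    using t T by (auto intro!: antimono)
  ultimately show ?thesis
    using m0 by (simp add: m_def)
qed

text \<open>This is \<open>alive_mass\<close> at t = T, where S is 1 on surviving paths.\<close>

lemma prob_alive: "prob (alive T T) = surv \<gamma> T x"
proof -
  have "ennreal (surv \<gamma> T x) = (\<integral>\<^sup>+\<omega>. indicator (alive T T) \<omega> \<partial>P)"
    unfolding alive_mass[OF less_imp_le[OF T] order_refl, symmetric]
    using T by (intro nn_integral_cong) (auto simp: indicator_def alive_def surv_def)
  also have "\<dots> = ennreal (prob (alive T T))"
    using T by (simp add: emeasure_eq_measure)
  finally show ?thesis
    using surv_nonneg[OF \<gamma> dim, of T x] T by simp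
qed

lemma surv_T_pos: "0 < surv \<gamma> T x"
  using T by (intro surv_pos \<gamma> dim x) auto

text \<open>The upper bound holds for \<open>A\<close> and \<open>B\<close> and for their complements, and the total masses agree,
  so each of the inequalities is an equality.\<close>

lemma killed_markov_indicator:
  assumes st: "0 \<le> s" "s < t" "t \<le> T" and A: "A \<in> sets (path_filt T s)" and B [measurable]: "B \<in> sets borel"
  shows "(\<integral>\<^sup>+\<omega>. indicator (A \<inter> alive T t) \<omega> * (indicator B (\<omega> t) * ennreal (surv \<gamma> (T - t) (\<omega> t))) \<partial>P) =
    (\<integral>\<^sup>+\<omega>. indicator (A \<inter> alive T s) \<omega> * killed_op \<gamma> (t - s) (\<lambda>y. indicator B y * ennreal (surv \<gamma> (T - t) y)) (\<omega> s) \<partial>P)"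
proof -
  let ?S = "\<lambda>y::real^'n. ennreal (surv \<gamma> (T - t) y)"
  define l where "l = (\<lambda>A B. \<integral>\<^sup>+\<omega>. indicator (A \<inter> alive T t) \<omega> * (indicator B (\<omega> t) * ?S (\<omega> t)) \<partial>P)"
  define r where "r = (\<lambda>A B. \<integral>\<^sup>+\<omega>. indicator (A \<inter> alive T s) \<omega> * killed_op \<gamma> (t - s) (\<lambda>y. indicator B y * ?S y) (\<omega> s) \<partial>P)"
  have [measurable]: "(\<lambda>\<omega>. \<omega> t) \<in> borel_measurable P" "(\<lambda>\<omega>. \<omega> s) \<in> borel_measurable P" "alive T t \<in> sets P" "alive T s \<in> sets P"
    using st by (auto intro!: coord alive_P)
  have [measurable]: "A \<in> sets P" using A by (rule sets_filt_P)
  have [measurable]: "(\<lambda>\<omega>. ?S (\<omega> t)) \<in> borel_measurable P"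
    using st by (intro measurable_compose[OF measurable_surv_coord measurable_ennreal]) auto
  have Ac: "space P - A \<in> sets (path_filt T s)"
    using sets.compl_sets[OF A] by (simp add: space_P)
  have le: "l A B \<le> r A B" if A: "A \<in> sets (path_filt T s)" and B [measurable]: "B \<in> sets borel" for A B
    unfolding l_def r_def by (rule killed_upper_bound[OF st A]) measurable
  have opadd: "killed_op \<gamma> (t - s) (\<lambda>y. indicator B y * ?S y) z + killed_op \<gamma> (t - s) (\<lambda>y. indicator (- B) y * ?S y) z =
     killed_op \<gamma> (t - s) ?S z" for z
    unfolding killed_op_def using st
    by (simp, subst nn_integral_add[symmetric]) (auto intro!: nn_integral_cong simp: indicator_def)
  have lsum: "l A B + l A (- B) + l (space P - A) UNIV = ennreal (surv \<gamma> T x)"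
  proof -
    let ?f = "\<lambda>A B \<omega>. indicator (A \<inter> alive T t) \<omega> * (indicator B (\<omega> t) * ?S (\<omega> t))"
    have "(\<integral>\<^sup>+\<omega>. indicator (alive T t) \<omega> * ?S (\<omega> t) \<partial>P) = (\<integral>\<^sup>+\<omega>. ?f A B \<omega> + ?f A (- B) \<omega> + ?f (space P - A) UNIV \<omega> \<partial>P)"
    proof (rule nn_integral_cong)
      fix \<omega> assume "\<omega> \<in> space P"
      then show "indicator (alive T t) \<omega> * ?S (\<omega> t) = ?f A B \<omega> + ?f A (- B) \<omega> + ?f (space P - A) UNIV \<omega>"
        by (cases "\<omega> \<in> A"; cases "\<omega> t \<in> B") (simp_all add: indicator_inter_arith)
    qed
    also have "\<dots> = (\<integral>\<^sup>+\<omega>. ?f A B \<omega> + ?f A (- B) \<omega> \<partial>P) + (\<integral>\<^sup>+\<omega>. ?f (space P - A) UNIV \<omega> \<partial>P)"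
      by (rule nn_integral_add) measurable
    also have "(\<integral>\<^sup>+\<omega>. ?f A B \<omega> + ?f A (- B) \<omega> \<partial>P) = (\<integral>\<^sup>+\<omega>. ?f A B \<omega> \<partial>P) + (\<integral>\<^sup>+\<omega>. ?f A (- B) \<omega> \<partial>P)"
      by (rule nn_integral_add) measurable
    finally show ?thesis
      unfolding l_def using alive_mass[of t] st by simp
  qed
  have rsum: "r A B + r A (- B) + r (space P - A) UNIV = ennreal (surv \<gamma> T x)"
  proof -
    let ?f = "\<lambda>A B \<omega>. indicator (A \<inter> alive T s) \<omega> * killed_op \<gamma> (t - s) (\<lambda>y. indicator B y * ?S y) (\<omega> s)"
    have kop: "(\<lambda>\<omega>. killed_op \<gamma> (t - s) (\<lambda>y. indicator B y * ?S y) (\<omega> s)) \<in> borel_measurable P"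
      if [measurable]: "B \<in> sets borel" for B
      by (rule measurable_compose[of "\<lambda>\<omega>. \<omega> s" P borel]) measurable
    have fm: "?f A B \<in> borel_measurable P" if "A \<in> sets P" "B \<in> sets borel" for A B
      using that \<open>alive T s \<in> sets P\<close> by (intro borel_measurable_times_ennreal borel_measurable_indicator sets.Int kop)
    have Acm: "space P - A \<in> sets P" "- B \<in> sets borel" by auto
    have "(\<integral>\<^sup>+\<omega>. ?f A B \<omega> + ?f A (- B) \<omega> + ?f (space P - A) UNIV \<omega> \<partial>P) =
      (\<integral>\<^sup>+\<omega>. ?f A B \<omega> + ?f A (- B) \<omega> \<partial>P) + (\<integral>\<^sup>+\<omega>. ?f (space P - A) UNIV \<omega> \<partial>P)"
      by (rule nn_integral_add[OF borel_measurable_add[OF fm fm] fm]) (use Acm in simp_all)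
    moreover have "(\<integral>\<^sup>+\<omega>. ?f A B \<omega> + ?f A (- B) \<omega> \<partial>P) = (\<integral>\<^sup>+\<omega>. ?f A B \<omega> \<partial>P) + (\<integral>\<^sup>+\<omega>. ?f A (- B) \<omega> \<partial>P)"
      by (rule nn_integral_add[OF fm fm]) (use Acm in simp_all)
    ultimately have "(\<integral>\<^sup>+\<omega>. ?f A B \<omega> \<partial>P) + (\<integral>\<^sup>+\<omega>. ?f A (- B) \<omega> \<partial>P) + (\<integral>\<^sup>+\<omega>. ?f (space P - A) UNIV \<omega> \<partial>P) =
      (\<integral>\<^sup>+\<omega>. ?f A B \<omega> + ?f A (- B) \<omega> + ?f (space P - A) UNIV \<omega> \<partial>P)"
      by (simp only:)
    also have "\<dots> = (\<integral>\<^sup>+\<omega>. indicator (alive T s) \<omega> * killed_op \<gamma> (t - s) ?S (\<omega> s) \<partial>P)"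
    proof (rule nn_integral_cong)
      fix \<omega> assume "\<omega> \<in> space P"
      then show "?f A B \<omega> + ?f A (- B) \<omega> + ?f (space P - A) UNIV \<omega> = indicator (alive T s) \<omega> * killed_op \<gamma> (t - s) ?S (\<omega> s)"
        by (cases "\<omega> \<in> A") (simp_all only: indicator_inter_arith distrib_left[symmetric] opadd, simp_all)
    qed
    finally have "r A B + r A (- B) + r (space P - A) UNIV = (\<integral>\<^sup>+\<omega>. indicator (alive T s) \<omega> * killed_op \<gamma> (t - s) ?S (\<omega> s) \<partial>P)"
      by (simp only: r_def)
    also have "\<dots> = (\<integral>\<^sup>+\<omega>. indicator (alive T s) \<omega> * ennreal (surv \<gamma> (T - s) (\<omega> s)) \<partial>P)"
      using st by (intro nn_integral_cong) (auto simp: indicator_def alive_def killed_op_surv)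
    finally show ?thesis using alive_mass[of s] st by simp
  qed
  have "l A B = r A B"
  proof (rule ccontr)
    assume "l A B \<noteq> r A B"
    then have lt: "l A B < r A B" using le[OF A B] by simp
    have le2: "l A (- B) + l (space P - A) UNIV \<le> r A (- B) + r (space P - A) UNIV"
      by (intro add_mono le A Ac) auto
    \<comment> \<open>Strictness survives the addition of the other two terms only because these are
      finite.\<close>
    have fin: "l A (- B) + l (space P - A) UNIV < \<top>"
    proof -
      have "l A (- B) + l (space P - A) UNIV \<le> l A B + l A (- B) + l (space P - A) UNIV"
        by (simp add: add.assoc)
      also have "\<dots> < \<top>" unfolding lsum by simp
      finally show ?thesis .
    qed
    have "(l A (- B) + l (space P - A) UNIV) + l A B < (l A (- B) + l (space P - A) UNIV) + r A B"
      unfolding ennreal_add_left_cancel_less using lt fin by (simp add: less_top)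
    also have "\<dots> \<le> (r A (- B) + r (space P - A) UNIV) + r A B"
      using le2 by (rule add_right_mono)
    finally show False using lsum rsum by (simp add: add.assoc add.commute add.left_commute)
  qed
  then show ?thesis by (simp add: l_def r_def)
qed

text \<open>The identity for indicators is an equality of two measures on \<open>real^'n\<close>,
  hence also of the integrals of every nonnegative u.\<close>

theorem killed_markov:
  assumes st: "0 \<le> s" "s < t" "t \<le> T" and A: "A \<in> sets (path_filt T s)" and u: "u \<in> borel_measurable borel"
  shows "(\<integral>\<^sup>+\<omega>. indicator (A \<inter> alive T t) \<omega> * (u (\<omega> t) * ennreal (surv \<gamma> (T - t) (\<omega> t))) \<partial>P) =
    (\<integral>\<^sup>+\<omega>. indicator (A \<inter> alive T s) \<omega> * killed_op \<gamma> (t - s) (\<lambda>y. u y * ennreal (surv \<gamma> (T - t) y)) (\<omega> s) \<partial>P)"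
proof -
  let ?S = "\<lambda>y::real^'n. ennreal (surv \<gamma> (T - t) y)"
  have [measurable]: "(\<lambda>\<omega>. \<omega> t) \<in> borel_measurable P" "(\<lambda>\<omega>. \<omega> s) \<in> borel_measurable P" "alive T t \<in> sets P" "alive T s \<in> sets P"
    using st by (auto intro!: coord alive_P)
  have [measurable]: "A \<in> sets P" using A by (rule sets_filt_P)
  have op: "killed_op \<gamma> (t - s) v z = (\<integral>\<^sup>+y. ennreal (killed_density \<gamma> (t - s) z y) * v y \<partial>lborel)" for v z
    using st by (simp add: killed_op_def)
  define \<mu> where "\<mu> = distr (density P (\<lambda>\<omega>. indicator (A \<inter> alive T t) \<omega> * ?S (\<omega> t))) borel (\<lambda>\<omega>. \<omega> t)"
  define \<nu> where "\<nu> = distr (density (P \<Otimes>\<^sub>M lborel) (\<lambda>(\<omega>, y). indicator (A \<inter> alive T s) \<omega> * (ennreal (killed_density \<gamma> (t - s) (\<omega> s) y) * ?S y))) borel snd"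
  have \<mu>: "(\<integral>\<^sup>+y. v y \<partial>\<mu>) = (\<integral>\<^sup>+\<omega>. indicator (A \<inter> alive T t) \<omega> * (v (\<omega> t) * ?S (\<omega> t)) \<partial>P)" if [measurable]: "v \<in> borel_measurable borel" for v
    unfolding \<mu>_def by (subst nn_integral_distr) (simp_all add: nn_integral_density mult_ac)
  have \<nu>: "(\<integral>\<^sup>+y. v y \<partial>\<nu>) = (\<integral>\<^sup>+\<omega>. indicator (A \<inter> alive T s) \<omega> * killed_op \<gamma> (t - s) (\<lambda>y. v y * ?S y) (\<omega> s) \<partial>P)"
    if [measurable]: "v \<in> borel_measurable borel" for v
  proof -
    have "(\<integral>\<^sup>+y. v y \<partial>\<nu>) = (\<integral>\<^sup>+p. (indicator (A \<inter> alive T s) (fst p) * (ennreal (killed_density \<gamma> (t - s) (fst p s) (snd p)) * ?S (snd p))) * v (snd p) \<partial>(P \<Otimes>\<^sub>M lborel))"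
      unfolding \<nu>_def by (subst nn_integral_distr) (simp_all add: nn_integral_density case_prod_beta')
    also have "\<dots> = (\<integral>\<^sup>+\<omega>. \<integral>\<^sup>+y. (indicator (A \<inter> alive T s) \<omega> * (ennreal (killed_density \<gamma> (t - s) (\<omega> s) y) * ?S y)) * v y \<partial>lborel \<partial>P)"
      by (subst lborel.nn_integral_fst[symmetric]) simp_all
    also have "\<dots> = (\<integral>\<^sup>+\<omega>. indicator (A \<inter> alive T s) \<omega> * killed_op \<gamma> (t - s) (\<lambda>y. v y * ?S y) (\<omega> s) \<partial>P)"
      unfolding op by (intro nn_integral_cong, subst nn_integral_cmult[symmetric]) (simp_all add: mult_ac)
    finally show ?thesis .
  qed
  have "\<mu> = \<nu>"
  proof (rule measure_eqI)
    show "sets \<mu> = sets \<nu>" by (simp add: \<mu>_def \<nu>_def)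
    fix B assume "B \<in> sets \<mu>"
    then have B [measurable]: "B \<in> sets borel" by (simp add: \<mu>_def)
    have "emeasure \<mu> B = (\<integral>\<^sup>+y. indicator B y \<partial>\<mu>)"
      by (rule nn_integral_indicator[symmetric]) (simp add: \<mu>_def)
    also have "\<dots> = (\<integral>\<^sup>+y. indicator B y \<partial>\<nu>)"
      using killed_markov_indicator[OF st A B] by (simp only: \<mu>[OF borel_measurable_indicator[OF B]] \<nu>[OF borel_measurable_indicator[OF B]])
    also have "\<dots> = emeasure \<nu> B"
      by (rule nn_integral_indicator) (simp add: \<nu>_def)
    finally show "emeasure \<mu> B = emeasure \<nu> B" .
  qed
  then show ?thesis
    using \<mu>[OF u] \<nu>[OF u] by simp
qed

end

section \<open>The law conditioned on survival\<close>

text \<open>The limit psi at time 0 is supplied by hand, because \<open>heat_kernel 0\<close> is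
  identically 0. In this way the bridge density covers the final time t = T.\<close>

definition heat_psi :: "real \<Rightarrow> real \<Rightarrow> real^'n \<Rightarrow> real" where
  "heat_psi \<gamma> t x = (if t = 0 then psi \<gamma> x else conv (heat_kernel t) (psi \<gamma>) x)"

text \<open>The exponential and \<open>psi\<close> factors of the killed density cancel against those of \<open>surv\<close>: conditioned
  on survival, the process is the heat flow transformed by the space-time harmonic function \<open>heat_psi\<close>.\<close>

definition bridge_density :: "real \<Rightarrow> real \<Rightarrow> real \<Rightarrow> real \<Rightarrow> real^'n \<Rightarrow> real^'n \<Rightarrow> real" where
  "bridge_density \<gamma> T s t y z = heat_kernel (t - s) (y - z) * heat_psi \<gamma> (T - t) z / heat_psi \<gamma> (T - s) y"

lemma measurable_heat_psi [measurable (raw)]: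
  fixes x :: "'b \<Rightarrow> real^'n"
  assumes g: "0 < \<gamma>" and d: "CARD('n) \<in> {2, 3}"
    and [measurable]: "x \<in> borel_measurable M"
  shows "(\<lambda>\<omega>. heat_psi \<gamma> t (x \<omega>)) \<in> borel_measurable M"
proof -
  note [measurable (raw)] = measurable_conv[OF integrable_psi[OF g d]]
  show ?thesis unfolding heat_psi_def by measurable
qed

lemma measurable_bridge_density [measurable (raw)]:
  fixes y z :: "'b \<Rightarrow> real^'n"
  assumes "0 < \<gamma>" "CARD('n) \<in> {2, 3}" and [measurable]: "y \<in> borel_measurable M" "z \<in> borel_measurable M"
  shows "(\<lambda>\<omega>. bridge_density \<gamma> T s t (y \<omega>) (z \<omega>)) \<in> borel_measurable M"
proof -
  note [measurable (raw)] = measurable_heat_psi[OF assms(1,2)]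
  show ?thesis unfolding bridge_density_def by measurable
qed

lemma heat_psi_nonneg:
  assumes "0 < \<gamma>"
  shows "0 \<le> heat_psi \<gamma> t (x::real^'n)"
  using assms by (simp add: heat_psi_def conv_def)

lemma heat_psi_pos:
  assumes "0 < \<gamma>" "CARD('n) \<in> {2, 3}" "0 < t"
  shows "0 < heat_psi \<gamma> t (x::real^'n)"
  using assms by (simp add: heat_psi_def conv_psi_pos)

lemma surv_eq_heat_psi:
  fixes x :: "real^'n"
  assumes "0 < \<gamma>" "x \<noteq> 0"
  shows "surv \<gamma> t x = exp (- lam CARD('n) \<gamma> * t) * heat_psi \<gamma> t x / psi \<gamma> x"
  using assms psi_pos[of \<gamma> x] by (simp add: surv_def heat_psi_def)

lemma killed_density_surv:
  fixes y z :: "real^'n"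
  assumes g: "0 < \<gamma>" and d: "CARD('n) \<in> {2, 3}" and s: "s < T" and y: "y \<noteq> 0" and z: "z \<noteq> 0"
  shows "killed_density \<gamma> (t - s) y z * surv \<gamma> (T - t) z = surv \<gamma> (T - s) y * bridge_density \<gamma> T s t y z"
proof -
  have p: "psi \<gamma> y \<noteq> 0" "psi \<gamma> z \<noteq> 0" "heat_psi \<gamma> (T - s) y \<noteq> 0"
    using psi_pos[OF g y] psi_pos[OF g z] heat_psi_pos[OF g d, of "T - s" y] s by auto
  have "exp (- lam CARD('n) \<gamma> * (t - s)) * exp (- lam CARD('n) \<gamma> * (T - t)) = exp (- lam CARD('n) \<gamma> * (T - s))"
    by (simp add: exp_add[symmetric] algebra_simps)
  then show ?thesis
    unfolding killed_density_def surv_eq_heat_psi[OF g y] surv_eq_heat_psi[OF g z] bridge_density_def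
    using p by (simp add: field_simps)
qed

context point_interaction
begin

abbreviation "F \<equiv> augmented_filt T P"
abbreviation "Q \<equiv> cond_law_surv T P"
abbreviation "p \<equiv> surv \<gamma> T x"

lemma augmented_generators: "sets (path_filt T t) \<union> {N. \<exists>Z \<in> null_sets P. N \<subseteq> Z} \<subseteq> Pow (space (path_borel T))"
  using sets.sets_into_space[of _ "path_filt T t"] sets.sets_into_space[of _ P]
  by (fastforce simp: null_sets_def space_P)

lemma space_augmented [simp]: "space (F t) = space P"
  unfolding augmented_filt_def space_P by (rule space_measure_of[OF augmented_generators])

lemma sets_augmented: "sets (F t) = sigma_sets (space P) (sets (path_filt T t) \<union> {N. \<exists>Z \<in> null_sets P. N \<subseteq> Z})"
  unfolding augmented_filt_def space_P by (rule sets_measure_of[OF augmented_generators])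

lemma path_filt_subset_augmented: "sets (path_filt T t) \<subseteq> sets (F t)"
  unfolding sets_augmented by auto

lemma augmented_subset_completion: "sets (F t) \<subseteq> sets (completion P)"
proof -
  have "sets (path_filt T t) \<union> {N. \<exists>Z \<in> null_sets P. N \<subseteq> Z} \<subseteq> sets (completion P)"
    using sets_completionI_sub by (auto simp: sets_filt_P)
  from sets.sigma_sets_subset[OF this] show ?thesis
    by (simp add: sets_augmented)
qed

lemma augmented_mono: "s \<le> t \<Longrightarrow> sets (F s) \<subseteq> sets (F t)"
  unfolding sets_augmented using path_filt_mono[of s t T] by (intro sigma_sets_mono') auto

lemma filtration_augmented: "filtration (space P) F"
  by unfold_locales (auto simp: augmented_mono[THEN subsetD])

text \<open>The sets with such a modification contain both kinds of generators and are closed under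
  complements and countable unions. Through this, the Markov identities pass from the raw to the
  augmented filtration.\<close>

lemma augmented_modification:
  assumes "A \<in> sets (F t)"
  shows "\<exists>A'\<in>sets (path_filt T t). AE \<omega> in P. \<omega> \<in> A \<longleftrightarrow> \<omega> \<in> A'"
  using assms unfolding sets_augmented
proof induction
  case (Basic a)
  then show ?case
  proof
    assume "a \<in> {N. \<exists>Z\<in>null_sets P. N \<subseteq> Z}"
    then obtain Z where "Z \<in> null_sets P" "a \<subseteq> Z" by auto
    then have "AE \<omega> in P. \<omega> \<in> a \<longleftrightarrow> \<omega> \<in> {}"
      using AE_not_in[of Z P] by (auto elim!: eventually_mono)
    then show ?thesis by (intro bexI[of _ "{}"]) auto
  qed auto
next
  case Empty
  then show ?case by (intro bexI[of _ "{}"]) auto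
next
  case (Compl a)
  then obtain a' where a': "a' \<in> sets (path_filt T t)" "AE \<omega> in P. \<omega> \<in> a \<longleftrightarrow> \<omega> \<in> a'" by auto
  have "space P - a' \<in> sets (path_filt T t)"
    using sets.compl_sets[OF a'(1)] by (simp add: space_P)
  moreover have "AE \<omega> in P. \<omega> \<in> space P - a \<longleftrightarrow> \<omega> \<in> space P - a'"
    using a'(2) by eventually_elim auto
  ultimately show ?case by blast
next
  case (Union a)
  then obtain a' where a': "\<And>i. a' i \<in> sets (path_filt T t)" "\<And>i. AE \<omega> in P. \<omega> \<in> a i \<longleftrightarrow> \<omega> \<in> a' i"
    by metis
  have "AE \<omega> in P. \<forall>i. \<omega> \<in> a i \<longleftrightarrow> \<omega> \<in> a' i"
    using a'(2) by (simp add: AE_all_countable)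
  then have "AE \<omega> in P. \<omega> \<in> (\<Union>i. a i) \<longleftrightarrow> \<omega> \<in> (\<Union>i. a' i)"
    by eventually_elim auto
  moreover have "(\<Union>i. a' i) \<in> sets (path_filt T t)"
    using a'(1) by auto
  ultimately show ?case by blast
qed

lemma survival_event: "{\<omega> \<in> space P. ereal T < hit_time T \<omega>} = alive T T"
  using less_hit_time_iff[of _ T T] T alive_subset[of T T] by (auto simp: space_P)

lemma Q_eq: "Q = uniform_measure (completion P) (alive T T)"
  unfolding cond_law_surv_def survival_event ..

lemma space_Q [simp]: "space Q = space P"
  by (simp add: Q_eq)

lemma sets_Q [simp, measurable_cong]: "sets Q = sets (completion P)"
  by (simp add: Q_eq)

lemma emeasure_alive: "emeasure (completion P) (alive T T) = ennreal p"
  using prob_alive by (simp add: emeasure_eq_measure)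

sublocale Q: prob_space Q
  unfolding Q_eq
proof (rule prob_space_uniform_measure)
  show "emeasure (completion P) (alive T T) \<noteq> 0"
    unfolding emeasure_alive using surv_T_pos by simp
  show "emeasure (completion P) (alive T T) \<noteq> \<infinity>"
    unfolding emeasure_alive by simp
qed

lemma measurable_Q: "f \<in> measurable P N \<Longrightarrow> f \<in> measurable Q N"
  using measurable_completion[of f P N] measurable_cong_sets[OF sets_Q refl] by blast

lemma coord_Q [measurable]: "s \<in> {0..T} \<Longrightarrow> (\<lambda>\<omega>. \<omega> s) \<in> borel_measurable Q"
  by (intro measurable_Q coord)

lemma nn_integral_Q:
  assumes "f \<in> borel_measurable (completion P)"
  shows "(\<integral>\<^sup>+\<omega>. f \<omega> \<partial>Q) = (\<integral>\<^sup>+\<omega>. indicator (alive T T) \<omega> * f \<omega> \<partial>P) / ennreal p"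
  unfolding Q_eq using assms
  by (subst nn_integral_uniform_measure) (auto simp: nn_integral_completion emeasure_alive[simplified] mult.commute emeasure_eq_measure prob_alive)

lemma AE_Q: "(AE \<omega> in P. R \<omega>) \<Longrightarrow> (AE \<omega> in Q. R \<omega>)"
  unfolding Q_eq by (rule AE_uniform_measureI) (auto simp: AE_completion_iff)

lemma subalgebra_Q: "subalgebra Q (F t)"
  using augmented_subset_completion by (auto simp: subalgebra_def)

lemma sets_augmented_Q: "A \<in> sets (F t) \<Longrightarrow> A \<in> sets Q"
  using augmented_subset_completion by auto

text \<open>The conditional probability of survival given the past of t:
  \<open>killed_markov\<close> from t to T with u = 1, as S at T is 1 off 0. A condition on X_t is
  first absorbed into the event, and comparing measures then gives general u.\<close>

lemma alive_T_augmented: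
  assumes t: "0 \<le> t" "t \<le> T" and A: "A \<in> sets (F t)" and u [measurable]: "u \<in> borel_measurable borel"
  shows "(\<integral>\<^sup>+\<omega>. indicator A \<omega> * (indicator (alive T T) \<omega> * u (\<omega> t)) \<partial>P) =
    (\<integral>\<^sup>+\<omega>. indicator A \<omega> * (indicator (alive T t) \<omega> * (u (\<omega> t) * ennreal (surv \<gamma> (T - t) (\<omega> t)))) \<partial>P)"
\<comment> \<open>\<open>killed_markov\<close> requires t < T; at t = T the two integrands
  coincide.\<close>
proof (cases "t = T")
  case True
  show ?thesis
  proof (rule nn_integral_cong)
    fix \<omega> :: "real \<Rightarrow> real^'n"
    have "surv \<gamma> 0 (\<omega> T) = 1" if "\<omega> \<in> alive T T"
      using that T by (auto simp: alive_def surv_def)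
    then show "indicator A \<omega> * (indicator (alive T T) \<omega> * u (\<omega> t)) =
      indicator A \<omega> * (indicator (alive T t) \<omega> * (u (\<omega> t) * ennreal (surv \<gamma> (T - t) (\<omega> t))))"
      using True by (auto simp: indicator_def)
  qed
next
  case False
  then have tT: "0 \<le> t" "t < T" "T \<le> T" using t by auto
  obtain A' where A': "A' \<in> sets (path_filt T t)" and eq: "AE \<omega> in P. \<omega> \<in> A \<longleftrightarrow> \<omega> \<in> A'"
    using augmented_modification[OF A] by auto
  have [measurable]: "A' \<in> sets P" using A' by (rule sets_filt_P)
  have [measurable]: "alive T t \<in> sets P" "(\<lambda>\<omega>. \<omega> t) \<in> borel_measurable P"
    using t by (auto intro!: coord alive_P)
  have [measurable]: "(\<lambda>\<omega>. ennreal (surv \<gamma> (T - t) (\<omega> t))) \<in> borel_measurable P"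
    using t by (intro measurable_compose[OF measurable_surv_coord measurable_ennreal]) auto
  define \<mu> where "\<mu> = distr (density P (\<lambda>\<omega>. indicator A' \<omega> * indicator (alive T T) \<omega>)) borel (\<lambda>\<omega>. \<omega> t)"
  define \<nu> where "\<nu> = distr (density P (\<lambda>\<omega>. indicator A' \<omega> * (indicator (alive T t) \<omega> * ennreal (surv \<gamma> (T - t) (\<omega> t))))) borel (\<lambda>\<omega>. \<omega> t)"
  have \<mu>: "(\<integral>\<^sup>+y. v y \<partial>\<mu>) = (\<integral>\<^sup>+\<omega>. indicator A' \<omega> * (indicator (alive T T) \<omega> * v (\<omega> t)) \<partial>P)" if [measurable]: "v \<in> borel_measurable borel" for v
    unfolding \<mu>_def by (subst nn_integral_distr) (simp_all add: nn_integral_density mult.assoc)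
  have \<nu>: "(\<integral>\<^sup>+y. v y \<partial>\<nu>) = (\<integral>\<^sup>+\<omega>. indicator A' \<omega> * (indicator (alive T t) \<omega> * (v (\<omega> t) * ennreal (surv \<gamma> (T - t) (\<omega> t)))) \<partial>P)"
    if [measurable]: "v \<in> borel_measurable borel" for v
    unfolding \<nu>_def by (subst nn_integral_distr) (simp_all add: nn_integral_density mult.assoc mult.commute[of "ennreal (surv _ _ _)"])
  have "\<mu> = \<nu>"
  proof (rule measure_eqI)
    show "sets \<mu> = sets \<nu>" by (simp add: \<mu>_def \<nu>_def)
    fix B assume "B \<in> sets \<mu>"
    then have B [measurable]: "B \<in> sets borel" by (simp add: \<mu>_def)
    define A'' where "A'' = A' \<inter> {\<omega> :: real \<Rightarrow> real^'n. \<omega> \<in> space (path_filt T t) \<and> \<omega> t \<in> B}"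
    have A'': "A'' \<in> sets (path_filt T t)"
    proof -
      have [measurable]: "(\<lambda>\<omega>::real \<Rightarrow> real^'n. \<omega> t) \<in> borel_measurable (path_filt T t)"
        using t by (intro measurable_path_filt_coordinate) auto
      have "{\<omega> :: real \<Rightarrow> real^'n. \<omega> \<in> space (path_filt T t) \<and> \<omega> t \<in> B} \<in> sets (path_filt T t)"
        by measurable
      then show ?thesis unfolding A''_def using A' by (intro sets.Int)
    qed
    have A's: "\<omega> \<in> A'' \<longleftrightarrow> \<omega> \<in> A' \<and> \<omega> t \<in> B" for \<omega>
      using sets.sets_into_space[OF A'] by (auto simp: A''_def)
    have "emeasure \<mu> B = (\<integral>\<^sup>+\<omega>. indicator A' \<omega> * (indicator (alive T T) \<omega> * indicator B (\<omega> t)) \<partial>P)"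
      by (subst nn_integral_indicator[symmetric]) (simp_all add: \<mu>_def[symmetric] \<mu>, simp add: \<mu>_def)
    also have "\<dots> = (\<integral>\<^sup>+\<omega>. indicator (A'' \<inter> alive T T) \<omega> * (1 * ennreal (surv \<gamma> (T - T) (\<omega> T))) \<partial>P)"
    proof (rule nn_integral_cong)
      fix \<omega> :: "real \<Rightarrow> real^'n"
      have "surv \<gamma> 0 (\<omega> T) = 1" if "\<omega> \<in> alive T T"
        using that T by (auto simp: alive_def surv_def)
      then show "indicator A' \<omega> * (indicator (alive T T) \<omega> * indicator B (\<omega> t)) = indicator (A'' \<inter> alive T T) \<omega> * (1 * ennreal (surv \<gamma> (T - T) (\<omega> T)))"
        by (auto simp: indicator_def A's)
    qed
    also have "\<dots> = (\<integral>\<^sup>+\<omega>. indicator (A'' \<inter> alive T t) \<omega> * killed_op \<gamma> (T - t) (\<lambda>y. 1 * ennreal (surv \<gamma> (T - T) y)) (\<omega> t) \<partial>P)"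
      by (rule killed_markov[OF tT A'']) simp
    also have "\<dots> = (\<integral>\<^sup>+\<omega>. indicator A' \<omega> * (indicator (alive T t) \<omega> * (indicator B (\<omega> t) * ennreal (surv \<gamma> (T - t) (\<omega> t)))) \<partial>P)"
    proof (rule nn_integral_cong)
      fix \<omega> :: "real \<Rightarrow> real^'n"
      have "killed_op \<gamma> (T - t) (\<lambda>y. ennreal (surv \<gamma> (T - T) y)) (\<omega> t) = ennreal (surv \<gamma> (T - t) (\<omega> t))" if "\<omega> \<in> alive T t"
        using that tT by (intro killed_op_surv) (auto simp: alive_def)
      then show "indicator (A'' \<inter> alive T t) \<omega> * killed_op \<gamma> (T - t) (\<lambda>y. 1 * ennreal (surv \<gamma> (T - T) y)) (\<omega> t) =
        indicator A' \<omega> * (indicator (alive T t) \<omega> * (indicator B (\<omega> t) * ennreal (surv \<gamma> (T - t) (\<omega> t))))"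
        by (auto simp: indicator_def A's)
    qed
    also have "\<dots> = emeasure \<nu> B"
      by (subst nn_integral_indicator[symmetric]) (simp_all add: \<nu>_def[symmetric] \<nu>, simp add: \<nu>_def)
    finally show "emeasure \<mu> B = emeasure \<nu> B" .
  qed
  then have A'eq: "(\<integral>\<^sup>+\<omega>. indicator A' \<omega> * (indicator (alive T T) \<omega> * u (\<omega> t)) \<partial>P) =
    (\<integral>\<^sup>+\<omega>. indicator A' \<omega> * (indicator (alive T t) \<omega> * (u (\<omega> t) * ennreal (surv \<gamma> (T - t) (\<omega> t)))) \<partial>P)"
    using \<mu>[OF u] \<nu>[OF u] by simp
  have mod: "(\<integral>\<^sup>+\<omega>. indicator A \<omega> * h \<omega> \<partial>P) = (\<integral>\<^sup>+\<omega>. indicator A' \<omega> * h \<omega> \<partial>P)" for h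
    by (rule nn_integral_cong_AE, use eq in eventually_elim) (simp add: indicator_def)
  show ?thesis
    unfolding mod by (rule A'eq)
qed

text \<open>Survival up to T is traded for S at time t, \<open>killed_markov\<close> then goes back
  from t to s, and the Doob transform leaves a factor S at time s, which is traded back for survival
  up to T.\<close>

lemma Q_markov_nn:
  assumes st: "0 \<le> s" "s < t" "t \<le> T" and A: "A \<in> sets (F s)" and u [measurable]: "u \<in> borel_measurable borel"
  shows "(\<integral>\<^sup>+\<omega>. indicator A \<omega> * u (\<omega> t) \<partial>Q) =
    (\<integral>\<^sup>+\<omega>. indicator A \<omega> * (\<integral>\<^sup>+z. ennreal (bridge_density \<gamma> T s t (\<omega> s) z) * u z \<partial>lborel) \<partial>Q)"
proof -
  have At: "A \<in> sets (F t)" using A augmented_mono[of s t] st by auto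
  have AQ [measurable]: "A \<in> sets (completion P)" using A augmented_subset_completion by auto
  have cP [measurable]: "(\<lambda>\<omega>. \<omega> s) \<in> borel_measurable P" "(\<lambda>\<omega>. \<omega> t) \<in> borel_measurable P"
    using st by (auto intro!: coord)
  note cc [measurable] = cP[THEN measurable_completion]
  note [measurable (raw)] = measurable_bridge_density[OF \<gamma> dim]
  let ?E = "\<lambda>y. \<integral>\<^sup>+z. ennreal (bridge_density \<gamma> T s t y z) * u z \<partial>lborel"
  have [measurable]: "?E \<in> borel_measurable borel"
    by measurable
  obtain A' where A': "A' \<in> sets (path_filt T s)" and eq: "AE \<omega> in P. \<omega> \<in> A \<longleftrightarrow> \<omega> \<in> A'"
    using augmented_modification[OF A] by auto
  have mod: "(\<integral>\<^sup>+\<omega>. indicator A \<omega> * h \<omega> \<partial>P) = (\<integral>\<^sup>+\<omega>. indicator A' \<omega> * h \<omega> \<partial>P)" for h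
    by (rule nn_integral_cong_AE, use eq in eventually_elim) (simp add: indicator_def)
  have op: "killed_op \<gamma> (t - s) (\<lambda>z. u z * ennreal (surv \<gamma> (T - t) z)) y = ?E y * ennreal (surv \<gamma> (T - s) y)" if y: "y \<noteq> 0" for y
  proof -
    have "killed_op \<gamma> (t - s) (\<lambda>z. u z * ennreal (surv \<gamma> (T - t) z)) y =
      (\<integral>\<^sup>+z. ennreal (surv \<gamma> (T - s) y) * (ennreal (bridge_density \<gamma> T s t y z) * u z) \<partial>lborel)"
      unfolding killed_op_def
    proof (subst if_not_P)
      show "t - s \<noteq> 0" using st by simp
      show "(\<integral>\<^sup>+z. ennreal (killed_density \<gamma> (t - s) y z) * (u z * ennreal (surv \<gamma> (T - t) z)) \<partial>lborel) =
        (\<integral>\<^sup>+z. ennreal (surv \<gamma> (T - s) y) * (ennreal (bridge_density \<gamma> T s t y z) * u z) \<partial>lborel)"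
      proof (rule nn_integral_cong_AE, use AE_lborel_nonzero in eventually_elim)
        fix z :: "real^'n" assume z: "z \<noteq> 0"
        have "ennreal (killed_density \<gamma> (t - s) y z) * ennreal (surv \<gamma> (T - t) z) = ennreal (killed_density \<gamma> (t - s) y z * surv \<gamma> (T - t) z)"
          using st by (intro ennreal_mult[symmetric] killed_density_nonneg surv_nonneg \<gamma> dim) auto
        also have "\<dots> = ennreal (surv \<gamma> (T - s) y * bridge_density \<gamma> T s t y z)"
          using st by (subst killed_density_surv[OF \<gamma> dim _ y z]) auto
        also have "\<dots> = ennreal (surv \<gamma> (T - s) y) * ennreal (bridge_density \<gamma> T s t y z)"
          using st by (intro ennreal_mult surv_nonneg \<gamma> dim) (auto simp: bridge_density_def heat_psi_nonneg \<gamma>)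
        finally have e: "ennreal (killed_density \<gamma> (t - s) y z) * ennreal (surv \<gamma> (T - t) z) =
          ennreal (surv \<gamma> (T - s) y) * ennreal (bridge_density \<gamma> T s t y z)" .
        have "ennreal (killed_density \<gamma> (t - s) y z) * (u z * ennreal (surv \<gamma> (T - t) z)) =
          (ennreal (killed_density \<gamma> (t - s) y z) * ennreal (surv \<gamma> (T - t) z)) * u z"
          by (simp only: mult_ac)
        then show "ennreal (killed_density \<gamma> (t - s) y z) * (u z * ennreal (surv \<gamma> (T - t) z)) =
           ennreal (surv \<gamma> (T - s) y) * (ennreal (bridge_density \<gamma> T s t y z) * u z)"
          unfolding e by (simp only: mult.assoc)
      qed
    qed
    also have "\<dots> = ennreal (surv \<gamma> (T - s) y) * ?E y"
      by (intro nn_integral_cmult borel_measurable_times_ennreal measurable_compose[OF _ measurable_ennreal]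
          measurable_bridge_density[OF \<gamma> dim]) simp_all
    finally show ?thesis by (simp only: mult.commute)
  qed
  have "(\<integral>\<^sup>+\<omega>. indicator A \<omega> * u (\<omega> t) \<partial>Q) = (\<integral>\<^sup>+\<omega>. indicator A \<omega> * (indicator (alive T T) \<omega> * u (\<omega> t)) \<partial>P) / ennreal p"
    by (subst nn_integral_Q) (simp_all add: mult.left_commute)
  also have "(\<integral>\<^sup>+\<omega>. indicator A \<omega> * (indicator (alive T T) \<omega> * u (\<omega> t)) \<partial>P) =
    (\<integral>\<^sup>+\<omega>. indicator A \<omega> * (indicator (alive T t) \<omega> * (u (\<omega> t) * ennreal (surv \<gamma> (T - t) (\<omega> t)))) \<partial>P)"
    using st by (intro alive_T_augmented At u) auto
  also have "\<dots> = (\<integral>\<^sup>+\<omega>. indicator (A' \<inter> alive T t) \<omega> * (u (\<omega> t) * ennreal (surv \<gamma> (T - t) (\<omega> t))) \<partial>P)"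
    unfolding mod by (simp add: indicator_inter_arith mult.assoc)
  also have "\<dots> = (\<integral>\<^sup>+\<omega>. indicator (A' \<inter> alive T s) \<omega> * killed_op \<gamma> (t - s) (\<lambda>z. u z * ennreal (surv \<gamma> (T - t) z)) (\<omega> s) \<partial>P)"
    by (rule killed_markov[OF st A' u])
  also have "\<dots> = (\<integral>\<^sup>+\<omega>. indicator A' \<omega> * (indicator (alive T s) \<omega> * (?E (\<omega> s) * ennreal (surv \<gamma> (T - s) (\<omega> s)))) \<partial>P)"
  proof (rule nn_integral_cong)
    fix \<omega> :: "real \<Rightarrow> real^'n"
    have "\<omega> s \<noteq> 0" if "\<omega> \<in> alive T s" using that st by (auto simp: alive_def)
    then show "indicator (A' \<inter> alive T s) \<omega> * killed_op \<gamma> (t - s) (\<lambda>z. u z * ennreal (surv \<gamma> (T - t) z)) (\<omega> s) =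
      indicator A' \<omega> * (indicator (alive T s) \<omega> * (?E (\<omega> s) * ennreal (surv \<gamma> (T - s) (\<omega> s))))"
      by (auto simp: indicator_def op)
  qed
  also have "\<dots> = (\<integral>\<^sup>+\<omega>. indicator A \<omega> * (indicator (alive T s) \<omega> * (?E (\<omega> s) * ennreal (surv \<gamma> (T - s) (\<omega> s)))) \<partial>P)"
    by (rule mod[symmetric])
  also have "\<dots> = (\<integral>\<^sup>+\<omega>. indicator A \<omega> * (indicator (alive T T) \<omega> * ?E (\<omega> s)) \<partial>P)"
    using st by (intro alive_T_augmented[symmetric] A) auto
  also have "\<dots> / ennreal p = (\<integral>\<^sup>+\<omega>. indicator A \<omega> * ?E (\<omega> s) \<partial>Q)"
    by (subst nn_integral_Q) (simp_all add: mult.left_commute)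
  finally show ?thesis .
qed

end

section \<open>Drift and martingale part\<close>

text \<open>The logarithmic gradient as a formula. \<open>reg_drift\<close> is a definite
  description, from which measurability and bounds are not apparent.\<close>

definition psi_drift :: "real \<Rightarrow> real \<Rightarrow> real^'n \<Rightarrow> real^'n" where
  "psi_drift \<gamma> r y = (1 / conv (heat_kernel r) (psi \<gamma>) y) *\<^sub>R conv_grad r (psi \<gamma>) y"

lemma gradient_eqI:
  assumes "GDERIV f x :> D"
  shows "gradient f x = D"
  unfolding gradient_def
proof (rule the_equality[where P="\<lambda>D. GDERIV f x :> D", OF assms])
  fix D' assume "GDERIV f x :> D'"
  then have "(\<lambda>h. h \<bullet> D') = (\<lambda>h. h \<bullet> D)"
    using assms unfolding gderiv_def by (rule has_derivative_unique)
  then show "D' = D"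
    by (metis vector_eq_rdot inner_commute)
qed

text \<open>At time \<open>0\<close> both sides vanish, because \<open>0 powr a = 0\<close> makes the heat kernel at time \<open>0\<close>
  identically zero. This value only enters the drift at the single time \<open>s = T\<close>.\<close>

lemma reg_drift_eq:
  fixes y :: "real^'n"
  assumes g: "0 < \<gamma>" and d: "CARD('n) \<in> {2, 3}" and r: "0 \<le> r"
  shows "reg_drift \<gamma> r y = psi_drift \<gamma> r y"
proof (cases "r = 0")
  case True
  then show ?thesis
    unfolding reg_drift_def psi_drift_def by (simp add: conv_def heat_kernel_def gradient_eqI[OF GDERIV_const])
next
  case False
  then have r: "0 < r" using r by simp
  have "GDERIV (\<lambda>z. ln (conv (heat_kernel r) (psi \<gamma>) z)) y :> (1 / conv (heat_kernel r) (psi \<gamma>) y) *\<^sub>R conv_grad r (psi \<gamma>) y"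
    using conv_psi_pos[OF g d r, of y]
    by (intro GDERIV_DERIV_compose GDERIV_conv integrable_psi g d r) (auto intro!: derivative_eq_intros)
  then show ?thesis
    unfolding reg_drift_def psi_drift_def by (rule gradient_eqI)
qed

lemma measurable_psi_drift [measurable (raw)]:
  fixes y :: "'b \<Rightarrow> real^'n"
  assumes g: "0 < \<gamma>" and d: "CARD('n) \<in> {2, 3}" and r: "r \<in> borel_measurable M" and y: "y \<in> borel_measurable M"
  shows "(\<lambda>\<omega>. psi_drift \<gamma> (r \<omega>) (y \<omega>)) \<in> borel_measurable M"
  unfolding psi_drift_def
  by (intro borel_measurable_scaleR borel_measurable_divide borel_measurable_const
      measurable_conv[OF integrable_psi[OF g d]] measurable_conv_grad[OF integrable_psi[OF g d]] r y)

lemma bridge_density_nonneg: "0 < \<gamma> \<Longrightarrow> 0 \<le> bridge_density \<gamma> T s t y z"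
  by (simp add: bridge_density_def heat_psi_nonneg)

text \<open>The explicit mean makes \<open>X\<^sub>t - x\<close> minus the integrated drift a martingale without any
  stochastic calculus.\<close>

lemma bridge_mean:
  fixes y :: "real^'n"
  assumes g: "0 < \<gamma>" and d: "CARD('n) \<in> {2, 3}" and st: "s < t" "t \<le> T"
  shows "integrable lborel (\<lambda>z. bridge_density \<gamma> T s t y z *\<^sub>R z)"
    and "(LINT z|lborel. bridge_density \<gamma> T s t y z *\<^sub>R z) = y + (t - s) *\<^sub>R psi_drift \<gamma> (T - s) y"
proof -
  note ip = integrable_psi[OF g d]
  let ?k = "\<lambda>z. heat_kernel (t - s) (y - z) * heat_psi \<gamma> (T - t) z"
  let ?c = "conv (heat_kernel (T - s)) (psi \<gamma>) y"
  have c: "0 < ?c" using st by (intro conv_psi_pos g d) auto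
  have hc: "heat_psi \<gamma> (T - s) y = ?c" using st by (simp add: heat_psi_def)
  have drift: "integrable lborel (\<lambda>z. ?k z *\<^sub>R (z - y)) \<and> (LINT z|lborel. ?k z *\<^sub>R (z - y)) = (t - s) *\<^sub>R conv_grad (T - s) (psi \<gamma>) y"
  proof (cases "t = T")
    case True
    then show ?thesis
      using drift_initial[OF ip, of "t - s" y] st by (simp add: heat_psi_def)
  next
    case False
    then show ?thesis
      using conv_drift[OF ip, of "t - s" "T - t" y] st by (simp add: heat_psi_def)
  qed
  have nn: "(\<integral>\<^sup>+z. ennreal (?k z) \<partial>lborel) = ennreal ?c"
  proof -
    have "(\<integral>\<^sup>+z. ennreal (?k z) \<partial>lborel) = (\<integral>\<^sup>+z. ennreal (heat_kernel (t - s) (y - z)) * ennreal (heat_psi \<gamma> (T - t) z) \<partial>lborel)"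
      using g by (simp add: ennreal_mult heat_psi_nonneg)
    also have "\<dots> = ennreal ?c"
    proof (cases "t = T")
      case True
      then show ?thesis
        using nn_integral_conv[OF ip, of "t - s" y] g st by (simp add: heat_psi_def)
    next
      case False
      then show ?thesis
        using nn_integral_conv_conv[OF ip, of "t - s" "T - t" y] g st by (simp add: heat_psi_def)
    qed
    finally show ?thesis .
  qed
  have k0: "0 \<le> ?k z" for z using g by (simp add: heat_psi_nonneg)
  have km: "?k \<in> borel_measurable lborel"
    by (intro borel_measurable_times measurable_heat_psi[OF g d] measurable_heat_kernel) simp_all
  have ik: "integrable lborel ?k"
    using nn k0 km by (intro integrableI_nonneg) auto
  have k1: "(LINT z|lborel. ?k z) = ?c"
    using nn k0 km c by (subst integral_eq_nn_integral) auto
  have eq: "bridge_density \<gamma> T s t y z *\<^sub>R z = (1 / ?c) *\<^sub>R (?k z *\<^sub>R (z - y) + ?k z *\<^sub>R y)" for z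
    unfolding bridge_density_def hc by (simp add: scaleR_diff_right)
  show "integrable lborel (\<lambda>z. bridge_density \<gamma> T s t y z *\<^sub>R z)"
    unfolding eq using drift ik by (intro integrable_scaleR_right Bochner_Integration.integrable_add integrable_scaleR_left) auto
  have "(LINT z|lborel. bridge_density \<gamma> T s t y z *\<^sub>R z) = (1 / ?c) *\<^sub>R ((LINT z|lborel. ?k z *\<^sub>R (z - y)) + (LINT z|lborel. ?k z *\<^sub>R y))"
    unfolding eq using drift ik
    by (subst integral_scaleR_right, subst Bochner_Integration.integral_add) (auto intro!: integrable_scaleR_left)
  also have "(LINT z|lborel. ?k z *\<^sub>R y) = ?c *\<^sub>R y"
    using ik k1 by (subst integral_scaleR_left) auto
  also have "(LINT z|lborel. ?k z *\<^sub>R (z - y)) = (t - s) *\<^sub>R conv_grad (T - s) (psi \<gamma>) y"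
    using drift by simp
  also have "(1 / ?c) *\<^sub>R ((t - s) *\<^sub>R conv_grad (T - s) (psi \<gamma>) y + ?c *\<^sub>R y) = y + (t - s) *\<^sub>R psi_drift \<gamma> (T - s) y"
    using c by (simp add: psi_drift_def scaleR_add_right)
  finally show "(LINT z|lborel. bridge_density \<gamma> T s t y z *\<^sub>R z) = y + (t - s) *\<^sub>R psi_drift \<gamma> (T - s) y" .
qed

text \<open>The heat flow of psi at z occurs in the numerator of the bridge density and in the
  denominator of the drift. At t = T the drift has the default value 0, hence t < T.\<close>

lemma bridge_psi_drift:
  fixes y :: "real^'n"
  assumes g: "0 < \<gamma>" and d: "CARD('n) \<in> {2, 3}" and st: "s < t" "t < T"
  shows "bridge_density \<gamma> T s t y z *\<^sub>R psi_drift \<gamma> (T - t) z =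
    (1 / conv (heat_kernel (T - s)) (psi \<gamma>) y) *\<^sub>R (heat_kernel (t - s) (y - z) *\<^sub>R conv_grad (T - t) (psi \<gamma>) z)"
proof -
  have "0 < conv (heat_kernel (T - t)) (psi \<gamma>) z"
    using st by (intro conv_psi_pos g d) auto
  then show ?thesis
    using st by (simp add: bridge_density_def psi_drift_def heat_psi_def)
qed

text \<open>After the cancellation this is the commutation of heat flow and gradient. It makes the
  drift along the conditioned process a martingale before T.\<close>

lemma bridge_drift_mean:
  fixes y :: "real^'n"
  assumes g: "0 < \<gamma>" and d: "CARD('n) \<in> {2, 3}" and st: "s < t" "t < T"
  shows "(LINT z|lborel. bridge_density \<gamma> T s t y z *\<^sub>R psi_drift \<gamma> (T - t) z) = psi_drift \<gamma> (T - s) y"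
  unfolding bridge_psi_drift[OF g d st] integral_scaleR_right
  using conv_conv_grad(2)[OF integrable_psi[OF g d], of "t - s" "T - t" y] st by (simp add: psi_drift_def)

text \<open>The gradient bound doubles the remaining time T - t, and the semigroup law adds t - s;
  this is the time 2T - t - s. The singularity (T - t)^(-1/2) is integrable up to T.\<close>

lemma nn_integral_bridge_drift:
  fixes y :: "real^'n"
  assumes g: "0 < \<gamma>" and d: "CARD('n) \<in> {2, 3}" and st: "s < t" "t < T"
  shows "(\<integral>\<^sup>+z. ennreal (bridge_density \<gamma> T s t y z) * ennreal (norm (psi_drift \<gamma> (T - t) z)) \<partial>lborel) \<le>
    ennreal (2 powr (real CARD('n) / 2) / sqrt (T - t) * conv (heat_kernel (2 * T - t - s)) (psi \<gamma>) y / conv (heat_kernel (T - s)) (psi \<gamma>) y)"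
proof -
  note ip = integrable_psi[OF g d]
  let ?c = "conv (heat_kernel (T - s)) (psi \<gamma>) y"
  define C where "C = 2 powr (real CARD('n) / 2) / sqrt (T - t)"
  have C: "0 \<le> C" using st by (simp add: C_def)
  have c: "0 < ?c" using st by (intro conv_psi_pos g d) auto
  have p0: "\<And>y::real^'n. 0 \<le> psi \<gamma> y" using g by simp
  have "(\<integral>\<^sup>+z. ennreal (bridge_density \<gamma> T s t y z) * ennreal (norm (psi_drift \<gamma> (T - t) z)) \<partial>lborel) \<le>
    (\<integral>\<^sup>+z. ennreal (C / ?c) * (ennreal (heat_kernel (t - s) (y - z)) * ennreal (conv (heat_kernel (2 * (T - t))) (psi \<gamma>) z)) \<partial>lborel)"
  proof (rule nn_integral_mono)
    fix z :: "real^'n"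
    have "bridge_density \<gamma> T s t y z * norm (psi_drift \<gamma> (T - t) z) = norm (bridge_density \<gamma> T s t y z *\<^sub>R psi_drift \<gamma> (T - t) z)"
      using g by (simp add: bridge_density_nonneg)
    also have "\<dots> = 1 / ?c * (heat_kernel (t - s) (y - z) * norm (conv_grad (T - t) (psi \<gamma>) z))"
      unfolding bridge_psi_drift[OF g d st] using c by simp
    also have "\<dots> \<le> 1 / ?c * (heat_kernel (t - s) (y - z) * (C * conv (heat_kernel (2 * (T - t))) (psi \<gamma>) z))"
      unfolding C_def using c st by (intro mult_left_mono norm_conv_grad_le ip p0) auto
    also have "\<dots> = (C / ?c) * (heat_kernel (t - s) (y - z) * conv (heat_kernel (2 * (T - t))) (psi \<gamma>) z)"
      by simp
    finally have "ennreal (bridge_density \<gamma> T s t y z * norm (psi_drift \<gamma> (T - t) z)) \<le> ennreal \<dots>"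
      by (rule ennreal_leI)
    then show "ennreal (bridge_density \<gamma> T s t y z) * ennreal (norm (psi_drift \<gamma> (T - t) z)) \<le>
       ennreal (C / ?c) * (ennreal (heat_kernel (t - s) (y - z)) * ennreal (conv (heat_kernel (2 * (T - t))) (psi \<gamma>) z))"
      using C c g by (simp only: ennreal_mult[symmetric] bridge_density_nonneg norm_ge_zero heat_kernel_nonneg
        conv_nonneg[OF ip p0] divide_nonneg_pos mult_nonneg_nonneg)
  qed
  also have "\<dots> = ennreal (C / ?c) * (\<integral>\<^sup>+z. ennreal (heat_kernel (t - s) (y - z)) * ennreal (conv (heat_kernel (2 * (T - t))) (psi \<gamma>) z) \<partial>lborel)"
    by (intro nn_integral_cmult borel_measurable_times_ennreal measurable_compose[OF _ measurable_ennreal]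
        measurable_conv[OF ip] measurable_heat_kernel) simp_all
  also have "\<dots> = ennreal (C / ?c) * ennreal (conv (heat_kernel (t - s + 2 * (T - t))) (psi \<gamma>) y)"
    using st by (subst nn_integral_conv_conv[OF ip p0]) auto
  also have "t - s + 2 * (T - t) = 2 * T - t - s" by simp
  also have "ennreal (C / ?c) * ennreal (conv (heat_kernel (2 * T - t - s)) (psi \<gamma>) y) = ennreal (C / ?c * conv (heat_kernel (2 * T - t - s)) (psi \<gamma>) y)"
    using C c conv_nonneg[OF ip p0, of "2 * T - t - s" y] by (subst ennreal_mult) auto
  finally show ?thesis by (simp add: C_def)
qed

lemma nn_integral_inverse_sqrt:
  assumes "0 \<le> C" "0 < T"
  shows "(\<integral>\<^sup>+s. indicator {0..T} s * ennreal (C / sqrt (T - s)) \<partial>lborel) < \<infinity>"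
proof -
  have "(\<integral>\<^sup>+s. indicator {0..T} s * ennreal (C / sqrt (T - s)) \<partial>lborel) = (\<integral>\<^sup>+s. (\<lambda>s. indicator {0..T} s * ennreal (C / sqrt s)) (T - s) \<partial>lborel)"
    by (intro nn_integral_cong) (auto simp: indicator_def)
  also have "\<dots> = (\<integral>\<^sup>+s. indicator {0..T} s * ennreal (C / sqrt s) \<partial>lborel)"
    by (rule nn_integral_lborel_reflect) measurable
  also have "\<dots> = (\<integral>\<^sup>+s. ennreal (indicator {0..T} s * (C * s powr (- 1 / 2))) \<partial>lborel)"
    by (intro nn_integral_cong) (auto simp: indicator_def powr_minus_divide powr_half_sqrt)
  also have "\<dots> = ennreal (C * (T powr (- 1 / 2 + 1) / (- 1 / 2 + 1)))"
  proof (rule nn_integral_has_integral_lebesgue)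
    show "((\<lambda>s. C * s powr (- 1 / 2)) has_integral C * (T powr (- 1 / 2 + 1) / (- 1 / 2 + 1))) {0..T}"
      using assms by (intro has_integral_mult_right has_integral_powr_from_0) auto
  qed (use assms in auto)
  finally show ?thesis by simp
qed

context point_interaction
begin

abbreviation "b \<equiv> \<lambda>s \<omega>. psi_drift \<gamma> (T - s) (\<omega> s :: real^'n)"

text \<open>For indicators the nonnegative version is an equality of the measures \<mu> and \<nu>,
  so it extends to vector-valued u. Integrability under \<mu> passes to \<nu>, which justifies
  Fubini.\<close>

lemma Q_markov:
  fixes u :: "real^'n \<Rightarrow> real^'n"
  assumes st: "0 \<le> s" "s < t" "t \<le> T" and A: "A \<in> sets (F s)" and u [measurable]: "u \<in> borel_measurable borel"
    and i: "integrable Q (\<lambda>\<omega>. u (\<omega> t))"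
  shows "(LINT \<omega>|Q. indicator A \<omega> *\<^sub>R u (\<omega> t)) =
    (LINT \<omega>|Q. indicator A \<omega> *\<^sub>R (LINT z|lborel. bridge_density \<gamma> T s t (\<omega> s) z *\<^sub>R u z))"
proof -
  have AQ [measurable]: "A \<in> sets Q" using A by (rule sets_augmented_Q)
  have cQ [measurable]: "(\<lambda>\<omega>. \<omega> t) \<in> borel_measurable Q" "(\<lambda>\<omega>. \<omega> s) \<in> borel_measurable Q"
    using st by (auto intro!: coord_Q)
  have km: "(\<lambda>p. bridge_density \<gamma> T s t (fst p s) (snd p)) \<in> borel_measurable (Q \<Otimes>\<^sub>M lborel)"
    by (rule measurable_bridge_density[OF \<gamma> dim]) measurable
  let ?w = "\<lambda>p. indicator A (fst p) * bridge_density \<gamma> T s t (fst p s) (snd p)"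
  have w [measurable]: "?w \<in> borel_measurable (Q \<Otimes>\<^sub>M lborel)"
    using km by measurable
  have w0: "0 \<le> ?w q" for q by (simp add: bridge_density_nonneg \<gamma>)
  define \<mu> where "\<mu> = distr (density Q (\<lambda>\<omega>. ennreal (indicator A \<omega>))) borel (\<lambda>\<omega>. \<omega> t)"
  define \<nu> where "\<nu> = distr (density (Q \<Otimes>\<^sub>M lborel) (\<lambda>q. ennreal (?w q))) borel snd"
  have \<mu>\<nu>: "\<mu> = \<nu>"
  proof (rule measure_eqI)
    show "sets \<mu> = sets \<nu>" by (simp add: \<mu>_def \<nu>_def)
    fix B assume "B \<in> sets \<mu>"
    then have B [measurable]: "B \<in> sets borel" by (simp add: \<mu>_def)
    have "emeasure \<mu> B = (\<integral>\<^sup>+y. indicator B y \<partial>\<mu>)"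
      by (rule nn_integral_indicator[symmetric]) (simp add: \<mu>_def)
    also have "\<dots> = (\<integral>\<^sup>+\<omega>. indicator A \<omega> * indicator B (\<omega> t) \<partial>Q)"
      unfolding \<mu>_def by (subst nn_integral_distr) (simp_all add: nn_integral_density ennreal_indicator)
    also have "\<dots> = (\<integral>\<^sup>+\<omega>. indicator A \<omega> * (\<integral>\<^sup>+z. ennreal (bridge_density \<gamma> T s t (\<omega> s) z) * indicator B z \<partial>lborel) \<partial>Q)"
      by (rule Q_markov_nn[OF st A]) measurable
    also have "\<dots> = (\<integral>\<^sup>+\<omega>. \<integral>\<^sup>+z. ennreal (?w (\<omega>, z)) * indicator B z \<partial>lborel \<partial>Q)"
    proof (rule nn_integral_cong)
      fix \<omega>
      show "indicator A \<omega> * (\<integral>\<^sup>+z. ennreal (bridge_density \<gamma> T s t (\<omega> s) z) * indicator B z \<partial>lborel) = (\<integral>\<^sup>+z. ennreal (?w (\<omega>, z)) * indicator B z \<partial>lborel)"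
        by (cases "\<omega> \<in> A") simp_all
    qed
    also have "\<dots> = (\<integral>\<^sup>+q. ennreal (?w q) * indicator B (snd q) \<partial>(Q \<Otimes>\<^sub>M lborel))"
      using w by (subst lborel.nn_integral_fst[symmetric]) simp_all
    also have "\<dots> = (\<integral>\<^sup>+y. indicator B y \<partial>\<nu>)"
      unfolding \<nu>_def using w by (subst nn_integral_distr) (simp_all add: nn_integral_density)
    also have "\<dots> = emeasure \<nu> B"
      by (rule nn_integral_indicator) (simp add: \<nu>_def)
    finally show "emeasure \<mu> B = emeasure \<nu> B" .
  qed
  have "(LINT \<omega>|Q. indicator A \<omega> *\<^sub>R u (\<omega> t)) = (LINT y|\<mu>. u y)"
    unfolding \<mu>_def by (subst integral_distr) (simp_all add: integral_density)
  also have "\<dots> = (LINT y|\<nu>. u y)"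
    unfolding \<mu>\<nu> ..
  also have "\<dots> = (LINT q|(Q \<Otimes>\<^sub>M lborel). ?w q *\<^sub>R u (snd q))"
    unfolding \<nu>_def using w w0 by (subst integral_distr) (simp_all add: integral_density)
  also have "\<dots> = (LINT \<omega>|Q. LINT z|lborel. ?w (\<omega>, z) *\<^sub>R u z)"
  proof -
    interpret QL: pair_sigma_finite Q lborel ..
    have "integrable \<mu> u"
      unfolding \<mu>_def using integrable_mult_indicator[OF AQ i] by (subst integrable_distr_eq) (simp_all add: integrable_density)
    then have "integrable \<nu> u" unfolding \<mu>\<nu> .
    then have "integrable (Q \<Otimes>\<^sub>M lborel) (\<lambda>q. ?w q *\<^sub>R u (snd q))"
      unfolding \<nu>_def using w w0 by (subst (asm) integrable_distr_eq) (simp_all add: integrable_density)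
    from QL.integral_fst'[OF this] show ?thesis by simp
  qed
  also have "\<dots> = (LINT \<omega>|Q. indicator A \<omega> *\<^sub>R (LINT z|lborel. bridge_density \<gamma> T s t (\<omega> s) z *\<^sub>R u z))"
    by (intro Bochner_Integration.integral_cong refl) (simp add: indicator_def)
  finally show ?thesis .
qed

lemma AE_Q_start: "AE \<omega> in Q. \<omega> 0 = x"
  by (rule AE_Q[OF AE_start])

lemma nn_integral_Q_coord:
  assumes t: "0 < t" "t \<le> T" and u: "u \<in> borel_measurable borel"
  shows "(\<integral>\<^sup>+\<omega>. u (\<omega> t) \<partial>Q) = (\<integral>\<^sup>+z. ennreal (bridge_density \<gamma> T 0 t x z) * u z \<partial>lborel)"
proof -
  have sp: "space P \<in> sets (F 0)" using sets.top[of "F 0"] by simp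
  have "(\<integral>\<^sup>+\<omega>. u (\<omega> t) \<partial>Q) = (\<integral>\<^sup>+\<omega>. indicator (space P) \<omega> * u (\<omega> t) \<partial>Q)"
    by (intro nn_integral_cong) simp
  also have "\<dots> = (\<integral>\<^sup>+\<omega>. indicator (space P) \<omega> * (\<integral>\<^sup>+z. ennreal (bridge_density \<gamma> T 0 t (\<omega> 0) z) * u z \<partial>lborel) \<partial>Q)"
    by (rule Q_markov_nn[OF order_refl t sp u])
  also have "\<dots> = (\<integral>\<^sup>+\<omega>. (\<integral>\<^sup>+z. ennreal (bridge_density \<gamma> T 0 t x z) * u z \<partial>lborel) \<partial>Q)"
  proof (rule nn_integral_cong_AE)
    show "AE \<omega> in Q. indicator (space P) \<omega> * (\<integral>\<^sup>+z. ennreal (bridge_density \<gamma> T 0 t (\<omega> 0) z) * u z \<partial>lborel) =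
       (\<integral>\<^sup>+z. ennreal (bridge_density \<gamma> T 0 t x z) * u z \<partial>lborel)"
      using AE_Q_start AE_space by eventually_elim simp
  qed
  finally show ?thesis
    by (simp add: Q.emeasure_space_1[simplified])
qed

lemma integrable_coord:
  assumes t: "0 \<le> t" "t \<le> T"
  shows "integrable Q (\<lambda>\<omega>. \<omega> t)"
proof (cases "t = 0")
  case True
  have "integrable Q (\<lambda>\<omega>. \<omega> t) \<longleftrightarrow> integrable Q (\<lambda>\<omega>. x)"
  proof (rule integrable_cong_AE)
    show "AE \<omega> in Q. \<omega> t = x" using AE_Q_start True by simp
  qed (use t in \<open>auto intro!: coord_Q\<close>)
  then show ?thesis by simp
next
  case False
  then have t0: "0 < t" using t by simp
  have [measurable]: "(\<lambda>\<omega>. \<omega> t) \<in> borel_measurable Q"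
    using t by (auto intro!: coord_Q)
  have "(\<integral>\<^sup>+\<omega>. ennreal (norm (\<omega> t)) \<partial>Q) = (\<integral>\<^sup>+z. ennreal (bridge_density \<gamma> T 0 t x z) * ennreal (norm z) \<partial>lborel)"
    by (rule nn_integral_Q_coord[OF t0 t(2)]) measurable
  also have "\<dots> = (\<integral>\<^sup>+z. ennreal (norm (bridge_density \<gamma> T 0 t x z *\<^sub>R z)) \<partial>lborel)"
    by (simp add: ennreal_mult bridge_density_nonneg \<gamma>)
  also have "\<dots> < \<infinity>"
    using bridge_mean(1)[OF \<gamma> dim t0 t(2), of x] unfolding integrable_iff_bounded by (rule conjunct2)
  finally show ?thesis
    using \<open>(\<lambda>\<omega>. \<omega> t) \<in> borel_measurable Q\<close> by (intro integrableI_bounded)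
qed

text \<open>Under the marginal started at x, the heat flow in the numerator runs for the time 2T - t
  >= T, so its value at x is at most the constant K.\<close>

lemma drift_bound:
  obtains C where "0 \<le> C" "\<And>t. 0 \<le> t \<Longrightarrow> t \<le> T \<Longrightarrow> (\<integral>\<^sup>+\<omega>. ennreal (norm (b t \<omega>)) \<partial>Q) \<le> ennreal (C / sqrt (T - t))"
proof -
  note ip = integrable_psi[OF \<gamma> dim]
  have p0: "\<And>y::real^'n. 0 \<le> psi \<gamma> y" using \<gamma> by simp
  have L0: "0 \<le> (LINT y|lborel. psi \<gamma> (y::real^'n))"
    by (intro integral_nonneg_AE AE_I2 p0)
  define K where "K = (2 * pi * T) powr (- (real CARD('n) / 2)) * (LINT y|lborel. psi \<gamma> (y::real^'n))"
  define c where "c = conv (heat_kernel T) (psi \<gamma>) x"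
  have c: "0 < c" unfolding c_def by (intro conv_psi_pos \<gamma> dim T)
  define D where "D = 2 powr (real CARD('n) / 2)"
  have K: "conv (heat_kernel r) (psi \<gamma>) x \<le> K" if "T \<le> r" for r
  proof -
    have "conv (heat_kernel r) (psi \<gamma>) x \<le> (2 * pi * r) powr (- (real CARD('n) / 2)) * (LINT y|lborel. psi \<gamma> (y::real^'n))"
      using that T by (intro conv_le ip p0) auto
    also have "\<dots> \<le> K"
      unfolding K_def using that T L0 by (intro mult_right_mono powr_mono2') auto
    finally show ?thesis .
  qed
  have K0: "0 \<le> K" unfolding K_def using L0 by simp
  show ?thesis
  proof (rule that[of "D * K / c"])
    show "0 \<le> D * K / c" using c K0 by (simp add: D_def)
    fix t assume t: "0 \<le> t" "t \<le> T"
    consider "t = T" | "t = 0" | "0 < t" "t < T" using t by linarith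
    then show "(\<integral>\<^sup>+\<omega>. ennreal (norm (b t \<omega>)) \<partial>Q) \<le> ennreal (D * K / c / sqrt (T - t))"
    proof cases
      \<comment> \<open>Both sides are 0: the heat kernel at time 0 vanishes, and so does a quotient
        by \<open>sqrt 0\<close>.\<close>
      case 1
      then show ?thesis by (simp add: psi_drift_def conv_def heat_kernel_def)
    next
      case 2
      have "norm (psi_drift \<gamma> T x) \<le> D * K / c / sqrt T"
      proof -
        have "norm (psi_drift \<gamma> T x) = norm (conv_grad T (psi \<gamma>) x) / c"
          using c by (simp add: psi_drift_def c_def)
        also have "\<dots> \<le> (D / sqrt T * conv (heat_kernel (2 * T)) (psi \<gamma>) x) / c"
          unfolding D_def using c T by (intro divide_right_mono norm_conv_grad_le ip p0) auto
        also have "\<dots> \<le> (D / sqrt T * K) / c"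
          using c T by (intro divide_right_mono mult_left_mono K) (auto simp: D_def)
        finally show ?thesis by (simp add: mult.commute)
      qed
      moreover have "(\<integral>\<^sup>+\<omega>. ennreal (norm (b t \<omega>)) \<partial>Q) = (\<integral>\<^sup>+\<omega>. ennreal (norm (psi_drift \<gamma> T x)) \<partial>Q)"
        unfolding 2 by (rule nn_integral_cong_AE, use AE_Q_start in eventually_elim) simp
      ultimately show ?thesis
        unfolding 2 by (simp add: Q.emeasure_space_1[simplified] ennreal_leI)
    next
      case 3
      have [measurable]: "psi_drift \<gamma> (T - t) \<in> borel_measurable (borel :: (real^'n) measure)"
        by (rule measurable_psi_drift[OF \<gamma> dim]) measurable
      have "(\<integral>\<^sup>+\<omega>. ennreal (norm (b t \<omega>)) \<partial>Q) = (\<integral>\<^sup>+z. ennreal (bridge_density \<gamma> T 0 t x z) * ennreal (norm (psi_drift \<gamma> (T - t) z)) \<partial>lborel)"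
        by (rule nn_integral_Q_coord[OF 3(1) t(2)]) measurable
      also have "\<dots> \<le> ennreal (D / sqrt (T - t) * conv (heat_kernel (2 * T - t - 0)) (psi \<gamma>) x / conv (heat_kernel (T - 0)) (psi \<gamma>) x)"
        unfolding D_def by (rule nn_integral_bridge_drift[OF \<gamma> dim 3])
      also have "\<dots> \<le> ennreal (D / sqrt (T - t) * K / c)"
        using 3 c by (intro ennreal_leI) (auto simp: c_def D_def intro!: divide_right_mono mult_left_mono K)
      finally show ?thesis by (simp add: mult_ac)
    qed
  qed
qed

section \<open>The integrated drift\<close>

lemma measurable_path_clamp:
  assumes t: "0 \<le> t" "t \<le> T" and N: "space N = space P" "\<And>u. u \<in> {0..t} \<Longrightarrow> (\<lambda>\<omega>. \<omega> u) \<in> borel_measurable N"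
  shows "(\<lambda>q. fst q (max 0 (min t (snd q))) :: real^'n) \<in> borel_measurable (N \<Otimes>\<^sub>M (lborel :: real measure))"
proof (rule measurable_continuous_at_random_time[where t=t])
  fix q assume "q \<in> space (N \<Otimes>\<^sub>M (lborel :: real measure))"
  then have "fst q \<in> space (path_borel T)"
    using N by (auto simp: space_pair_measure space_P)
  then show "continuous_on {0..t} (fst q)"
    using t by (intro path_continuous)
next
  show "(\<lambda>q. fst q u) \<in> borel_measurable (N \<Otimes>\<^sub>M (lborel :: real measure))" if "u \<in> {0..t}" for u
    by (rule measurable_compose[OF measurable_fst N(2)[OF that]])
qed (use t in auto)

text \<open>Evaluating the path at the time clamped to [0, t] changes nothing where the indicator is
  1, but makes the field jointly measurable with respect to the past of t. The integrated drift is
  adapted for this reason.\<close>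

definition drift_field :: "real \<Rightarrow> (real \<Rightarrow> real^'n) \<times> real \<Rightarrow> real^'n" where
  "drift_field t q = indicator {0..t} (snd q) *\<^sub>R psi_drift \<gamma> (T - snd q) (fst q (max 0 (min t (snd q))))"

lemma drift_field_eq: "0 \<le> t \<Longrightarrow> drift_field t (\<omega>, s) = indicator {0..t} s *\<^sub>R b s \<omega>"
  by (auto simp: drift_field_def indicator_def)

lemma measurable_drift_field:
  assumes t: "0 \<le> t" "t \<le> T" and N: "space N = space P" "\<And>u. u \<in> {0..t} \<Longrightarrow> (\<lambda>\<omega>. \<omega> u) \<in> borel_measurable N"
  shows "drift_field t \<in> borel_measurable (N \<Otimes>\<^sub>M lborel)"
  unfolding drift_field_def
  by (intro borel_measurable_scaleR measurable_psi_drift[OF \<gamma> dim] measurable_path_clamp[OF t N]) measurable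

lemma integrable_drift_field:
  assumes t: "0 \<le> t" "t \<le> T"
  shows "integrable (Q \<Otimes>\<^sub>M lborel) (drift_field t)"
proof (rule integrableI_bounded)
  interpret QL: pair_sigma_finite Q lborel ..
  show m: "drift_field t \<in> borel_measurable (Q \<Otimes>\<^sub>M lborel)"
    using t by (intro measurable_drift_field coord_Q) auto
  obtain C where C: "0 \<le> C" "\<And>t. 0 \<le> t \<Longrightarrow> t \<le> T \<Longrightarrow> (\<integral>\<^sup>+\<omega>. ennreal (norm (b t \<omega>)) \<partial>Q) \<le> ennreal (C / sqrt (T - t))"
    using drift_bound by blast
  have "(\<integral>\<^sup>+q. ennreal (norm (drift_field t q)) \<partial>(Q \<Otimes>\<^sub>M lborel)) = (\<integral>\<^sup>+s. \<integral>\<^sup>+\<omega>. ennreal (norm (drift_field t (\<omega>, s))) \<partial>Q \<partial>lborel)"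
    using m by (subst QL.nn_integral_snd[symmetric]) simp_all
  also have "\<dots> \<le> (\<integral>\<^sup>+s. indicator {0..T} s * ennreal (C / sqrt (T - s)) \<partial>lborel)"
  proof (rule nn_integral_mono)
    fix s :: real
    show "(\<integral>\<^sup>+\<omega>. ennreal (norm (drift_field t (\<omega>, s))) \<partial>Q) \<le> indicator {0..T} s * ennreal (C / sqrt (T - s))"
    proof (cases "s \<in> {0..t}")
      case True
      then show ?thesis using C(2)[of s] t by (simp add: drift_field_eq)
    next
      case False
      then show ?thesis using t by (simp add: drift_field_eq)
    qed
  qed
  also have "\<dots> < \<infinity>"
    by (rule nn_integral_inverse_sqrt[OF C(1) T])
  finally show "(\<integral>\<^sup>+q. ennreal (norm (drift_field t q)) \<partial>(Q \<Otimes>\<^sub>M lborel)) < \<infinity>" .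
qed

definition drift_int :: "real \<Rightarrow> (real \<Rightarrow> real^'n) \<Rightarrow> real^'n" where
  "drift_int t \<omega> = (LBINT s:{0..t}. b s \<omega>)"

lemma drift_int_eq: "0 \<le> t \<Longrightarrow> drift_int t \<omega> = (LINT s|lborel. drift_field t (\<omega>, s))"
  by (simp add: drift_int_def set_lebesgue_integral_def drift_field_eq)

lemma drift_int_eq': "0 \<le> t \<Longrightarrow> drift_int t = (\<lambda>\<omega>. LINT s|lborel. drift_field t (\<omega>, s))"
  by (rule ext) (rule drift_int_eq)

lemma measurable_drift_int:
  assumes t: "0 \<le> t" "t \<le> T"
  shows "drift_int t \<in> borel_measurable (path_filt T t)"
proof -
  have [measurable]: "drift_field t \<in> borel_measurable (path_filt T t \<Otimes>\<^sub>M lborel)"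
    using t by (intro measurable_drift_field measurable_path_filt_coordinate) (auto simp: space_P)
  have "(\<lambda>\<omega>. LINT s|lborel. drift_field t (\<omega>, s)) \<in> borel_measurable (path_filt T t)"
    by measurable
  then show ?thesis unfolding drift_int_eq'[OF t(1)] .
qed

lemma integrable_drift_int:
  assumes t: "0 \<le> t" "t \<le> T"
  shows "integrable Q (drift_int t)"
proof -
  interpret QL: pair_sigma_finite Q lborel ..
  show ?thesis
    unfolding drift_int_eq'[OF t(1)] by (rule QL.integrable_fst'[OF integrable_drift_field[OF t]])
qed

lemma AE_integrable_drift: "AE \<omega> in Q. set_integrable lborel {0..T} (\<lambda>s. b s \<omega>)"
proof -
  interpret QL: pair_sigma_finite Q lborel ..
  have "AE \<omega> in Q. integrable lborel (\<lambda>s. drift_field T (\<omega>, s))"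
    using QL.AE_integrable_fst'[OF integrable_drift_field[OF less_imp_le[OF T] order_refl]] .
  then show ?thesis
    unfolding set_integrable_def using T by (simp add: drift_field_eq)
qed

lemma coord_increment:
  assumes st: "0 \<le> s" "s < t" "t \<le> T" and A: "A \<in> sets (F s)"
  shows "(LINT \<omega>|Q. indicator A \<omega> *\<^sub>R \<omega> t) = (LINT \<omega>|Q. indicator A \<omega> *\<^sub>R (\<omega> s + (t - s) *\<^sub>R b s \<omega>))"
proof -
  have "(LINT \<omega>|Q. indicator A \<omega> *\<^sub>R \<omega> t) = (LINT \<omega>|Q. indicator A \<omega> *\<^sub>R (LINT z|lborel. bridge_density \<gamma> T s t (\<omega> s) z *\<^sub>R z))"
    using st by (intro Q_markov[OF st A, of "\<lambda>z. z"] integrable_coord) auto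
  then show ?thesis
    by (simp only: bridge_mean[OF \<gamma> dim st(2,3)])
qed

lemma integrable_b:
  assumes t: "0 \<le> t" "t < T"
  shows "integrable Q (b t)"
proof (rule integrableI_bounded)
  show "b t \<in> borel_measurable Q"
    using t by (intro measurable_psi_drift[OF \<gamma> dim] coord_Q) auto
  obtain C where C: "(\<integral>\<^sup>+\<omega>. ennreal (norm (b t \<omega>)) \<partial>Q) \<le> ennreal (C / sqrt (T - t))"
    using drift_bound t by (metis less_imp_le)
  then show "(\<integral>\<^sup>+\<omega>. ennreal (norm (b t \<omega>)) \<partial>Q) < \<infinity>"
    by (rule order.strict_trans1) simp
qed

lemma drift_martingale:
  assumes st: "0 \<le> s" "s < t" "t < T" and A: "A \<in> sets (F s)"
  shows "(LINT \<omega>|Q. indicator A \<omega> *\<^sub>R b t \<omega>) = (LINT \<omega>|Q. indicator A \<omega> *\<^sub>R b s \<omega>)"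
proof -
  have "(LINT \<omega>|Q. indicator A \<omega> *\<^sub>R b t \<omega>) = (LINT \<omega>|Q. indicator A \<omega> *\<^sub>R (LINT z|lborel. bridge_density \<gamma> T s t (\<omega> s) z *\<^sub>R psi_drift \<gamma> (T - t) z))"
    using st by (intro Q_markov[OF _ _ _ A, of t "psi_drift \<gamma> (T - t)"] integrable_b measurable_psi_drift[OF \<gamma> dim]) auto
  then show ?thesis
    by (simp only: bridge_drift_mean[OF \<gamma> dim st(2,3)])
qed

text \<open>By Fubini the expectation moves inside the time integral, and by the martingale property
  the expectation of the drift on A is the same for all u in (s, t]. The time u = T, where the drift
  has its default value, is a null set.\<close>

lemma drift_int_increment:
  assumes st: "0 \<le> s" "s < t" "t \<le> T" and A: "A \<in> sets (F s)"
  shows "(LINT \<omega>|Q. indicator A \<omega> *\<^sub>R (drift_int t \<omega> - drift_int s \<omega>)) = (t - s) *\<^sub>R (LINT \<omega>|Q. indicator A \<omega> *\<^sub>R b s \<omega>)"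
proof -
  interpret QL: pair_sigma_finite Q lborel ..
  have AQ [measurable]: "A \<in> sets Q" using A by (rule sets_augmented_Q)
  have t: "0 \<le> t" and sT: "s \<le> T" using st by simp_all
  let ?G = "\<lambda>q. indicator (A \<times> UNIV) q *\<^sub>R (drift_field t q - drift_field s q)"
  have iD: "integrable (Q \<Otimes>\<^sub>M lborel) (\<lambda>q. drift_field t q - drift_field s q)"
    using st by (intro Bochner_Integration.integrable_diff integrable_drift_field) auto
  have iG: "integrable (Q \<Otimes>\<^sub>M lborel) ?G"
    by (rule integrable_mult_indicator[OF _ iD]) measurable
  have "(\<lambda>(\<omega>, u). ?G (\<omega>, u)) = ?G"
    by (rule ext) (simp only: split_def prod.collapse)
  then have iG': "integrable (Q \<Otimes>\<^sub>M lborel) (\<lambda>(\<omega>, u). ?G (\<omega>, u))"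
    using iG by (simp only:)
  have Geq: "?G (\<omega>, u) = indicator {s<..t} u *\<^sub>R (indicator A \<omega> *\<^sub>R b u \<omega>)" for \<omega> u
    using st by (auto simp: drift_field_eq indicator_def)
  have "(LINT \<omega>|Q. indicator A \<omega> *\<^sub>R (drift_int t \<omega> - drift_int s \<omega>)) = (LINT \<omega>|Q. LINT u|lborel. ?G (\<omega>, u))"
  proof (rule integral_cong_AE)
    show "AE \<omega> in Q. indicator A \<omega> *\<^sub>R (drift_int t \<omega> - drift_int s \<omega>) = (LINT u|lborel. ?G (\<omega>, u))"
      using QL.AE_integrable_fst'[OF integrable_drift_field[OF t st(3)]] QL.AE_integrable_fst'[OF integrable_drift_field[OF st(1) sT]]
    proof eventually_elim
      case (elim \<omega>)
      then show ?case
        using st t by (simp add: drift_int_eq indicator_times)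
    qed
    show "(\<lambda>\<omega>. indicator A \<omega> *\<^sub>R (drift_int t \<omega> - drift_int s \<omega>)) \<in> borel_measurable Q"
      by (intro borel_measurable_scaleR borel_measurable_diff borel_measurable_indicator AQ
          borel_measurable_integrable[OF integrable_drift_int] t sT st)
    show "(\<lambda>\<omega>. LINT u|lborel. ?G (\<omega>, u)) \<in> borel_measurable Q"
      using QL.integrable_fst'[OF iG] by auto
  qed
  also have "\<dots> = (LINT u|lborel. LINT \<omega>|Q. ?G (\<omega>, u))"
    by (rule QL.Fubini_integral[OF iG', symmetric])
  also have "\<dots> = (LINT u|lborel. indicator {s<..t} u *\<^sub>R (LINT \<omega>|Q. indicator A \<omega> *\<^sub>R b u \<omega>))"
    by (simp only: Geq integral_scaleR_right)
  also have "\<dots> = (LINT u|lborel. indicator {s<..t} u *\<^sub>R (LINT \<omega>|Q. indicator A \<omega> *\<^sub>R b s \<omega>))"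
  proof (rule integral_cong_AE)
    show "AE u in lborel. indicator {s<..t} u *\<^sub>R (LINT \<omega>|Q. indicator A \<omega> *\<^sub>R b u \<omega>) = indicator {s<..t} u *\<^sub>R (LINT \<omega>|Q. indicator A \<omega> *\<^sub>R b s \<omega>)"
      using AE_lborel_singleton[of T]
    proof eventually_elim
      case (elim u)
      then show ?case
        using st drift_martingale[OF st(1) _ _ A, of u] by (cases "u \<in> {s<..t}") auto
    qed
    show "(\<lambda>u. indicator {s<..t} u *\<^sub>R (LINT \<omega>|Q. indicator A \<omega> *\<^sub>R b u \<omega>)) \<in> borel_measurable lborel"
      using borel_measurable_integrable[OF QL.integrable_snd[OF iG']] unfolding Geq integral_scaleR_right .
  qed measurable
  also have "\<dots> = (t - s) *\<^sub>R (LINT \<omega>|Q. indicator A \<omega> *\<^sub>R b s \<omega>)"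
    using st by (subst integral_scaleR_left) auto
  finally show ?thesis .
qed

section \<open>The martingale part\<close>

definition mart :: "real \<Rightarrow> (real \<Rightarrow> real^'n) \<Rightarrow> real^'n" where
  "mart t \<omega> = \<omega> t - x - drift_int t \<omega>"

lemma integrable_mart: "0 \<le> t \<Longrightarrow> t \<le> T \<Longrightarrow> integrable Q (mart t)"
  unfolding mart_def[abs_def]
  by (intro Bochner_Integration.integrable_diff integrable_coord integrable_drift_int) auto

lemma measurable_mart:
  assumes t: "0 \<le> t" "t \<le> T"
  shows "mart t \<in> borel_measurable (F t)"
proof -
  have [measurable]: "drift_int t \<in> borel_measurable (path_filt T t)" "(\<lambda>\<omega>::real \<Rightarrow> real^'n. \<omega> t) \<in> borel_measurable (path_filt T t)"
    using t by (auto intro!: measurable_drift_int measurable_path_filt_coordinate)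
  have "mart t \<in> borel_measurable (path_filt T t)"
    unfolding mart_def[abs_def] by measurable
  then show ?thesis
    by (rule measurable_mono[THEN subsetD, rotated -1]) (auto simp: path_filt_subset_augmented[THEN subsetD] space_P)
qed

text \<open>On A, the increments of X and of the integrated drift have the same expectation, that of
  (t - s) times the drift at s.\<close>

lemma mart_increment:
  assumes st: "0 \<le> s" "s \<le> t" "t \<le> T" and A: "A \<in> sets (F s)"
  shows "(LINT \<omega>|Q. indicator A \<omega> *\<^sub>R mart t \<omega>) = (LINT \<omega>|Q. indicator A \<omega> *\<^sub>R mart s \<omega>)"
proof (cases "s = t")
  case False
  then have st': "0 \<le> s" "s < t" "t \<le> T" using st by auto
  have AQ: "A \<in> sets Q" using A by (rule sets_augmented_Q)
  note ind = integrable_mult_indicator[OF AQ]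
  have i: "integrable Q (\<lambda>\<omega>. indicator A \<omega> *\<^sub>R \<omega> t)" "integrable Q (\<lambda>\<omega>. indicator A \<omega> *\<^sub>R \<omega> s)"
    "integrable Q (\<lambda>\<omega>. indicator A \<omega> *\<^sub>R (drift_int t \<omega> - drift_int s \<omega>))" "integrable Q (\<lambda>\<omega>. indicator A \<omega> *\<^sub>R b s \<omega>)"
    using st' by (auto intro!: ind integrable_coord Bochner_Integration.integrable_diff integrable_drift_int integrable_b)
  have im: "integrable Q (\<lambda>\<omega>. indicator A \<omega> *\<^sub>R mart t \<omega>)" "integrable Q (\<lambda>\<omega>. indicator A \<omega> *\<^sub>R mart s \<omega>)"
    using st' by (auto intro!: ind integrable_mart)
  have "(LINT \<omega>|Q. indicator A \<omega> *\<^sub>R mart t \<omega>) - (LINT \<omega>|Q. indicator A \<omega> *\<^sub>R mart s \<omega>) =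
    (LINT \<omega>|Q. indicator A \<omega> *\<^sub>R mart t \<omega> - indicator A \<omega> *\<^sub>R mart s \<omega>)"
    by (rule Bochner_Integration.integral_diff[OF im, symmetric])
  also have "\<dots> = (LINT \<omega>|Q. (indicator A \<omega> *\<^sub>R \<omega> t - indicator A \<omega> *\<^sub>R \<omega> s) - indicator A \<omega> *\<^sub>R (drift_int t \<omega> - drift_int s \<omega>))"
    by (intro Bochner_Integration.integral_cong refl) (simp add: mart_def algebra_simps)
  also have "\<dots> = ((LINT \<omega>|Q. indicator A \<omega> *\<^sub>R \<omega> t) - (LINT \<omega>|Q. indicator A \<omega> *\<^sub>R \<omega> s)) - (LINT \<omega>|Q. indicator A \<omega> *\<^sub>R (drift_int t \<omega> - drift_int s \<omega>))"
    using i by (simp only: Bochner_Integration.integral_diff Bochner_Integration.integrable_diff)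
  also have "(LINT \<omega>|Q. indicator A \<omega> *\<^sub>R \<omega> t) = (LINT \<omega>|Q. indicator A \<omega> *\<^sub>R \<omega> s + (t - s) *\<^sub>R (indicator A \<omega> *\<^sub>R b s \<omega>))"
    unfolding coord_increment[OF st' A] by (intro Bochner_Integration.integral_cong refl) (simp add: scaleR_add_right)
  also have "\<dots> = (LINT \<omega>|Q. indicator A \<omega> *\<^sub>R \<omega> s) + (t - s) *\<^sub>R (LINT \<omega>|Q. indicator A \<omega> *\<^sub>R b s \<omega>)"
    using i by (simp only: Bochner_Integration.integral_add integrable_scaleR_right integral_scaleR_right)
  also have "(LINT \<omega>|Q. indicator A \<omega> *\<^sub>R (drift_int t \<omega> - drift_int s \<omega>)) = (t - s) *\<^sub>R (LINT \<omega>|Q. indicator A \<omega> *\<^sub>R b s \<omega>)"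
    by (rule drift_int_increment[OF st' A])
  finally show ?thesis by simp
qed simp

theorem continuous_martingale_mart: "continuous_martingale Q F T mart"
  unfolding continuous_martingale_def
proof (intro conjI ballI)
  show "prob_space Q" by (rule Q.prob_space_axioms)
  show "filtration (space Q) F" using filtration_augmented by simp
  fix t assume t: "t \<in> {0..T}"
  then show "subalgebra Q (F t)" "mart t \<in> borel_measurable (F t)" "integrable Q (mart t)"
    by (auto intro: subalgebra_Q measurable_mart integrable_mart)
next
  fix s t and e :: "real^'n" assume s: "s \<in> {0..T}" and t: "t \<in> {s..T}" and e: "e \<in> Basis"
  have st: "0 \<le> s" "s \<le> t" "t \<le> T" using s t by auto
  interpret S: finite_measure_subalgebra Q "F s"
    by unfold_locales (rule subalgebra_Q)
  show "AE \<omega> in Q. real_cond_exp Q (F s) (\<lambda>\<omega>. mart t \<omega> \<bullet> e) \<omega> = mart s \<omega> \<bullet> e"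
  proof (rule S.real_cond_exp_charact)
    have i: "integrable Q (mart t)" "integrable Q (mart s)" using st by (auto intro: integrable_mart)
    then show "integrable Q (\<lambda>\<omega>. mart t \<omega> \<bullet> e)" "integrable Q (\<lambda>\<omega>. mart s \<omega> \<bullet> e)"
      by (auto intro: integrable_inner_left)
    have "mart s \<in> borel_measurable (F s)" using st by (intro measurable_mart) auto
    then show "(\<lambda>\<omega>. mart s \<omega> \<bullet> e) \<in> borel_measurable (F s)" by measurable
    fix A assume A: "A \<in> sets (F s)"
    have AQ: "A \<in> sets Q" using A by (rule sets_augmented_Q)
    have "(LINT \<omega>:A|Q. mart r \<omega> \<bullet> e) = (LINT \<omega>|Q. indicator A \<omega> *\<^sub>R mart r \<omega>) \<bullet> e" if "integrable Q (mart r)" for r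
      unfolding set_lebesgue_integral_def
      by (subst integral_inner_left[symmetric]) (auto intro: integrable_mult_indicator[OF AQ that])
    then show "(LINT \<omega>:A|Q. mart t \<omega> \<bullet> e) = (LINT \<omega>:A|Q. mart s \<omega> \<bullet> e)"
      using i mart_increment[OF st A] by simp
  qed
next
  \<comment> \<open>Almost every path has an integrable drift, and then the indefinite integral is
    continuous up to T in spite of the singularity there.\<close>
  show "AE \<omega> in Q. continuous_on {0..T} (\<lambda>t. mart t \<omega>)"
    using AE_integrable_drift AE_space
  proof eventually_elim
    case (elim \<omega>)
    have \<omega>: "continuous_on {0..T} \<omega>"
      using elim(2) by (intro path_continuous[of _ T]) (auto simp: space_P)
    have hk: "drift_int t \<omega> = integral {0..t} (\<lambda>s. b s \<omega>)" if "t \<in> {0..T}" for t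
    proof -
      have "set_integrable lborel {0..t} (\<lambda>s. b s \<omega>)"
        using that by (intro set_integrable_subset[OF elim(1)]) auto
      then show ?thesis
        unfolding drift_int_def by (rule set_borel_integral_eq_integral(2))
    qed
    have "continuous_on {0..T} (\<lambda>t. integral {0..t} (\<lambda>s. b s \<omega>))"
      by (intro indefinite_integral_continuous_1 set_borel_integral_eq_integral(1) elim(1))
    then have "continuous_on {0..T} (\<lambda>t. drift_int t \<omega>)"
      by (rule continuous_on_eq) (simp add: hk)
    then show "continuous_on {0..T} (\<lambda>t. mart t \<omega>)"
      unfolding mart_def using \<omega> by (intro continuous_intros)
  qed
qed

theorem semimartingale_decomposition:
  "\<exists>M. continuous_martingale Q F T M \<and>
    (AE \<omega> in Q. set_integrable lborel {0..T} (\<lambda>s. reg_drift \<gamma> (T - s) (\<omega> s)) \<and>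
       (\<forall>t \<in> {0..T}. \<omega> t = x + (LBINT s:{0..t}. reg_drift \<gamma> (T - s) (\<omega> s)) + M t \<omega>))"
proof (intro exI[of _ mart] conjI continuous_martingale_mart)
  have cong: "indicator {0..t} s *\<^sub>R reg_drift \<gamma> (T - s) (\<omega> s) = indicator {0..t} s *\<^sub>R b s \<omega>" if "t \<le> T" for s t \<omega>
    using that by (auto simp: indicator_def reg_drift_eq[OF \<gamma> dim])
  show "AE \<omega> in Q. set_integrable lborel {0..T} (\<lambda>s. reg_drift \<gamma> (T - s) (\<omega> s)) \<and>
       (\<forall>t \<in> {0..T}. \<omega> t = x + (LBINT s:{0..t}. reg_drift \<gamma> (T - s) (\<omega> s)) + mart t \<omega>)"
    using AE_integrable_drift
  proof eventually_elim
    case (elim \<omega>)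
    have "set_integrable lborel {0..T} (\<lambda>s. reg_drift \<gamma> (T - s) (\<omega> s))"
      using elim unfolding set_integrable_def cong[OF order_refl] .
    moreover have "(LBINT s:{0..t}. reg_drift \<gamma> (T - s) (\<omega> s)) = drift_int t \<omega>" if "t \<in> {0..T}" for t
      using that unfolding drift_int_def set_lebesgue_integral_def by (simp add: cong)
    ultimately show ?case by (simp add: mart_def)
  qed
qed

end

section \<open>Optional sampling\<close>

lemma stopped_path_in_space:
  assumes \<omega>: "\<omega> \<in> space (path_borel T)" and r: "\<rho> \<omega> \<in> {0..T}"
  shows "stopped_path T \<rho> \<omega> \<in> space (path_borel T :: (real \<Rightarrow> real^'n) measure)"
proof -
  have "continuous_on {0..T} (\<lambda>t. \<omega> (min t (\<rho> \<omega>)))"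
    using r by (intro continuous_on_compose2[OF path_continuous[OF \<omega> order_refl]] continuous_intros) auto
  then have "continuous_on {0..T} (stopped_path T \<rho> \<omega>)"
    by (rule continuous_on_eq) (simp add: stopped_path_def)
  then show ?thesis
    unfolding space_path_borel by (auto simp: stopped_path_def)
qed

text \<open>Expresses \<rho> < \<tau> through the stopped path alone, which makes it an event before
  \<rho>.\<close>

lemma stopped_path_alive_iff:
  fixes \<omega> :: "real \<Rightarrow> real^'n"
  assumes \<omega>: "\<omega> \<in> space (path_borel T)" and r: "\<rho> \<omega> \<in> {0..T}"
  shows "stopped_path T \<rho> \<omega> \<in> alive T T \<longleftrightarrow> \<omega> \<in> alive T (\<rho> \<omega>)"
proof -
  have "(\<forall>u\<in>{0..T}. \<omega> (min u (\<rho> \<omega>)) \<noteq> 0) \<longleftrightarrow> (\<forall>u\<in>{0..\<rho> \<omega>}. \<omega> u \<noteq> 0)"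
  proof safe
    fix u assume *: "\<forall>u\<in>{0..T}. \<omega> (min u (\<rho> \<omega>)) \<noteq> 0" "u \<in> {0..\<rho> \<omega>}" "\<omega> u = 0"
    then have "u \<in> {0..T}" using r by auto
    with *(1) have "\<omega> (min u (\<rho> \<omega>)) \<noteq> 0" by blast
    then show False using * by (simp add: min_def)
  next
    fix u assume *: "\<forall>u\<in>{0..\<rho> \<omega>}. \<omega> u \<noteq> 0" "u \<in> {0..T}" "\<omega> (min u (\<rho> \<omega>)) = 0"
    then show False using r by auto
  qed
  then show ?thesis
    using \<omega> stopped_path_in_space[of \<omega> T \<rho>] r by (auto simp: alive_def stopped_path_def)
qed

lemma surv_tendsto:
  fixes y :: "nat \<Rightarrow> real^'n"
  assumes g: "0 < \<gamma>" and d: "CARD('n) \<in> {2, 3}" and r: "r \<longlonglongrightarrow> r0" "0 < r0" and y: "y \<longlonglongrightarrow> y0" "y0 \<noteq> 0"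
  shows "(\<lambda>n. surv \<gamma> (r n) (y n)) \<longlonglongrightarrow> surv \<gamma> r0 y0"
proof -
  have lim: "(\<lambda>n. exp (- lam CARD('n) \<gamma> * r n) * conv (heat_kernel (r n)) (psi \<gamma>) (y n) / psi \<gamma> (y n)) \<longlonglongrightarrow>
    exp (- lam CARD('n) \<gamma> * r0) * conv (heat_kernel r0) (psi \<gamma>) y0 / psi \<gamma> y0"
    using psi_pos[OF g y(2)] by (intro tendsto_intros tendsto_conv[OF integrable_psi[OF g d]] tendsto_psi[OF g] r y) auto
  have "\<forall>\<^sub>F n in sequentially. y n \<noteq> 0"
    using y by (rule tendsto_imp_eventually_ne)
  moreover have "\<forall>\<^sub>F n in sequentially. 0 < r n"
    using r by (intro order_tendstoD) auto
  ultimately have "\<forall>\<^sub>F n in sequentially. exp (- lam CARD('n) \<gamma> * r n) * conv (heat_kernel (r n)) (psi \<gamma>) (y n) / psi \<gamma> (y n) = surv \<gamma> (r n) (y n)"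
    by eventually_elim (simp add: surv_def)
  with lim have "(\<lambda>n. surv \<gamma> (r n) (y n)) \<longlonglongrightarrow> exp (- lam CARD('n) \<gamma> * r0) * conv (heat_kernel r0) (psi \<gamma>) y0 / psi \<gamma> y0"
    by (rule Lim_transform_eventually)
  then show ?thesis using r y by (simp add: surv_def)
qed

context point_interaction
begin

definition surv_mart :: "real \<Rightarrow> (real \<Rightarrow> real^'n) \<Rightarrow> real" where
  "surv_mart t \<omega> = indicator (alive T t) \<omega> * surv \<gamma> (T - t) (\<omega> t)"

text \<open>A path that has hit 0 by time s stays excluded, and one that is alive at s stays nonzero
  for a while, so the indicator is constant just after s. The rest is the joint continuity of S at
  positive remaining time, hence s < T.\<close>

lemma surv_mart_right_continuous:
  assumes \<omega>: "\<omega> \<in> space P" and r: "r \<longlonglongrightarrow> s" "\<And>n. s \<le> r n" "\<And>n. r n \<le> T" and s: "0 \<le> s" "s < T"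
  shows "(\<lambda>n. surv_mart (r n) \<omega>) \<longlonglongrightarrow> surv_mart s \<omega>"
proof (cases "\<omega> \<in> alive T s")
  case False
  then have "\<omega> \<notin> alive T (r n)" for n using alive_antimono[OF r(2), of T n] by auto
  then show ?thesis using False by (simp add: surv_mart_def)
next
  case True
  have cont: "continuous_on {0..T} \<omega>" using \<omega> by (intro path_continuous) (auto simp: space_P)
  have \<omega>s: "\<omega> s \<noteq> 0" using True s by (auto simp: alive_def)
  have \<omega>r: "(\<lambda>n. \<omega> (r n)) \<longlonglongrightarrow> \<omega> s"
    using r s by (intro continuous_on_tendsto_compose[OF cont r(1)]) (auto intro!: always_eventually intro: order_trans)
  have lim: "(\<lambda>n. surv \<gamma> (T - r n) (\<omega> (r n))) \<longlonglongrightarrow> surv \<gamma> (T - s) (\<omega> s)"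
    using s by (intro surv_tendsto \<gamma> dim \<omega>r \<omega>s tendsto_diff tendsto_const r(1)) auto
  have "0 < norm (\<omega> s)" using \<omega>s by simp
  then obtain d where d: "0 < d" "\<And>a. a \<in> {0..T} \<Longrightarrow> dist a s < d \<Longrightarrow> dist (\<omega> a) (\<omega> s) < norm (\<omega> s)"
    using cont s unfolding continuous_on_iff by (metis atLeastAtMost_iff less_imp_le)
  have "\<forall>\<^sub>F n in sequentially. r n < s + d"
    using d(1) by (intro order_tendstoD[OF r(1)]) simp
  then have "\<forall>\<^sub>F n in sequentially. surv \<gamma> (T - r n) (\<omega> (r n)) = surv_mart (r n) \<omega>"
  proof eventually_elim
    case (elim n)
    have "\<omega> u \<noteq> 0" if u: "u \<in> {0..r n}" for u
    proof (cases "u \<le> s")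
      case True
      then show ?thesis using \<open>\<omega> \<in> alive T s\<close> u by (auto simp: alive_def)
    next
      case False
      have "u \<in> {0..T}" "dist u s < d"
        using u False elim r(3)[of n] by (auto simp: dist_real_def)
      from d(2)[OF this] show ?thesis by (auto simp: dist_norm)
    qed
    then have "\<omega> \<in> alive T (r n)" using \<omega> by (simp add: alive_def space_P)
    then show ?case by (simp add: surv_mart_def)
  qed
  with lim have "(\<lambda>n. surv_mart (r n) \<omega>) \<longlonglongrightarrow> surv \<gamma> (T - s) (\<omega> s)"
    by (rule Lim_transform_eventually)
  then show ?thesis using True by (simp add: surv_mart_def)
qed

lemma alive_T_surv_mart:
  assumes t: "0 \<le> t" "t \<le> T" and A: "A \<in> sets (F t)"
  shows "(\<integral>\<^sup>+\<omega>. indicator A \<omega> * indicator (alive T T) \<omega> \<partial>P) = (\<integral>\<^sup>+\<omega>. indicator A \<omega> * ennreal (surv_mart t \<omega>) \<partial>P)"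
proof -
  have "(\<integral>\<^sup>+\<omega>. indicator A \<omega> * indicator (alive T T) \<omega> \<partial>P) = (\<integral>\<^sup>+\<omega>. indicator A \<omega> * (indicator (alive T T) \<omega> * 1) \<partial>P)"
    by simp
  also have "\<dots> = (\<integral>\<^sup>+\<omega>. indicator A \<omega> * (indicator (alive T t) \<omega> * (1 * ennreal (surv \<gamma> (T - t) (\<omega> t)))) \<partial>P)"
    by (rule alive_T_augmented[OF t A, where u="\<lambda>_. 1"]) simp
  also have "\<dots> = (\<integral>\<^sup>+\<omega>. indicator A \<omega> * ennreal (surv_mart t \<omega>) \<partial>P)"
    by (intro nn_integral_cong) (auto simp: surv_mart_def indicator_def)
  finally show ?thesis .
qed

lemma measurable_surv_mart: "0 \<le> t \<Longrightarrow> t \<le> T \<Longrightarrow> surv_mart t \<in> borel_measurable P"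
  unfolding surv_mart_def[abs_def]
  by (intro borel_measurable_times borel_measurable_indicator alive_P measurable_surv_coord) auto

section \<open>Stopping times and the events before them\<close>

context
  fixes \<rho> :: "(real \<Rightarrow> real^'n) \<Rightarrow> real"
  assumes \<rho>: "stopping_time F \<rho>" and \<rho>_range: "\<And>\<omega>. \<omega> \<in> space P \<Longrightarrow> \<rho> \<omega> \<in> {0..T}"
begin

interpretation fF: filtration "space P" F
  by (rule filtration_augmented)

abbreviation "G \<equiv> filtration.pre_sigma (space P) F \<rho>"

lemma space_G: "space G = space P"
  by (rule fF.space_pre_sigma)

text \<open>As \<rho> is at most T, an event before \<rho> is known at time T.\<close>

lemma G_completion: "A \<in> sets G \<Longrightarrow> A \<in> sets (completion P)"
proof -
  assume A: "A \<in> sets G"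
  have "{\<omega> \<in> A. \<rho> \<omega> \<le> T} \<in> sets (F T)"
    by (rule fF.sets_pre_sigmaD[OF \<rho> A])
  moreover have "{\<omega> \<in> A. \<rho> \<omega> \<le> T} = A"
    using sets.sets_into_space[OF A] \<rho>_range by (auto simp: space_G)
  ultimately show ?thesis
    using augmented_subset_completion by auto
qed

lemma measurable_G_completion:
  assumes f: "f \<in> measurable G N"
  shows "f \<in> measurable (completion P) N"
proof (rule measurableI)
  fix \<omega> assume "\<omega> \<in> space (completion P)"
  then have "\<omega> \<in> space G" by (simp only: space_G space_completion)
  then show "f \<omega> \<in> space N" by (rule measurable_space[OF f])
next
  fix A assume "A \<in> sets N"
  then have "f -` A \<inter> space G \<in> sets (completion P)"
    by (intro G_completion measurable_sets[OF f])
  then show "f -` A \<inter> space (completion P) \<in> sets (completion P)"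
    by (simp only: space_G space_completion)
qed

lemma measurable_rho: "\<rho> \<in> borel_measurable G"
  by (rule fF.measurable_stopping_time_pre_sigma[OF \<rho>])

lemma measurable_min_rho:
  assumes "0 \<le> t"
  shows "(\<lambda>\<omega>. min (\<rho> \<omega>) t) \<in> borel_measurable (F t)"
proof (rule borel_measurableI_le)
  fix c
  show "{\<omega> \<in> space (F t). min (\<rho> \<omega>) t \<le> c} \<in> sets (F t)"
  proof (cases "t \<le> c")
    case True
    then have "{\<omega> \<in> space (F t). min (\<rho> \<omega>) t \<le> c} = space (F t)" by auto
    then show ?thesis by (metis sets.top)
  next
    case False
    then have "{\<omega> \<in> space (F t). min (\<rho> \<omega>) t \<le> c} = {\<omega> \<in> space (F c). \<rho> \<omega> \<le> c}" by auto
    also have "\<dots> \<in> sets (F c)" using stopping_timeD[OF \<rho>, of c] by (simp add: pred_def)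
    also have "sets (F c) \<subseteq> sets (F t)" using False by (intro augmented_mono) simp
    finally show ?thesis .
  qed
qed

text \<open>On the event \<rho> <= t, the stopped coordinate is the path at a random time in [0, t]
  that is itself known at t, so \<open>measurable_continuous_at_random_time\<close> applies.\<close>

lemma measurable_stopped_coord:
  assumes u: "u \<in> {0..T}"
  shows "(\<lambda>\<omega>. \<omega> (min u (\<rho> \<omega>))) \<in> borel_measurable G"
proof (rule measurableI)
  fix B :: "(real^'n) set" assume B: "B \<in> sets borel"
  show "(\<lambda>\<omega>. \<omega> (min u (\<rho> \<omega>))) -` B \<inter> space G \<in> sets G"
  proof (rule fF.sets_pre_sigmaI[OF \<rho>])
    fix t
    show "{\<omega> \<in> (\<lambda>\<omega>. \<omega> (min u (\<rho> \<omega>))) -` B \<inter> space G. \<rho> \<omega> \<le> t} \<in> sets (F t)"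
    proof (cases "0 \<le> t")
      case False
      then have "{\<omega> \<in> (\<lambda>\<omega>. \<omega> (min u (\<rho> \<omega>))) -` B \<inter> space G. \<rho> \<omega> \<le> t} = {}"
        using \<rho>_range by (force simp: space_G)
      then show ?thesis by (simp only: sets.empty_sets)
    next
      case t: True
      \<comment> \<open>The indices of the filtration go beyond T while the paths do not.\<close>
      let ?t = "min t T"
      let ?\<tau> = "\<lambda>\<omega>. min u (min (\<rho> \<omega>) ?t)"
      have t0: "0 \<le> ?t" using t T by simp
      have "(\<lambda>\<omega>. \<omega> (?\<tau> \<omega>)) \<in> borel_measurable (F t)"
      proof (rule measurable_continuous_at_random_time[where t="?t"])
        show "continuous_on {0..?t} \<omega>" if "\<omega> \<in> space (F t)" for \<omega>
          using that by (intro path_continuous[of _ T]) (auto simp: space_P)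
        show "(\<lambda>\<omega>. \<omega> v) \<in> borel_measurable (F t)" if "v \<in> {0..?t}" for v
        proof (rule measurable_mono[THEN subsetD, of borel borel])
          show "(\<lambda>\<omega>. \<omega> v) \<in> borel_measurable (path_filt T t)"
            using that by (intro measurable_path_filt_coordinate) auto
        qed (auto simp: path_filt_subset_augmented[THEN subsetD] space_P)
        have "sets (F ?t) \<subseteq> sets (F t)"
          by (intro augmented_mono) simp
        then have "(\<lambda>\<omega>. min (\<rho> \<omega>) ?t) \<in> borel_measurable (F t)"
          using measurable_mono[of borel borel "F ?t" "F t"] measurable_min_rho[OF t0] by auto
        then show "?\<tau> \<in> borel_measurable (F t)"
          by measurable
        show "?\<tau> \<omega> \<in> {0..?t}" if "\<omega> \<in> space (F t)" for \<omega>
          using that \<rho>_range[of \<omega>] u t0 by auto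
      qed
      then have m: "(\<lambda>\<omega>. \<omega> (?\<tau> \<omega>)) -` B \<inter> space (F t) \<in> sets (F t)"
        using B by (rule measurable_sets)
      have "{\<omega> \<in> space (F t). \<rho> \<omega> \<le> t} \<in> sets (F t)"
        using stopping_timeD[OF \<rho>, of t] by (simp add: pred_def)
      with m have "((\<lambda>\<omega>. \<omega> (?\<tau> \<omega>)) -` B \<inter> space (F t)) \<inter> {\<omega> \<in> space (F t). \<rho> \<omega> \<le> t} \<in> sets (F t)"
        by (rule sets.Int)
      also have "((\<lambda>\<omega>. \<omega> (?\<tau> \<omega>)) -` B \<inter> space (F t)) \<inter> {\<omega> \<in> space (F t). \<rho> \<omega> \<le> t} =
        {\<omega> \<in> (\<lambda>\<omega>. \<omega> (min u (\<rho> \<omega>))) -` B \<inter> space G. \<rho> \<omega> \<le> t}"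
      proof -
        have "?\<tau> \<omega> = min u (\<rho> \<omega>)" if "\<omega> \<in> space P" "\<rho> \<omega> \<le> t" for \<omega>
          using that \<rho>_range[of \<omega>] by auto
        then show ?thesis by (auto simp: space_G)
      qed
      finally show ?thesis .
    qed
  qed
qed simp

lemma measurable_stopped_path: "stopped_path T \<rho> \<in> measurable G (path_borel T)"
proof (rule measurable_path_borel[OF T])
  show "stopped_path T \<rho> \<omega> \<in> space (path_borel T)" if "\<omega> \<in> space G" for \<omega>
    using that \<rho>_range[of \<omega>] unfolding space_G by (intro stopped_path_in_space) (simp_all add: space_P)
  show "(\<lambda>\<omega>. stopped_path T \<rho> \<omega> s) \<in> borel_measurable G" if "s \<in> {0..T}" for s
    using measurable_stopped_coord[OF that] that by (simp add: stopped_path_def)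
qed

definition before_hit :: "(real \<Rightarrow> real^'n) set" where
  "before_hit = {\<omega> \<in> space P. \<omega> \<in> alive T (\<rho> \<omega>)}"

lemma before_hit_eq: "{\<omega> \<in> space P. ereal (\<rho> \<omega>) < hit_time T \<omega>} = before_hit"
  unfolding before_hit_def using less_hit_time_iff \<rho>_range by (auto simp: space_P)

lemma before_hit_G: "before_hit \<in> sets G"
proof -
  have "alive T T \<in> sets (path_borel T :: (real \<Rightarrow> real^'n) measure)"
    using alive_T_P by (simp add: sets_P)
  from measurable_sets[OF measurable_stopped_path this]
  have "stopped_path T \<rho> -` alive T T \<inter> space G \<in> sets G" .
  also have "stopped_path T \<rho> -` alive T T \<inter> space G = before_hit"
    unfolding space_G before_hit_def using stopped_path_alive_iff[of _ T \<rho>] \<rho>_range by (auto simp: space_P)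
  finally show ?thesis .
qed

definition surv_at :: "(real \<Rightarrow> real^'n) \<Rightarrow> real" where
  "surv_at \<omega> = surv \<gamma> (T - \<rho> \<omega>) (\<omega> (\<rho> \<omega>))"

lemma surv_at_G: "surv_at \<in> borel_measurable G"
proof -
  have "(\<lambda>\<omega>. \<omega> (\<rho> \<omega>)) \<in> borel_measurable G"
  proof (rule measurable_cong[THEN iffD1])
    show "(\<lambda>\<omega>. \<omega> (min T (\<rho> \<omega>))) \<in> borel_measurable G"
      using T by (intro measurable_stopped_coord) auto
    show "\<omega> (min T (\<rho> \<omega>)) = \<omega> (\<rho> \<omega>)" if "\<omega> \<in> space G" for \<omega>
    proof -
      have "min T (\<rho> \<omega>) = \<rho> \<omega>" using \<rho>_range[of \<omega>] that by (simp add: space_G)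
      then show ?thesis by simp
    qed
  qed
  then show ?thesis
    unfolding surv_at_def[abs_def] by (intro measurable_surv[OF \<gamma> dim] borel_measurable_diff measurable_rho) auto
qed

lemma surv_at_nonneg: "\<omega> \<in> space P \<Longrightarrow> 0 \<le> surv_at \<omega>"
  unfolding surv_at_def using \<rho>_range[of \<omega>] by (intro surv_nonneg \<gamma> dim) auto

lemma surv_at_pos: "\<omega> \<in> before_hit \<Longrightarrow> 0 < surv_at \<omega>"
  unfolding surv_at_def before_hit_def using \<rho>_range[of \<omega>] by (intro surv_pos \<gamma> dim) (auto simp: alive_def)

lemma surv_mart_rho: "\<omega> \<in> space P \<Longrightarrow> surv_mart (\<rho> \<omega>) \<omega> = indicator before_hit \<omega> * surv_at \<omega>"
  by (auto simp: surv_mart_def surv_at_def before_hit_def indicator_def)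

text \<open>The paths of \<open>surv_mart\<close> are right-continuous on \<open>[0, T)\<close>, so \<open>\<rho>\<close> may be approximated from above by
  stopping times with values in a grid.\<close>

lemma optional_sampling:
  assumes A: "A \<in> sets G"
  shows "(\<integral>\<^sup>+\<omega>. indicator A \<omega> * indicator (alive T T) \<omega> \<partial>completion P) =
    (\<integral>\<^sup>+\<omega>. indicator A \<omega> * (indicator before_hit \<omega> * ennreal (surv_at \<omega>)) \<partial>completion P)"
proof -
  define k where "k = (\<lambda>n \<omega>. nat \<lfloor>\<rho> \<omega> * real (Suc n) / T\<rfloor>)"
  \<comment> \<open>The right end of the grid cell that contains \<rho>, hence an approximation from
    above. The cap takes effect only at \<rho> = T.\<close>
  define g where "g = (\<lambda>n (k::nat). min T (real (Suc k) * T / real (Suc n)))"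
  have g0: "0 \<le> g n j" "g n j \<le> T" for n j using T by (auto simp: g_def)
  have k: "real (k n \<omega>) \<le> \<rho> \<omega> * real (Suc n) / T" "\<rho> \<omega> * real (Suc n) / T < real (Suc (k n \<omega>))"
    if "\<omega> \<in> space P" for n \<omega>
  proof -
    have "0 \<le> \<rho> \<omega> * real (Suc n) / T" using \<rho>_range[OF that] T by auto
    then have "real (k n \<omega>) = real_of_int \<lfloor>\<rho> \<omega> * real (Suc n) / T\<rfloor>"
      unfolding k_def by (subst of_nat_nat) auto
    then show "real (k n \<omega>) \<le> \<rho> \<omega> * real (Suc n) / T" "\<rho> \<omega> * real (Suc n) / T < real (Suc (k n \<omega>))"
      by (simp_all del: of_nat_Suc, linarith+)
  qed
  have gk: "\<rho> \<omega> \<le> g n (k n \<omega>)" "g n (k n \<omega>) \<le> \<rho> \<omega> + T / real (Suc n)" if \<omega>: "\<omega> \<in> space P" for n \<omega>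
  proof -
    have "\<rho> \<omega> \<le> real (Suc (k n \<omega>)) * T / real (Suc n)"
      using k(2)[OF \<omega>, of n] T by (simp add: field_simps del: of_nat_Suc)
    then show "\<rho> \<omega> \<le> g n (k n \<omega>)" using \<rho>_range[OF \<omega>] by (simp add: g_def)
    have "real (k n \<omega>) * T / real (Suc n) \<le> \<rho> \<omega>"
      using k(1)[OF \<omega>, of n] T by (simp add: field_simps del: of_nat_Suc)
    moreover have "real (Suc (k n \<omega>)) * T / real (Suc n) = real (k n \<omega>) * T / real (Suc n) + T / real (Suc n)"
      by (simp add: add_divide_distrib distrib_right)
    ultimately show "g n (k n \<omega>) \<le> \<rho> \<omega> + T / real (Suc n)"
      unfolding g_def by (simp del: of_nat_Suc)
  qed
  have kle: "k n \<omega> \<le> Suc n" if \<omega>: "\<omega> \<in> space P" for n \<omega>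
  proof -
    have "\<rho> \<omega> * real (Suc n) / T \<le> real (Suc n)"
      using \<rho>_range[OF \<omega>] T by (simp add: field_simps del: of_nat_Suc)
    then show ?thesis using k(1)[OF \<omega>, of n] by linarith
  qed
  have km: "k n \<in> measurable G (count_space UNIV)" for n
    unfolding k_def using measurable_rho by measurable
  define B where "B = (\<lambda>n j. {\<omega> \<in> A. k n \<omega> = j})"
  have AP: "A \<subseteq> space P" using sets.sets_into_space[OF A] by (simp add: space_G)
  have BG: "B n j \<in> sets G" for n j
  proof -
    have "B n j = A \<inter> (k n -` {j} \<inter> space G)" using AP by (auto simp: B_def space_G)
    then show ?thesis using A measurable_sets[OF km, of "{j}"] by simp
  qed
  \<comment> \<open>On \<open>B n j\<close> the stopping time is at most the grid point, so this
    event is known at that deterministic time and the identity for fixed times applies.\<close>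
  have BF: "B n j \<in> sets (F (g n j))" for n j
  proof -
    have "{\<omega> \<in> B n j. \<rho> \<omega> \<le> g n j} = B n j" using gk(1) AP by (auto simp: B_def)
    then show ?thesis using fF.sets_pre_sigmaD[OF \<rho> BG, of n j "g n j"] by simp
  qed
  have Am: "A \<in> sets (completion P)" and Bm: "B n j \<in> sets (completion P)" for n j
    using A BG by (auto intro: G_completion)
  have split: "(\<integral>\<^sup>+\<omega>. indicator A \<omega> * h \<omega> (k n \<omega>) \<partial>completion P) = (\<Sum>j\<le>Suc n. \<integral>\<^sup>+\<omega>. indicator (B n j) \<omega> * h \<omega> j \<partial>completion P)"
    if h: "\<And>j. (\<lambda>\<omega>. h \<omega> j) \<in> borel_measurable (completion P)" for h :: "(real \<Rightarrow> real^'n) \<Rightarrow> nat \<Rightarrow> ennreal" and n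
  proof -
    have "(\<integral>\<^sup>+\<omega>. indicator A \<omega> * h \<omega> (k n \<omega>) \<partial>completion P) = (\<integral>\<^sup>+\<omega>. (\<Sum>j\<le>Suc n. indicator (B n j) \<omega> * h \<omega> j) \<partial>completion P)"
    proof (rule nn_integral_cong)
      fix \<omega> assume "\<omega> \<in> space (completion P)"
      then have \<omega>: "\<omega> \<in> space P" by simp
      have "(\<Sum>j\<le>Suc n. indicator (B n j) \<omega> * h \<omega> j) = (\<Sum>j\<in>{..Suc n}. if j = k n \<omega> then indicator A \<omega> * h \<omega> (k n \<omega>) else 0)"
        by (intro sum.cong refl) (auto simp: B_def indicator_def)
      also have "\<dots> = indicator A \<omega> * h \<omega> (k n \<omega>)"
        using kle[OF \<omega>, of n] by (subst sum.delta) auto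
      finally show "indicator A \<omega> * h \<omega> (k n \<omega>) = (\<Sum>j\<le>Suc n. indicator (B n j) \<omega> * h \<omega> j)" ..
    qed
    also have "\<dots> = (\<Sum>j\<le>Suc n. \<integral>\<^sup>+\<omega>. indicator (B n j) \<omega> * h \<omega> j \<partial>completion P)"
      using h Bm by (intro nn_integral_sum borel_measurable_times_ennreal borel_measurable_indicator) auto
    finally show ?thesis .
  qed
  have mm: "(\<lambda>\<omega>. ennreal (surv_mart (g n j) \<omega>)) \<in> borel_measurable (completion P)" for n j
    using g0 by (intro measurable_compose[OF measurable_completion[OF measurable_surv_mart] measurable_ennreal]) auto
  have discrete: "(\<integral>\<^sup>+\<omega>. indicator A \<omega> * indicator (alive T T) \<omega> \<partial>completion P) =
     (\<integral>\<^sup>+\<omega>. indicator A \<omega> * ennreal (surv_mart (g n (k n \<omega>)) \<omega>) \<partial>completion P)" for n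
  proof -
    have "(\<integral>\<^sup>+\<omega>. indicator A \<omega> * indicator (alive T T) \<omega> \<partial>completion P) = (\<Sum>j\<le>Suc n. \<integral>\<^sup>+\<omega>. indicator (B n j) \<omega> * indicator (alive T T) \<omega> \<partial>completion P)"
      by (rule split[of "\<lambda>\<omega> _. indicator (alive T T) \<omega>"]) (intro borel_measurable_indicator sets_completionI_sets alive_T_P)
    also have "\<dots> = (\<Sum>j\<le>Suc n. \<integral>\<^sup>+\<omega>. indicator (B n j) \<omega> * ennreal (surv_mart (g n j) \<omega>) \<partial>completion P)"
      unfolding nn_integral_completion by (intro sum.cong refl alive_T_surv_mart g0 BF)
    also have "\<dots> = (\<integral>\<^sup>+\<omega>. indicator A \<omega> * ennreal (surv_mart (g n (k n \<omega>)) \<omega>) \<partial>completion P)"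
      by (rule split[of "\<lambda>\<omega> j. ennreal (surv_mart (g n j) \<omega>)", symmetric]) (rule mm)
    finally show ?thesis .
  qed
  have lim: "(\<lambda>n. indicator A \<omega> * ennreal (surv_mart (g n (k n \<omega>)) \<omega>)) \<longlonglongrightarrow> indicator A \<omega> * ennreal (surv_mart (\<rho> \<omega>) \<omega>)"
    if \<omega>: "\<omega> \<in> space P" for \<omega>
  \<comment> \<open>If \<rho> = T, the approximations equal T, so right-continuity is used before T
    only.\<close>
  proof (cases "\<rho> \<omega> = T")
    case True
    then have "g n (k n \<omega>) = T" for n using gk(1)[OF \<omega>, of n] g0(2)[of n "k n \<omega>"] by simp
    then show ?thesis using True by simp
  next
    case False
    have "(\<lambda>n. g n (k n \<omega>)) \<longlonglongrightarrow> \<rho> \<omega>"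
    proof (rule tendsto_sandwich)
      show "\<forall>\<^sub>F n in sequentially. \<rho> \<omega> \<le> g n (k n \<omega>)" "\<forall>\<^sub>F n in sequentially. g n (k n \<omega>) \<le> \<rho> \<omega> + T / real (Suc n)"
        using gk[OF \<omega>] by (auto simp del: of_nat_Suc)
      have "(\<lambda>n. \<rho> \<omega> + T / real (Suc n)) \<longlonglongrightarrow> \<rho> \<omega> + 0"
        by (intro tendsto_intros LIMSEQ_Suc[OF lim_const_over_n])
      then show "(\<lambda>n. \<rho> \<omega> + T / real (Suc n)) \<longlonglongrightarrow> \<rho> \<omega>" by simp
    qed simp
    then have "(\<lambda>n. surv_mart (g n (k n \<omega>)) \<omega>) \<longlonglongrightarrow> surv_mart (\<rho> \<omega>) \<omega>"
      using False \<rho>_range[OF \<omega>] gk(1)[OF \<omega>] g0 by (intro surv_mart_right_continuous \<omega>) auto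
    then have "(\<lambda>n. ennreal (surv_mart (g n (k n \<omega>)) \<omega>)) \<longlonglongrightarrow> ennreal (surv_mart (\<rho> \<omega>) \<omega>)"
      by (rule tendsto_ennrealI)
    then show ?thesis
      by (cases "\<omega> \<in> A") simp_all
  qed
  have "(\<lambda>n. \<integral>\<^sup>+\<omega>. indicator A \<omega> * ennreal (surv_mart (g n (k n \<omega>)) \<omega>) \<partial>completion P) \<longlonglongrightarrow>
     (\<integral>\<^sup>+\<omega>. indicator A \<omega> * ennreal (surv_mart (\<rho> \<omega>) \<omega>) \<partial>completion P)"
  proof (rule nn_integral_dominated_convergence[where w="\<lambda>_. 1"])
    have kmc: "k n \<in> measurable (completion P) (count_space UNIV)" for n
      by (rule measurable_G_completion[OF km])
    show m: "(\<lambda>\<omega>. indicator A \<omega> * ennreal (surv_mart (g n (k n \<omega>)) \<omega>)) \<in> borel_measurable (completion P)" for n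
      by (intro borel_measurable_times_ennreal borel_measurable_indicator Am
          measurable_compose_countable[where f="\<lambda>j \<omega>. ennreal (surv_mart (g n j) \<omega>)", OF mm kmc])
    show "(\<lambda>\<omega>. indicator A \<omega> * ennreal (surv_mart (\<rho> \<omega>) \<omega>)) \<in> borel_measurable (completion P)"
      by (rule borel_measurable_LIMSEQ_order[OF _ m]) (use lim in auto)
    show "AE \<omega> in completion P. (\<lambda>n. indicator A \<omega> * ennreal (surv_mart (g n (k n \<omega>)) \<omega>)) \<longlonglongrightarrow> indicator A \<omega> * ennreal (surv_mart (\<rho> \<omega>) \<omega>)"
      using lim by (intro AE_I2) auto
    \<comment> \<open>The almost sure bound S <= 1 holds at countably many grid times at once,
      whatever cell \<rho> falls in; this is the domination.\<close>
    show "AE \<omega> in completion P. indicator A \<omega> * ennreal (surv_mart (g n (k n \<omega>)) \<omega>) \<le> 1" for n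
    proof -
      have "AE \<omega> in P. \<forall>j. surv \<gamma> (T - g n j) (\<omega> (g n j)) \<le> 1"
        unfolding AE_all_countable using AE_surv_le_1 g0 by auto
      then have "AE \<omega> in P. indicator A \<omega> * ennreal (surv_mart (g n (k n \<omega>)) \<omega>) \<le> 1"
        by eventually_elim (auto simp: surv_mart_def indicator_def)
      then show ?thesis by (rule AE_completion)
    qed
    show "(\<integral>\<^sup>+\<omega>. 1 \<partial>completion P) < \<infinity>"
      by (simp add: nn_integral_completion emeasure_space_1)
  qed simp
  then have "(\<lambda>n::nat. \<integral>\<^sup>+\<omega>. indicator A \<omega> * indicator (alive T T) \<omega> \<partial>completion P) \<longlonglongrightarrow>
     (\<integral>\<^sup>+\<omega>. indicator A \<omega> * ennreal (surv_mart (\<rho> \<omega>) \<omega>) \<partial>completion P)"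
    by (simp only: discrete[symmetric])
  then have "(\<integral>\<^sup>+\<omega>. indicator A \<omega> * indicator (alive T T) \<omega> \<partial>completion P) = (\<integral>\<^sup>+\<omega>. indicator A \<omega> * ennreal (surv_mart (\<rho> \<omega>) \<omega>) \<partial>completion P)"
    by (rule LIMSEQ_unique[OF tendsto_const])
  also have "\<dots> = (\<integral>\<^sup>+\<omega>. indicator A \<omega> * (indicator before_hit \<omega> * ennreal (surv_at \<omega>)) \<partial>completion P)"
    by (intro nn_integral_cong) (auto simp: surv_mart_rho indicator_def)
  finally show ?thesis .
qed

lemma optional_sampling_fun:
  assumes h: "h \<in> borel_measurable G"
  shows "(\<integral>\<^sup>+\<omega>. h \<omega> * indicator (alive T T) \<omega> \<partial>completion P) =
    (\<integral>\<^sup>+\<omega>. h \<omega> * (indicator before_hit \<omega> * ennreal (surv_at \<omega>)) \<partial>completion P)"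
proof -
  have idG: "(\<lambda>\<omega>. \<omega>) \<in> measurable (completion P) G"
    by (rule measurable_G_completion) simp
  have m1: "(\<lambda>\<omega>. indicator (alive T T) \<omega> :: ennreal) \<in> borel_measurable (completion P)"
    by (intro borel_measurable_indicator sets_completionI_sets alive_T_P)
  have m2: "(\<lambda>\<omega>. indicator before_hit \<omega> * ennreal (surv_at \<omega>)) \<in> borel_measurable (completion P)"
    by (intro borel_measurable_times_ennreal borel_measurable_indicator G_completion before_hit_G
        measurable_compose[OF measurable_G_completion[OF surv_at_G] measurable_ennreal])
  define \<mu> where "\<mu> = distr (density (completion P) (\<lambda>\<omega>. indicator (alive T T) \<omega>)) G (\<lambda>\<omega>. \<omega>)"
  define \<nu> where "\<nu> = distr (density (completion P) (\<lambda>\<omega>. indicator before_hit \<omega> * ennreal (surv_at \<omega>))) G (\<lambda>\<omega>. \<omega>)"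
  have \<mu>: "(\<integral>\<^sup>+\<omega>. v \<omega> \<partial>\<mu>) = (\<integral>\<^sup>+\<omega>. v \<omega> * indicator (alive T T) \<omega> \<partial>completion P)" if v: "v \<in> borel_measurable G" for v
    unfolding \<mu>_def using idG v m1 measurable_G_completion[OF v]
    by (subst nn_integral_distr) (simp_all add: nn_integral_density mult.commute)
  have \<nu>: "(\<integral>\<^sup>+\<omega>. v \<omega> \<partial>\<nu>) = (\<integral>\<^sup>+\<omega>. v \<omega> * (indicator before_hit \<omega> * ennreal (surv_at \<omega>)) \<partial>completion P)" if v: "v \<in> borel_measurable G" for v
    unfolding \<nu>_def using idG v m2 measurable_G_completion[OF v]
    by (subst nn_integral_distr) (simp_all add: nn_integral_density mult.commute[of "indicator _ _ * _"])
  have "\<mu> = \<nu>"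
  proof (rule measure_eqI)
    show "sets \<mu> = sets \<nu>" by (simp add: \<mu>_def \<nu>_def)
    fix B assume "B \<in> sets \<mu>"
    then have B: "B \<in> sets G" by (simp add: \<mu>_def)
    have "emeasure \<mu> B = (\<integral>\<^sup>+y. indicator B y \<partial>\<mu>)"
      by (rule nn_integral_indicator[symmetric]) (simp add: \<mu>_def B)
    also have "\<dots> = (\<integral>\<^sup>+y. indicator B y \<partial>\<nu>)"
      unfolding \<mu>[OF borel_measurable_indicator[OF B]] \<nu>[OF borel_measurable_indicator[OF B]] by (rule optional_sampling[OF B])
    also have "\<dots> = emeasure \<nu> B"
      by (rule nn_integral_indicator) (simp add: \<nu>_def B)
    finally show "emeasure \<mu> B = emeasure \<nu> B" .
  qed
  then show ?thesis
    using \<mu>[OF h] \<nu>[OF h] by simp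
qed

text \<open>On \<rho> < \<tau> the factor S that optional sampling produces cancels its inverse.
  With c = 1 and the whole space this gives the normalising constant; with c the inverse of that
  constant it gives the stopped law.\<close>

lemma nn_integral_inverse_surv_at:
  assumes E: "E \<in> sets G" and c: "0 \<le> c"
  shows "(\<integral>\<^sup>+\<omega>. ennreal (inverse (surv_at \<omega>) * c) * indicator E \<omega> \<partial>Q) =
    ennreal c * emeasure (completion P) (E \<inter> before_hit) / ennreal p"
proof -
  have h: "(\<lambda>\<omega>. ennreal (inverse (surv_at \<omega>) * c) * indicator E \<omega>) \<in> borel_measurable G"
    using surv_at_G E by measurable
  have "(\<integral>\<^sup>+\<omega>. ennreal (inverse (surv_at \<omega>) * c) * indicator E \<omega> \<partial>Q) =
    (\<integral>\<^sup>+\<omega>. (ennreal (inverse (surv_at \<omega>) * c) * indicator E \<omega>) * indicator (alive T T) \<omega> \<partial>completion P) / ennreal p"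
    using nn_integral_Q[OF measurable_G_completion[OF h]] by (simp only: mult.commute nn_integral_completion)
  also have "(\<integral>\<^sup>+\<omega>. (ennreal (inverse (surv_at \<omega>) * c) * indicator E \<omega>) * indicator (alive T T) \<omega> \<partial>completion P) =
    (\<integral>\<^sup>+\<omega>. (ennreal (inverse (surv_at \<omega>) * c) * indicator E \<omega>) * (indicator before_hit \<omega> * ennreal (surv_at \<omega>)) \<partial>completion P)"
    by (rule optional_sampling_fun[OF h])
  also have "\<dots> = (\<integral>\<^sup>+\<omega>. ennreal c * indicator (E \<inter> before_hit) \<omega> \<partial>completion P)"
  proof (rule nn_integral_cong)
    fix \<omega>
    show "(ennreal (inverse (surv_at \<omega>) * c) * indicator E \<omega>) * (indicator before_hit \<omega> * ennreal (surv_at \<omega>)) = ennreal c * indicator (E \<inter> before_hit) \<omega>"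
    proof (cases "\<omega> \<in> E \<inter> before_hit")
      case True
      then have "0 < surv_at \<omega>" by (intro surv_at_pos) auto
      then have "ennreal (inverse (surv_at \<omega>) * c) * ennreal (surv_at \<omega>) = ennreal c"
        using c by (subst ennreal_mult[symmetric]) (auto simp: field_simps)
      then show ?thesis using True by simp
    qed (auto simp: indicator_def)
  qed
  also have "\<dots> = ennreal c * emeasure (completion P) (E \<inter> before_hit)"
    by (rule nn_integral_cmult_indicator) (intro sets.Int G_completion E before_hit_G)
  finally show ?thesis .
qed

theorem stopped_law:
  assumes pos: "0 < measure (completion P) before_hit"
  shows "distr (uniform_measure (completion P) before_hit) (path_borel T) (stopped_path T \<rho>) =
    distr (density Q (\<lambda>\<omega>. ennreal (inverse (surv_at \<omega>) / (LINT \<omega>'|Q. inverse (surv_at \<omega>'))))) (path_borel T) (stopped_path T \<rho>)"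
proof (rule measure_eqI)
  interpret Pc: prob_space "completion P"
    by (rule prob_spaceI) (simp add: emeasure_space_1)
  let ?D = "measure (completion P) before_hit"
  let ?c = "LINT \<omega>'|Q. inverse (surv_at \<omega>')"
  have sm: "stopped_path T \<rho> \<in> measurable (completion P) (path_borel T)"
    by (rule measurable_G_completion[OF measurable_stopped_path])
  have D: "before_hit \<in> sets (completion P)" by (rule G_completion[OF before_hit_G])
  have sQ: "surv_at \<in> borel_measurable Q"
    using measurable_G_completion[OF surv_at_G] measurable_cong_sets[OF sets_Q refl] by blast
  \<comment> \<open>The normalising constant is P(\<rho> < \<tau>) / P(\<tau> > T); the survival
    probability p cancels in the final quotient.\<close>
  have c: "?c = ?D / p"
  proof -
    have "(\<integral>\<^sup>+\<omega>. ennreal (inverse (surv_at \<omega>)) \<partial>Q) = (\<integral>\<^sup>+\<omega>. ennreal (inverse (surv_at \<omega>) * 1) * indicator (space P) \<omega> \<partial>Q)"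
      by (intro nn_integral_cong) simp
    also have "\<dots> = ennreal 1 * emeasure (completion P) (space P \<inter> before_hit) / ennreal p"
      using sets.top[of G] by (intro nn_integral_inverse_surv_at) (simp_all add: space_G)
    also have "space P \<inter> before_hit = before_hit" by (auto simp: before_hit_def)
    also have "ennreal 1 * emeasure (completion P) before_hit / ennreal p = ennreal (?D / p)"
      using surv_T_pos by (simp only: Pc.emeasure_eq_measure ennreal_1 mult_1_left divide_ennreal measure_nonneg)
    finally have "(\<integral>\<^sup>+\<omega>. ennreal (inverse (surv_at \<omega>)) \<partial>Q) = ennreal (?D / p)" .
    moreover have "AE \<omega> in Q. 0 \<le> inverse (surv_at \<omega>)"
      by (intro AE_I2) (simp add: surv_at_nonneg)
    ultimately show ?thesis
      using sQ surv_T_pos by (subst integral_eq_nn_integral) auto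
  qed
  show "sets (distr (uniform_measure (completion P) before_hit) (path_borel T) (stopped_path T \<rho>)) =
    sets (distr (density Q (\<lambda>\<omega>. ennreal (inverse (surv_at \<omega>) / ?c))) (path_borel T) (stopped_path T \<rho>))"
    by simp
  fix C assume "C \<in> sets (distr (uniform_measure (completion P) before_hit) (path_borel T) (stopped_path T \<rho>))"
  then have C: "C \<in> sets (path_borel T)" by simp
  define E where "E = stopped_path T \<rho> -` C \<inter> space P"
  have EG: "E \<in> sets G"
    using measurable_sets[OF measurable_stopped_path C] by (simp add: E_def space_G)
  have Ec: "E \<in> sets (completion P)" by (rule G_completion[OF EG])
  have D0: "emeasure (completion P) before_hit \<noteq> 0"
    using pos by (simp add: Pc.emeasure_eq_measure del: emeasure_completion)
  have "emeasure (distr (uniform_measure (completion P) before_hit) (path_borel T) (stopped_path T \<rho>)) C =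
     emeasure (uniform_measure (completion P) before_hit) E"
    using sm C by (subst emeasure_distr) (simp_all add: E_def)
  also have "\<dots> = emeasure (completion P) (before_hit \<inter> E) / emeasure (completion P) before_hit"
    by (rule emeasure_uniform_measure[OF D Ec])
  also have "\<dots> = ennreal (measure (completion P) (E \<inter> before_hit) / ?D)"
    using pos by (simp only: Pc.emeasure_eq_measure divide_ennreal measure_nonneg Int_commute)
  also have "\<dots> = ennreal (inverse ?c) * emeasure (completion P) (E \<inter> before_hit) / ennreal p"
  proof -
    have "measure (completion P) (E \<inter> before_hit) / ?D = inverse ?c * measure (completion P) (E \<inter> before_hit) / p"
      unfolding c using surv_T_pos pos by (simp add: field_simps)
    moreover have "0 \<le> inverse ?c"
      unfolding c using surv_T_pos pos by (simp only: inverse_nonnegative_iff_nonnegative zero_le_divide_iff less_imp_le simp_thms)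
    ultimately show ?thesis
      using surv_T_pos
      by (simp only: Pc.emeasure_eq_measure ennreal_mult[symmetric] divide_ennreal mult_nonneg_nonneg measure_nonneg)
  qed
  also have "\<dots> = (\<integral>\<^sup>+\<omega>. ennreal (inverse (surv_at \<omega>) * inverse ?c) * indicator E \<omega> \<partial>Q)"
    using surv_T_pos pos by (intro nn_integral_inverse_surv_at[symmetric] EG) (simp add: c)
  also have "\<dots> = emeasure (density Q (\<lambda>\<omega>. ennreal (inverse (surv_at \<omega>) / ?c))) E"
    using sQ Ec by (subst emeasure_density) (simp_all add: divide_inverse)
  also have "\<dots> = emeasure (distr (density Q (\<lambda>\<omega>. ennreal (inverse (surv_at \<omega>) / ?c))) (path_borel T) (stopped_path T \<rho>)) C"
  proof -
    have "stopped_path T \<rho> \<in> measurable (density Q (\<lambda>\<omega>. ennreal (inverse (surv_at \<omega>) / ?c))) (path_borel T)"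
      using sm by (simp add: measurable_def)
    then show ?thesis
      using C by (subst emeasure_distr) (simp_all add: E_def)
  qed
  finally show "emeasure (distr (uniform_measure (completion P) before_hit) (path_borel T) (stopped_path T \<rho>)) C =
    emeasure (distr (density Q (\<lambda>\<omega>. ennreal (inverse (surv_at \<omega>) / ?c))) (path_borel T) (stopped_path T \<rho>)) C" .
qed

end

end

theorem lemma1p7:
  fixes T \<gamma> :: real and x :: "real^'n" and P :: "(real \<Rightarrow> real^'n) measure"
  assumes "CARD('n) \<in> {2, 3}" and "T > 0" and "\<gamma> > 0" and "x \<noteq> 0"
    and "point_interaction_law T \<gamma> x P"
  shows "(\<exists>M. continuous_martingale (cond_law_surv T P) (augmented_filt T P) T M \<and>
            (AE \<omega> in cond_law_surv T P.
               set_integrable lborel {0..T} (\<lambda>s. reg_drift \<gamma> (T - s) (\<omega> s)) \<and>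
               (\<forall>t \<in> {0..T}.
                  \<omega> t = x + (LBINT s:{0..t}. reg_drift \<gamma> (T - s) (\<omega> s)) + M t \<omega>)))
       \<and>
         (\<forall>\<rho>. stopping_time (augmented_filt T P) \<rho> \<longrightarrow>
            (\<forall>\<omega> \<in> space P. \<rho> \<omega> \<in> {0..T}) \<longrightarrow>
            measure (completion P) {\<omega> \<in> space P. ereal (\<rho> \<omega>) < hit_time T \<omega>} > 0 \<longrightarrow>
            distr (cond_law_before T P \<rho>) (path_borel T) (stopped_path T \<rho>)
            = distr
                (density (cond_law_surv T P)
                  (\<lambda>\<omega>. ennreal (inverse (surv \<gamma> (T - \<rho> \<omega>) (\<omega> (\<rho> \<omega>)))
                     / (LINT \<omega>'|cond_law_surv T P. inverse (surv \<gamma> (T - \<rho> \<omega>') (\<omega>' (\<rho> \<omega>')))))))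
                (path_borel T) (stopped_path T \<rho>))"
proof -
  interpret point_interaction T \<gamma> x P
    using assms by unfold_locales
  show ?thesis
  proof (intro conjI allI impI)
    fix \<rho> assume *: "stopping_time (augmented_filt T P) \<rho>" "\<forall>\<omega> \<in> space P. \<rho> \<omega> \<in> {0..T}"
      "0 < measure (completion P) {\<omega> \<in> space P. ereal (\<rho> \<omega>) < hit_time T \<omega>}"
    then have r: "\<And>\<omega>. \<omega> \<in> space P \<Longrightarrow> \<rho> \<omega> \<in> {0..T}" by auto
    have b: "before_hit \<rho> = {\<omega> \<in> space P. ereal (\<rho> \<omega>) < hit_time T \<omega>}"
      by (rule before_hit_eq[OF *(1) r, symmetric])
    have s: "surv_at \<rho> \<omega> = surv \<gamma> (T - \<rho> \<omega>) (\<omega> (\<rho> \<omega>))" for \<omega>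
      by (rule surv_at_def[OF *(1) r])
    have "0 < measure (completion P) (before_hit \<rho>)"
      using *(3) by (simp only: b)
    from stopped_law[OF *(1) r this]
    show "distr (cond_law_before T P \<rho>) (path_borel T) (stopped_path T \<rho>)
            = distr
                (density (cond_law_surv T P)
                  (\<lambda>\<omega>. ennreal (inverse (surv \<gamma> (T - \<rho> \<omega>) (\<omega> (\<rho> \<omega>)))
                     / (LINT \<omega>'|cond_law_surv T P. inverse (surv \<gamma> (T - \<rho> \<omega>') (\<omega>' (\<rho> \<omega>')))))))
                (path_borel T) (stopped_path T \<rho>)"
      by (simp only: s b cond_law_before_def)
  qed (rule semimartingale_decomposition)
qed

end
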